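(* Let $A=(a_{i,j})$ be an indecomposable Cartan matrix of finite type with index set $I=\{1,\dots,n\}$, and let $c=s_1s_2\cdots s_n$ and $\tilde c=s_2\cdots s_ns_1$ be Coxeter elements of its Weyl group. Let $\mathcal{A}(c)$ and $\mathcal{A}(\tilde c)$ be the cluster algebras with principal coefficients at the initial seeds $\big((x_{\omega_i;c})_{i\in I},(y_{i;c})_{i\in I},B(c)\big)$ and $\big((x_{\omega_i;\tilde c})_{i\in I},(y_{i;\tilde c})_{i\in I},B(\tilde c)\big)$, respectively. Let $(\mathbf{x}',\mathbf{y}',B(\tilde c))$ be the seed of $\mathcal{A}(c)$ obtained from its initial seed by the mutation $\mu_1$. Then the correspondence sending each cluster variable $z^\circ\in\mathcal{A}(\tilde c)$ to $F_{z^\circ}|_{\mathbb{P}}(y'_1,\dots,y'_n)\,z\in\mathcal{A}(c)$ (where $z$ is the cluster variable of $\mathcal{A}(c)$ corresponding to $z^\circ$ with respect to the seed $(\mathbf{x}',\mathbf{y}',B(\tilde c))$) and each $y_{i;\tilde c}$ to $y'_i$ establishes an isomorphism of cluster algebras $\varphi:\mathcal{A}(\tilde c)\to\mathcal{A}(c)$, acting on the initial cluster variables and the initial coefficient tuple in $\mathcal{A}(\tilde c)$ as follows: $$\varphi(x_{\omega_i;\tilde c})=x_{\omega_i;c},\qquad \varphi(y_{i;\tilde c})=y_{i;c}\,y_{1;c}^{-a_{1,i}}\qquad(i\ne1),$$ $$\varphi(x_{\omega_1;\tilde c})=x_{c\omega_1;c}=x_{\omega_1;c}^{-1}\Big(y_{1;c}+\prod_{i\ne1}x_{\omega_i;c}^{-a_{i,1}}\Big),\qquad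 \varphi(y_{1;\tilde c})=y_{1;c}^{-1}.$$
   Context: Root data. $\alpha_i$ are the simple roots, $\omega_i$ the fundamental weights ($\alpha_j=\sum_i a_{i,j}\omega_i$), $s_i$ the simple reflections, $s_i\alpha_j=\alpha_j-a_{i,j}\alpha_i$. For a Coxeter element $c$ (product of all simple reflections, each once, in some order), $i\prec_c j$ means that $i\ne j$, $a_{i,j}\ne0$, and $s_i$ precedes $s_j$ in the factorization of $c$. $B(c)=(b_{i,j})$: $b_{i,j}=-a_{i,j}$ if $i\prec_c j$, $b_{i,j}=a_{i,j}$ if $j\prec_c i$, $b_{i,j}=0$ otherwise. For $c,\tilde c$ as in the claim, the mutation $\mu_1$ takes $B(c)$ to $B(\tilde c)$. Cluster algebras. A semifield $\mathbb{P}$ is an abelian multiplicative group with a commutative, associative addition $\oplus$ over which multiplication distributes. $\mathrm{Trop}(u_j:j\in J)$ is the free abelian multiplicative group on the $u_j$ with $\prod u_j^{a_j}\oplus\prod u_j^{b_j}=\prod u_j^{\min(a_j,b_j)}$. Let $\mathbb{ZP}$ be the group ring, $\mathbb{Q}(\mathbb{P})$ its fraction field, $\mathcal{F}$ a field isomorphic to the rational functions in $n$ variables over $\mathbb{Q}(\mathbb{P})$. A seed is $(\mathbf{x},\mathbf{y},B)$ with $\mathbf{x}=(x_i)_{i\in I}$ a free generating set of $\mathcal{F}$ over $\mathbb{Q}(\mathbb{P})$ (the cluster), $\mathbf{y}=(y_i)_{i\in I}$ a tuple in $\mathbb{P}$, $B$ a skew-symmetrizable integer matrix. With $[b]_+=\max(b,0)$,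 the mutation $\mu_k$ gives $(\mathbf{x}',\mathbf{y}',B')$: $b'_{i,j}=-b_{i,j}$ if $i=k$ or $j=k$, otherwise $b'_{i,j}=b_{i,j}+[b_{i,k}]_+[b_{k,j}]_+-[-b_{i,k}]_+[-b_{k,j}]_+$; $y'_k=y_k^{-1}$, $y'_j=y_jy_k^{[b_{k,j}]_+}(y_k\oplus1)^{-b_{k,j}}$ for $j\ne k$; $x'_j=x_j$ for $j\ne k$, $x_kx'_k=\dfrac{y_k\prod_i x_i^{[b_{i,k}]_+}+\prod_i x_i^{[-b_{i,k}]_+}}{y_k\oplus1}$. Cluster variables are all elements of clusters of seeds obtained from the initial seed by sequences of mutations; the cluster algebra is the $\mathbb{ZP}$-subalgebra of $\mathcal{F}$ they generate. Principal coefficients at the initial seed means $\mathbb{P}=\mathrm{Trop}(y_i:i\in I)$ for the initial coefficient tuple; here $\mathbb{P}=\mathrm{Trop}(y_{i;c}:i\in I)$ denotes the coefficient semifield of $\mathcal{A}(c)$. The algebra $\mathcal{A}(c)$ (with scalars extended to $\mathbb{C}$) is the coordinate ring of the reduced double Bruhat cell $L^{c,c^{-1}}=N\overline{c}N\cap B_-c^{-1}B_-$ in the simply connected complex semisimple group $G$ with Cartan matrix $A$, and $x_{\gamma;c}$ is then the restriction to $L^{c,c^{-1}}$ of the generalized minor $\Delta_{\gamma,\gamma}$. Here $\overline{s_i}=\varphi_i\begin{pmatrix}0&-1\\1&0\end{pmatrix}$ with $\varphi_i:SL_2\to G$ the canonical embedding for $\alpha_i$, $\overline{w}$ is the product of the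 $\overline{s_i}$ along a reduced word of $w$, $N,N_-$ are the opposite maximal unipotent subgroups (positive and negative), $H$ is the maximal torus, $B_-=HN_-$, and $\Delta_{u\omega_i,v\omega_i}$ is the regular function on $G$ equal to $([\overline{u}^{-1}x\overline{v}]_0)^{\omega_i}$ for $x\in\overline{u}N_-HN\overline{v}^{-1}$, with $[\cdot]_0$ the $H$-component in $N_-HN$. The function $y_{j;c}$ is the restriction of $\Delta_{\omega_j,c\omega_j}\prod_{i\prec_c j}\Delta_{\omega_i,c\omega_i}^{a_{i,j}}$. $F$-polynomials and the correspondence. In the cluster algebra $\mathcal{A}^\circ$ with principal coefficients at $(\mathbf{x}^\circ,\mathbf{y}^\circ,B)$, put $\widehat y_j^\circ=y_j^\circ\prod_i(x_i^\circ)^{b_{i,j}}$; every cluster variable $z^\circ$ is uniquely $z^\circ=\prod_i(x_i^\circ)^{g_i}F_{z^\circ}(\widehat y_1^\circ,\dots,\widehat y_n^\circ)$ with $g_i\in\mathbb{Z}$ and $F_{z^\circ}$ an integer polynomial not divisible by any variable. $F_{z^\circ}$ has a subtraction-free rational expression, so it can be evaluated in any semifield $\mathbb{P}$; this is denoted $F_{z^\circ}|_{\mathbb{P}}$. If $(\mathbf{x},\mathbf{y},B)$ is a seed with the same $B$ in a cluster algebra over $\mathbb{P}$, the cluster variable corresponding to $z^\circ$ is $z=\prod_i x_i^{g_i}\,F_{z^\circ}(\widehat y_1,\dots,\widehat y_n)/F_{z^\circ}|_{\mathbb{P}}(y_1,\dots,y_n)$, where $\widehat y_j=y_j\prod_i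 x_i^{b_{i,j}}$. *)

theory Defs
  imports
    "HOL-Analysis.Analysis"
    "HOL-Algebra.Generated_Groups"
    "HOL-Library.Poly_Mapping"
    "HOL-Computational_Algebra.Fraction_Field"
begin

section \<open>Root data\<close>

text \<open>Index sets are finite sets of natural numbers; a Cartan matrix is a function
  \<open>a\<close> of which only the entries with both indices in \<open>{1..n}\<close> matter.\<close>

definition finite_type_cartan :: "nat \<Rightarrow> (nat \<Rightarrow> nat \<Rightarrow> int) \<Rightarrow> bool" where
  "finite_type_cartan n a \<longleftrightarrow>
     (\<forall>i\<in>{1..n}. a i i = 2) \<and>
     (\<forall>i\<in>{1..n}. \<forall>j\<in>{1..n}. i \<noteq> j \<longrightarrow> a i j \<le> 0 \<and> (a i j = 0 \<longleftrightarrow> a j i = 0)) \<and>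
     (\<exists>d :: nat \<Rightarrow> int.
        (\<forall>i\<in>{1..n}. d i > 0) \<and>
        (\<forall>i\<in>{1..n}. \<forall>j\<in>{1..n}. d i * a i j = d j * a j i) \<and>
        (\<forall>v :: nat \<Rightarrow> real. (\<exists>i\<in>{1..n}. v i \<noteq> 0) \<longrightarrow>
           (\<Sum>i=1..n. \<Sum>j=1..n. of_int (d i * a i j) * v i * v j) > 0))"

definition indecomposable :: "nat \<Rightarrow> (nat \<Rightarrow> nat \<Rightarrow> int) \<Rightarrow> bool" where
  "indecomposable n a \<longleftrightarrow> 1 \<le> n \<and>
     \<not> (\<exists>J K. J \<noteq> {} \<and> K \<noteq> {} \<and> J \<inter> K = {} \<and> J \<union> K = {1..n} \<and>
            (\<forall>i\<in>J. \<forall>j\<in>K. a i j = 0 \<and> a j i = 0))"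

text \<open>Weights are given by their coordinates in the basis of fundamental weights. Elements of the
  Weyl group are given by words in the simple reflections; \<open>[i, j, k]\<close> stands for \<open>s\<^sub>i s\<^sub>j s\<^sub>k\<close>,
  which applies \<open>s\<^sub>k\<close> first.\<close>

type_synonym weight = "nat \<Rightarrow> int"

definition fund_weight :: "nat \<Rightarrow> weight" where
  "fund_weight i = (\<lambda>k. if k = i then 1 else 0)"

definition simple_root :: "nat \<Rightarrow> (nat \<Rightarrow> nat \<Rightarrow> int) \<Rightarrow> nat \<Rightarrow> weight" where
  "simple_root n a j = (\<lambda>i. if i \<in> {1..n} then a i j else 0)"

text \<open>The coefficient of \<open>\<omega>\<^sub>i\<close> in \<open>\<lambda>\<close> is the pairing of \<open>\<lambda>\<close> with the \<open>i\<close>-th simple coroot;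
  in particular \<open>s\<^sub>i \<alpha>\<^sub>j = \<alpha>\<^sub>j - a\<^sub>i\<^sub>j \<alpha>\<^sub>i\<close>.\<close>

definition simple_reflection :: "nat \<Rightarrow> (nat \<Rightarrow> nat \<Rightarrow> int) \<Rightarrow> nat \<Rightarrow> weight \<Rightarrow> weight" where
  "simple_reflection n a i l = (\<lambda>k. l k - l i * simple_root n a i k)"

definition weyl_action :: "nat \<Rightarrow> (nat \<Rightarrow> nat \<Rightarrow> int) \<Rightarrow> nat list \<Rightarrow> weight \<Rightarrow> weight" where
  "weyl_action n a w = foldr (simple_reflection n a) w"

definition reduced_word :: "nat \<Rightarrow> (nat \<Rightarrow> nat \<Rightarrow> int) \<Rightarrow> nat list \<Rightarrow> bool" where
  "reduced_word n a w \<longleftrightarrow> set w \<subseteq> {1..n} \<and>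
     (\<forall>w'. set w' \<subseteq> {1..n} \<and> weyl_action n a w' = weyl_action n a w \<longrightarrow> length w \<le> length w')"

text \<open>The relation \<open>i \<prec>\<^sub>c j\<close> and the matrix \<open>B(c)\<close>, for the Coxeter element \<open>c\<close>
  with factorization \<open>c\<close>.\<close>

definition coxeter_prec :: "(nat \<Rightarrow> nat \<Rightarrow> int) \<Rightarrow> nat list \<Rightarrow> nat \<Rightarrow> nat \<Rightarrow> bool" where
  "coxeter_prec a c i j \<longleftrightarrow> i \<noteq> j \<and> a i j \<noteq> 0 \<and>
     (\<exists>p q. p < q \<and> q < length c \<and> c ! p = i \<and> c ! q = j)"

definition coxeter_matrix :: "(nat \<Rightarrow> nat \<Rightarrow> int) \<Rightarrow> nat list \<Rightarrow> nat \<Rightarrow> nat \<Rightarrow> int" where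
  "coxeter_matrix a c i j =
     (if coxeter_prec a c i j then - a i j
      else if coxeter_prec a c j i then a i j
      else 0)"


section \<open>Semifields\<close>

record 'p semifield = "'p monoid" +
  splus :: "'p \<Rightarrow> 'p \<Rightarrow> 'p"

locale semifield = comm_group P for P :: "('p, 'q) semifield_scheme" (structure) +
  assumes splus_closed: "x \<in> carrier P \<Longrightarrow> y \<in> carrier P \<Longrightarrow> splus P x y \<in> carrier P"
    and splus_comm: "x \<in> carrier P \<Longrightarrow> y \<in> carrier P \<Longrightarrow> splus P x y = splus P y x"
    and splus_assoc: "x \<in> carrier P \<Longrightarrow> y \<in> carrier P \<Longrightarrow> z \<in> carrier P \<Longrightarrow>
          splus P (splus P x y) z = splus P x (splus P y z)"
    and splus_distrib: "x \<in> carrier P \<Longrightarrow> y \<in> carrier P \<Longrightarrow> z \<in> carrier P \<Longrightarrow>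
          x \<otimes> splus P y z = splus P (x \<otimes> y) (x \<otimes> z)"

text \<open>The tropical semifield \<open>Trop(u\<^sub>j : j \<in> J)\<close>, a monomial being represented by its exponents.\<close>

definition trop :: "nat set \<Rightarrow> (nat \<Rightarrow> int) semifield" where
  "trop J = \<lparr>carrier = {p. finite {j. p j \<noteq> 0} \<and> (\<forall>j. j \<notin> J \<longrightarrow> p j = 0)},
             mult = (\<lambda>p q j. p j + q j),
             one = (\<lambda>j. 0),
             splus = (\<lambda>p q j. min (p j) (q j))\<rparr>"

definition trop_gen :: "nat \<Rightarrow> nat \<Rightarrow> int" where
  "trop_gen j = (\<lambda>k. if k = j then 1 else 0)"

lemma semifield_trop: "semifield (trop J)"
proof -
  have fin: "finite {j. p j + q j \<noteq> 0}" "finite {j. min (p j) (q j) \<noteq> 0}"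
    if "finite {j. p j \<noteq> 0}" "finite {j. q j \<noteq> 0}" for p q :: "nat \<Rightarrow> int"
    by (rule finite_subset[of _ "{j. p j \<noteq> 0} \<union> {j. q j \<noteq> 0}"]; use that in \<open>auto simp: min_def\<close>)+
  have "comm_group (trop J)"
  proof (rule comm_groupI)
    fix x assume x: "x \<in> carrier (trop J)"
    have "(\<lambda>j. - x j) \<in> carrier (trop J)"
      using x by (auto simp: trop_def)
    moreover have "(\<lambda>j. - x j) \<otimes>\<^bsub>trop J\<^esub> x = \<one>\<^bsub>trop J\<^esub>"
      by (auto simp: trop_def)
    ultimately show "\<exists>y\<in>carrier (trop J). y \<otimes>\<^bsub>trop J\<^esub> x = \<one>\<^bsub>trop J\<^esub>" by blast
  qed (use fin in \<open>auto simp: trop_def\<close>)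
  then show ?thesis
    by (intro semifield.intro semifield_axioms.intro)
      (use fin in \<open>auto simp: trop_def min_def fun_eq_iff\<close>)
qed


section \<open>Polynomials\<close>

text \<open>Polynomials in variables indexed by the natural numbers.\<close>

type_synonym 'c mpoly = "(nat \<Rightarrow>\<^sub>0 nat) \<Rightarrow>\<^sub>0 'c"

definition mpoly_vars :: "'c::zero mpoly \<Rightarrow> nat set" where
  "mpoly_vars f = (\<Union>m\<in>Poly_Mapping.keys f. Poly_Mapping.keys m)"

definition mpoly_eval :: "('c::zero \<Rightarrow> 'k::field) \<Rightarrow> (nat \<Rightarrow> 'k) \<Rightarrow> 'c mpoly \<Rightarrow> 'k" where
  "mpoly_eval h v f =
     (\<Sum>m\<in>Poly_Mapping.keys f. h (Poly_Mapping.lookup f m) *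
        (\<Prod>i\<in>Poly_Mapping.keys m. v i ^ Poly_Mapping.lookup m i))"

definition mpoly_var :: "nat \<Rightarrow> int mpoly" where
  "mpoly_var i = Poly_Mapping.single (Poly_Mapping.single i 1) 1"

definition subring :: "'k::field set \<Rightarrow> bool" where
  "subring R \<longleftrightarrow> 0 \<in> R \<and> 1 \<in> R \<and>
     (\<forall>x\<in>R. \<forall>y\<in>R. x + y \<in> R \<and> x - y \<in> R \<and> x * y \<in> R)"

definition subfield :: "'k::field set \<Rightarrow> bool" where
  "subfield R \<longleftrightarrow> subring R \<and> (\<forall>x\<in>R. inverse x \<in> R)"

definition alg_independent :: "'k::field set \<Rightarrow> nat set \<Rightarrow> (nat \<Rightarrow> 'k) \<Rightarrow> bool" where
  "alg_independent K I x \<longleftrightarrow>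
     (\<forall>f :: 'k mpoly. range (Poly_Mapping.lookup f) \<subseteq> K \<and> mpoly_vars f \<subseteq> I \<and>
        mpoly_eval (\<lambda>t. t) x f = 0 \<longrightarrow> f = 0)"


section \<open>Cluster algebras\<close>

text \<open>The coefficient semifield \<open>P\<close> is related to the ambient field by a map \<open>e\<close>, which is to be
  multiplicative and to extend to an embedding of the group ring of \<open>P\<close>. The fraction field of the
  group ring is then the subfield generated by the image of \<open>e\<close>.\<close>

definition coeff_embedding :: "'p semifield \<Rightarrow> ('p \<Rightarrow> 'k::field_char_0) \<Rightarrow> bool" where
  "coeff_embedding P e \<longleftrightarrow>
     (\<forall>p\<in>carrier P. \<forall>q\<in>carrier P. e (p \<otimes>\<^bsub>P\<^esub> q) = e p * e q) \<and>
     (\<forall>S c. finite S \<and> S \<subseteq> carrier P \<and> (\<Sum>p\<in>S. of_int (c p) * e p) = 0 \<longrightarrow> (\<forall>p\<in>S. c p = (0::int)))"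

datatype ('k, 'p) seed =
  Seed (cluster: "nat \<Rightarrow> 'k") (coeffs: "nat \<Rightarrow> 'p") (exch: "nat \<Rightarrow> nat \<Rightarrow> int")

definition skew_symmetrizable :: "nat set \<Rightarrow> (nat \<Rightarrow> nat \<Rightarrow> int) \<Rightarrow> bool" where
  "skew_symmetrizable I B \<longleftrightarrow>
     (\<exists>d :: nat \<Rightarrow> int. (\<forall>i\<in>I. d i > 0) \<and> (\<forall>i\<in>I. \<forall>j\<in>I. d i * B i j = - (d j * B j i)))"

text \<open>The field \<open>\<F>\<close> need not be all of the type \<open>'k\<close>: it is the subfield generated by the
  coefficients and the cluster, over which the cluster is then a free generating set.\<close>

definition is_seed ::
  "nat set \<Rightarrow> 'p semifield \<Rightarrow> ('p \<Rightarrow> 'k::field_char_0) \<Rightarrow> ('k, 'p) seed \<Rightarrow> bool" where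
  "is_seed I P e S \<longleftrightarrow> finite I \<and> semifield P \<and> coeff_embedding P e \<and>
     alg_independent (subfield hull (e ` carrier P)) I (cluster S) \<and>
     (\<forall>i\<in>I. coeffs S i \<in> carrier P) \<and>
     skew_symmetrizable I (exch S)"

abbreviation pos_part :: "int \<Rightarrow> int" where
  "pos_part b \<equiv> max b 0"

definition mutate_exch :: "nat \<Rightarrow> (nat \<Rightarrow> nat \<Rightarrow> int) \<Rightarrow> nat \<Rightarrow> nat \<Rightarrow> int" where
  "mutate_exch k B i j =
     (if i = k \<or> j = k then - B i j
      else B i j + pos_part (B i k) * pos_part (B k j)
                 - pos_part (- B i k) * pos_part (- B k j))"

definition mutate_coeffs ::
  "'p semifield \<Rightarrow> nat \<Rightarrow> (nat \<Rightarrow> nat \<Rightarrow> int) \<Rightarrow> (nat \<Rightarrow> 'p) \<Rightarrow> nat \<Rightarrow> 'p" where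
  "mutate_coeffs P k B y j =
     (if j = k then inv\<^bsub>P\<^esub> (y k)
      else y j \<otimes>\<^bsub>P\<^esub> (y k [^]\<^bsub>P\<^esub> pos_part (B k j))
               \<otimes>\<^bsub>P\<^esub> (splus P (y k) \<one>\<^bsub>P\<^esub> [^]\<^bsub>P\<^esub> (- B k j)))"

definition mutate_cluster ::
  "nat set \<Rightarrow> 'p semifield \<Rightarrow> ('p \<Rightarrow> 'k::field_char_0) \<Rightarrow> nat \<Rightarrow> ('k, 'p) seed \<Rightarrow> nat \<Rightarrow> 'k" where
  "mutate_cluster I P e k S j =
     (if j = k then
        (e (coeffs S k) * (\<Prod>i\<in>I. cluster S i powi pos_part (exch S i k))
           + (\<Prod>i\<in>I. cluster S i powi pos_part (- exch S i k)))
        / e (splus P (coeffs S k) \<one>\<^bsub>P\<^esub>) / cluster S k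
      else cluster S j)"

definition mutate ::
  "nat set \<Rightarrow> 'p semifield \<Rightarrow> ('p \<Rightarrow> 'k::field_char_0) \<Rightarrow> nat \<Rightarrow> ('k, 'p) seed \<Rightarrow> ('k, 'p) seed" where
  "mutate I P e k S =
     Seed (mutate_cluster I P e k S) (mutate_coeffs P k (exch S) (coeffs S)) (mutate_exch k (exch S))"

inductive_set seeds ::
  "nat set \<Rightarrow> 'p semifield \<Rightarrow> ('p \<Rightarrow> 'k::field_char_0) \<Rightarrow> ('k, 'p) seed \<Rightarrow> ('k, 'p) seed set"
  for I P e S where
  initial: "S \<in> seeds I P e S"
| mutated: "T \<in> seeds I P e S \<Longrightarrow> k \<in> I \<Longrightarrow> mutate I P e k T \<in> seeds I P e S"

definition cluster_variables ::
  "nat set \<Rightarrow> 'p semifield \<Rightarrow> ('p \<Rightarrow> 'k::field_char_0) \<Rightarrow> ('k, 'p) seed \<Rightarrow> 'k set" where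
  "cluster_variables I P e S = {cluster T i |T i. T \<in> seeds I P e S \<and> i \<in> I}"

definition cluster_algebra ::
  "nat set \<Rightarrow> 'p semifield \<Rightarrow> ('p \<Rightarrow> 'k::field_char_0) \<Rightarrow> ('k, 'p) seed \<Rightarrow> 'k set" where
  "cluster_algebra I P e S = subring hull (e ` carrier P \<union> cluster_variables I P e S)"

text \<open>An isomorphism of cluster algebras: a ring isomorphism \<open>\<phi>\<close> which identifies the groups of
  coefficients and, up to coefficients, takes cluster variables to cluster variables by means
  of a bijection \<open>\<beta>\<close>; the latter takes seeds to seeds (in both directions), respecting the labelling,
  the exchange matrices and mutations. The addition of the coefficient semifields need not
  be preserved.\<close>

definition cluster_algebra_iso ::
  "nat set \<Rightarrow> 'p semifield \<Rightarrow> ('p \<Rightarrow> 'k::field_char_0) \<Rightarrow> ('k, 'p) seed \<Rightarrow>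
   'q semifield \<Rightarrow> ('q \<Rightarrow> 'l::field_char_0) \<Rightarrow> ('l, 'q) seed \<Rightarrow>
   ('k \<Rightarrow> 'l) \<Rightarrow> ('k \<Rightarrow> 'l) \<Rightarrow> bool" where
  "cluster_algebra_iso I P e S Q e' S' \<phi> \<beta> \<longleftrightarrow>
     bij_betw \<phi> (cluster_algebra I P e S) (cluster_algebra I Q e' S') \<and>
     \<phi> 1 = 1 \<and>
     (\<forall>x\<in>cluster_algebra I P e S. \<forall>y\<in>cluster_algebra I P e S.
        \<phi> (x + y) = \<phi> x + \<phi> y \<and> \<phi> (x * y) = \<phi> x * \<phi> y) \<and>
     \<phi> ` e ` carrier P = e' ` carrier Q \<and>
     bij_betw \<beta> (cluster_variables I P e S) (cluster_variables I Q e' S') \<and>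
     (\<forall>z\<in>cluster_variables I P e S. \<exists>q\<in>carrier Q. \<phi> z = e' q * \<beta> z) \<and>
     (let rel = (\<lambda>T T'. \<forall>i\<in>I. cluster T' i = \<beta> (cluster T i) \<and> (\<forall>j\<in>I. exch T' i j = exch T i j));
          compat = (\<lambda>T T'. rel T T' \<and> (\<forall>k\<in>I. rel (mutate I P e k T) (mutate I Q e' k T')))
      in (\<forall>T\<in>seeds I P e S. \<exists>T'\<in>seeds I Q e' S'. compat T T') \<and>
         (\<forall>T'\<in>seeds I Q e' S'. \<exists>T\<in>seeds I P e S. compat T T'))"


section \<open>F-polynomials and corresponding cluster variables\<close>

definition y_hat :: "nat set \<Rightarrow> ('p \<Rightarrow> 'k::field_char_0) \<Rightarrow> ('k, 'p) seed \<Rightarrow> nat \<Rightarrow> 'k" where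
  "y_hat I e S j = e (coeffs S j) * (\<Prod>i\<in>I. cluster S i powi exch S i j)"

text \<open>In the following, \<open>e\<close> and \<open>S\<close> belong to a cluster algebra with principal coefficients at \<open>S\<close>.\<close>

definition gF_expansion ::
  "nat set \<Rightarrow> ('p \<Rightarrow> 'k::field_char_0) \<Rightarrow> ('k, 'p) seed \<Rightarrow> 'k \<Rightarrow> (nat \<Rightarrow> int) \<Rightarrow> int mpoly \<Rightarrow> bool" where
  "gF_expansion I e S z g F \<longleftrightarrow>
     (\<forall>i. i \<notin> I \<longrightarrow> g i = 0) \<and> mpoly_vars F \<subseteq> I \<and> (\<forall>i\<in>I. \<not> mpoly_var i dvd F) \<and>
     z = (\<Prod>i\<in>I. cluster S i powi g i) * mpoly_eval of_int (y_hat I e S) F"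

definition g_vector ::
  "nat set \<Rightarrow> ('p \<Rightarrow> 'k::field_char_0) \<Rightarrow> ('k, 'p) seed \<Rightarrow> 'k \<Rightarrow> nat \<Rightarrow> int" where
  "g_vector I e S z = (THE g. \<exists>F. gF_expansion I e S z g F)"

definition F_polynomial ::
  "nat set \<Rightarrow> ('p \<Rightarrow> 'k::field_char_0) \<Rightarrow> ('k, 'p) seed \<Rightarrow> 'k \<Rightarrow> int mpoly" where
  "F_polynomial I e S z = (THE F. \<exists>g. gF_expansion I e S z g F)"

datatype sf_expr =
  SF_Var nat | SF_One | SF_Add sf_expr sf_expr | SF_Mult sf_expr sf_expr | SF_Div sf_expr sf_expr

primrec sf_vars :: "sf_expr \<Rightarrow> nat set" where
  "sf_vars (SF_Var i) = {i}"
| "sf_vars SF_One = {}"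
| "sf_vars (SF_Add s t) = sf_vars s \<union> sf_vars t"
| "sf_vars (SF_Mult s t) = sf_vars s \<union> sf_vars t"
| "sf_vars (SF_Div s t) = sf_vars s \<union> sf_vars t"

primrec sf_fract :: "sf_expr \<Rightarrow> int mpoly fract" where
  "sf_fract (SF_Var i) = Fract (mpoly_var i) 1"
| "sf_fract SF_One = 1"
| "sf_fract (SF_Add s t) = sf_fract s + sf_fract t"
| "sf_fract (SF_Mult s t) = sf_fract s * sf_fract t"
| "sf_fract (SF_Div s t) = sf_fract s / sf_fract t"

primrec sf_value :: "'p semifield \<Rightarrow> (nat \<Rightarrow> 'p) \<Rightarrow> sf_expr \<Rightarrow> 'p" where
  "sf_value P y (SF_Var i) = y i"
| "sf_value P y SF_One = \<one>\<^bsub>P\<^esub>"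
| "sf_value P y (SF_Add s t) = splus P (sf_value P y s) (sf_value P y t)"
| "sf_value P y (SF_Mult s t) = sf_value P y s \<otimes>\<^bsub>P\<^esub> sf_value P y t"
| "sf_value P y (SF_Div s t) = sf_value P y s \<otimes>\<^bsub>P\<^esub> inv\<^bsub>P\<^esub> (sf_value P y t)"

text \<open>The value of \<open>F\<close> at \<open>y\<close> in the semifield \<open>P\<close>, computed from any subtraction-free expression
  for \<open>F\<close>.\<close>

definition semifield_eval :: "nat set \<Rightarrow> 'p semifield \<Rightarrow> (nat \<Rightarrow> 'p) \<Rightarrow> int mpoly \<Rightarrow> 'p" where
  "semifield_eval I P y F =
     (THE v. \<exists>t. sf_vars t \<subseteq> I \<and> sf_fract t = Fract F 1 \<and> v = sf_value P y t)"

text \<open>The cluster variable that corresponds to \<open>z\<close>, where \<open>z\<close> lives in the cluster algebra with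
  principal coefficients at \<open>S0\<close> (with embedding \<open>e0\<close>), and \<open>S\<close> is a seed with the same exchange
  matrix in a cluster algebra over \<open>P\<close>.\<close>

definition corresponding_variable ::
  "nat set \<Rightarrow> ('o \<Rightarrow> 'l::field_char_0) \<Rightarrow> ('l, 'o) seed \<Rightarrow>
   'p semifield \<Rightarrow> ('p \<Rightarrow> 'k::field_char_0) \<Rightarrow> ('k, 'p) seed \<Rightarrow> 'l \<Rightarrow> 'k" where
  "corresponding_variable I e0 S0 P e S z =
     (\<Prod>i\<in>I. cluster S i powi g_vector I e0 S0 z i) *
     mpoly_eval of_int (y_hat I e S) (F_polynomial I e0 S0 z) /
     e (semifield_eval I P (coeffs S) (F_polynomial I e0 S0 z))"


section \<open>The simply connected group and its generalized minors\<close>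

text \<open>Regular functions on a (locally closed) set of matrices: functions that are locally quotients
  of polynomials in the matrix entries.\<close>

inductive entry_polynomial :: "(complex^'m^'m \<Rightarrow> complex) \<Rightarrow> bool" where
  "entry_polynomial (\<lambda>X. z)"
| "entry_polynomial (\<lambda>X. X $ i $ j)"
| "entry_polynomial f \<Longrightarrow> entry_polynomial g \<Longrightarrow> entry_polynomial (\<lambda>X. f X + g X)"
| "entry_polynomial f \<Longrightarrow> entry_polynomial g \<Longrightarrow> entry_polynomial (\<lambda>X. f X * g X)"

definition regular_on :: "(complex^'m^'m) set \<Rightarrow> (complex^'m^'m \<Rightarrow> complex) \<Rightarrow> bool" where
  "regular_on X f \<longleftrightarrow>
     (\<forall>p\<in>X. \<exists>r s. entry_polynomial r \<and> entry_polynomial s \<and> s p \<noteq> 0 \<and>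
        (\<forall>q\<in>X. s q \<noteq> 0 \<longrightarrow> f q = r q / s q))"

definition mat22 :: "complex \<Rightarrow> complex \<Rightarrow> complex \<Rightarrow> complex \<Rightarrow> complex^2^2" where
  "mat22 p q r s = vector [vector [p, q], vector [r, s]]"

definition SL2 :: "(complex^2^2) set" where
  "SL2 = {A. det A = 1}"

definition GL :: "(complex^'m::finite^'m) monoid" where
  "GL = \<lparr>carrier = {A. invertible A}, mult = (**), one = mat 1\<rparr>"

type_synonym 'm pinning = "nat \<Rightarrow> complex^2^2 \<Rightarrow> complex^'m^'m"

definition x_pos :: "('m::finite) pinning \<Rightarrow> nat \<Rightarrow> complex \<Rightarrow> complex^'m^'m" where
  "x_pos \<phi> i t = \<phi> i (mat22 1 t 0 1)"

definition x_neg :: "('m::finite) pinning \<Rightarrow> nat \<Rightarrow> complex \<Rightarrow> complex^'m^'m" where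
  "x_neg \<phi> i t = \<phi> i (mat22 1 0 t 1)"

definition coroot :: "('m::finite) pinning \<Rightarrow> nat \<Rightarrow> complex \<Rightarrow> complex^'m^'m" where
  "coroot \<phi> i t = \<phi> i (mat22 t 0 0 (inverse t))"

definition s_bar :: "('m::finite) pinning \<Rightarrow> nat \<Rightarrow> complex^'m^'m" where
  "s_bar \<phi> i = \<phi> i (mat22 0 (- 1) 1 0)"

definition w_bar :: "('m::finite) pinning \<Rightarrow> nat list \<Rightarrow> complex^'m^'m" where
  "w_bar \<phi> w = foldr (\<lambda>i X. s_bar \<phi> i ** X) w (mat 1)"

definition torus_elem :: "nat \<Rightarrow> ('m::finite) pinning \<Rightarrow> (nat \<Rightarrow> complex) \<Rightarrow> complex^'m^'m" where
  "torus_elem n \<phi> t = foldr (\<lambda>i X. coroot \<phi> i (t i) ** X) [1..<Suc n] (mat 1)"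

text \<open>A simply connected complex semisimple group with Cartan matrix \<open>a\<close>, in a faithful linear
  realization, together with its embeddings \<open>\<phi>\<^sub>i\<close> of \<open>SL\<^sub>2\<close>. The group is generated by the images of the
  \<open>\<phi>\<^sub>i\<close> (see \<open>group_set\<close>). The second and third conditions say that \<open>x\<^sub>j\<close> and \<open>y\<^sub>j\<close> are
  root subgroups for \<open>\<alpha>\<^sub>j\<close> and \<open>- \<alpha>\<^sub>j\<close>, where \<open>\<langle>\<alpha>\<^sub>j, \<alpha>\<^sub>i\<^sup>\<or>\<rangle> = a\<^sub>i\<^sub>j\<close>, and that
  \<open>[e\<^sub>i, f\<^sub>j] = 0\<close> for \<open>i \<noteq> j\<close>; on Lie algebras this gives the Chevalley relations, of which the
  Serre relations are a consequence in finite dimension. The last condition is simple connectedness: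
  the simple coroots are a basis of the cocharacter lattice of the maximal torus.\<close>

definition simply_connected_group ::
  "nat \<Rightarrow> (nat \<Rightarrow> nat \<Rightarrow> int) \<Rightarrow> ('m::finite) pinning \<Rightarrow> bool" where
  "simply_connected_group n a \<phi> \<longleftrightarrow>
     (\<forall>i\<in>{1..n}. \<phi> i (mat 1) = mat 1 \<and>
        (\<forall>A\<in>SL2. \<forall>B\<in>SL2. \<phi> i (A ** B) = \<phi> i A ** \<phi> i B) \<and>
        (\<forall>r s. regular_on SL2 (\<lambda>A. \<phi> i A $ r $ s))) \<and>
     (\<forall>i\<in>{1..n}. \<forall>j\<in>{1..n}. \<forall>t u. t \<noteq> 0 \<longrightarrow>
        coroot \<phi> i t ** x_pos \<phi> j u = x_pos \<phi> j (t powi a i j * u) ** coroot \<phi> i t \<and>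
        coroot \<phi> i t ** x_neg \<phi> j u = x_neg \<phi> j (t powi (- a i j) * u) ** coroot \<phi> i t) \<and>
     (\<forall>i\<in>{1..n}. \<forall>j\<in>{1..n}. \<forall>t u. i \<noteq> j \<longrightarrow>
        x_pos \<phi> i t ** x_neg \<phi> j u = x_neg \<phi> j u ** x_pos \<phi> i t) \<and>
     (\<forall>t. (\<forall>i\<in>{1..n}. t i \<noteq> 0) \<and> torus_elem n \<phi> t = mat 1 \<longrightarrow> (\<forall>i\<in>{1..n}. t i = 1))"

definition group_set :: "nat \<Rightarrow> ('m::finite) pinning \<Rightarrow> (complex^'m^'m) set" where
  "group_set n \<phi> = generate GL (\<Union>i\<in>{1..n}. \<phi> i ` SL2)"

definition N_pos :: "nat \<Rightarrow> ('m::finite) pinning \<Rightarrow> (complex^'m^'m) set" where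
  "N_pos n \<phi> = generate GL {x_pos \<phi> i t |i t. i \<in> {1..n}}"

definition N_neg :: "nat \<Rightarrow> ('m::finite) pinning \<Rightarrow> (complex^'m^'m) set" where
  "N_neg n \<phi> = generate GL {x_neg \<phi> i t |i t. i \<in> {1..n}}"

definition max_torus :: "nat \<Rightarrow> ('m::finite) pinning \<Rightarrow> (complex^'m^'m) set" where
  "max_torus n \<phi> = {torus_elem n \<phi> t |t. \<forall>i\<in>{1..n}. t i \<noteq> 0}"

definition B_neg :: "nat \<Rightarrow> ('m::finite) pinning \<Rightarrow> (complex^'m^'m) set" where
  "B_neg n \<phi> = {h ** u |h u. h \<in> max_torus n \<phi> \<and> u \<in> N_neg n \<phi>}"

text \<open>\<open>\<Delta> \<gamma> \<delta>\<close> is the generalized minor \<open>\<Delta>\<^sub>\<gamma>\<^sub>,\<^sub>\<delta>\<close> for \<open>\<gamma> = u \<omega>\<^sub>i\<close> and \<open>\<delta> = v \<omega>\<^sub>i\<close>; the \<open>\<omega>\<^sub>i\<close>-th power of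
  \<open>torus_elem n \<phi> t\<close> is \<open>t i\<close>.\<close>

definition generalized_minors ::
  "nat \<Rightarrow> (nat \<Rightarrow> nat \<Rightarrow> int) \<Rightarrow> ('m::finite) pinning \<Rightarrow>
   (weight \<Rightarrow> weight \<Rightarrow> complex^'m^'m \<Rightarrow> complex) \<Rightarrow> bool" where
  "generalized_minors n a \<phi> \<Delta> \<longleftrightarrow>
     (\<forall>i\<in>{1..n}. \<forall>u v. reduced_word n a u \<and> reduced_word n a v \<longrightarrow>
        (let D = \<Delta> (weyl_action n a u (fund_weight i)) (weyl_action n a v (fund_weight i)) in
           regular_on (group_set n \<phi>) D \<and>
           (\<forall>n1\<in>N_neg n \<phi>. \<forall>n2\<in>N_pos n \<phi>. \<forall>t. (\<forall>j\<in>{1..n}. t j \<noteq> 0) \<longrightarrow>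
              D (w_bar \<phi> u ** n1 ** torus_elem n \<phi> t ** n2 ** matrix_inv (w_bar \<phi> v)) = t i)))"

text \<open>The reduced double Bruhat cell of a Coxeter element; \<open>rev c\<close> is a reduced word of the
  inverse of \<open>c\<close>.\<close>

definition reduced_cell :: "nat \<Rightarrow> ('m::finite) pinning \<Rightarrow> nat list \<Rightarrow> (complex^'m^'m) set" where
  "reduced_cell n \<phi> c =
     {n1 ** w_bar \<phi> c ** n2 |n1 n2. n1 \<in> N_pos n \<phi> \<and> n2 \<in> N_pos n \<phi>} \<inter>
     {b1 ** w_bar \<phi> (rev c) ** b2 |b1 b2. b1 \<in> B_neg n \<phi> \<and> b2 \<in> B_neg n \<phi>}"

text \<open>The field \<open>'k\<close> is the field of fractions of the coordinate ring of \<open>X\<close>, the embedding being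
  given by \<open>\<iota>\<close>.\<close>

definition is_function_field ::
  "(complex^'m^'m) set \<Rightarrow> ((complex^'m^'m \<Rightarrow> complex) \<Rightarrow> 'k::field) \<Rightarrow> bool" where
  "is_function_field X \<iota> \<longleftrightarrow>
     \<iota> (\<lambda>p. 1) = 1 \<and>
     (\<forall>f g. regular_on X f \<and> regular_on X g \<longrightarrow>
        \<iota> (\<lambda>p. f p + g p) = \<iota> f + \<iota> g \<and>
        \<iota> (\<lambda>p. f p * g p) = \<iota> f * \<iota> g \<and>
        (\<iota> f = \<iota> g \<longleftrightarrow> (\<forall>p\<in>X. f p = g p))) \<and>
     (\<forall>z. \<exists>f g. regular_on X f \<and> regular_on X g \<and> \<iota> g \<noteq> 0 \<and> z = \<iota> f / \<iota> g)"


section \<open>The cluster algebra of a Coxeter element\<close>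

context
  fixes n :: nat and a :: "nat \<Rightarrow> nat \<Rightarrow> int"
    and \<Delta> :: "weight \<Rightarrow> weight \<Rightarrow> complex^'m::finite^'m \<Rightarrow> complex"
    and c :: "nat list"
    and \<iota> :: "(complex^'m^'m \<Rightarrow> complex) \<Rightarrow> 'k::field_char_0"
begin

definition cox_x :: "weight \<Rightarrow> 'k" where
  "cox_x \<gamma> = \<iota> (\<Delta> \<gamma> \<gamma>)"

definition cox_y :: "nat \<Rightarrow> 'k" where
  "cox_y j = \<iota> (\<lambda>p. \<Delta> (fund_weight j) (weyl_action n a c (fund_weight j)) p *
     (\<Prod>i | coxeter_prec a c i j.
        \<Delta> (fund_weight i) (weyl_action n a c (fund_weight i)) p powi a i j))"

text \<open>Principal coefficients: the coefficient semifield is \<open>trop {1..n}\<close>, whose \<open>i\<close>-th generator is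
  realized in the field by \<open>cox_y i\<close>.\<close>

definition cox_coeff :: "(nat \<Rightarrow> int) \<Rightarrow> 'k" where
  "cox_coeff p = (\<Prod>i\<in>{1..n}. cox_y i powi p i)"

definition cox_seed :: "('k, nat \<Rightarrow> int) seed" where
  "cox_seed = Seed (\<lambda>i. cox_x (fund_weight i)) trop_gen (coxeter_matrix a c)"

end

end

theory Submission
  imports Defs
begin

text \<open>In a cluster algebra with principal coefficients, clusters are subtraction-free expressions in
  the algebraically independent elements \<open>x\<^sub>i\<close>, \<open>y\<^sub>i\<close>. The seed obtained by \<open>\<mu>\<^sub>1\<close> consists of algebraically
  independent elements again, and its coefficients \<open>y'\<^sub>i\<close> are a basis of the coefficient group; so sending
  one initial seed to this seed defines a field isomorphism. As the elements \<open>y_hat\<close> mutate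
  without reference to the coefficients, it takes cluster variables to cluster variables up to
  a coefficient. Cluster variables do not vanish at \<open>y\<^sub>j = 0\<close>, and the order of vanishing of
  a subtraction-free expression is its tropical value; hence that coefficient is the value of the
  F-polynomial at \<open>y'\<close>. That F is a polynomial is the Laurent phenomenon, for
  which three consecutive mutations in directions \<open>j\<close>, \<open>k\<close>, \<open>j\<close> are compared.

  The exchange relation comes from the identity
  \<open>\<Delta>\<^sub>\<omega>\<^sub>,\<^sub>\<omega> \<Delta>\<^sub>s\<^sub>\<omega>\<^sub>,\<^sub>s\<^sub>\<omega> = \<Delta>\<^sub>\<omega>\<^sub>,\<^sub>s\<^sub>\<omega> \<Delta>\<^sub>s\<^sub>\<omega>\<^sub>,\<^sub>\<omega> + \<Prod>\<^sub>i \<Delta>\<^sub>i\<^bsup>-a\<^sub>i\<^sub>1\<^esup>\<close> for \<open>\<omega> = \<omega>\<^sub>1\<close>, \<open>s = s\<^sub>1\<close> and \<open>\<Delta>\<^sub>i = \<Delta>\<^sub>\<omega>\<^sub>i\<^sub>,\<^sub>\<omega>\<^sub>i\<close> with \<open>i \<noteq> 1\<close>. It holds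
  on \<open>N\<^sub>- H N\<close>, which is dense, by direct computation, and the factor \<open>\<Delta>\<^sub>s\<^sub>\<omega>\<^sub>,\<^sub>\<omega>\<close> is \<open>1\<close> on the reduced cell.\<close>

section \<open>Evaluation of integer polynomials\<close>

text \<open>Elements of the ambient fields are studied through real functions. By algebraic
  independence an identity between subtraction-free expressions in the field holds at all positive
  real points, and there it can be analysed by continuity and growth: a polynomial is zero if it
  vanishes on the positive orthant, divisibility by \<open>y_j - c\<close> is read off from values
  on a hyperplane, and tropical values are growth exponents along curves. No greatest common
  divisors are formed; in the Laurent phenomenon, coprimality to \<open>1 + y_j\<close> is replaced
  by not vanishing at \<open>y_j = -1\<close>. Since the initial cluster contributes only a monomial
  factor to later clusters, that phenomenon is proved with all \<open>x_i = 1\<close>. The field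
  isomorphism is handled as a relation, its graph, so that the two generated fields need not be
  constructed. On the side of the group, the minors are prescribed only on translates of
  \<open>N\<^sub>- H N\<close>; the calculation there moves one root subgroup element at a time
  through a word and is valid for all but finitely many parameters.\<close>

definition mon_eval :: "(nat \<Rightarrow> 'r::comm_ring_1) \<Rightarrow> (nat \<Rightarrow>\<^sub>0 nat) \<Rightarrow> 'r" where
  "mon_eval v m = (\<Prod>i\<in>Poly_Mapping.keys m. v i ^ Poly_Mapping.lookup m i)"

text \<open>Values in any commutative ring are allowed, so that polynomials can also be substituted
  into polynomials, as in \<open>meval_compose\<close>.\<close>

definition meval :: "(nat \<Rightarrow> 'r::comm_ring_1) \<Rightarrow> int mpoly \<Rightarrow> 'r" where
  "meval v p = (\<Sum>m\<in>Poly_Mapping.keys p. of_int (Poly_Mapping.lookup p m) * mon_eval v m)"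

lemma mpoly_eval_of_int: "mpoly_eval of_int v = meval v"
  by (simp add: fun_eq_iff mpoly_eval_def meval_def mon_eval_def)

lemma mon_eval_superset:
  assumes "finite A" "Poly_Mapping.keys m \<subseteq> A"
  shows "mon_eval v m = (\<Prod>i\<in>A. v i ^ Poly_Mapping.lookup m i)"
  unfolding mon_eval_def
  by (rule prod.mono_neutral_left) (use assms in \<open>auto simp: in_keys_iff\<close>)

lemma mon_eval_add: "mon_eval v (m + m') = mon_eval v m * mon_eval v m'"
proof -
  let ?A = "Poly_Mapping.keys m \<union> Poly_Mapping.keys m'"
  have "Poly_Mapping.keys (m + m') \<subseteq> ?A" by (rule Poly_Mapping.keys_add)
  then show ?thesis
    by (simp add: mon_eval_superset[of ?A] lookup_add power_add prod.distrib)
qed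

lemma mon_eval_0 [simp]: "mon_eval v 0 = 1"
  by (simp add: mon_eval_def)

lemma mon_eval_single [simp]: "mon_eval v (Poly_Mapping.single i k) = v i ^ k"
  by (cases "k = 0") (auto simp: mon_eval_def)

lemma meval_add [simp]: "meval v (p + q) = meval v p + meval v q"
  unfolding meval_def by (rule setsum_keys_plus_distrib) (auto simp: algebra_simps)

lemma meval_0 [simp]: "meval v 0 = 0"
  by (simp add: meval_def)

lemma meval_single [simp]: "meval v (Poly_Mapping.single m c) = of_int c * mon_eval v m"
  by (cases "c = 0") (auto simp: meval_def)

lemma meval_sum: "meval v (\<Sum>x\<in>A. f x) = (\<Sum>x\<in>A. meval v (f x))"
  by (induction A rule: infinite_finite_induct) auto

lemma poly_mapping_eq_sum_single:
  "p = (\<Sum>m\<in>Poly_Mapping.keys p. Poly_Mapping.single m (Poly_Mapping.lookup p m))"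
  by (rule poly_mapping_eqI) (auto simp: lookup_sum lookup_single when_def in_keys_iff)

lemma meval_mult [simp]: "meval v (p * q) = meval v p * meval v q"
proof -
  let ?s = "\<lambda>p::int mpoly. \<Sum>m\<in>Poly_Mapping.keys p. Poly_Mapping.single m (Poly_Mapping.lookup p m)"
  have "meval v (?s p * ?s q) = meval v (?s p) * meval v (?s q)"
    by (simp add: sum_product mult_single meval_sum mon_eval_add algebra_simps)
  then show ?thesis by (simp add: poly_mapping_eq_sum_single[symmetric])
qed

lemma meval_1 [simp]: "meval v 1 = 1"
  by (simp add: single_one[symmetric] del: single_one)

lemma meval_uminus [simp]: "meval v (- p) = - meval v p"
  using meval_add[of v p "- p"] by (simp add: add_eq_0_iff del: meval_add)

lemma meval_diff [simp]: "meval v (p - q) = meval v p - meval v q"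
  using meval_add[of v p "- q"] by simp

lemma meval_of_int [simp]: "meval v (of_int c) = of_int c"
  by (simp add: single_of_int[symmetric] del: single_of_int)

lemma meval_power [simp]: "meval v (p ^ k) = meval v p ^ k"
  by (induction k) auto

lemma meval_prod: "meval v (\<Prod>x\<in>A. f x) = (\<Prod>x\<in>A. meval v (f x))"
  by (induction A rule: infinite_finite_induct) auto

lemma meval_var [simp]: "meval v (mpoly_var i) = v i"
  by (simp add: mpoly_var_def)

text \<open>Integer polynomials are generated as a ring by constants and variables. With this rule,
  facts about substitution reduce to ring identities without a look at monomials.\<close>

lemma mpoly_induct [case_names const var add mult]:
  assumes "\<And>c. P (of_int c)" "\<And>i. P (mpoly_var i)"
    and add: "\<And>p q. P p \<Longrightarrow> P q \<Longrightarrow> P (p + q)" and mult: "\<And>p q. P p \<Longrightarrow> P q \<Longrightarrow> P (p * q)"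
  shows "P (p :: int mpoly)"
proof -
  have sum: "P (\<Sum>x\<in>A. f x)" if "\<And>x. P (f x)" for f :: "(nat \<Rightarrow>\<^sub>0 nat) \<Rightarrow> int mpoly" and A
    using that assms(1)[of 0] add by (induction A rule: infinite_finite_induct) auto
  have pow: "P (mpoly_var i ^ k)" for i k
    using assms(1)[of 1] assms(2) mult by (induction k) auto
  have mono: "P (Poly_Mapping.single m 1)" for m
  proof (induction m rule: Poly_Mapping.update_induct)
    case const
    show ?case using assms(1)[of 1] by simp
  next
    case (update m i k)
    have "Poly_Mapping.update i k m = Poly_Mapping.single i k + m"
      using update(1) by (intro poly_mapping_eqI) (auto simp: lookup_update lookup_add lookup_single when_def in_keys_iff)
    then have "Poly_Mapping.single (Poly_Mapping.update i k m) 1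
        = Poly_Mapping.single (Poly_Mapping.single i k) 1 * Poly_Mapping.single m (1::int)"
      by (simp add: mult_single)
    moreover have "Poly_Mapping.single (Poly_Mapping.single i k) (1::int) = mpoly_var i ^ k"
    proof (induction k)
      case (Suc k)
      have "Poly_Mapping.single (Poly_Mapping.single i (Suc k)) (1::int)
          = mpoly_var i * Poly_Mapping.single (Poly_Mapping.single i k) 1"
        by (simp add: mpoly_var_def mult_single single_add[symmetric])
      then show ?case by (simp only: Suc power_Suc)
    qed simp
    ultimately show ?case using mult[OF pow update(3)] by simp
  qed
  have "P (Poly_Mapping.single m c)" for m c
  proof -
    have "Poly_Mapping.single m c = of_int c * Poly_Mapping.single m (1::int)"
      by (simp add: single_of_int[symmetric] mult_single del: single_of_int)
    then show ?thesis using mult[OF assms(1) mono] by simp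
  qed
  then show ?thesis by (subst poly_mapping_eq_sum_single) (rule sum)
qed

lemma meval_compose: "meval v (meval (\<lambda>i. q i :: int mpoly) p) = meval (\<lambda>i. meval v (q i)) p"
  by (induction p rule: mpoly_induct) auto

lemma meval_mpoly_var: "meval mpoly_var p = p"
  by (induction p rule: mpoly_induct) auto

lemma meval_cong_vars:
  assumes "\<And>i. i \<in> mpoly_vars p \<Longrightarrow> v i = w i"
  shows "meval v p = meval w p"
proof -
  have "mon_eval v m = mon_eval w m" if "m \<in> Poly_Mapping.keys p" for m
  proof -
    have "v i = w i" if "i \<in> Poly_Mapping.keys m" for i
      using that \<open>m \<in> Poly_Mapping.keys p\<close> by (intro assms) (auto simp: mpoly_vars_def)
    then show ?thesis by (simp add: mon_eval_def)
  qed
  then show ?thesis by (simp add: meval_def)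
qed

text \<open>Polynomial expressions respect congruence modulo \<open>d\<close>. This is the source of
  the factor theorem in \<open>dvd_of_pos_vanish\<close>.\<close>

lemma dvd_meval_diff:
  assumes "\<And>i. d dvd v i - w i"
  shows "d dvd meval v p - meval w p"
proof (induction p rule: mpoly_induct)
  case (add p q)
  have "meval v (p + q) - meval w (p + q) = (meval v p - meval w p) + (meval v q - meval w q)"
    by (simp add: algebra_simps)
  with add show ?case by (simp del: meval_add)
next
  case (mult p q)
  have "meval v (p * q) - meval w (p * q)
      = (meval v p - meval w p) * meval v q + meval w p * (meval v q - meval w q)"
    by (simp add: algebra_simps)
  with mult show ?case by (metis dvd_add dvd_mult dvd_mult2)
qed (use assms in auto)

lemma mpoly_vars_0 [simp]: "mpoly_vars 0 = {}"
  by (simp add: mpoly_vars_def)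

lemma mpoly_vars_of_int [simp]: "mpoly_vars (of_int c :: int mpoly) = {}"
  by (simp add: single_of_int[symmetric] mpoly_vars_def del: single_of_int)

lemma mpoly_vars_1 [simp]: "mpoly_vars (1 :: int mpoly) = {}"
  using mpoly_vars_of_int[of 1] by (simp del: mpoly_vars_of_int)

lemma mpoly_vars_var [simp]: "mpoly_vars (mpoly_var i) = {i}"
  by (simp add: mpoly_vars_def mpoly_var_def)

lemma mpoly_vars_add: "mpoly_vars (p + q) \<subseteq> mpoly_vars p \<union> mpoly_vars q"
  using Poly_Mapping.keys_add[of p q] by (auto simp: mpoly_vars_def)

lemma mpoly_vars_uminus [simp]: "mpoly_vars (- p :: int mpoly) = mpoly_vars p"
  by (simp add: mpoly_vars_def)

lemma mpoly_vars_diff: "mpoly_vars (p - q :: int mpoly) \<subseteq> mpoly_vars p \<union> mpoly_vars q"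
  using mpoly_vars_add[of p "- q"] by simp

lemma mpoly_vars_mult: "mpoly_vars (p * q :: int mpoly) \<subseteq> mpoly_vars p \<union> mpoly_vars q"
proof
  fix i assume "i \<in> mpoly_vars (p * q)"
  then obtain m where m: "m \<in> Poly_Mapping.keys (p * q)" "i \<in> Poly_Mapping.keys m"
    by (auto simp: mpoly_vars_def)
  then obtain m1 m2 where "m = m1 + m2" "m1 \<in> Poly_Mapping.keys p" "m2 \<in> Poly_Mapping.keys q"
    using Poly_Mapping.keys_mult[of p q] by blast
  then show "i \<in> mpoly_vars p \<union> mpoly_vars q"
    using m Poly_Mapping.keys_add[of m1 m2] by (auto simp: mpoly_vars_def)
qed

lemma mpoly_vars_meval:
  assumes "\<And>i. mpoly_vars (v i :: int mpoly) \<subseteq> A"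
  shows "mpoly_vars (meval v p) \<subseteq> A"
proof (induction p rule: mpoly_induct)
  case (add p q) then show ?case using mpoly_vars_add[of "meval v p" "meval v q"] by auto
next
  case (mult p q) then show ?case using mpoly_vars_mult[of "meval v p" "meval v q"] by auto
qed (use assms in auto)

section \<open>Integer polynomials as functions on the positive orthant\<close>

definition posv :: "(nat \<Rightarrow> real) \<Rightarrow> bool" where
  "posv Y \<longleftrightarrow> (\<forall>i. 0 < Y i)"

lemma mon_eval_mult: "mon_eval (\<lambda>i. v i * w i) m = mon_eval v m * mon_eval w m"
  by (simp add: mon_eval_def power_mult_distrib prod.distrib)

lemma mon_eval_real_inj:
  assumes "m \<noteq> m'"
  shows "\<exists>Y::nat \<Rightarrow> real. posv Y \<and> mon_eval Y m \<noteq> mon_eval Y m'"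
proof -
  obtain i where i: "Poly_Mapping.lookup m i \<noteq> Poly_Mapping.lookup m' i"
    using assms by (metis poly_mapping_eqI)
  let ?Y = "\<lambda>k. if k = i then 2 else 1 :: real"
  have "mon_eval ?Y m = 2 ^ Poly_Mapping.lookup m i" for m
    by (subst mon_eval_superset[of "insert i (Poly_Mapping.keys m)"])
      (auto simp: if_distrib[of "\<lambda>x. x ^ _"] prod.If_cases intro!: prod.neutral)
  then have "mon_eval ?Y m \<noteq> mon_eval ?Y m'" using i by simp
  then show ?thesis by (intro exI[of _ ?Y]) (auto simp: posv_def)
qed

text \<open>Distinct monomials are distinct characters of the positive orthant, hence linearly
  independent.\<close>

lemma monomials_independent:
  fixes c :: "(nat \<Rightarrow>\<^sub>0 nat) \<Rightarrow> real"
  assumes "finite S" "\<And>Y. posv Y \<Longrightarrow> (\<Sum>m\<in>S. c m * mon_eval Y m) = 0" "m \<in> S"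
  shows "c m = 0"
  using assms
proof (induction S arbitrary: c m rule: finite_induct)
  case (insert m0 S)
  have 0: "c m1 = 0" if m1: "m1 \<in> S" for m1
  proof -
    have "m0 \<noteq> m1" using m1 insert.hyps by auto
    then obtain Z :: "nat \<Rightarrow> real" where Z: "posv Z" "mon_eval Z m0 \<noteq> mon_eval Z m1"
      using mon_eval_real_inj by blast
    \<comment> \<open>Dedekind's argument: the relation at the product of \<open>Z\<close> and
      \<open>Y\<close>, minus \<open>mon_eval Z m0\<close> times the relation at \<open>Y\<close>,
      no longer involves \<open>m0\<close>, while the coefficient of \<open>m1\<close> only gains a
      nonzero factor.\<close>
    have "(\<Sum>m\<in>S. (c m * (mon_eval Z m - mon_eval Z m0)) * mon_eval Y m) = 0" if Y: "posv Y" for Y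
    proof -
      have "posv (\<lambda>i. Z i * Y i)" using Y Z by (auto simp: posv_def)
      then have "(\<Sum>m\<in>insert m0 S. c m * mon_eval (\<lambda>i. Z i * Y i) m) = 0"
        by (rule insert.prems)
      moreover have "mon_eval Z m0 * (\<Sum>m\<in>insert m0 S. c m * mon_eval Y m) = 0"
        using insert.prems(1)[OF Y] by simp
      ultimately show ?thesis
        using insert.hyps by (simp add: mon_eval_mult sum_distrib_left sum_subtractf algebra_simps)
    qed
    from insert.IH[OF this m1] Z show ?thesis by simp
  qed
  have "c m0 = 0"
  proof -
    have "(\<Sum>m\<in>insert m0 S. c m * mon_eval (\<lambda>_. 1) m) = 0"
      by (rule insert.prems) (simp add: posv_def)
    moreover have "mon_eval (\<lambda>_. 1 :: real) m = 1" for m by (simp add: mon_eval_def)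
    ultimately show ?thesis using 0 insert.hyps by simp
  qed
  with 0 insert.prems(2) show ?case by auto
qed auto

lemma meval_pos_zero:
  assumes "\<And>Y. posv Y \<Longrightarrow> meval Y p = (0::real)"
  shows "p = 0"
proof (rule poly_mapping_eqI)
  fix m
  show "Poly_Mapping.lookup p m = Poly_Mapping.lookup 0 m"
  proof (cases "m \<in> Poly_Mapping.keys p")
    case True
    have "real_of_int (Poly_Mapping.lookup p m) = 0"
      by (rule monomials_independent[of "Poly_Mapping.keys p"]) (use assms True in \<open>auto simp: meval_def\<close>)
    then show ?thesis by simp
  qed (simp add: in_keys_iff)
qed

lemma meval_pos_eq:
  assumes "\<And>Y. posv Y \<Longrightarrow> meval Y p = (meval Y q :: real)"
  shows "p = q"
  using meval_pos_zero[of "p - q"] assms by simp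

text \<open>Setting variable \<open>j\<close> to \<open>c\<close> changes \<open>p\<close> by a
  multiple of the linear polynomial, and the result is zero because it vanishes at all positive
  points. The hyperplane itself may lie outside the positive orthant: the values used below are
  \<open>c = 0\<close> and \<open>c = -1\<close>.\<close>

lemma dvd_of_pos_vanish:
  assumes "\<And>Y. posv Y \<Longrightarrow> meval (Y(j := of_int c)) p = (0::real)"
  shows "mpoly_var j - of_int c dvd p"
proof -
  let ?w = "mpoly_var(j := of_int c)"
  have "meval ?w p = 0"
  proof (rule meval_pos_zero)
    fix Y :: "nat \<Rightarrow> real" assume Y: "posv Y"
    have "(\<lambda>i. meval Y (?w i)) = Y(j := of_int c)" by auto
    then show "meval Y (meval ?w p) = 0" using assms[OF Y] by (simp add: meval_compose)
  qed
  moreover have "mpoly_var j - of_int c dvd meval mpoly_var p - meval ?w p"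
    by (rule dvd_meval_diff) auto
  ultimately show ?thesis by (simp add: meval_mpoly_var)
qed

section \<open>Algebraic independence over the integers\<close>

text \<open>Independence over the integers is the right notion because the generators of the
  coefficient group will themselves be members of the family \<open>v\<close>.\<close>

definition zindep :: "nat set \<Rightarrow> (nat \<Rightarrow> 'k::comm_ring_1) \<Rightarrow> bool" where
  "zindep J v \<longleftrightarrow> (\<forall>p. mpoly_vars p \<subseteq> J \<and> meval v p = 0 \<longrightarrow> p = 0)"

lemma zindepD: "zindep J v \<Longrightarrow> mpoly_vars p \<subseteq> J \<Longrightarrow> meval v p = 0 \<Longrightarrow> p = 0"
  by (simp add: zindep_def)

text \<open>For independent families this is the graph of the isomorphism, between the fields they
  generate, that sends \<open>v i\<close> to \<open>v' i\<close>.\<close>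

definition qrel :: "nat set \<Rightarrow> (nat \<Rightarrow> 'k::field) \<Rightarrow> (nat \<Rightarrow> 'l::field) \<Rightarrow> 'k \<Rightarrow> 'l \<Rightarrow> bool" where
  "qrel J v v' z z' \<longleftrightarrow> (\<exists>N D. mpoly_vars N \<subseteq> J \<and> mpoly_vars D \<subseteq> J \<and> D \<noteq> 0 \<and>
     z = meval v N / meval v D \<and> z' = meval v' N / meval v' D)"

lemma qrel_sym: "qrel J v v' z z' \<Longrightarrow> qrel J v' v z' z"
  unfolding qrel_def by blast

lemma vars_multI: "mpoly_vars p \<subseteq> J \<Longrightarrow> mpoly_vars q \<subseteq> J \<Longrightarrow> mpoly_vars (p * q :: int mpoly) \<subseteq> J"
  using mpoly_vars_mult[of p q] by blast

lemma vars_addI: "mpoly_vars p \<subseteq> J \<Longrightarrow> mpoly_vars q \<subseteq> J \<Longrightarrow> mpoly_vars (p + q) \<subseteq> J"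
  using mpoly_vars_add[of p q] by blast

lemma vars_diffI: "mpoly_vars p \<subseteq> J \<Longrightarrow> mpoly_vars q \<subseteq> J \<Longrightarrow> mpoly_vars (p - q :: int mpoly) \<subseteq> J"
  using mpoly_vars_diff[of p q] by blast

lemma qrel_poly: "mpoly_vars N \<subseteq> J \<Longrightarrow> qrel J v v' (meval v N) (meval v' N)"
  unfolding qrel_def by (rule exI[of _ N], rule exI[of _ 1]) simp

lemma qrel_var: "i \<in> J \<Longrightarrow> qrel J v v' (v i) (v' i)"
  using qrel_poly[of "mpoly_var i" J v v'] by simp

lemma qrel_1: "qrel J v v' 1 1"
  using qrel_poly[of 1 J v v'] by simp

lemma qrel_0: "qrel J v v' 0 0"
  using qrel_poly[of 0 J v v'] by simp

context
  fixes J and v :: "nat \<Rightarrow> 'k::field" and v' :: "nat \<Rightarrow> 'l::field"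
  assumes ind: "zindep J v" "zindep J v'"
begin

lemma qrel_add:
  assumes "qrel J v v' a a'" "qrel J v v' b b'" shows "qrel J v v' (a + b) (a' + b')"
proof -
  obtain N D N1 D1 where *: "mpoly_vars N \<subseteq> J" "mpoly_vars D \<subseteq> J" "D \<noteq> 0" "a = meval v N / meval v D"
    "a' = meval v' N / meval v' D" "mpoly_vars N1 \<subseteq> J" "mpoly_vars D1 \<subseteq> J" "D1 \<noteq> 0"
    "b = meval v N1 / meval v D1" "b' = meval v' N1 / meval v' D1"
    using assms unfolding qrel_def by metis
  have "meval v D \<noteq> 0" "meval v D1 \<noteq> 0" "meval v' D \<noteq> 0" "meval v' D1 \<noteq> 0"
    using * ind by (auto dest: zindepD)
  then show ?thesis unfolding qrel_def
    by - (rule exI[of _ "N * D1 + N1 * D"], rule exI[of _ "D * D1"],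
        use * in \<open>simp add: add_frac_eq vars_multI vars_addI\<close>)
qed

lemma qrel_mult:
  assumes "qrel J v v' a a'" "qrel J v v' b b'" shows "qrel J v v' (a * b) (a' * b')"
proof -
  obtain N D N1 D1 where *: "mpoly_vars N \<subseteq> J" "mpoly_vars D \<subseteq> J" "D \<noteq> 0" "a = meval v N / meval v D"
    "a' = meval v' N / meval v' D" "mpoly_vars N1 \<subseteq> J" "mpoly_vars D1 \<subseteq> J" "D1 \<noteq> 0"
    "b = meval v N1 / meval v D1" "b' = meval v' N1 / meval v' D1"
    using assms unfolding qrel_def by metis
  then show ?thesis unfolding qrel_def
    by - (rule exI[of _ "N * N1"], rule exI[of _ "D * D1"],
        simp add: vars_multI)
qed

lemma qrel_uminus:
  assumes "qrel J v v' a a'" shows "qrel J v v' (- a) (- a')"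
  using qrel_mult[OF qrel_poly[of "of_int (-1)"] assms] by simp

lemma qrel_diff:
  assumes "qrel J v v' a a'" "qrel J v v' b b'" shows "qrel J v v' (a - b) (a' - b')"
  using qrel_add[OF assms(1) qrel_uminus[OF assms(2)]] by simp

lemma qrel_inverse:
  assumes "qrel J v v' a a'" shows "qrel J v v' (inverse a) (inverse a')"
proof -
  obtain N D where *: "mpoly_vars N \<subseteq> J" "mpoly_vars D \<subseteq> J" "D \<noteq> 0" "a = meval v N / meval v D"
    "a' = meval v' N / meval v' D"
    using assms unfolding qrel_def by metis
  show ?thesis
  proof (cases "N = 0")
    case True
    then show ?thesis using * qrel_0[of J v v'] by simp
  next
    case False
    then show ?thesis unfolding qrel_def
      by - (rule exI[of _ D], rule exI[of _ N],
        use * in auto)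
  qed
qed

lemma qrel_divide:
  assumes "qrel J v v' a a'" "qrel J v v' b b'" shows "qrel J v v' (a / b) (a' / b')"
  using qrel_mult[OF assms(1) qrel_inverse[OF assms(2)]] by (simp add: divide_inverse)

lemma qrel_power: "qrel J v v' a a' \<Longrightarrow> qrel J v v' (a ^ k) (a' ^ k)"
  by (induction k) (auto intro: qrel_1 qrel_mult)

lemma qrel_powi: "qrel J v v' a a' \<Longrightarrow> qrel J v v' (a powi k) (a' powi k)"
  by (auto simp: power_int_def intro: qrel_power qrel_inverse)

lemma qrel_prod:
  assumes "\<And>i. i \<in> A \<Longrightarrow> qrel J v v' (f i) (f' i)"
  shows "qrel J v v' (\<Prod>i\<in>A. f i) (\<Prod>i\<in>A. f' i)"
  using assms by (induction A rule: infinite_finite_induct) (auto intro: qrel_1 qrel_mult)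

text \<open>By subtraction it is enough to see what is related to \<open>0\<close>: independence of
  \<open>v\<close> forces the numerator to be the zero polynomial. Together with
  \<open>qrel_sym\<close> this also gives injectivity.\<close>

lemma qrel_unique:
  assumes "qrel J v v' a a'" "qrel J v v' a b'" shows "a' = b'"
proof -
  have "qrel J v v' 0 (a' - b')" using qrel_diff[OF assms] by simp
  then obtain N D where *: "mpoly_vars N \<subseteq> J" "mpoly_vars D \<subseteq> J" "D \<noteq> 0" "0 = meval v N / meval v D"
    "a' - b' = meval v' N / meval v' D"
    unfolding qrel_def by metis
  then have "meval v D \<noteq> 0" using ind by (auto dest: zindepD)
  then have "N = 0" using * ind by (auto dest: zindepD)
  then show ?thesis using * by simp
qed

end

section \<open>Subtraction-free expressions\<close>

primrec sfe :: "(nat \<Rightarrow> 'k::field) \<Rightarrow> sf_expr \<Rightarrow> 'k" where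
  "sfe v (SF_Var i) = v i"
| "sfe v SF_One = 1"
| "sfe v (SF_Add s t) = sfe v s + sfe v t"
| "sfe v (SF_Mult s t) = sfe v s * sfe v t"
| "sfe v (SF_Div s t) = sfe v s / sfe v t"

text \<open>Nothing is cancelled, so both components are built by addition and multiplication alone
  and stay positive at positive points. In particular neither is the zero polynomial.\<close>

fun sf_numden :: "sf_expr \<Rightarrow> int mpoly \<times> int mpoly" where
  "sf_numden (SF_Var i) = (mpoly_var i, 1)"
| "sf_numden SF_One = (1, 1)"
| "sf_numden (SF_Add s t) = (fst (sf_numden s) * snd (sf_numden t) + fst (sf_numden t) * snd (sf_numden s),
     snd (sf_numden s) * snd (sf_numden t))"
| "sf_numden (SF_Mult s t) = (fst (sf_numden s) * fst (sf_numden t), snd (sf_numden s) * snd (sf_numden t))"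
| "sf_numden (SF_Div s t) = (fst (sf_numden s) * snd (sf_numden t), snd (sf_numden s) * fst (sf_numden t))"

abbreviation "sf_num t \<equiv> fst (sf_numden t)"
abbreviation "sf_den t \<equiv> snd (sf_numden t)"

lemma sf_numden_vars: "mpoly_vars (sf_num t) \<subseteq> sf_vars t \<and> mpoly_vars (sf_den t) \<subseteq> sf_vars t"
  by (induction t)
    (auto intro: vars_addI vars_multI dest!: subsetD[OF mpoly_vars_add] subsetD[OF mpoly_vars_mult])

lemma sf_numden_pos:
  assumes "posv V"
  shows "0 < meval V (sf_num t) \<and> 0 < meval V (sf_den t) \<and> sfe V t = meval V (sf_num t) / meval V (sf_den t)"
  using assms by (induction t) (auto simp: posv_def add_frac_eq add_pos_pos)

lemma sfe_pos: "posv V \<Longrightarrow> 0 < sfe V t"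
  using sf_numden_pos[of V t] by simp

lemma posv_1: "posv (\<lambda>_. 1)"
  by (simp add: posv_def)

lemma sf_numden_nonzero: "sf_num t \<noteq> 0" "sf_den t \<noteq> 0"
  using sf_numden_pos[OF posv_1, of t] by auto

lemma sf_fract_numden: "sf_fract t = Fract (sf_num t) (sf_den t)"
  by (induction t) (simp_all add: sf_numden_nonzero One_fract_def algebra_simps)

lemma sf_numden_zindep:
  assumes "zindep J v" "sf_vars t \<subseteq> J"
  shows "meval v (sf_num t) \<noteq> 0" "meval v (sf_den t) \<noteq> 0"
  using zindepD[OF assms(1), of "sf_num t"] zindepD[OF assms(1), of "sf_den t"]
    sf_numden_nonzero[of t] sf_numden_vars[of t] assms(2) by auto

lemma sfe_zindep:
  assumes "zindep J v" "sf_vars t \<subseteq> J"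
  shows "sfe v t = meval v (sf_num t) / meval v (sf_den t)"
  using assms(2)
proof (induction t)
  case (SF_Add s t)
  then show ?case
    using sf_numden_zindep[OF assms(1), of s] sf_numden_zindep[OF assms(1), of t] by (simp add: add_frac_eq)
qed auto

lemma sfe_cong: "(\<And>i. i \<in> sf_vars t \<Longrightarrow> v i = w i) \<Longrightarrow> sfe v t = sfe w t"
  by (induction t) auto

text \<open>After clearing denominators the equation says that an integer polynomial vanishes at the
  independent family \<open>v\<close>, so that polynomial is zero. This is the passage from elements
  of a field to functions on the positive orthant.\<close>

lemma sfe_eq_transfer:
  assumes "zindep J v" "sf_vars t \<subseteq> J" "sf_vars t' \<subseteq> J" "sfe v t = sfe v t'" "posv V"
  shows "sfe V t = sfe V t'"
proof -
  let ?p = "sf_num t * sf_den t' - sf_num t' * sf_den t"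
  have "meval v ?p = 0"
    using assms sf_numden_zindep[OF assms(1), of t] sf_numden_zindep[OF assms(1), of t']
    by (simp add: sfe_zindep[OF assms(1)] frac_eq_eq)
  moreover have "mpoly_vars ?p \<subseteq> J"
    using sf_numden_vars[of t] sf_numden_vars[of t'] assms
    by (intro vars_diffI vars_multI) auto
  ultimately have "?p = 0" using zindepD[OF assms(1)] by blast
  then have "meval V ?p = 0" by simp
  then show ?thesis
    using sf_numden_pos[OF assms(5), of t] sf_numden_pos[OF assms(5), of t']
    by (simp add: frac_eq_eq)
qed

section \<open>Tropical values\<close>

lemma carrier_trop: "finite I \<Longrightarrow> p \<in> carrier (trop I) \<longleftrightarrow> (\<forall>j. j \<notin> I \<longrightarrow> p j = 0)"
  unfolding trop_def by (auto intro: finite_subset)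

lemma trop_simps [simp]:
  "p \<otimes>\<^bsub>trop I\<^esub> q = (\<lambda>j. p j + q j)" "\<one>\<^bsub>trop I\<^esub> = (\<lambda>j. 0)" "splus (trop I) p q = (\<lambda>j. min (p j) (q j))"
  by (simp_all add: trop_def)

lemma comm_group_trop: "comm_group (trop I)"
  using semifield_trop[of I] by (simp add: semifield_def)

lemma trop_inv:
  assumes "finite I" "p \<in> carrier (trop I)"
  shows "inv\<^bsub>trop I\<^esub> p = (\<lambda>j. - p j)"
proof -
  interpret comm_group "trop I" by (rule comm_group_trop)
  show ?thesis
    by (rule inv_equality) (use assms in \<open>auto simp: carrier_trop\<close>)
qed

lemma trop_nat_pow: "p [^]\<^bsub>trop I\<^esub> (k::nat) = (\<lambda>j. int k * p j)"
  by (induction k) (auto simp: algebra_simps fun_eq_iff)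

lemma trop_int_pow:
  assumes "finite I" "p \<in> carrier (trop I)"
  shows "p [^]\<^bsub>trop I\<^esub> (k::int) = (\<lambda>j. k * p j)"
proof -
  have "(\<lambda>j. int (nat (- k)) * p j) \<in> carrier (trop I)" using assms by (auto simp: carrier_trop)
  then show ?thesis
    by (auto simp: int_pow_def2 trop_nat_pow trop_inv[OF assms(1)] fun_eq_iff)
qed

lemma sf_value_carrier:
  assumes "finite I" "\<And>i. i \<in> sf_vars t \<Longrightarrow> w i \<in> carrier (trop I)"
  shows "sf_value (trop I) w t \<in> carrier (trop I)"
  using assms(2)
proof (induction t)
  case (SF_Div s t)
  then show ?case using assms(1) by (simp add: trop_inv) (simp add: carrier_trop)
qed (use assms(1) in \<open>auto simp: carrier_trop\<close>)

text \<open>Along the curve \<open>s \<mapsto> (a\<^sub>i s\<^bsup>w\<^sub>i\<^esup>)\<^sub>i\<close>, a subtraction-free expression has the order of magnitude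
  of \<open>s\<close> to its tropical value as \<open>s \<rightarrow> 0\<close>, because nothing can cancel.\<close>

lemma sfe_trop_bounds:
  assumes "finite I" "\<And>i. i \<in> sf_vars t \<Longrightarrow> w i \<in> carrier (trop I)" "posv a"
  shows "\<exists>C1>0. \<exists>C2>0. \<forall>s. 0 < s \<and> s \<le> 1 \<longrightarrow>
    C1 * s powi sf_value (trop I) w t l \<le> sfe (\<lambda>i. a i * s powi w i l) t \<and>
    sfe (\<lambda>i. a i * s powi w i l) t \<le> C2 * s powi sf_value (trop I) w t l"
    (is "\<exists>C1>0. \<exists>C2>0. ?P C1 C2 t")
  using assms(2)
proof (induction t)
  case (SF_Var i)
  have "a i > 0" using assms(3) by (simp add: posv_def)
  then show ?case by (intro exI[of _ "a i"] conjI) auto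
next
  case SF_One
  show ?case by (intro exI[of _ "1::real"] conjI) auto
next
  case (SF_Add t1 t2)
  then obtain A1 A2 B1 B2 where pos: "A1 > 0" "A2 > 0" "B1 > 0" "B2 > 0" and A: "?P A1 A2 t1" and B: "?P B1 B2 t2"
    by auto
  let ?m = "sf_value (trop I) w (SF_Add t1 t2) l"
  have "?P (min A1 B1) (A2 + B2) (SF_Add t1 t2)"
  proof (intro allI impI)
    fix s :: real assume s: "0 < s \<and> s \<le> 1"
    let ?f = "\<lambda>t. sfe (\<lambda>i. a i * s powi w i l) t" and ?v = "\<lambda>t. sf_value (trop I) w t l"
    have m: "?m = min (?v t1) (?v t2)" by simp
    have up: "s powi ?v t1 \<le> s powi ?m" "s powi ?v t2 \<le> s powi ?m"
      unfolding m using s by (auto intro!: power_int_decreasing)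
    have pos': "0 < s powi k" for k :: int using s by simp
    have fpos: "0 < ?f t1" "0 < ?f t2"
      using s assms(3) by (auto intro!: sfe_pos simp: posv_def)
    have b: "A1 * s powi ?v t1 \<le> ?f t1" "?f t1 \<le> A2 * s powi ?v t1"
      "B1 * s powi ?v t2 \<le> ?f t2" "?f t2 \<le> B2 * s powi ?v t2"
      using A B s by auto
    have u1: "?f t1 \<le> A2 * s powi ?m" using b(2) mult_left_mono[OF up(1), of A2] pos by linarith
    have u2: "?f t2 \<le> B2 * s powi ?m" using b(4) mult_left_mono[OF up(2), of B2] pos by linarith
    \<comment> \<open>Both summands are positive, so the one with the smaller exponent alone bounds
      the sum from below.\<close>
    have l: "min A1 B1 * s powi ?m \<le> ?f t1 + ?f t2"
    proof (cases "?v t1 \<le> ?v t2")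
      case True
      then have "min A1 B1 * s powi ?m \<le> A1 * s powi ?v t1"
        unfolding m using pos' by (simp add: mult_right_mono less_imp_le)
      then show ?thesis using b(1) fpos by linarith
    next
      case False
      then have "min A1 B1 * s powi ?m \<le> B1 * s powi ?v t2"
        unfolding m using pos' by (simp add: mult_right_mono less_imp_le)
      then show ?thesis using b(3) fpos by linarith
    qed
    show "min A1 B1 * s powi ?m \<le> ?f (SF_Add t1 t2) \<and> ?f (SF_Add t1 t2) \<le> (A2 + B2) * s powi ?m"
      using u1 u2 l by (auto simp: distrib_right)
  qed
  then show ?case using pos by (intro exI[of _ "min A1 B1"] conjI exI[of _ "A2 + B2"]) auto
next
  case (SF_Mult t1 t2)
  then obtain A1 A2 B1 B2 where pos: "A1 > 0" "A2 > 0" "B1 > 0" "B2 > 0" and A: "?P A1 A2 t1" and B: "?P B1 B2 t2"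
    by auto
  have "?P (A1 * B1) (A2 * B2) (SF_Mult t1 t2)"
  proof (intro allI impI)
    fix s :: real assume s: "0 < s \<and> s \<le> 1"
    let ?f = "\<lambda>t. sfe (\<lambda>i. a i * s powi w i l) t" and ?v = "\<lambda>t. sf_value (trop I) w t l"
    have fpos: "0 < ?f t1" "0 < ?f t2"
      using s assms(3) by (auto intro!: sfe_pos simp: posv_def)
    have b: "A1 * s powi ?v t1 \<le> ?f t1" "?f t1 \<le> A2 * s powi ?v t1"
      "B1 * s powi ?v t2 \<le> ?f t2" "?f t2 \<le> B2 * s powi ?v t2"
      using A B s by auto
    have e: "s powi sf_value (trop I) w (SF_Mult t1 t2) l = s powi ?v t1 * s powi ?v t2"
      using s by (simp add: power_int_add)
    have "(A1 * s powi ?v t1) * (B1 * s powi ?v t2) \<le> ?f t1 * ?f t2"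
      using b s pos fpos by (intro mult_mono) auto
    moreover have "?f t1 * ?f t2 \<le> (A2 * s powi ?v t1) * (B2 * s powi ?v t2)"
      using b s pos fpos by (intro mult_mono) auto
    ultimately show "A1 * B1 * s powi sf_value (trop I) w (SF_Mult t1 t2) l \<le> ?f (SF_Mult t1 t2) \<and>
        ?f (SF_Mult t1 t2) \<le> A2 * B2 * s powi sf_value (trop I) w (SF_Mult t1 t2) l"
      unfolding e by (simp add: algebra_simps)
  qed
  then show ?case using pos by (intro exI[of _ "A1 * B1"] conjI exI[of _ "A2 * B2"]) auto
next
  case (SF_Div t1 t2)
  then obtain A1 A2 B1 B2 where pos: "A1 > 0" "A2 > 0" "B1 > 0" "B2 > 0" and A: "?P A1 A2 t1" and B: "?P B1 B2 t2"
    by auto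
  have "?P (A1 / B2) (A2 / B1) (SF_Div t1 t2)"
  proof (intro allI impI)
    fix s :: real assume s: "0 < s \<and> s \<le> 1"
    let ?f = "\<lambda>t. sfe (\<lambda>i. a i * s powi w i l) t" and ?v = "\<lambda>t. sf_value (trop I) w t l"
    have fpos: "0 < ?f t1" "0 < ?f t2"
      using s assms(3) by (auto intro!: sfe_pos simp: posv_def)
    have b: "A1 * s powi ?v t1 \<le> ?f t1" "?f t1 \<le> A2 * s powi ?v t1"
      "B1 * s powi ?v t2 \<le> ?f t2" "?f t2 \<le> B2 * s powi ?v t2"
      using A B s by auto
    have "sf_value (trop I) w t2 \<in> carrier (trop I)"
      using SF_Div.prems by (intro sf_value_carrier assms(1)) auto
    then have e: "s powi sf_value (trop I) w (SF_Div t1 t2) l = s powi ?v t1 / s powi ?v t2"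
      using s by (simp add: trop_inv[OF assms(1)] power_int_diff)
    have "(A1 * s powi ?v t1) / (B2 * s powi ?v t2) \<le> ?f t1 / ?f t2"
      using b s pos fpos by (intro frac_le) auto
    moreover have "?f t1 / ?f t2 \<le> (A2 * s powi ?v t1) / (B1 * s powi ?v t2)"
      using b s pos fpos by (intro frac_le) auto
    ultimately show "A1 / B2 * s powi sf_value (trop I) w (SF_Div t1 t2) l \<le> ?f (SF_Div t1 t2) \<and>
        ?f (SF_Div t1 t2) \<le> A2 / B1 * s powi sf_value (trop I) w (SF_Div t1 t2) l"
      unfolding e by simp
  qed
  then show ?case using pos by (intro exI[of _ "A1 / B2"] conjI exI[of _ "A2 / B1"]) auto
qed

lemma sfe_trop_boundsE:
  assumes "finite I" "\<And>i. i \<in> sf_vars t \<Longrightarrow> w i \<in> carrier (trop I)" "posv a"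
  obtains C1 C2 where "C1 > 0" "C2 > 0"
    "\<And>s. 0 < s \<Longrightarrow> s \<le> 1 \<Longrightarrow>
       C1 * s powi sf_value (trop I) w t l \<le> sfe (\<lambda>i. a i * s powi w i l) t"
    "\<And>s. 0 < s \<Longrightarrow> s \<le> 1 \<Longrightarrow>
       sfe (\<lambda>i. a i * s powi w i l) t \<le> C2 * s powi sf_value (trop I) w t l"
proof -
  have "\<exists>C1>0. \<exists>C2>0. \<forall>s. 0 < s \<and> s \<le> 1 \<longrightarrow>
    C1 * s powi sf_value (trop I) w t l \<le> sfe (\<lambda>i. a i * s powi w i l) t \<and>
    sfe (\<lambda>i. a i * s powi w i l) t \<le> C2 * s powi sf_value (trop I) w t l"
    by (rule sfe_trop_bounds) (fact assms)+
  then show thesis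
  proof (elim exE conjE)
    fix C1 C2 :: real
    assume "0 < C1" "0 < C2" and "\<forall>s. 0 < s \<and> s \<le> 1 \<longrightarrow>
      C1 * s powi sf_value (trop I) w t l \<le> sfe (\<lambda>i. a i * s powi w i l) t \<and>
      sfe (\<lambda>i. a i * s powi w i l) t \<le> C2 * s powi sf_value (trop I) w t l"
    then show thesis by (intro that[of C1 C2]) auto
  qed
qed

lemma sfe_trop_lower:
  assumes "finite I" "\<And>i. i \<in> sf_vars t \<Longrightarrow> w i \<in> carrier (trop I)" "posv a"
  shows "\<exists>C>0. \<forall>s. 0 < s \<and> s \<le> 1 \<longrightarrow>
    C * s powi sf_value (trop I) w t l \<le> sfe (\<lambda>i. a i * s powi w i l) t"
proof (rule sfe_trop_boundsE[where t = t and w = w and l = l and a = a and I = I])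
  fix C1 C2 :: real
  assume "C1 > 0" "\<And>s. 0 < s \<Longrightarrow> s \<le> 1 \<Longrightarrow>
       C1 * s powi sf_value (trop I) w t l \<le> sfe (\<lambda>i. a i * s powi w i l) t"
  then show ?thesis by (intro exI[of _ C1]) auto
qed (fact assms)+

lemma sfe_trop_upper:
  assumes "finite I" "\<And>i. i \<in> sf_vars t \<Longrightarrow> w i \<in> carrier (trop I)" "posv a"
  shows "\<exists>C>0. \<forall>s. 0 < s \<and> s \<le> 1 \<longrightarrow>
    sfe (\<lambda>i. a i * s powi w i l) t \<le> C * s powi sf_value (trop I) w t l"
proof (rule sfe_trop_boundsE[where t = t and w = w and l = l and a = a and I = I])
  fix C1 C2 :: real
  assume "C2 > 0" "\<And>s. 0 < s \<Longrightarrow> s \<le> 1 \<Longrightarrow>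
       sfe (\<lambda>i. a i * s powi w i l) t \<le> C2 * s powi sf_value (trop I) w t l"
  then show ?thesis by (intro exI[of _ C2]) auto
qed (fact assms)+

lemma powi_le_imp_ge:
  assumes "C > 0" "D > 0" "\<And>s::real. 0 < s \<Longrightarrow> s \<le> 1 \<Longrightarrow> C * s powi m \<le> D * s powi n"
  shows "n \<le> m"
proof (rule ccontr)
  assume "\<not> n \<le> m"
  then have "1 \<le> n - m" by simp
  \<comment> \<open>Chosen so that \<open>D * s\<close> is at most \<open>C / 2\<close>, against the
    inequality \<open>C \<le> D * s\<close> derived below.\<close>
  define s where "s = min 1 (C / (2 * D))"
  have s: "0 < s" "s \<le> 1" using assms by (auto simp: s_def)
  have "C * s powi m \<le> D * s powi n" by (rule assms(3)[OF s])
  also have "s powi n = s powi (n - m) * s powi m" using s by (simp flip: power_int_add)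
  also have "s powi (n - m) \<le> s powi 1" using s \<open>1 \<le> n - m\<close> by (intro power_int_decreasing) auto
  finally have "C * s powi m \<le> D * s * s powi m" using assms s by (simp add: mult_left_mono mult_right_mono)
  then have "C \<le> D * s" using s by simp
  also have "\<dots> \<le> D * (C / (2 * D))" using assms by (intro mult_left_mono) (auto simp: s_def)
  finally show False using assms by simp
qed

text \<open>The tropical value is the growth exponent of the expression along a curve, hence
  determined by the function on positive points. This makes \<open>semifield_eval\<close>
  independent of the chosen expression.\<close>

lemma sf_value_unique:
  assumes "finite I" "\<And>i. i \<in> sf_vars t \<union> sf_vars t' \<Longrightarrow> w i \<in> carrier (trop I)"
    and "\<And>V. posv V \<Longrightarrow> sfe V t = sfe V t'"
  shows "sf_value (trop I) w t = sf_value (trop I) w t'"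
proof -
  have le: "sf_value (trop I) w t' l \<le> sf_value (trop I) w t l"
    if "\<And>i. i \<in> sf_vars t \<union> sf_vars t' \<Longrightarrow> w i \<in> carrier (trop I)" "\<And>V. posv V \<Longrightarrow> sfe V t = sfe V t'"
    for t t' and l :: nat
  proof -
    have "\<exists>C>0. \<forall>s::real. 0 < s \<and> s \<le> 1 \<longrightarrow>
        C * s powi sf_value (trop I) w t l \<le> sfe (\<lambda>i. 1 * s powi w i l) t"
      by (rule sfe_trop_lower[OF assms(1) _ posv_1]) (use that in auto)
    then obtain C where C: "C > 0 \<and> (\<forall>s::real. 0 < s \<and> s \<le> 1 \<longrightarrow>
        C * s powi sf_value (trop I) w t l \<le> sfe (\<lambda>i. 1 * s powi w i l) t)" ..
    have "\<exists>C>0. \<forall>s::real. 0 < s \<and> s \<le> 1 \<longrightarrow>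
        sfe (\<lambda>i. 1 * s powi w i l) t' \<le> C * s powi sf_value (trop I) w t' l"
      by (rule sfe_trop_upper[OF assms(1) _ posv_1]) (use that in auto)
    then obtain D where D: "D > 0 \<and> (\<forall>s::real. 0 < s \<and> s \<le> 1 \<longrightarrow>
        sfe (\<lambda>i. 1 * s powi w i l) t' \<le> D * s powi sf_value (trop I) w t' l)" ..
    show ?thesis
    proof (rule powi_le_imp_ge[OF conjunct1[OF C] conjunct1[OF D]])
      fix s :: real assume s: "0 < s" "s \<le> 1"
      have "sfe (\<lambda>i. 1 * s powi w i l) t = sfe (\<lambda>i. 1 * s powi w i l) t'"
        by (rule that(2)) (use s in \<open>simp add: posv_def\<close>)
      then show "C * s powi sf_value (trop I) w t l \<le> D * s powi sf_value (trop I) w t' l"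
        using conjunct2[OF C, THEN spec, of s] conjunct2[OF D, THEN spec, of s] s by linarith
    qed
  qed
  show ?thesis
  proof (rule ext, rule antisym)
    fix l
    show "sf_value (trop I) w t l \<le> sf_value (trop I) w t' l"
      by (rule le[of t' t]) (use assms(2) assms(3)[symmetric] in blast)+
    show "sf_value (trop I) w t' l \<le> sf_value (trop I) w t l"
      by (rule le[of t t']) (use assms(2,3) in blast)+
  qed
qed

section \<open>Elements with a subtraction-free expression\<close>

text \<open>The three evaluations, in the field, at positive reals and in the tropical semifield,
  must come from one and the same expression. Keeping them together lets an equation in the field
  yield an equation of growth exponents.\<close>

definition sfrel :: "nat set \<Rightarrow> nat set \<Rightarrow> (nat \<Rightarrow> 'k::field) \<Rightarrow> (nat \<Rightarrow> nat \<Rightarrow> int) \<Rightarrow>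
    'k \<Rightarrow> ((nat \<Rightarrow> real) \<Rightarrow> real) \<Rightarrow> (nat \<Rightarrow> int) \<Rightarrow> bool" where
  "sfrel I J v w z f p \<longleftrightarrow> (\<exists>t. sf_vars t \<subseteq> J \<and> z = sfe v t \<and> (\<forall>V. posv V \<longrightarrow> f V = sfe V t) \<and>
     p = sf_value (trop I) w t)"

context
  fixes I J :: "nat set" and v :: "nat \<Rightarrow> 'k::field" and w :: "nat \<Rightarrow> nat \<Rightarrow> int"
  assumes fin: "finite I" and w: "\<forall>i\<in>J. w i \<in> carrier (trop I)"
begin

lemma sfrel_carrier: "sfrel I J v w z f p \<Longrightarrow> p \<in> carrier (trop I)"
  unfolding sfrel_def using fin w by (auto intro!: sf_value_carrier)

lemma sfrel_var: "i \<in> J \<Longrightarrow> sfrel I J v w (v i) (\<lambda>V. V i) (w i)"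
  unfolding sfrel_def by (rule exI[of _ "SF_Var i"]) auto

lemma sfrel_1: "sfrel I J v w 1 (\<lambda>V. 1) (\<lambda>j. 0)"
  unfolding sfrel_def by (rule exI[of _ SF_One]) auto

lemma sfrel_add:
  assumes "sfrel I J v w z f p" "sfrel I J v w z' f' p'"
  shows "sfrel I J v w (z + z') (\<lambda>V. f V + f' V) (\<lambda>j. min (p j) (p' j))"
proof -
  obtain t t' where "sf_vars t \<subseteq> J \<and> z = sfe v t \<and> (\<forall>V. posv V \<longrightarrow> f V = sfe V t) \<and> p = sf_value (trop I) w t"
    "sf_vars t' \<subseteq> J \<and> z' = sfe v t' \<and> (\<forall>V. posv V \<longrightarrow> f' V = sfe V t') \<and> p' = sf_value (trop I) w t'"
    using assms unfolding sfrel_def by blast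
  then show ?thesis unfolding sfrel_def by (intro exI[of _ "SF_Add t t'"]) auto
qed

lemma sfrel_mult:
  assumes "sfrel I J v w z f p" "sfrel I J v w z' f' p'"
  shows "sfrel I J v w (z * z') (\<lambda>V. f V * f' V) (\<lambda>j. p j + p' j)"
proof -
  obtain t t' where "sf_vars t \<subseteq> J \<and> z = sfe v t \<and> (\<forall>V. posv V \<longrightarrow> f V = sfe V t) \<and> p = sf_value (trop I) w t"
    "sf_vars t' \<subseteq> J \<and> z' = sfe v t' \<and> (\<forall>V. posv V \<longrightarrow> f' V = sfe V t') \<and> p' = sf_value (trop I) w t'"
    using assms unfolding sfrel_def by blast
  then show ?thesis unfolding sfrel_def by (intro exI[of _ "SF_Mult t t'"]) auto
qed

lemma sfrel_divide:
  assumes "sfrel I J v w z f p" "sfrel I J v w z' f' p'"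
  shows "sfrel I J v w (z / z') (\<lambda>V. f V / f' V) (\<lambda>j. p j - p' j)"
proof -
  obtain t t' where "sf_vars t \<subseteq> J \<and> z = sfe v t \<and> (\<forall>V. posv V \<longrightarrow> f V = sfe V t) \<and> p = sf_value (trop I) w t"
    "sf_vars t' \<subseteq> J \<and> z' = sfe v t' \<and> (\<forall>V. posv V \<longrightarrow> f' V = sfe V t') \<and> p' = sf_value (trop I) w t'"
    using assms unfolding sfrel_def by blast
  moreover have "p' \<in> carrier (trop I)" using assms(2) by (rule sfrel_carrier)
  ultimately show ?thesis unfolding sfrel_def by (intro exI[of _ "SF_Div t t'"]) (auto simp: trop_inv[OF fin])
qed

lemma sfrel_power:
  assumes "sfrel I J v w z f p"
  shows "sfrel I J v w (z ^ k) (\<lambda>V. f V ^ k) (\<lambda>j. int k * p j)"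
proof (induction k)
  case 0 then show ?case using sfrel_1 by simp
next
  case (Suc k) then show ?case using sfrel_mult[OF assms Suc] by (simp add: algebra_simps)
qed

lemma sfrel_powi:
  assumes "sfrel I J v w z f p"
  shows "sfrel I J v w (z powi k) (\<lambda>V. f V powi k) (\<lambda>j. k * p j)"
proof (cases "k \<ge> 0")
  case True then show ?thesis using sfrel_power[OF assms, of "nat k"] by (simp add: power_int_def)
next
  case False then show ?thesis
    using sfrel_divide[OF sfrel_1 sfrel_power[OF assms, of "nat (- k)"]]
    by (simp add: power_int_def power_one_over inverse_eq_divide)
qed

lemma sfrel_prod:
  assumes "finite A" "\<And>a. a \<in> A \<Longrightarrow> sfrel I J v w (z a) (f a) (p a)"
  shows "sfrel I J v w (\<Prod>a\<in>A. z a) (\<lambda>V. \<Prod>a\<in>A. f a V) (\<lambda>j. \<Sum>a\<in>A. p a j)"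
  using assms
proof (induction A rule: finite_induct)
  case empty then show ?case using sfrel_1 by simp
next
  case (insert a A) then show ?case using sfrel_mult[of "z a" "f a" "p a"] by simp
qed

lemma sfrel_nonzero:
  assumes "zindep J v" "sfrel I J v w z f p" shows "z \<noteq> 0"
  using assms sf_numden_zindep[OF assms(1)] unfolding sfrel_def by (auto simp: sfe_zindep)

lemma sfrel_unique:
  assumes "zindep J v" "sfrel I J v w z f p" "sfrel I J v w z f' p'"
  shows "p = p'" "posv V \<Longrightarrow> f V = f' V"
proof -
  obtain t t' where *: "sf_vars t \<subseteq> J \<and> z = sfe v t \<and> (\<forall>V. posv V \<longrightarrow> f V = sfe V t) \<and> p = sf_value (trop I) w t"
    "sf_vars t' \<subseteq> J \<and> z = sfe v t' \<and> (\<forall>V. posv V \<longrightarrow> f' V = sfe V t') \<and> p' = sf_value (trop I) w t'"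
    using assms unfolding sfrel_def by blast
  then have eq: "sfe V t = sfe V t'" if "posv V" for V using sfe_eq_transfer[OF assms(1) _ _ _ that] by auto
  then show "posv V \<Longrightarrow> f V = f' V" using * by auto
  have "sf_value (trop I) w t = sf_value (trop I) w t'"
    using fin w * by (intro sf_value_unique eq) auto
  then show "p = p'" using * by auto
qed

lemma sfrel_sfe:
  assumes "\<And>i. i \<in> sf_vars t \<Longrightarrow> sfrel I J v w (z i) (f i) (p i)"
  shows "sfrel I J v w (sfe z t) (\<lambda>V. sfe (\<lambda>i. f i V) t) (sf_value (trop I) p t)"
  using assms
proof (induction t)
  case SF_One then show ?case using sfrel_1 by simp
next
  case (SF_Add s t) then show ?case using sfrel_add[of "sfe z s" _ _ "sfe z t"] by simp
next
  case (SF_Mult s t) then show ?case using sfrel_mult[of "sfe z s" _ _ "sfe z t"] by simp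
next
  case (SF_Div s t)
  then have "sfrel I J v w (sfe z t) (\<lambda>V. sfe (\<lambda>i. f i V) t) (sf_value (trop I) p t)" by auto
  then have "sf_value (trop I) p t \<in> carrier (trop I)" by (rule sfrel_carrier)
  with SF_Div show ?case using sfrel_divide[of "sfe z s" _ _ "sfe z t"] by (simp add: trop_inv[OF fin])
qed auto

text \<open>A relation \<open>q\<close> among the new elements becomes, after clearing denominators,
  a relation among the independent \<open>v\<close>, hence trivial. So \<open>q\<close> vanishes at
  all values of the functions \<open>f m\<close> at positive points; by \<open>onto\<close> these
  are all positive points. Surjectivity on positive real points thus replaces a comparison of
  transcendence degrees.\<close>

lemma zindep_change:
  assumes "zindep J v" "\<And>m. m \<in> J' \<Longrightarrow> sfrel I J v w (v' m) (f m) (p m)"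
    and onto: "\<And>V'. posv V' \<Longrightarrow> \<exists>V. posv V \<and> (\<forall>m\<in>J'. f m V = V' m)"
  shows "zindep J' v'"
  unfolding zindep_def
proof (intro allI impI)
  fix q assume q: "mpoly_vars q \<subseteq> J' \<and> meval v' q = 0"
  \<comment> \<open>The induction passes through polynomials in arbitrary variables; those outside
    \<open>J'\<close> receive the dummy value \<open>1\<close>.\<close>
  let ?v = "\<lambda>m. if m \<in> J' then v' m else 1" and ?f = "\<lambda>m V. if m \<in> J' then f m V else 1"
  have "\<exists>N D. mpoly_vars N \<subseteq> J \<and> mpoly_vars D \<subseteq> J \<and> (\<forall>V. posv V \<longrightarrow> 0 < meval V D) \<and>
      meval v D \<noteq> 0 \<and> meval ?v q = meval v N / meval v D \<and>
      (\<forall>V. posv V \<longrightarrow> meval (\<lambda>m. ?f m V) q = meval V N / meval V D)"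
  proof (induction q rule: mpoly_induct)
    case (const c)
    show ?case by (rule exI[of _ "of_int c"], rule exI[of _ 1]) simp
  next
    case (var m)
    show ?case
    proof (cases "m \<in> J'")
      case True
      with assms(2) obtain t where t: "sf_vars t \<subseteq> J" "v' m = sfe v t" "\<And>V. posv V \<Longrightarrow> f m V = sfe V t"
        unfolding sfrel_def by blast
      show ?thesis
        by - (rule exI[of _ "sf_num t"], rule exI[of _ "sf_den t"],
        use True t sf_numden_vars[of t] sf_numden_pos[of _ t] sf_numden_zindep[OF assms(1) t(1)]
            sfe_zindep[OF assms(1) t(1)] in auto)
    next
      case False
      then show ?thesis by (intro exI[of _ 1]) simp
    qed
  next
    case (add p q)
    then obtain N D N' D' where "mpoly_vars N \<subseteq> J \<and> mpoly_vars D \<subseteq> J \<and> (\<forall>V. posv V \<longrightarrow> 0 < meval V D) \<and>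
      meval v D \<noteq> 0 \<and> meval ?v p = meval v N / meval v D \<and>
      (\<forall>V. posv V \<longrightarrow> meval (\<lambda>m. ?f m V) p = meval V N / meval V D)"
      "mpoly_vars N' \<subseteq> J \<and> mpoly_vars D' \<subseteq> J \<and> (\<forall>V. posv V \<longrightarrow> 0 < meval V D') \<and>
      meval v D' \<noteq> 0 \<and> meval ?v q = meval v N' / meval v D' \<and>
      (\<forall>V. posv V \<longrightarrow> meval (\<lambda>m. ?f m V) q = meval V N' / meval V D')"
      by blast
    moreover from this have "meval V D \<noteq> 0" "meval V D' \<noteq> 0" if "posv V" for V :: "nat \<Rightarrow> real"
      using that by (metis less_irrefl)+
    ultimately show ?case
      by - (rule exI[of _ "N * D' + N' * D"], rule exI[of _ "D * D'"],
        simp add: add_frac_eq vars_addI vars_multI)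
  next
    case (mult p q)
    then obtain N D N' D' where "mpoly_vars N \<subseteq> J \<and> mpoly_vars D \<subseteq> J \<and> (\<forall>V. posv V \<longrightarrow> 0 < meval V D) \<and>
      meval v D \<noteq> 0 \<and> meval ?v p = meval v N / meval v D \<and>
      (\<forall>V. posv V \<longrightarrow> meval (\<lambda>m. ?f m V) p = meval V N / meval V D)"
      "mpoly_vars N' \<subseteq> J \<and> mpoly_vars D' \<subseteq> J \<and> (\<forall>V. posv V \<longrightarrow> 0 < meval V D') \<and>
      meval v D' \<noteq> 0 \<and> meval ?v q = meval v N' / meval v D' \<and>
      (\<forall>V. posv V \<longrightarrow> meval (\<lambda>m. ?f m V) q = meval V N' / meval V D')"
      by blast
    then show ?case
      by - (rule exI[of _ "N * N'"], rule exI[of _ "D * D'"],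
        simp add: vars_multI)
  qed
  then obtain N D where ND: "mpoly_vars N \<subseteq> J" "meval v D \<noteq> 0" "meval ?v q = meval v N / meval v D"
    "\<And>V. posv V \<Longrightarrow> meval (\<lambda>m. ?f m V) q = meval V N / meval V D" by blast
  have "meval ?v q = meval v' q" using q by (intro meval_cong_vars) auto
  then have "meval v N = 0" using ND q by auto
  then have "N = 0" using zindepD[OF assms(1) ND(1)] by simp
  show "q = 0"
  proof (rule meval_pos_zero)
    fix V' :: "nat \<Rightarrow> real" assume "posv V'"
    then obtain V where V: "posv V" "\<forall>m\<in>J'. f m V = V' m" using onto by blast
    have "meval V' q = meval (\<lambda>m. ?f m V) q" using q V by (intro meval_cong_vars) auto
    then show "meval V' q = 0" using ND(4)[OF V(1)] \<open>N = 0\<close> by simp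
  qed
qed

end

lemma semifield_eval_trop:
  assumes "finite I" "\<And>i. i \<in> I \<Longrightarrow> y i \<in> carrier (trop I)" "sf_vars t \<subseteq> I" "sf_fract t = Fract F 1"
  shows "semifield_eval I (trop I) y F = sf_value (trop I) y t"
  unfolding semifield_eval_def
proof (rule the_equality)
  fix p assume "\<exists>t. sf_vars t \<subseteq> I \<and> sf_fract t = Fract F 1 \<and> p = sf_value (trop I) y t"
  then obtain t' where t': "sf_vars t' \<subseteq> I" "sf_fract t' = Fract F 1" "p = sf_value (trop I) y t'" by blast
  have "sfe V s = meval V F" if "sf_fract s = Fract F 1" "posv V" for s and V :: "nat \<Rightarrow> real"
  proof -
    have "sf_num s = F * sf_den s"
      using that(1) by (simp add: sf_fract_numden eq_fract sf_numden_nonzero)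
    then show ?thesis using sf_numden_pos[OF that(2), of s] by simp
  qed
  then show "p = sf_value (trop I) y t"
    unfolding t'(3) using assms t' by (intro sf_value_unique) auto
qed (use assms in auto)

section \<open>Localizations of the polynomial ring, as rings of functions\<close>

text \<open>Values outside the positive orthant are disregarded. The equation is multiplied out
  because denominators, for instance those in \<open>dens_off\<close>, may have zeros at positive
  points.\<close>

definition loc :: "int mpoly set \<Rightarrow> ((nat \<Rightarrow> real) \<Rightarrow> real) set" where
  "loc S = {f. \<exists>s\<in>S. \<exists>r. \<forall>Y. posv Y \<longrightarrow> meval Y s * f Y = meval Y r}"

definition loc_unit :: "int mpoly set \<Rightarrow> ((nat \<Rightarrow> real) \<Rightarrow> real) \<Rightarrow> bool" where
  "loc_unit S f \<longleftrightarrow> f \<in> loc S \<and> (\<lambda>Y. inverse (f Y)) \<in> loc S \<and> (\<forall>Y. posv Y \<longrightarrow> 0 < f Y)"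

lemma locI: "s \<in> S \<Longrightarrow> (\<And>Y. posv Y \<Longrightarrow> meval Y s * f Y = meval Y r) \<Longrightarrow> f \<in> loc S"
  unfolding loc_def by blast

lemma loc_cong: "f \<in> loc S \<Longrightarrow> (\<And>Y. posv Y \<Longrightarrow> f Y = g Y) \<Longrightarrow> g \<in> loc S"
  unfolding loc_def by fastforce

lemma loc_unit_cong:
  assumes "loc_unit S f" "\<And>Y. posv Y \<Longrightarrow> f Y = g Y" shows "loc_unit S g"
  unfolding loc_unit_def
proof (intro conjI allI impI)
  show "g \<in> loc S" using assms loc_cong unfolding loc_unit_def by blast
  show "(\<lambda>Y. inverse (g Y)) \<in> loc S"
    by (rule loc_cong[of "\<lambda>Y. inverse (f Y)"]) (use assms in \<open>auto simp: loc_unit_def\<close>)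
qed (use assms in \<open>auto simp: loc_unit_def\<close>)

lemma loc_unit_loc: "loc_unit S f \<Longrightarrow> f \<in> loc S"
  by (simp add: loc_unit_def)

lemma loc_unit_inverse: "loc_unit S f \<Longrightarrow> loc_unit S (\<lambda>Y. inverse (f Y))"
  by (simp add: loc_unit_def)

context
  fixes S :: "int mpoly set"
  assumes S_1: "1 \<in> S" and S_mult: "\<And>s t. s \<in> S \<Longrightarrow> t \<in> S \<Longrightarrow> s * t \<in> S"
begin

lemma loc_poly: "(\<lambda>Y. meval Y r) \<in> loc S"
  by (rule locI[OF S_1, of _ r]) simp

lemma loc_inverse_poly: "s \<in> S \<Longrightarrow> (\<And>Y. posv Y \<Longrightarrow> meval Y s \<noteq> 0) \<Longrightarrow> (\<lambda>Y. inverse (meval Y s)) \<in> loc S"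
  by (rule locI[of s _ _ 1]) auto

lemma loc_unit_poly: "s \<in> S \<Longrightarrow> (\<And>Y. posv Y \<Longrightarrow> 0 < meval Y s) \<Longrightarrow> loc_unit S (\<lambda>Y. meval Y s)"
  unfolding loc_unit_def using loc_poly loc_inverse_poly by fastforce

lemma loc_add:
  assumes "f \<in> loc S" "g \<in> loc S" shows "(\<lambda>Y. f Y + g Y) \<in> loc S"
proof -
  obtain s r s' r' where *: "s \<in> S" "s' \<in> S" "\<And>Y. posv Y \<Longrightarrow> meval Y s * f Y = meval Y r"
    "\<And>Y. posv Y \<Longrightarrow> meval Y s' * g Y = meval Y r'"
    using assms unfolding loc_def by blast
  have "meval Y (s * s') * (f Y + g Y) = meval Y (r * s' + r' * s)" if "posv Y" for Y
    by (simp add: *(3,4)[OF that, symmetric] algebra_simps)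
  then show ?thesis by (rule locI[OF S_mult[OF *(1,2)]])
qed

lemma loc_mult:
  assumes "f \<in> loc S" "g \<in> loc S" shows "(\<lambda>Y. f Y * g Y) \<in> loc S"
proof -
  obtain s r s' r' where *: "s \<in> S" "s' \<in> S" "\<And>Y. posv Y \<Longrightarrow> meval Y s * f Y = meval Y r"
    "\<And>Y. posv Y \<Longrightarrow> meval Y s' * g Y = meval Y r'"
    using assms unfolding loc_def by blast
  have "meval Y (s * s') * (f Y * g Y) = meval Y (r * r')" if "posv Y" for Y
    by (simp add: *(3,4)[OF that, symmetric] algebra_simps)
  then show ?thesis by (rule locI[OF S_mult[OF *(1,2)]])
qed

lemma loc_1: "(\<lambda>Y. 1) \<in> loc S"
  using loc_poly[of 1] by simp

lemma loc_power: "f \<in> loc S \<Longrightarrow> (\<lambda>Y. f Y ^ k) \<in> loc S"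
  by (induction k) (auto intro: loc_1 loc_mult)

lemma loc_prod: "finite A \<Longrightarrow> (\<And>a. a \<in> A \<Longrightarrow> f a \<in> loc S) \<Longrightarrow> (\<lambda>Y. \<Prod>a\<in>A. f a Y) \<in> loc S"
  by (induction A rule: finite_induct) (auto intro: loc_1 loc_mult)

lemma loc_meval:
  assumes "\<And>i. h i \<in> loc S"
  shows "(\<lambda>Y. meval (\<lambda>i. h i Y) p) \<in> loc S"
proof (induction p rule: mpoly_induct)
  case (const c)
  then show ?case using loc_poly[of "of_int c"] by simp
qed (use assms loc_add loc_mult in auto)

lemma loc_unit_1: "loc_unit S (\<lambda>Y. 1)"
  unfolding loc_unit_def using loc_1 by simp

lemma loc_unit_mult: "loc_unit S f \<Longrightarrow> loc_unit S g \<Longrightarrow> loc_unit S (\<lambda>Y. f Y * g Y)"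
  unfolding loc_unit_def using loc_mult[of f g] loc_mult[of "\<lambda>Y. inverse (f Y)" "\<lambda>Y. inverse (g Y)"] by simp

lemma loc_unit_divide: "loc_unit S f \<Longrightarrow> loc_unit S g \<Longrightarrow> loc_unit S (\<lambda>Y. f Y / g Y)"
  using loc_unit_mult[OF _ loc_unit_inverse] by (simp add: divide_inverse)

lemma loc_unit_power: "loc_unit S f \<Longrightarrow> loc_unit S (\<lambda>Y. f Y ^ k)"
  by (induction k) (auto intro: loc_unit_1 loc_unit_mult)

lemma loc_unit_powi: "loc_unit S f \<Longrightarrow> loc_unit S (\<lambda>Y. f Y powi k)"
  by (cases "k \<ge> 0") (auto simp: power_int_def intro: loc_unit_power loc_unit_inverse)

lemma loc_unit_prod:
  "finite A \<Longrightarrow> (\<And>a. a \<in> A \<Longrightarrow> loc_unit S (f a)) \<Longrightarrow> loc_unit S (\<lambda>Y. \<Prod>a\<in>A. f a Y)"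
  by (induction A rule: finite_induct) (auto intro: loc_unit_1 loc_unit_mult)

end

definition all_vars :: "nat set \<Rightarrow> int mpoly" where
  "all_vars I = (\<Prod>l\<in>I. mpoly_var l)"

lemma meval_all_vars: "meval Y (all_vars I) = (\<Prod>l\<in>I. Y l)"
  by (simp add: all_vars_def meval_prod)

definition laurent_dens :: "nat set \<Rightarrow> int mpoly set" where
  "laurent_dens I = range (\<lambda>N. all_vars I ^ N)"

definition laurent_dens1 :: "nat set \<Rightarrow> nat \<Rightarrow> int mpoly set" where
  "laurent_dens1 I j = range (\<lambda>(N, a). all_vars I ^ N * (1 + mpoly_var j) ^ a)"

text \<open>Having no zero on the hyperplane where variable \<open>j\<close> is \<open>-1\<close>,
  at points positive in the other coordinates, serves as a substitute for being prime to
  \<open>1 + mpoly_var j\<close>; it is visibly stable under products.\<close>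

definition dens_off :: "nat \<Rightarrow> int mpoly set" where
  "dens_off j = {s. \<forall>Y::nat \<Rightarrow> real. posv Y \<longrightarrow> meval (Y(j := -1)) s \<noteq> 0}"

abbreviation "laurent I \<equiv> loc (laurent_dens I)"

lemma laurent_dens_mult: "1 \<in> laurent_dens I" "s \<in> laurent_dens I \<Longrightarrow> t \<in> laurent_dens I \<Longrightarrow> s * t \<in> laurent_dens I"
  unfolding laurent_dens_def by (auto simp: image_iff simp flip: power_add intro: exI[of _ 0])

lemma laurent_dens1_mult: "1 \<in> laurent_dens1 I j"
  "s \<in> laurent_dens1 I j \<Longrightarrow> t \<in> laurent_dens1 I j \<Longrightarrow> s * t \<in> laurent_dens1 I j"
proof -
  show "1 \<in> laurent_dens1 I j" unfolding laurent_dens1_def by (rule image_eqI[of _ _ "(0,0)"]) auto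
  assume "s \<in> laurent_dens1 I j" "t \<in> laurent_dens1 I j"
  then obtain N a N' a' where "s = all_vars I ^ N * (1 + mpoly_var j) ^ a" "t = all_vars I ^ N' * (1 + mpoly_var j) ^ a'"
    unfolding laurent_dens1_def by auto
  then have "s * t = all_vars I ^ (N + N') * (1 + mpoly_var j) ^ (a + a')"
    by (simp add: power_add algebra_simps)
  then show "s * t \<in> laurent_dens1 I j" unfolding laurent_dens1_def by (intro image_eqI[of _ _ "(N+N',a+a')"]) auto
qed

lemma dens_off_mult: "1 \<in> dens_off j" "s \<in> dens_off j \<Longrightarrow> t \<in> dens_off j \<Longrightarrow> s * t \<in> dens_off j"
  by (auto simp: dens_off_def)

lemma all_vars_pos: "posv Y \<Longrightarrow> 0 < meval Y (all_vars I)"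
  by (auto simp: meval_all_vars posv_def intro!: prod_pos)

lemma loc_unit_dvd_poly:
  assumes "s * t \<in> S" "\<And>Y. posv Y \<Longrightarrow> 0 < meval Y s" "1 \<in> S"
  shows "loc_unit S (\<lambda>Y. meval Y s)"
  unfolding loc_unit_def
proof (intro conjI allI impI)
  show "(\<lambda>Y. meval Y s) \<in> loc S" by (rule locI[OF assms(3), of _ s]) simp
  show "(\<lambda>Y. inverse (meval Y s)) \<in> loc S"
  proof (rule locI[OF assms(1), of _ t])
    fix Y :: "nat \<Rightarrow> real" assume "posv Y"
    then have "meval Y s \<noteq> 0" using assms(2) by force
    then show "meval Y (s * t) * inverse (meval Y s) = meval Y t" by (simp add: field_simps)
  qed
qed (use assms(2) in auto)

lemma all_vars_remove: "finite I \<Longrightarrow> l \<in> I \<Longrightarrow> all_vars I = mpoly_var l * all_vars (I - {l})"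
  unfolding all_vars_def by (rule prod.remove)

lemma laurent_unit_var: "finite I \<Longrightarrow> l \<in> I \<Longrightarrow> loc_unit (laurent_dens I) (\<lambda>Y. Y l)"
  using loc_unit_dvd_poly[of "mpoly_var l" "all_vars (I - {l})" "laurent_dens I"] laurent_dens_mult(1)[of I]
  by (simp add: posv_def all_vars_remove[symmetric] laurent_dens_def) (metis power_one_right rangeI)

lemma laurent1_unit_var:
  assumes "finite I" "l \<in> I" shows "loc_unit (laurent_dens1 I j) (\<lambda>Y. Y l)"
proof -
  have "all_vars I \<in> laurent_dens1 I j"
    unfolding laurent_dens1_def by (rule image_eqI[of _ _ "(1,0)"]) auto
  then show ?thesis
    using loc_unit_dvd_poly[of "mpoly_var l" "all_vars (I - {l})" "laurent_dens1 I j"] laurent_dens1_mult(1)[of I]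
    by (simp add: posv_def all_vars_remove[OF assms, symmetric])
qed

lemma laurent1_unit_factor: "loc_unit (laurent_dens1 I j) (\<lambda>Y. 1 + Y j)"
proof -
  have "1 + mpoly_var j \<in> laurent_dens1 I j"
    unfolding laurent_dens1_def by (rule image_eqI[of _ _ "(0,1)"]) auto
  then show ?thesis
    using loc_unit_poly[where S = "laurent_dens1 I j" and s = "1 + mpoly_var j", OF laurent_dens1_mult] by (simp add: posv_def add_pos_pos)
qed

lemma off_unit_var: "loc_unit (dens_off j) (\<lambda>Y. Y l)"
proof -
  have "mpoly_var l \<in> dens_off j"
    unfolding dens_off_def by (auto simp: posv_def) (metis less_irrefl)
  then show ?thesis
    using loc_unit_poly[where S = "dens_off j" and s = "mpoly_var l", OF dens_off_mult] by (simp add: posv_def)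
qed

text \<open>Only variables in \<open>I\<close> occur with negative exponents, so only their images
  have to be units.\<close>

lemma laurent_compose:
  assumes I: "finite I" and S: "1 \<in> S" "\<And>s t. s \<in> S \<Longrightarrow> t \<in> S \<Longrightarrow> s * t \<in> S"
    and f: "f \<in> laurent I" and h: "\<And>i. h i \<in> loc S" "\<And>i. i \<in> I \<Longrightarrow> loc_unit S (h i)"
    and pos: "\<And>Y. posv Y \<Longrightarrow> posv (\<lambda>i. h i Y)"
  shows "(\<lambda>Y. f (\<lambda>i. h i Y)) \<in> loc S"
proof -
  obtain N r where r: "\<And>Y. posv Y \<Longrightarrow> meval Y (all_vars I) ^ N * f Y = meval Y r"
    using f unfolding loc_def laurent_dens_def by auto
  have "(\<lambda>Y. (\<Prod>l\<in>I. inverse (h l Y)) ^ N * meval (\<lambda>i. h i Y) r) \<in> loc S"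
    by (intro loc_mult loc_power loc_prod loc_meval S I h loc_unit_loc loc_unit_inverse)
  then show ?thesis
  proof (rule loc_cong)
    fix Y assume "posv Y"
    note p = pos[OF this]
    have "meval (\<lambda>i. h i Y) (all_vars I) > 0" using p by (rule all_vars_pos)
    then have "f (\<lambda>i. h i Y) = inverse (meval (\<lambda>i. h i Y) (all_vars I)) ^ N * meval (\<lambda>i. h i Y) r"
      using r[OF p] by (simp add: field_simps)
    then show "(\<Prod>l\<in>I. inverse (h l Y)) ^ N * meval (\<lambda>i. h i Y) r = f (\<lambda>i. h i Y)"
      by (simp add: meval_all_vars prod_inversef[symmetric] comp_def)
  qed
qed

text \<open>The polynomial \<open>1 + y\<^sub>j\<close> is cancelled by comparing values at \<open>y\<^sub>j = -1\<close>.\<close>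

lemma laurent_cancel:
  assumes "f \<in> loc (laurent_dens1 I j)" "f \<in> loc (dens_off j)"
  shows "f \<in> laurent I"
proof -
  obtain s r0 where s: "s \<in> dens_off j" "\<And>Y. posv Y \<Longrightarrow> meval Y s * f Y = meval Y r0"
    using assms(2) unfolding loc_def by blast
  obtain N a r where r: "\<And>Y. posv Y \<Longrightarrow> meval Y (all_vars I ^ N * (1 + mpoly_var j) ^ a) * f Y = meval Y r"
    using assms(1) unfolding loc_def laurent_dens1_def by auto
  show ?thesis using r
  proof (induction a arbitrary: r)
    case 0
    then show ?case by (intro locI[of "all_vars I ^ N" _ _ r]) (auto simp: laurent_dens_def)
  next
    case (Suc a)
    \<comment> \<open>The two representations of \<open>f\<close> give an identity of polynomials,
      which may then be evaluated on the hyperplane outside the positive orthant.\<close>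
    have "r * s = r0 * (all_vars I ^ N * (1 + mpoly_var j) ^ Suc a)"
    proof (rule meval_pos_eq)
      fix Y :: "nat \<Rightarrow> real" assume Y: "posv Y"
      let ?D = "all_vars I ^ N * (1 + mpoly_var j) ^ Suc a"
      have "meval Y r = meval Y ?D * f Y" "meval Y r0 = meval Y s * f Y"
        using Suc.prems[OF Y] s(2)[OF Y] by simp_all
      then show "meval Y (r * s) = meval Y (r0 * ?D)"
        by (simp only: meval_mult[of Y r s] meval_mult[of Y r0 ?D]) (simp only: mult_ac)
    qed
    then have e: "meval Z r * meval Z s = meval Z (r0 * (all_vars I ^ N * (1 + mpoly_var j) ^ Suc a))" for Z :: "nat \<Rightarrow> real"
      by (metis meval_mult)
    have "mpoly_var j - of_int (-1) dvd r"
    proof (rule dvd_of_pos_vanish)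
      fix Y :: "nat \<Rightarrow> real" assume Y: "posv Y"
      have "meval (Y(j := -1)) r * meval (Y(j := -1)) s = 0" by (subst e) simp
      then show "meval (Y(j := of_int (-1))) r = 0" using s(1) Y by (auto simp: dens_off_def)
    qed
    then obtain r' where r': "r = (1 + mpoly_var j) * r'" by (auto simp: add.commute)
    show ?case
    proof (rule Suc.IH[of r'])
      fix Y :: "nat \<Rightarrow> real" assume Y: "posv Y"
      then have "1 + Y j \<noteq> 0" by (auto simp: posv_def add_pos_pos less_imp_neq[symmetric])
      moreover have "(1 + Y j) * (meval Y (all_vars I ^ N * (1 + mpoly_var j) ^ a) * f Y) = (1 + Y j) * meval Y r'"
        using Suc.prems[OF Y] by (simp add: r' algebra_simps)
      ultimately show "meval Y (all_vars I ^ N * (1 + mpoly_var j) ^ a) * f Y = meval Y r'"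
        by (simp only: mult_cancel_left) simp
    qed
  qed
qed

section \<open>The Laurent phenomenon\<close>

text \<open>Mutation of clusters without coefficients, in terms of the variables
  \<open>y\<^sub>j \<Prod>\<^sub>i x\<^sub>i\<^bsup>b\<^sub>i\<^sub>j\<^esup>\<close>.\<close>

definition ystep :: "nat \<Rightarrow> (nat \<Rightarrow> nat \<Rightarrow> int) \<Rightarrow> (nat \<Rightarrow> 'k::field) \<Rightarrow> nat \<Rightarrow> 'k" where
  "ystep k B Y j = (if j = k then inverse (Y k)
     else Y j * Y k powi pos_part (B k j) * (1 + Y k) powi (- B k j))"

text \<open>The normalizing denominator of the exchange relation is left out. Therefore this step is
  an involution only up to a monomial factor, which later arguments have to carry along.\<close>

definition xstep :: "nat set \<Rightarrow> nat \<Rightarrow> (nat \<Rightarrow> nat \<Rightarrow> int) \<Rightarrow> (nat \<Rightarrow> 'k::field) \<Rightarrow> (nat \<Rightarrow> 'k) \<Rightarrow> nat \<Rightarrow> 'k" where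
  "xstep I k B X Y j = (if j = k then (1 + Y k) * (\<Prod>i\<in>I. X i powi pos_part (- B i k)) / X k else X j)"

fun brun :: "(nat \<Rightarrow> nat \<Rightarrow> int) \<Rightarrow> nat list \<Rightarrow> nat \<Rightarrow> nat \<Rightarrow> int" where
  "brun B [] = B"
| "brun B (k # w) = brun (mutate_exch k B) w"

fun yrun :: "(nat \<Rightarrow> nat \<Rightarrow> int) \<Rightarrow> (nat \<Rightarrow> 'k::field) \<Rightarrow> nat list \<Rightarrow> nat \<Rightarrow> 'k" where
  "yrun B Y [] = Y"
| "yrun B Y (k # w) = yrun (mutate_exch k B) (ystep k B Y) w"

fun xrun :: "nat set \<Rightarrow> (nat \<Rightarrow> nat \<Rightarrow> int) \<Rightarrow> (nat \<Rightarrow> 'k::field) \<Rightarrow> (nat \<Rightarrow> 'k) \<Rightarrow> nat list \<Rightarrow> nat \<Rightarrow> 'k" where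
  "xrun I B X Y [] = X"
| "xrun I B X Y (k # w) = xrun I (mutate_exch k B) (xstep I k B X Y) (ystep k B Y) w"

lemma run_snoc:
  "brun B (w @ [k]) = mutate_exch k (brun B w)"
  "yrun B Y (w @ [k]) = ystep k (brun B w) (yrun B Y w)"
  "xrun I B X Y (w @ [k]) = xstep I k (brun B w) (xrun I B X Y w) (yrun B Y w)"
  by (induction w arbitrary: B X Y) auto

lemma posv_ystep: "posv Y \<Longrightarrow> posv (ystep k B Y)"
  unfolding posv_def ystep_def by (auto intro!: mult_pos_pos add_pos_pos zero_less_power_int)

lemma posv_xstep: "posv X \<Longrightarrow> posv Y \<Longrightarrow> posv (xstep I k B X Y)"
  unfolding posv_def xstep_def by (auto intro!: mult_pos_pos divide_pos_pos add_pos_pos prod_pos zero_less_power_int)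

section \<open>Dependence of clusters on the initial cluster\<close>

definition monomial_fun :: "nat set \<Rightarrow> ((nat \<Rightarrow> real) \<Rightarrow> real) \<Rightarrow> bool" where
  "monomial_fun I f \<longleftrightarrow> (\<exists>g. \<forall>X. posv X \<longrightarrow> f X = (\<Prod>l\<in>I. X l powi g l))"

lemma monomial_fun_1: "monomial_fun I (\<lambda>X. 1)"
  unfolding monomial_fun_def by (rule exI[of _ "\<lambda>_. 0"]) simp

lemma monomial_fun_mult:
  assumes "monomial_fun I f" "monomial_fun I f'" shows "monomial_fun I (\<lambda>X. f X * f' X)"
proof -
  obtain g g' where *: "\<And>X. posv X \<Longrightarrow> f X = (\<Prod>l\<in>I. X l powi g l)" "\<And>X. posv X \<Longrightarrow> f' X = (\<Prod>l\<in>I. X l powi g' l)"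
    using assms unfolding monomial_fun_def by blast
  have "f X * f' X = (\<Prod>l\<in>I. X l powi (g l + g' l))" if "posv X" for X
    using that by (simp add: * posv_def power_int_add prod.distrib less_imp_neq[symmetric])
  then show ?thesis unfolding monomial_fun_def by (intro exI[of _ "\<lambda>l. g l + g' l"]) auto
qed

lemma prod_powi: "(\<Prod>l\<in>I. f l) powi n = (\<Prod>l\<in>I. (f l :: 'k::field) powi n)"
  by (induction I rule: infinite_finite_induct) (auto simp: power_int_mult_distrib)

lemma monomial_fun_powi:
  assumes "monomial_fun I f" shows "monomial_fun I (\<lambda>X. f X powi n)"
proof -
  obtain g where *: "\<And>X. posv X \<Longrightarrow> f X = (\<Prod>l\<in>I. X l powi g l)"
    using assms unfolding monomial_fun_def by blast
  have "f X powi n = (\<Prod>l\<in>I. X l powi (g l * n))" if "posv X" for X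
    using that by (simp add: * prod_powi power_int_mult)
  then show ?thesis unfolding monomial_fun_def by (intro exI[of _ "\<lambda>l. g l * n"]) auto
qed

lemma monomial_fun_prod:
  "finite A \<Longrightarrow> (\<And>a. a \<in> A \<Longrightarrow> monomial_fun I (f a)) \<Longrightarrow> monomial_fun I (\<lambda>X. \<Prod>a\<in>A. f a X)"
  by (induction A rule: finite_induct) (auto intro: monomial_fun_1 monomial_fun_mult)

lemma monomial_fun_var: "finite I \<Longrightarrow> l \<in> I \<Longrightarrow> monomial_fun I (\<lambda>X. X l)"
  unfolding monomial_fun_def
  by (rule exI[of _ "\<lambda>i. if i = l then 1 else 0"])
    (auto simp: if_distrib[of "\<lambda>n. _ powi n"] prod.If_cases Int_def if_distrib cong: if_cong)

lemma monomial_fun_divide: "monomial_fun I f \<Longrightarrow> monomial_fun I f' \<Longrightarrow> monomial_fun I (\<lambda>X. f X / f' X)"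
  using monomial_fun_mult[OF _ monomial_fun_powi[of I f' "-1"]] by (simp add: divide_inverse power_int_minus)

abbreviation ones :: "nat \<Rightarrow> 'k::field" where "ones \<equiv> \<lambda>_. 1"

lemma xstep_scale:
  assumes "finite I" "k \<in> I" "i \<in> I"
  shows "\<exists>m. monomial_fun I m \<and> (\<forall>X Y. xstep I k B X Y i = m X * xstep I k B ones Y i)"
proof (cases "i = k")
  case True
  show ?thesis
    by (rule exI[of _ "\<lambda>X. (\<Prod>i\<in>I. X i powi pos_part (- B i k)) / X k"])
      (use assms True in \<open>auto simp: xstep_def intro!: monomial_fun_divide monomial_fun_prod monomial_fun_powi monomial_fun_var\<close>)
next
  case False
  then show ?thesis
    by (intro exI[of _ "\<lambda>X. X i"]) (use assms in \<open>auto simp: xstep_def intro: monomial_fun_var\<close>)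
qed

text \<open>The recursion for \<open>Y\<close> does not involve \<open>X\<close>, and each step
  multiplies by monomials in the current cluster. Hence \<open>X\<close> splits off as a Laurent
  monomial that does not depend on \<open>Y\<close>, and the value at \<open>ones\<close> carries
  all other information.\<close>

lemma xrun_scale:
  assumes "finite I" "set w \<subseteq> I" "i \<in> I"
  shows "\<exists>m. monomial_fun I m \<and>
    (\<forall>X Y. posv X \<and> posv Y \<longrightarrow> xrun I B X Y w i = m X * xrun I B ones Y w i)"
  using assms(2)
proof (induction w arbitrary: B)
  case Nil
  then show ?case by (intro exI[of _ "\<lambda>X. X i"]) (use assms in \<open>auto intro: monomial_fun_var\<close>)
next
  case (Cons k w)
  then obtain m where m: "monomial_fun I m" "\<And>X Y. posv X \<Longrightarrow> posv Y \<Longrightarrow>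
      xrun I (mutate_exch k B) X Y w i = m X * xrun I (mutate_exch k B) ones Y w i" by auto metis
  obtain g where g: "\<And>X. posv X \<Longrightarrow> m X = (\<Prod>l\<in>I. X l powi g l)"
    using m(1) unfolding monomial_fun_def by blast
  have "\<forall>l\<in>I. \<exists>h. monomial_fun I h \<and> (\<forall>X Y. xstep I k B X Y l = h X * xstep I k B ones Y l)"
    using xstep_scale[OF assms(1)] Cons.prems by auto
  then obtain h where h: "\<And>l. l \<in> I \<Longrightarrow> monomial_fun I (h l)"
    "\<And>l X Y. l \<in> I \<Longrightarrow> xstep I k B X Y l = h l X * xstep I k B ones Y l" by metis
  show ?case
  proof (intro exI[of _ "\<lambda>X. \<Prod>l\<in>I. h l X powi g l"] conjI allI impI)
    show "monomial_fun I (\<lambda>X. \<Prod>l\<in>I. h l X powi g l)"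
      by (intro monomial_fun_prod monomial_fun_powi h assms)
    fix X Y :: "nat \<Rightarrow> real" assume XY: "posv X \<and> posv Y"
    have p1: "posv (ones :: nat \<Rightarrow> real)" by (simp add: posv_def)
    have "m (xstep I k B X Y) = (\<Prod>l\<in>I. h l X powi g l) * m (xstep I k B ones Y)"
      using XY p1 by (simp add: g posv_xstep h(2)[of _ X] power_int_mult_distrib prod.distrib)
    then show "xrun I B X Y (k # w) i = (\<Prod>l\<in>I. h l X powi g l) * xrun I B ones Y (k # w) i"
      using XY p1 m(2)[of "xstep I k B X Y" "ystep k B Y"] m(2)[of "xstep I k B ones Y" "ystep k B Y"]
      by (simp add: posv_xstep posv_ystep)
  qed
qed

section \<open>Sign patterns of exchange matrices and involutivity of mutation\<close>

lemma mutate_exch_mutate_exch: "mutate_exch k (mutate_exch k B) = B"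
  by (auto simp: mutate_exch_def fun_eq_iff)

lemma skew_symmetrizable_diag: "skew_symmetrizable I B \<Longrightarrow> i \<in> I \<Longrightarrow> B i i = 0"
  unfolding skew_symmetrizable_def by force

lemma skew_symmetrizable_sign:
  assumes "skew_symmetrizable I B" "i \<in> I" "j \<in> I"
  shows "0 < B i j \<longleftrightarrow> B j i < 0"
proof -
  obtain d :: "nat \<Rightarrow> int" where d: "d i > 0" "d j > 0" "d i * B i j = - (d j * B j i)"
    using assms unfolding skew_symmetrizable_def by blast
  have "0 < d i * B i j \<longleftrightarrow> d j * B j i < 0" by (simp add: d(3))
  then show ?thesis using d(1,2) by (simp add: zero_less_mult_iff mult_less_0_iff)
qed

text \<open>The same symmetrizer \<open>d\<close> works: it is moved across the two factors of a
  correction term one after the other, and each time a positive part of \<open>B\<close> turns into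
  one of the negative transpose.\<close>

lemma skew_symmetrizable_mutate:
  assumes "skew_symmetrizable I B" "k \<in> I"
  shows "skew_symmetrizable I (mutate_exch k B)"
proof -
  obtain d :: "nat \<Rightarrow> int" where d: "\<And>i. i \<in> I \<Longrightarrow> d i > 0"
    "\<And>i j. i \<in> I \<Longrightarrow> j \<in> I \<Longrightarrow> d i * B i j = - (d j * B j i)"
    using assms unfolding skew_symmetrizable_def by blast
  have pp: "a * pos_part x = pos_part (a * x)" if "a > 0" for a x :: int
    using that by (auto simp: max_def mult_le_0_iff zero_le_mult_iff)
  have "d i * mutate_exch k B i j = - (d j * mutate_exch k B j i)" if ij: "i \<in> I" "j \<in> I" for i j
  proof (cases "i = k \<or> j = k")
    case True then show ?thesis using d(2)[OF ij] by (auto simp: mutate_exch_def)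
  next
    case False
    have flip: "d p * pos_part (s * B p q) = d q * pos_part (- s * B q p)"
      if "p \<in> I" "q \<in> I" for p q s
    proof -
      have "d p * (s * B p q) = d q * (- s * B q p)"
        using d(2)[OF that] by (simp add: algebra_simps)
      then show ?thesis using d(1)[OF that(1)] d(1)[OF that(2)] by (simp add: pp del: mult_minus_left)
    qed
    have *: "d i * (pos_part (s * B i k) * pos_part (s * B k j)) = d j * (pos_part (- s * B j k) * pos_part (- s * B k i))"
      for s
    proof -
      have "d i * (pos_part (s * B i k) * pos_part (s * B k j)) = (d k * pos_part (- s * B k i)) * pos_part (s * B k j)"
        by (simp add: flip[OF ij(1) assms(2), symmetric] del: mult_minus_left)
      also have "\<dots> = (d k * pos_part (s * B k j)) * pos_part (- s * B k i)" by simp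
      also have "\<dots> = d j * (pos_part (- s * B j k) * pos_part (- s * B k i))"
        by (subst flip[OF assms(2) ij(2)]) simp
      finally show ?thesis .
    qed
    show ?thesis using False *[of 1] *[of "-1"] d(2)[OF ij] by (simp add: mutate_exch_def algebra_simps)
  qed
  then show ?thesis using d(1) unfolding skew_symmetrizable_def by blast
qed

lemma prod_eq_single:
  assumes "finite I" "k \<in> I" "\<And>i. i \<in> I \<Longrightarrow> i \<noteq> k \<Longrightarrow> g i = 1"
  shows "(\<Prod>i\<in>I. g i) = (g k :: 'a::comm_monoid_mult)"
  using assms by (simp add: prod.remove[of I k])

lemma one_plus_inverse_powi: "0 < y \<Longrightarrow> (1 + inverse y) powi n = (1 + y) powi n * y powi (- n)" for y :: real
proof -
  assume "0 < y"
  then have "1 + inverse y = (1 + y) / y" by (simp add: field_simps)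
  then show ?thesis by (simp only: power_int_divide_distrib) (simp add: power_int_minus divide_inverse)
qed

lemma involution_ratio:
  "0 < y \<Longrightarrow> 0 < x \<Longrightarrow> 0 < q \<Longrightarrow> (1 + inverse y) * p / ((1 + y) * q / x) / x = p / q / (y :: real)"
proof -
  assume "0 < y" "0 < x" "0 < q"
  then have "1 + inverse y = (1 + y) / y" "1 + y \<noteq> 0" by (simp_all add: field_simps)
  then show ?thesis using \<open>0 < y\<close> \<open>0 < x\<close> \<open>0 < q\<close> by simp
qed

lemma cancel_factor: "q \<noteq> 0 \<Longrightarrow> inverse (v * q) * s * (q * t) = inverse v * s * (t :: real)"
  by (simp add: field_simps)

lemma powi_mult3: "y \<noteq> 0 \<Longrightarrow> y powi a * y powi b * y powi c = (y :: real) powi (a + b + c)"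
  by (simp add: power_int_add)

lemma powi_mult4: "y \<noteq> 0 \<Longrightarrow> y powi a * y powi b * y powi c * y powi d = (y :: real) powi (a + b + c + d)"
  by (simp add: power_int_add)

lemma ystep_ystep:
  fixes Y :: "nat \<Rightarrow> real"
  assumes "posv Y" shows "ystep j (mutate_exch j B) (ystep j B Y) = Y"
proof
  fix i
  have y: "0 < Y j" "0 < 1 + Y j" using assms by (auto simp: posv_def add_pos_pos)
  show "ystep j (mutate_exch j B) (ystep j B Y) i = Y i"
  proof (cases "i = j")
    case False
    have "ystep j (mutate_exch j B) (ystep j B Y) i
        = Y i * (Y j powi pos_part (B j i) * Y j powi (- pos_part (- B j i)) * Y j powi (- B j i)) *
          ((1 + Y j) powi (- B j i) * (1 + Y j) powi B j i)"
      using False y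
      by (simp add: ystep_def mutate_exch_def one_plus_inverse_powi power_int_inverse power_int_minus)
    also have "(1 + Y j) powi (- B j i) * (1 + Y j) powi B j i = 1"
      using y by (simp add: power_int_minus)
    also have "Y j powi pos_part (B j i) * Y j powi (- pos_part (- B j i)) * Y j powi (- B j i)
        = Y j powi (pos_part (B j i) + - pos_part (- B j i) + - B j i)"
      using y by (intro powi_mult3) simp
    also have "pos_part (B j i) + - pos_part (- B j i) + - B j i = 0" by (simp add: max_def)
    finally show ?thesis by simp
  qed (simp add: ystep_def)
qed

text \<open>By \<open>xrun_scale\<close> the run is a monomial in the cluster \<open>x Y\<close>,
  which is a unit, times the run from \<open>ones\<close>, into which the \<open>h Y l\<close> are
  substituted by \<open>laurent_compose\<close>.\<close>

lemma xrun_loc: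
  assumes "finite I" "set v \<subseteq> I" "i \<in> I" and S: "1 \<in> S" "\<And>s t. s \<in> S \<Longrightarrow> t \<in> S \<Longrightarrow> s * t \<in> S"
    and F: "(\<lambda>Y. xrun I B ones Y v i) \<in> laurent I"
    and h: "\<And>l. (\<lambda>Y. h Y l) \<in> loc S" "\<And>l. l \<in> I \<Longrightarrow> loc_unit S (\<lambda>Y. h Y l)" "\<And>Y. posv Y \<Longrightarrow> posv (h Y)"
    and x: "\<And>l. l \<in> I \<Longrightarrow> loc_unit S (\<lambda>Y. x Y l)" "\<And>Y. posv Y \<Longrightarrow> posv (x Y)"
  shows "(\<lambda>Y. xrun I B (x Y) (h Y) v i) \<in> loc S"
proof -
  obtain m where m: "monomial_fun I m" "\<And>X Y. posv X \<Longrightarrow> posv Y \<Longrightarrow> xrun I B X Y v i = m X * xrun I B ones Y v i"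
    using xrun_scale[OF assms(1-3)] by blast
  obtain g where g: "\<And>X. posv X \<Longrightarrow> m X = (\<Prod>l\<in>I. X l powi g l)"
    using m(1) unfolding monomial_fun_def by blast
  have "(\<lambda>Y. xrun I B ones (\<lambda>l. h Y l) v i) \<in> loc S"
    by (rule laurent_compose[where h = "\<lambda>l Y. h Y l", OF assms(1) S F h(1) h(2)]) (use h(3) in auto)
  moreover have "(\<lambda>Y. \<Prod>l\<in>I. x Y l powi g l) \<in> loc S"
    by (intro loc_prod loc_unit_loc loc_unit_powi S assms(1) x(1))
  ultimately have "(\<lambda>Y. (\<Prod>l\<in>I. x Y l powi g l) * xrun I B ones (h Y) v i) \<in> loc S"
    using loc_mult[OF S] by simp
  then show ?thesis by (rule loc_cong) (simp add: m(2) g h(3) x(2))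
qed

text \<open>The third mutation leads away from the word \<open>j # k # w\<close> under study. It
  yields a seed from which the later clusters can be reached by a second route, and along that route
  no denominator vanishes on the hyperplane where variable \<open>j\<close> is
  \<open>-1\<close>.\<close>

locale three_mutations =
  fixes I :: "nat set" and B :: "nat \<Rightarrow> nat \<Rightarrow> int" and j k :: nat
  assumes I: "finite I" "j \<in> I" "k \<in> I" and jk: "j \<noteq> k"
    and diag: "B j j = 0" and sign: "0 < B j k \<longleftrightarrow> B k j < 0" "0 < B k j \<longleftrightarrow> B j k < 0"
begin

definition "B1 = mutate_exch j B"
definition "B2 = mutate_exch k B1"
definition "y1 Y = ystep j B (Y :: nat \<Rightarrow> real)"
definition "y2 Y = ystep k B1 (y1 Y)"
definition "y3 Y = ystep j B2 (y2 Y)"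
definition "x1 Y = xstep I j B ones (Y :: nat \<Rightarrow> real)"
definition "x2 Y = xstep I k B1 (x1 Y) (y1 Y)"
definition "x3 Y = xstep I j B2 (x2 Y) (y2 Y)"

lemma B1_simps: "B1 j l = - B j l" "B1 l j = - B l j"
  by (auto simp: B1_def mutate_exch_def)

lemma B2_j: "l \<noteq> k \<Longrightarrow> B2 j l = - B j l + pos_part (- B j k) * pos_part (B1 k l) - pos_part (B j k) * pos_part (- B1 k l)"
  "B2 j k = B j k" "B2 k j = B k j"
  using jk by (auto simp: B2_def mutate_exch_def B1_simps)

lemma B2_jj: "B2 j j = 0"
  using jk diag sign
  by (cases "0 < B j k"; cases "B j k < 0") (auto simp: B2_j B1_simps max_def)

lemma posv_runs: "posv Y \<Longrightarrow> posv (y1 Y)" "posv Y \<Longrightarrow> posv (y2 Y)" "posv Y \<Longrightarrow> posv (y3 Y)"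
  "posv Y \<Longrightarrow> posv (x1 Y)" "posv Y \<Longrightarrow> posv (x2 Y)" "posv Y \<Longrightarrow> posv (x3 Y)"
proof -
  have "posv (ones :: nat \<Rightarrow> real)" by (simp add: posv_def)
  then show "posv Y \<Longrightarrow> posv (y1 Y)" "posv Y \<Longrightarrow> posv (y2 Y)" "posv Y \<Longrightarrow> posv (y3 Y)"
    "posv Y \<Longrightarrow> posv (x1 Y)" "posv Y \<Longrightarrow> posv (x2 Y)" "posv Y \<Longrightarrow> posv (x3 Y)"
    unfolding y1_def y2_def y3_def x1_def x2_def x3_def
    by (auto intro!: posv_ystep posv_xstep)
qed

lemma x1_simps: "x1 Y l = (if l = j then 1 + Y j else 1)"
  by (simp add: x1_def xstep_def)

abbreviation "S \<equiv> dens_off j"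

lemmas unit_intros = loc_unit_mult[OF dens_off_mult] loc_unit_divide[OF dens_off_mult]
  loc_unit_powi[OF dens_off_mult] loc_unit_power[OF dens_off_mult] loc_unit_inverse off_unit_var
  loc_unit_1[OF dens_off_mult]

definition "u Y = Y k * Y j powi pos_part (B j k)"

lemma u_unit: "loc_unit S u"
  unfolding u_def by (intro unit_intros)

lemma y1_k: "y1 Y k = u Y * (1 + Y j) powi (- B j k)"
  using jk by (simp add: y1_def ystep_def u_def)

text \<open>Mutating in the directions \<open>j\<close>, \<open>k\<close>, \<open>j\<close> produces the new factors \<open>1 + y\<^sub>j\<close>, \<open>p2\<close> and \<open>p3\<close>; the last
  two do not vanish at \<open>y\<^sub>j = -1\<close>.\<close>

lemma core:
  "\<exists>P2 U3. loc_unit S P2 \<and> loc_unit S U3 \<and> (\<forall>Y. posv Y \<longrightarrow>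
      1 + y1 Y k = P2 Y * (1 + Y j) powi (- pos_part (B j k)) \<and>
      y2 Y j = inverse (Y j) * u Y powi pos_part (- B k j) * P2 Y powi B k j \<and>
      1 + y2 Y j = (1 + Y j) * U3 Y)"
proof (cases "0 < B j k")
  case False
  then have b: "B j k \<le> 0" "0 \<le> B k j" using sign by auto
  define e where "e = nat (- B j k)"
  define c where "c = nat (B k j)"
  have e: "B j k = - int e" "B k j = int c" "e = 0 \<longleftrightarrow> c = 0"
    using b sign by (auto simp: e_def c_def)
  define p2 where "p2 = 1 + mpoly_var k * (1 + mpoly_var j) ^ e"
  \<comment> \<open>This is \<open>Y j + p2 ^ c\<close> divided by \<open>1 + Y j\<close>: the
    geometric sum comes from dividing \<open>p2 ^ c - 1\<close> by \<open>p2 - 1\<close>, which is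
    \<open>Y k\<close> times the \<open>e\<close>-th power of \<open>1 + Y j\<close>. For
    \<open>e = 0\<close> also \<open>c = 0\<close>; the sum is then empty and the truncated
    \<open>e - 1\<close> does no harm.\<close>
  define p3 where "p3 = 1 + mpoly_var k * (1 + mpoly_var j) ^ (e - 1) * (\<Sum>i<c. p2 ^ i)"
  \<comment> \<open>The range of \<open>Z\<close> contains the positive points as well as the
    hyperplane \<open>Z j = -1\<close>, so one bound yields both positivity and membership in
    \<open>dens_off j\<close>.\<close>
  have p2pos: "1 \<le> meval Z p2" if "0 \<le> Z k" "-1 \<le> Z j" for Z :: "nat \<Rightarrow> real"
    unfolding p2_def using that by simp
  have p3pos: "1 \<le> meval Z p3" if "0 \<le> Z k" "-1 \<le> Z j" for Z :: "nat \<Rightarrow> real"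
    unfolding p3_def using that p2pos[OF that] by (simp add: meval_sum sum_nonneg)
  have unit: "loc_unit S (\<lambda>Y. meval Y p)"
    if "\<And>Z :: nat \<Rightarrow> real. 0 \<le> Z k \<Longrightarrow> -1 \<le> Z j \<Longrightarrow> 1 \<le> meval Z p" for p
  proof (rule loc_unit_poly[OF dens_off_mult])
    show "p \<in> S"
      unfolding dens_off_def
    proof (intro CollectI allI impI)
      fix Y :: "nat \<Rightarrow> real" assume "posv Y"
      then have "1 \<le> meval (Y(j := -1)) p" using jk by (intro that) (auto simp: posv_def less_imp_le)
      then show "meval (Y(j := -1)) p \<noteq> 0" by auto
    qed
    fix Y :: "nat \<Rightarrow> real" assume "posv Y"
    then have "0 < Y k" "0 < Y j" by (auto simp: posv_def)
    then show "0 < meval Y p" using that[of Y] by linarith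
  qed
  have P2: "loc_unit S (\<lambda>Y. meval Y p2)" and P3: "loc_unit S (\<lambda>Y. meval Y p3)"
    by (intro unit p2pos p3pos; assumption)+
  show ?thesis
  proof (rule exI[of _ "\<lambda>Y. meval Y p2"], rule exI[of _ "\<lambda>Y. meval Y p3 / Y j"], intro conjI allI impI)
    show "loc_unit S (\<lambda>Y. meval Y p2)" "loc_unit S (\<lambda>Y. meval Y p3 / Y j)"
      by (intro unit_intros P2 P3)+
    fix Y :: "nat \<Rightarrow> real" assume Y: "posv Y"
    have pos: "0 < Y j" "0 < Y k" using Y by (auto simp: posv_def)
    have y1k: "1 + y1 Y k = meval Y p2"
      by (simp add: y1_k u_def e p2_def)
    then show "1 + y1 Y k = meval Y p2 * (1 + Y j) powi (- pos_part (B j k))" by (simp add: e)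
    have y2j: "y2 Y j = inverse (Y j) * meval Y p2 ^ c"
      using jk y1k by (simp add: y2_def ystep_def B1_simps e) (simp add: y1_def ystep_def)
    then show "y2 Y j = inverse (Y j) * u Y powi pos_part (- B k j) * meval Y p2 powi B k j"
      by (simp add: e)
    have "meval Y p2 ^ c - 1 = (meval Y p2 - 1) * (\<Sum>i<c. meval Y p2 ^ i)"
      by (rule power_diff_1_eq)
    also have "\<dots> = (1 + Y j) * (meval Y p3 - 1)"
    proof (cases "e = 0")
      case True then show ?thesis using e by (simp add: p3_def)
    next
      case False
      then have "(1 + Y j) ^ e = (1 + Y j) * (1 + Y j) ^ (e - 1)" by (simp flip: power_Suc)
      then show ?thesis by (simp add: p3_def meval_sum) (simp add: p2_def)
    qed
    finally have "Y j + meval Y p2 ^ c = (1 + Y j) * meval Y p3" by (simp add: algebra_simps)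
    then show "1 + y2 Y j = (1 + Y j) * (meval Y p3 / Y j)"
      using pos by (simp add: y2j field_simps)
  qed
next
  case True
  define e where "e = nat (B j k)"
  define c where "c = nat (- B k j)"
  have e: "B j k = int e" "B k j = - int c" "0 < e" "0 < c"
    using True sign by (auto simp: e_def c_def)
  define a where "a = mpoly_var k * mpoly_var j ^ e"
  define p2 where "p2 = (1 + mpoly_var j) ^ e + a"
  \<comment> \<open>This is \<open>Y j * p2 ^ c + a ^ c\<close> divided by \<open>1 + Y j\<close>:
    the dividend is \<open>p2 ^ c\<close> times \<open>1 + Y j\<close>, minus
    \<open>p2 ^ c - a ^ c\<close>, and the latter is divisible by \<open>p2 - a\<close>, the
    \<open>e\<close>-th power of \<open>1 + Y j\<close> with \<open>e\<close> positive.\<close>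
  define p3 where "p3 = p2 ^ c - (1 + mpoly_var j) ^ (e - 1) * (\<Sum>i<c. a ^ (c - Suc i) * p2 ^ i)"
  have S2: "p2 \<in> S"
    unfolding dens_off_def
  proof (intro CollectI allI impI)
    fix Y :: "nat \<Rightarrow> real" assume "posv Y"
    then have "0 < Y k" by (simp add: posv_def)
    then show "meval (Y(j := -1)) p2 \<noteq> 0" using e jk by (simp add: p2_def a_def power_0_left)
  qed
  have S3: "p3 \<in> S"
    unfolding dens_off_def
  proof (intro CollectI allI impI)
    fix Y :: "nat \<Rightarrow> real" assume Y: "posv Y"
    let ?Z = "Y(j := -1)"
    have p: "meval ?Z p2 = meval ?Z a" using e by (simp add: p2_def)
    have a: "meval ?Z a = Y k * (-1) ^ e" using jk by (simp add: a_def)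
    have yk: "0 < Y k" using Y by (simp add: posv_def)
    have sm: "(\<Sum>i<c. meval ?Z a ^ (c - Suc i) * meval ?Z a ^ i) = real c * meval ?Z a ^ (c - 1)"
      by (simp flip: power_add)
    have c: "meval ?Z a ^ c = meval ?Z a * meval ?Z a ^ (c - 1)"
      using e by (simp flip: power_Suc)
    have "meval ?Z p3 = meval ?Z a ^ (c - 1) * (meval ?Z a - (if e = 1 then real c else 0))"
    proof -
      have "meval ?Z p3 = meval ?Z a ^ c - 0 ^ (e - 1) * (real c * meval ?Z a ^ (c - 1))"
        by (simp add: p3_def p meval_sum sm)
      also have "(0::real) ^ (e - 1) = (if e = 1 then 1 else 0)" using e by (auto simp: power_0_left)
      finally show ?thesis by (subst (asm) c) (auto simp: algebra_simps)
    qed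
    \<comment> \<open>For \<open>e = 1\<close> the value of \<open>a\<close> is
      \<open>- Y k\<close>, negative, so subtracting the positive number \<open>c\<close> cannot
      give zero; for larger \<open>e\<close> nothing is subtracted and \<open>a\<close> itself is
      nonzero.\<close>
    moreover have "meval ?Z a - (if e = 1 then real c else 0) \<noteq> 0"
      using yk e by (auto simp: a)
    moreover have "meval ?Z a \<noteq> 0" using yk by (simp add: a)
    ultimately show "meval ?Z p3 \<noteq> 0" by simp
  qed
  have id: "(1 + Y j) * meval Y p3 = Y j * meval Y p2 ^ c + meval Y a ^ c" for Y :: "nat \<Rightarrow> real"
  proof -
    have "meval Y p2 ^ c - meval Y a ^ c
        = (meval Y p2 - meval Y a) * (\<Sum>i<c. meval Y a ^ (c - Suc i) * meval Y p2 ^ i)"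
      by (rule power_diff_sumr2)
    also have "meval Y p2 - meval Y a = (1 + Y j) * (1 + Y j) ^ (e - 1)"
      using e by (simp add: p2_def flip: power_Suc)
    finally show ?thesis by (simp add: p3_def meval_sum algebra_simps)
  qed
  have apos: "0 < meval Y a" if "posv Y" for Y using that by (simp add: posv_def a_def)
  have p2pos: "0 < meval Y p2" if "posv Y" for Y
    using that apos[OF that] by (simp add: posv_def p2_def add_pos_pos)
  have p3pos: "0 < meval Y p3" if Y: "posv Y" for Y
  proof -
    have "0 < Y j" using Y by (simp add: posv_def)
    then have "0 < (1 + Y j) * meval Y p3" unfolding id using apos[OF Y] p2pos[OF Y] by (simp add: add_pos_pos)
    then show ?thesis using \<open>0 < Y j\<close> by (simp add: zero_less_mult_iff)
  qed
  have P2: "loc_unit S (\<lambda>Y. meval Y p2)" and P3: "loc_unit S (\<lambda>Y. meval Y p3)"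
    using loc_unit_poly[OF dens_off_mult S2] loc_unit_poly[OF dens_off_mult S3] p2pos p3pos by auto
  show ?thesis
  proof (rule exI[of _ "\<lambda>Y. meval Y p2"], rule exI[of _ "\<lambda>Y. meval Y p3 / (Y j * meval Y p2 ^ c)"],
      intro conjI allI impI)
    show "loc_unit S (\<lambda>Y. meval Y p2)" "loc_unit S (\<lambda>Y. meval Y p3 / (Y j * meval Y p2 ^ c))"
      by (intro unit_intros P2 P3)+
    fix Y :: "nat \<Rightarrow> real" assume Y: "posv Y"
    have pos: "0 < Y j" "0 < Y k" "0 < 1 + Y j" using Y by (auto simp: posv_def add_pos_pos)
    have y1k: "y1 Y k = meval Y a / (1 + Y j) ^ e"
      by (simp add: y1_k u_def e a_def power_int_minus divide_inverse)
    then have y1k': "1 + y1 Y k = meval Y p2 / (1 + Y j) ^ e"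
      using pos by (simp add: p2_def field_simps)
    then show "1 + y1 Y k = meval Y p2 * (1 + Y j) powi (- pos_part (B j k))"
      by (simp add: e power_int_minus divide_inverse)
    have "y2 Y j = inverse (Y j) * (y1 Y k) ^ c * inverse ((1 + y1 Y k) ^ c)"
      using jk by (simp add: y2_def ystep_def B1_simps e power_int_minus) (simp add: y1_def ystep_def)
    then have y2j: "y2 Y j = inverse (Y j) * meval Y a ^ c * inverse (meval Y p2 ^ c)"
      unfolding y1k' unfolding y1k using pos by (simp add: field_simps)
    then show "y2 Y j = inverse (Y j) * u Y powi pos_part (- B k j) * meval Y p2 powi B k j"
      by (simp add: e power_int_minus a_def u_def)
    show "1 + y2 Y j = (1 + Y j) * (meval Y p3 / (Y j * meval Y p2 ^ c))"
      using id[of Y] pos p2pos[OF Y] by (simp add: y2j field_simps)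
  qed
qed

lemma x2_k: "x2 Y k = (1 + y1 Y k) * (1 + Y j) powi pos_part (B j k)"
proof -
  have "(\<Prod>i\<in>I. x1 Y i powi pos_part (- B1 i k)) = x1 Y j powi pos_part (- B1 j k)"
    by (rule prod_eq_single) (use I in \<open>auto simp: x1_simps\<close>)
  then show ?thesis using jk by (simp add: x2_def xstep_def x1_simps B1_simps)
qed

lemma x2_other: "l \<noteq> k \<Longrightarrow> x2 Y l = (if l = j then 1 + Y j else 1)"
  by (simp add: x2_def xstep_def x1_simps)

lemma x3_j: "x3 Y j = (1 + y2 Y j) * x2 Y k powi pos_part (- B k j) / (1 + Y j)"
proof -
  have "(\<Prod>i\<in>I. x2 Y i powi pos_part (- B2 i j)) = x2 Y k powi pos_part (- B2 k j)"
    by (rule prod_eq_single) (use I in \<open>auto simp: x2_other B2_jj\<close>)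
  then show ?thesis using jk by (simp add: x3_def xstep_def x2_other B2_j)
qed

lemma x3_other: "l \<noteq> j \<Longrightarrow> x3 Y l = x2 Y l"
  by (simp add: x3_def xstep_def)

text \<open>The intermediate seeds contain powers of \<open>1 + Y j\<close>, but in the entries
  listed here all of them cancel. This makes the third seed a legitimate starting point over
  \<open>dens_off j\<close>.\<close>

lemma units_j:
  "loc_unit S (\<lambda>Y. x2 Y k)" "loc_unit S (\<lambda>Y. y2 Y j)" "loc_unit S (\<lambda>Y. x3 Y l)" "loc_unit S (\<lambda>Y. y3 Y l)"
proof -
  obtain P2 U3 where PU: "loc_unit S P2" "loc_unit S U3" and c: "\<And>Y. posv Y \<Longrightarrow>
      1 + y1 Y k = P2 Y * (1 + Y j) powi (- pos_part (B j k)) \<and>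
      y2 Y j = inverse (Y j) * u Y powi pos_part (- B k j) * P2 Y powi B k j \<and>
      1 + y2 Y j = (1 + Y j) * U3 Y"
    using core by blast
  have P1: "0 < 1 + Y j" if "posv Y" for Y :: "nat \<Rightarrow> real"
    using that by (auto simp: posv_def add_pos_pos)
  have x2k: "x2 Y k = P2 Y" if "posv Y" for Y
    using c[OF that] P1[OF that] by (simp add: x2_k power_int_minus field_simps)
  show ux2: "loc_unit S (\<lambda>Y. x2 Y k)"
    by (rule loc_unit_cong[OF PU(1)]) (simp add: x2k)
  show uy2: "loc_unit S (\<lambda>Y. y2 Y j)"
    by (rule loc_unit_cong[of _ "\<lambda>Y. inverse (Y j) * u Y powi pos_part (- B k j) * P2 Y powi B k j"])
      (use c in \<open>auto intro!: unit_intros PU u_unit\<close>)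
  have "loc_unit S (\<lambda>Y. x3 Y j)"
  proof (rule loc_unit_cong[of _ "\<lambda>Y. U3 Y * x2 Y k powi pos_part (- B k j)"])
    fix Y :: "nat \<Rightarrow> real" assume Y: "posv Y"
    have "1 + y2 Y j = (1 + Y j) * U3 Y" using c[OF Y] by blast
    then show "U3 Y * x2 Y k powi pos_part (- B k j) = x3 Y j"
      unfolding x3_j using P1[OF Y] by simp
  qed (intro unit_intros PU ux2)
  then show "loc_unit S (\<lambda>Y. x3 Y l)"
    using ux2 by (cases "l = j"; cases "l = k") (auto simp: x3_other x2_other unit_intros)
  show "loc_unit S (\<lambda>Y. y3 Y l)"
  proof (cases "l = j")
    case True
    then show ?thesis by (simp add: y3_def ystep_def loc_unit_inverse uy2)
  next
    case lj: False
    show ?thesis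
    proof (cases "l = k")
      case True
      let ?f = "\<lambda>Y. inverse (u Y) * y2 Y j powi pos_part (B j k) * U3 Y powi (- B j k)"
      show ?thesis
      proof (rule loc_unit_cong[of _ ?f])
        fix Y :: "nat \<Rightarrow> real" assume Y: "posv Y"
        have "y3 Y k = inverse (y1 Y k) * y2 Y j powi pos_part (B j k) * ((1 + Y j) * U3 Y) powi (- B j k)"
        proof -
          have "y2 Y k = inverse (y1 Y k)" by (simp add: y2_def ystep_def)
          moreover have "1 + y2 Y j = (1 + Y j) * U3 Y" using c[OF Y] by blast
          ultimately show ?thesis using jk by (simp add: y3_def ystep_def B2_j)
        qed
        then show "?f Y = y3 Y l"
          using P1[OF Y] True by (simp only: y1_k power_int_mult_distrib) (subst cancel_factor, simp_all)
      qed (intro unit_intros u_unit uy2 PU)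
    next
      case lk: False
      define \<beta> where "\<beta> = B1 k l"
      let ?p = "\<lambda>Y. 1 + Y j :: real"
      let ?f = "\<lambda>Y. Y l * Y j powi pos_part (B j l) * u Y powi pos_part \<beta> * P2 Y powi (- \<beta>) *
          y2 Y j powi pos_part (B2 j l) * U3 Y powi (- B2 j l)"
      show ?thesis
      proof (rule loc_unit_cong[of _ ?f])
        fix Y :: "nat \<Rightarrow> real" assume Y: "posv Y"
        have "y1 Y l = Y l * Y j powi pos_part (B j l) * ?p Y powi (- B j l)"
          using lj by (simp add: y1_def ystep_def)
        moreover have "y2 Y l = y1 Y l * y1 Y k powi pos_part \<beta> * (1 + y1 Y k) powi (- \<beta>)"
          using lk by (simp add: y2_def ystep_def \<beta>_def)
        moreover have "y3 Y l = y2 Y l * y2 Y j powi pos_part (B2 j l) * (?p Y * U3 Y) powi (- B2 j l)"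
        proof -
          have "1 + y2 Y j = ?p Y * U3 Y" using c[OF Y] by blast
          then show ?thesis using lj by (simp add: y3_def ystep_def)
        qed
        moreover have "1 + y1 Y k = P2 Y * ?p Y powi (- pos_part (B j k))" using c[OF Y] by simp
        ultimately have "y3 Y l = ?f Y * (?p Y powi (- B j l) * ?p Y powi (- B j k * pos_part \<beta>) *
            ?p Y powi (- pos_part (B j k) * - \<beta>) * ?p Y powi (- B2 j l))"
          by (simp add: y1_k power_int_mult_distrib power_int_mult[symmetric] mult_ac)
        also have "?p Y powi (- B j l) * ?p Y powi (- B j k * pos_part \<beta>) *
            ?p Y powi (- pos_part (B j k) * - \<beta>) * ?p Y powi (- B2 j l)
          = ?p Y powi (- B j l + - B j k * pos_part \<beta> + - pos_part (B j k) * - \<beta> + - B2 j l)"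
          using P1[OF Y] by (intro powi_mult4) simp
        \<comment> \<open>The total exponent of \<open>1 + Y j\<close>. It is zero because the
          mutation rule for \<open>B2 j l\<close> collects exactly the same terms.\<close>
        also have "- B j l + - B j k * pos_part \<beta> + - pos_part (B j k) * - \<beta> + - B2 j l = 0"
          unfolding B2_j(1)[OF lk] \<beta>_def[symmetric] by (simp add: max_def algebra_simps)
        finally show "?f Y = y3 Y l" by simp
      qed (intro unit_intros u_unit uy2 PU)
    qed
  qed
qed

text \<open>Because \<open>xstep\<close> omits the normalizing coefficient, mutating back returns to
  the cluster \<open>x2 Y\<close> only up to a factor. What matters is that this factor is a unit by
  \<open>units_j\<close>.\<close>

lemma back_j:
  assumes Y: "posv Y"
  shows "xstep I j (mutate_exch j B2) (x3 Y) (y3 Y) l / x2 Y l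
    = (if l = j then x2 Y k powi B k j / y2 Y j else 1)"
proof (cases "l = j")
  case False
  then show ?thesis using posv_runs(5)[OF Y] by (simp add: xstep_def x3_other posv_def less_imp_neq[symmetric])
next
  case True
  have "(\<Prod>i\<in>I. x3 Y i powi pos_part (- mutate_exch j B2 i j)) = x3 Y k powi pos_part (- mutate_exch j B2 k j)"
  proof (rule prod_eq_single)
    fix i assume "i \<noteq> k"
    then show "x3 Y i powi pos_part (- mutate_exch j B2 i j) = 1"
      using B2_jj by (cases "i = j") (auto simp: mutate_exch_def x3_other x2_other)
  qed (use I in auto)
  then have "(\<Prod>i\<in>I. x3 Y i powi pos_part (- mutate_exch j B2 i j)) = x2 Y k powi pos_part (B k j)"
    using jk by (simp add: mutate_exch_def x3_other B2_j)
  then have e1: "xstep I j (mutate_exch j B2) (x3 Y) (y3 Y) j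
      = (1 + inverse (y2 Y j)) * x2 Y k powi pos_part (B k j) / x3 Y j"
    by (simp add: xstep_def) (simp add: y3_def ystep_def)
  have e2: "x3 Y j = (1 + y2 Y j) * x2 Y k powi pos_part (- B k j) / x2 Y j"
    using jk by (simp add: x3_j x2_other)
  have e3: "x2 Y k powi B k j = x2 Y k powi pos_part (B k j) / x2 Y k powi pos_part (- B k j)"
  proof -
    have "x2 Y k \<noteq> 0" using posv_runs(5)[OF Y] by (simp add: posv_def less_imp_neq[symmetric])
    then show ?thesis by (subst power_int_diff[symmetric]) (auto simp: max_def)
  qed
  have "0 < y2 Y j" "0 < x2 Y j" "0 < x2 Y k" using posv_runs[OF Y] by (auto simp: posv_def)
  then have "xstep I j (mutate_exch j B2) (x3 Y) (y3 Y) j / x2 Y j = x2 Y k powi B k j / y2 Y j"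
    unfolding e1 e2 e3 by (intro involution_ratio) auto
  then show ?thesis using True by simp
qed

text \<open>The later clusters are reached from the third seed by undoing the last mutation and
  following \<open>w\<close>. The hypothesis is the Laurent property for the shorter word
  \<open>j # w\<close>; substituting the third seed into it introduces only denominators from
  \<open>dens_off j\<close>.\<close>

lemma xrun_off:
  assumes "set w \<subseteq> I" "i \<in> I" "(\<lambda>Y. xrun I (mutate_exch j B2) ones Y (j # w) i) \<in> laurent I"
  shows "(\<lambda>Y. xrun I B ones Y (j # k # w) i) \<in> loc S"
proof -
  let ?x4 = "\<lambda>Y. xstep I j (mutate_exch j B2) (x3 Y) (y3 Y)"
  have G: "(\<lambda>Y. xrun I (mutate_exch j B2) (x3 Y) (y3 Y) (j # w) i) \<in> loc S"
    by (rule xrun_loc[OF I(1) _ assms(2) dens_off_mult assms(3)])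
      (use assms I units_j posv_runs loc_unit_loc in auto)
  obtain m where m: "monomial_fun I m" "\<And>X Y. posv X \<Longrightarrow> posv Y \<Longrightarrow> xrun I B2 X Y w i = m X * xrun I B2 ones Y w i"
    using xrun_scale[OF I(1) assms(1,2)] by blast
  obtain g where g: "\<And>X. posv X \<Longrightarrow> m X = (\<Prod>l\<in>I. X l powi g l)"
    using m(1) unfolding monomial_fun_def by blast
  have "loc_unit S (\<lambda>Y. if l = j then x2 Y k powi B k j / y2 Y j else 1)" for l
    by (cases "l = j") (auto intro!: unit_intros units_j)
  then have "loc_unit S (\<lambda>Y. ?x4 Y l / x2 Y l)" for l
    by (rule loc_unit_cong) (simp add: back_j)
  \<comment> \<open>The exponents \<open>g\<close> describe how the run along \<open>w\<close>
    depends on its starting cluster, so these factors turn \<open>m (?x4 Y)\<close> into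
    \<open>m (x2 Y)\<close>.\<close>
  then have "loc_unit S (\<lambda>Y. \<Prod>l\<in>I. (?x4 Y l / x2 Y l) powi (- g l))"
    by (intro loc_unit_prod[OF dens_off_mult I(1)] loc_unit_powi[OF dens_off_mult])
  from loc_mult[OF dens_off_mult G loc_unit_loc[OF this]] show ?thesis
  proof (rule loc_cong)
    fix Y :: "nat \<Rightarrow> real" assume Y: "posv Y"
    have p4: "posv (?x4 Y)" by (intro posv_xstep posv_runs Y)
    have "xrun I (mutate_exch j B2) (x3 Y) (y3 Y) (j # w) i = m (?x4 Y) * xrun I B2 ones (y2 Y) w i"
      using p4 by (simp add: mutate_exch_mutate_exch m(2) posv_runs Y y3_def ystep_ystep)
    moreover have "xrun I B ones Y (j # k # w) i = m (x2 Y) * xrun I B2 ones (y2 Y) w i"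
      by (simp add: m(2)[symmetric] posv_runs Y) (simp add: x2_def x1_def y2_def y1_def B2_def B1_def)
    moreover have "m (?x4 Y) * (\<Prod>l\<in>I. (?x4 Y l / x2 Y l) powi (- g l)) = m (x2 Y)"
      unfolding g[OF p4] g[OF posv_runs(5)[OF Y]] prod.distrib[symmetric]
    proof (rule prod.cong[OF refl])
      fix l
      have "0 < ?x4 Y l" "0 < x2 Y l" using p4 posv_runs(5)[OF Y] by (auto simp: posv_def)
      then show "?x4 Y l powi g l * (?x4 Y l / x2 Y l) powi (- g l) = x2 Y l powi g l"
        by (simp add: power_int_minus power_int_divide_distrib field_simps)
    qed
    ultimately show "xrun I (mutate_exch j B2) (x3 Y) (y3 Y) (j # w) i * (\<Prod>l\<in>I. (?x4 Y l / x2 Y l) powi (- g l))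
        = xrun I B ones Y (j # k # w) i"
      by (simp add: mult_ac)
  qed
qed

end

text \<open>For \<open>j # k # v\<close> the induction hypothesis is used twice. After the first
  mutation, for \<open>k # v\<close>, it bounds the denominators by monomials times powers of
  \<open>1 + Y j\<close>; from the third seed, for \<open>j # v\<close>, it gives denominators that
  avoid \<open>1 + Y j\<close>. By \<open>laurent_cancel\<close> only monomials remain.\<close>

theorem laurent_xrun:
  assumes "finite I" "set w \<subseteq> I" "skew_symmetrizable I B" "i \<in> I"
  shows "(\<lambda>Y. xrun I B ones Y w i) \<in> laurent I"
  using assms(2,3)
proof (induction "length w" arbitrary: w B rule: less_induct)
  case less
  have p1: "posv (ones :: nat \<Rightarrow> real)" by (simp add: posv_def)
  have first: "(\<lambda>Y. xrun I B ones Y (j # v) i) \<in> loc (laurent_dens1 I j)" if w: "w = j # v" for j v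
  proof -
    have "(\<lambda>Y. xrun I (mutate_exch j B) ones Y v i) \<in> laurent I"
      using less w by (intro less.hyps) (auto intro: skew_symmetrizable_mutate)
    note IH = this
    have "(\<lambda>Y. xrun I (mutate_exch j B) (xstep I j B ones Y) (ystep j B Y) v i) \<in> loc (laurent_dens1 I j)"
    proof (rule xrun_loc[OF assms(1) _ assms(4) laurent_dens1_mult IH])
      have j: "j \<in> I" and v: "set v \<subseteq> I" using less.prems w by auto
      show "set v \<subseteq> I" by fact
      note ui = loc_unit_mult[OF laurent_dens1_mult] loc_unit_powi[OF laurent_dens1_mult] loc_unit_inverse
        laurent1_unit_factor laurent1_unit_var[OF assms(1)] loc_unit_1[OF laurent_dens1_mult] j
      show "loc_unit (laurent_dens1 I j) (\<lambda>Y. ystep j B Y l)" if "l \<in> I" for l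
        using that unfolding ystep_def by (cases "l = j") (auto intro!: ui)
      show "(\<lambda>Y. ystep j B Y l) \<in> loc (laurent_dens1 I j)" for l
      proof (cases "l = j")
        case True
        then show ?thesis unfolding ystep_def by (auto intro!: loc_unit_loc ui)
      next
        case False
        have "(\<lambda>Y. Y l) \<in> loc (laurent_dens1 I j)"
          using loc_poly[where r = "mpoly_var l", OF laurent_dens1_mult] by simp
        moreover have "loc_unit (laurent_dens1 I j) (\<lambda>Y. Y j powi pos_part (B j l) * (1 + Y j) powi (- B j l))"
          by (intro ui)
        ultimately show ?thesis using False loc_mult[OF laurent_dens1_mult _ loc_unit_loc] unfolding ystep_def
          by (simp add: mult.assoc)
      qed
      show "loc_unit (laurent_dens1 I j) (\<lambda>Y. xstep I j B ones Y l)" for l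
        unfolding xstep_def by (cases "l = j") (auto intro!: ui)
    qed (auto intro: posv_ystep posv_xstep p1)
    then show ?thesis by simp
  qed
  \<comment> \<open>The case rule serves only to separate lists of length zero, one and at least
    two.\<close>
  show ?case
  proof (cases w rule: remdups_adj.cases)
    case 1
    then show ?thesis using loc_1[OF laurent_dens_mult] by simp
  next
    case (2 j)
    have "(\<lambda>Y. meval Y (if i = j then 1 + mpoly_var j else 1)) \<in> laurent I"
      by (rule loc_poly[OF laurent_dens_mult])
    then show ?thesis by (rule loc_cong) (auto simp: 2 xstep_def)
  next
    case (3 j k v)
    have mem: "j \<in> I" "k \<in> I" "set v \<subseteq> I" using less.prems 3 by auto
    show ?thesis
    proof (cases "j = k")
      case True
      \<comment> \<open>Two equal mutations restore \<open>Y\<close> and the matrix, and change the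
        cluster \<open>ones\<close> only by the unit \<open>inverse (Y j)\<close>; so the shorter
        word \<open>v\<close> decides.\<close>
      let ?x = "\<lambda>Y. xstep I j (mutate_exch j B) (xstep I j B ones Y) (ystep j B Y)"
      have x: "?x Y l = (if l = j then inverse (Y j) else 1)" if "posv Y" for Y :: "nat \<Rightarrow> real" and l
      proof -
        have "(\<Prod>i\<in>I. xstep I j B ones Y i powi pos_part (- mutate_exch j B i j)) = 1"
          using skew_symmetrizable_diag[OF less.prems(2) mem(1)]
          by (intro prod.neutral) (auto simp: xstep_def mutate_exch_def)
        moreover have "xstep I j B ones Y j = 1 + Y j" "ystep j B Y j = inverse (Y j)"
          by (simp_all add: xstep_def ystep_def)
        ultimately have "?x Y j = (1 + inverse (Y j)) / (1 + Y j)" by (subst xstep_def) simp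
        also have "\<dots> = inverse (Y j)" using involution_ratio[of "Y j" 1 1 1] that by (simp add: posv_def divide_inverse)
        finally show ?thesis by (simp add: xstep_def)
      qed
      have "(\<lambda>Y. xrun I B (\<lambda>l. if l = j then inverse (Y j) else 1) Y v i) \<in> laurent I"
      proof (rule xrun_loc[OF assms(1) mem(3) assms(4) laurent_dens_mult])
        show "(\<lambda>Y. xrun I B ones Y v i) \<in> laurent I" using less 3 mem by (intro less.hyps) auto
        show "(\<lambda>Y. Y l) \<in> laurent I" for l using loc_poly[where r = "mpoly_var l", OF laurent_dens_mult] by simp
        show "loc_unit (laurent_dens I) (\<lambda>Y. if l = j then inverse (Y j) else 1)" for l
          using loc_unit_inverse[OF laurent_unit_var[OF assms(1) mem(1)]] loc_unit_1[OF laurent_dens_mult]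
          by (cases "l = j") simp_all
      qed (auto intro: laurent_unit_var assms(1) simp: posv_def)
      then show ?thesis
      proof (rule loc_cong)
        fix Y :: "nat \<Rightarrow> real" assume Y: "posv Y"
        have "?x Y = (\<lambda>l. if l = j then inverse (Y j) else 1)" using x[OF Y] by auto
        then show "xrun I B (\<lambda>l. if l = j then inverse (Y j) else 1) Y v i = xrun I B ones Y w i"
          using 3 True Y by (simp add: mutate_exch_mutate_exch ystep_ystep)
      qed
    next
      case False
      have "(\<lambda>Y. xrun I (mutate_exch j (mutate_exch k (mutate_exch j B))) ones Y (j # v) i) \<in> laurent I"
        using less 3 mem by (intro less.hyps) (auto intro!: skew_symmetrizable_mutate)
      note IH = this
      interpret three_mutations I B j k
        using assms(1) mem False skew_symmetrizable_diag[OF less.prems(2) mem(1)]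
          skew_symmetrizable_sign[OF less.prems(2)]
        by unfold_locales auto
      have "(\<lambda>Y. xrun I B ones Y (j # k # v) i) \<in> loc (dens_off j)"
        using xrun_off[OF mem(3) assms(4)] IH by (simp add: B2_def B1_def)
      then show ?thesis using laurent_cancel first[of j "k # v"] 3 by simp
    qed
  qed
qed

section \<open>Mutation of seeds over a tropical semifield\<close>

definition coeff_map :: "nat set \<Rightarrow> (nat \<Rightarrow> 'k::field) \<Rightarrow> (nat \<Rightarrow> int) \<Rightarrow> 'k" where
  "coeff_map I y p = (\<Prod>i\<in>I. y i powi p i)"

lemma trop_gen_carrier: "finite I \<Longrightarrow> i \<in> I \<Longrightarrow> trop_gen i \<in> carrier (trop I)"
  by (auto simp: carrier_trop trop_gen_def)

lemma sum_trop_gen: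
  assumes "finite I" "p \<in> carrier (trop I)"
  shows "(\<lambda>j. \<Sum>i\<in>I. p i * trop_gen i j) = p"
proof
  fix j
  have "(\<Sum>i\<in>I. p i * trop_gen i j) = (\<Sum>i\<in>I. if i = j then p i else 0)"
    by (rule sum.cong) (auto simp: trop_gen_def)
  also have "\<dots> = p j" using assms by (simp add: carrier_trop)
  finally show "(\<Sum>i\<in>I. p i * trop_gen i j) = p j" .
qed

lemma mutate_coeffs_trop:
  assumes "finite I" "y k \<in> carrier (trop I)"
  shows "mutate_coeffs (trop I) k B y j = (if j = k then (\<lambda>l. - y k l)
    else (\<lambda>l. y j l + pos_part (B k j) * y k l + - B k j * min (y k l) 0))"
proof -
  have "(\<lambda>l. min (y k l) 0) \<in> carrier (trop I)" using assms by (auto simp: carrier_trop)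
  then show ?thesis using assms by (auto simp: mutate_coeffs_def trop_inv trop_int_pow fun_eq_iff)
qed

lemma mutate_coeffs_carrier:
  assumes "finite I" "\<And>i. i \<in> I \<Longrightarrow> y i \<in> carrier (trop I)" "k \<in> I" "j \<in> I"
  shows "mutate_coeffs (trop I) k B y j \<in> carrier (trop I)"
  using assms by (subst mutate_coeffs_trop) (auto simp: carrier_trop)

context
  fixes I :: "nat set" and y :: "nat \<Rightarrow> 'k::field_char_0"
  assumes fin: "finite I" and y: "\<forall>i\<in>I. y i \<noteq> 0"
begin

lemma coeff_map_nonzero: "coeff_map I y p \<noteq> 0"
  using fin y by (simp add: coeff_map_def)

lemma coeff_map_add: "coeff_map I y (\<lambda>l. p l + q l) = coeff_map I y p * coeff_map I y q"
  using y by (simp add: coeff_map_def power_int_add prod.distrib)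

lemma coeff_map_mult: "coeff_map I y (\<lambda>l. c * p l) = coeff_map I y p powi c"
  by (simp add: coeff_map_def prod_powi power_int_mult[symmetric] mult.commute)

lemma coeff_map_0: "coeff_map I y (\<lambda>l. 0) = 1"
  by (simp add: coeff_map_def)

lemma coeff_map_uminus: "coeff_map I y (\<lambda>l. - p l) = inverse (coeff_map I y p)"
  using coeff_map_mult[of "-1" p] by (simp add: power_int_minus)

lemma coeff_map_sum: "finite A \<Longrightarrow> coeff_map I y (\<lambda>l. \<Sum>a\<in>A. p a l) = (\<Prod>a\<in>A. coeff_map I y (p a))"
  by (induction A rule: finite_induct) (simp_all add: coeff_map_0 coeff_map_add)

lemma coeff_map_gen: "i \<in> I \<Longrightarrow> coeff_map I y (trop_gen i) = y i"
  unfolding coeff_map_def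
  by (subst prod_eq_single[of _ i]) (use fin in \<open>auto simp: trop_gen_def\<close>)

context
  fixes T :: "('k, nat \<Rightarrow> int) seed" and k :: nat
  assumes T: "\<And>i. i \<in> I \<Longrightarrow> cluster T i \<noteq> 0" "\<And>i. i \<in> I \<Longrightarrow> coeffs T i \<in> carrier (trop I)"
    and k: "k \<in> I" "exch T k k = 0"
begin

text \<open>Taking the second monomial of the exchange relation out of the numerator leaves
  \<open>1 + y_hat\<close>; the denominator is the tropical sum of the coefficient and one, an
  entrywise minimum with \<open>0\<close>.\<close>

lemma cluster_mutate:
  "cluster (mutate I (trop I) (coeff_map I y) k T) j
    = xstep I k (exch T) (cluster T) (y_hat I (coeff_map I y) T) j /
      (if j = k then coeff_map I y (\<lambda>l. min (coeffs T k l) 0) else 1)"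
proof (cases "j = k")
  case False
  then show ?thesis by (simp add: mutate_def mutate_cluster_def xstep_def)
next
  case True
  have "(\<Prod>i\<in>I. cluster T i powi exch T i k) * (\<Prod>i\<in>I. cluster T i powi pos_part (- exch T i k))
      = (\<Prod>i\<in>I. cluster T i powi pos_part (exch T i k))"
    unfolding prod.distrib[symmetric]
    by (rule prod.cong[OF refl], subst power_int_add[symmetric]) (use T(1) in \<open>auto simp: max_def\<close>)
  then show ?thesis using True
    by (simp add: mutate_def mutate_cluster_def xstep_def y_hat_def distrib_right mult.assoc)
      (simp add: add.commute mult.commute)
qed

text \<open>The normalizing factor \<open>m\<close> enters the new coefficient with exponent
  \<open>- ?b\<close> and, through the new cluster variable, with exponent \<open>?b\<close>. It
  cancels, so \<open>y_hat\<close> obeys a rule in which tropical addition has become ordinary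
  addition.\<close>

lemma y_hat_mutate:
  assumes j: "j \<in> I" and new: "cluster (mutate I (trop I) (coeff_map I y) k T) k \<noteq> 0"
  shows "y_hat I (coeff_map I y) (mutate I (trop I) (coeff_map I y) k T) j
    = ystep k (exch T) (y_hat I (coeff_map I y) T) j"
proof -
  let ?e = "coeff_map I y"
  let ?T' = "mutate I (trop I) ?e k T"
  let ?B = "exch T" and ?X = "cluster T" and ?Y = "y_hat I ?e T"
  have co: "coeffs ?T' j = (if j = k then (\<lambda>l. - coeffs T k l)
    else (\<lambda>l. coeffs T j l + pos_part (?B k j) * coeffs T k l + - ?B k j * min (coeffs T k l) 0))" for j
    using mutate_coeffs_trop[where y = "coeffs T" and k = k and B = ?B, OF fin T(2)[OF k(1)]] by (simp add: mutate_def)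
  have other: "i \<noteq> k \<Longrightarrow> cluster ?T' i = ?X i" for i
    by (simp add: mutate_def mutate_cluster_def)
  show ?thesis
  proof (cases "j = k")
    case True
    have "(\<Prod>i\<in>I. cluster ?T' i powi exch ?T' i k) = (\<Prod>i\<in>I. ?X i powi (- ?B i k))"
    proof (rule prod.cong[OF refl])
      fix i
      show "cluster ?T' i powi exch ?T' i k = ?X i powi (- ?B i k)"
        using k(2) other[of i] by (cases "i = k") (auto simp: mutate_def mutate_exch_def)
    qed
    then show ?thesis using True
      by (simp add: y_hat_def ystep_def co coeff_map_uminus power_int_minus prod_inversef[unfolded comp_def])
  next
    case False
    let ?b = "?B k j"
    define m where "m = ?e (\<lambda>l. min (coeffs T k l) 0)"
    have m: "m \<noteq> 0" unfolding m_def by (rule coeff_map_nonzero)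
    have "?e (coeffs ?T' j) = ?e (coeffs T j) * ?e (coeffs T k) powi pos_part ?b * m powi (- ?b)"
      using False by (simp only: co if_False coeff_map_add coeff_map_mult m_def)
    moreover have "(\<Prod>i\<in>I. cluster ?T' i powi exch ?T' i j)
        = cluster ?T' k powi (- ?b) * (\<Prod>i\<in>I - {k}. ?X i powi mutate_exch k ?B i j)"
    proof -
      have "(\<Prod>i\<in>I - {k}. cluster ?T' i powi exch ?T' i j) = (\<Prod>i\<in>I - {k}. ?X i powi mutate_exch k ?B i j)"
        by (rule prod.cong[OF refl]) (simp add: other, simp add: mutate_def)
      then show ?thesis
        by (subst prod.remove[OF fin k(1)]) (simp add: mutate_def mutate_exch_def)
    qed
    moreover have "cluster ?T' k powi (- ?b)
        = (1 + ?Y k) powi (- ?b) * (\<Prod>i\<in>I. ?X i powi (pos_part (- ?B i k) * - ?b)) * ?X k powi ?b * m powi ?b"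
    proof -
      have "cluster ?T' k = (1 + ?Y k) * (\<Prod>i\<in>I. ?X i powi pos_part (- ?B i k)) * inverse (?X k) * inverse m"
        unfolding cluster_mutate by (simp add: xstep_def m_def divide_inverse)
      then show ?thesis
        by (simp only: power_int_mult_distrib prod_powi power_int_mult[symmetric] power_int_inverse)
          (simp add: power_int_minus)
    qed
    moreover have "(\<Prod>i\<in>I. ?X i powi (pos_part (- ?B i k) * - ?b)) * ?X k powi ?b *
        (\<Prod>i\<in>I - {k}. ?X i powi mutate_exch k ?B i j)
      = (\<Prod>i\<in>I. ?X i powi ?B i j) * (\<Prod>i\<in>I. ?X i powi ?B i k) powi pos_part ?b"
    proof -
      have "?X k powi ?b * (\<Prod>i\<in>I - {k}. ?X i powi mutate_exch k ?B i j)
          = (\<Prod>i\<in>I. ?X i powi (if i = k then ?b else mutate_exch k ?B i j))"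
        by (subst prod.remove[OF fin k(1)]) simp
      moreover have "(\<Prod>i\<in>I. ?X i powi (pos_part (- ?B i k) * - ?b)) *
          (\<Prod>i\<in>I. ?X i powi (if i = k then ?b else mutate_exch k ?B i j))
          = (\<Prod>i\<in>I. ?X i powi ?B i j * (?X i powi (?B i k * pos_part ?b)))"
        unfolding prod.distrib[symmetric]
      proof (rule prod.cong[OF refl])
        fix i assume i: "i \<in> I"
        have "pos_part (- ?B i k) * - ?b + (if i = k then ?b else mutate_exch k ?B i j)
            = ?B i j + ?B i k * pos_part ?b"
          using False k(2) by (auto simp: mutate_exch_def max_def algebra_simps)
        then show "?X i powi (pos_part (- ?B i k) * - ?b) * ?X i powi (if i = k then ?b else mutate_exch k ?B i j)
            = ?X i powi ?B i j * (?X i powi (?B i k * pos_part ?b))"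
          using T(1)[OF i] by (simp only: power_int_add[symmetric] simp_thms)
      qed
      ultimately show ?thesis by (simp add: prod.distrib prod_powi power_int_mult mult.assoc)
    qed
    moreover have "ystep k ?B ?Y j = ?e (coeffs T j) * ?e (coeffs T k) powi pos_part ?b * (1 + ?Y k) powi (- ?b) *
       ((\<Prod>i\<in>I. ?X i powi ?B i j) * (\<Prod>i\<in>I. ?X i powi ?B i k) powi pos_part ?b)"
      using False unfolding ystep_def by (simp add: y_hat_def[of _ _ _ j] y_hat_def[of _ _ _ k] power_int_mult_distrib mult_ac)
    moreover have "m powi (- ?b) * m powi ?b = 1" using m by (simp add: power_int_minus)
    ultimately show ?thesis
      unfolding y_hat_def[of _ _ ?T'] by (simp add: mult_ac)
  qed
qed

end

end

section \<open>Seeds with principal coefficients\<close>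

text \<open>One family for the cluster variables and the generators of the coefficients, so that a single
  condition expresses that all of them together are independent.\<close>

definition interleave :: "(nat \<Rightarrow> 'a) \<Rightarrow> (nat \<Rightarrow> 'a) \<Rightarrow> nat \<Rightarrow> 'a" where
  "interleave x y m = (if even m then x (m div 2) else y (m div 2))"

definition doubled :: "nat set \<Rightarrow> nat set" where
  "doubled I = {m. m div 2 \<in> I}"

lemma interleave_simps [simp]:
  "interleave x y (2 * i) = x i" "interleave x y (Suc (2 * i)) = y i"
  by (auto simp: interleave_def)

lemma doubled_simps [simp]: "2 * i \<in> doubled I \<longleftrightarrow> i \<in> I" "Suc (2 * i) \<in> doubled I \<longleftrightarrow> i \<in> I"
  by (auto simp: doubled_def)

lemma doubledE:
  assumes "m \<in> doubled I"
  obtains i where "i \<in> I" "m = 2 * i" | i where "i \<in> I" "m = Suc (2 * i)"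
  using assms by (cases "even m") (auto simp: doubled_def elim!: evenE oddE)

text \<open>Initial valuations: each cluster variable has valuation zero everywhere, and the
  \<open>i\<close>-th generator has valuation one at \<open>y i = 0\<close> and zero
  elsewhere.\<close>

abbreviation wgt :: "nat \<Rightarrow> nat \<Rightarrow> int" where
  "wgt \<equiv> interleave (\<lambda>_ _. 0) trop_gen"

lemma wgt_carrier: "finite I \<Longrightarrow> m \<in> doubled I \<Longrightarrow> wgt m \<in> carrier (trop I)"
  by (erule doubledE) (auto simp: trop_gen_carrier, simp add: carrier_trop)

definition hat :: "nat set \<Rightarrow> (nat \<Rightarrow> nat \<Rightarrow> int) \<Rightarrow> (nat \<Rightarrow> 'k::field) \<Rightarrow> (nat \<Rightarrow> 'k) \<Rightarrow> nat \<Rightarrow> 'k" where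
  "hat I B x y j = y j * (\<Prod>i\<in>I. x i powi B i j)"

text \<open>Multiplying each \<open>y j\<close> by a monomial in \<open>x\<close> is undone by
  dividing by it, which gives the preimages needed for \<open>zindep_change\<close>. For the second
  claim the preimage has all \<open>x\<close> equal to \<open>1\<close>.\<close>

lemma zindep_hat:
  fixes x y :: "nat \<Rightarrow> 'k::field"
  assumes fin: "finite I" and ind: "zindep (doubled I) (interleave x y)"
  shows "zindep (doubled I) (interleave x (hat I B x y))" "zindep I (hat I B x y)"
proof -
  let ?r = "sfrel I (doubled I) (interleave x y) wgt"
  have w: "\<forall>m\<in>doubled I. wgt m \<in> carrier (trop I)" using wgt_carrier[OF fin] by blast
  define F where "F m V = (if even m then V m else V m * (\<Prod>i\<in>I. V (2 * i) powi B i (m div 2)))"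
    for m and V :: "nat \<Rightarrow> real"
  have F_even: "F (2 * i) = (\<lambda>V. V (2 * i))"
    and F_odd: "F (Suc (2 * i)) = (\<lambda>V. V (Suc (2 * i)) * (\<Prod>l\<in>I. V (2 * l) powi B l i))" for i
    by (simp_all add: F_def fun_eq_iff)
  have x: "?r (x i) (F (2 * i)) (\<lambda>j. 0)" if "i \<in> I" for i
    using sfrel_var[where i = "2 * i" and v = "interleave x y", OF fin w] that by (simp add: F_even)
  have "\<exists>p. ?r (hat I B x y j) (F (Suc (2 * j))) p" if "j \<in> I" for j
  proof -
    have "?r (x i) (\<lambda>V. V (2 * i)) (\<lambda>j. 0)" if "i \<in> I" for i
      using x[OF that] by (simp add: F_even)
    then have "?r (\<Prod>i\<in>I. x i powi B i j) (\<lambda>V. \<Prod>i\<in>I. V (2 * i) powi B i j) (\<lambda>l. \<Sum>i\<in>I. B i j * 0)"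
      by (intro sfrel_prod[OF fin w] sfrel_powi[OF fin w] fin)
    moreover have "?r (y j) (\<lambda>V. V (Suc (2 * j))) (wgt (Suc (2 * j)))"
      using sfrel_var[where i = "Suc (2 * j)" and v = "interleave x y", OF fin w] that by simp
    ultimately show ?thesis
      using sfrel_mult[OF fin w] unfolding hat_def F_odd by blast
  qed
  then obtain p where y: "\<And>j. j \<in> I \<Longrightarrow> ?r (hat I B x y j) (F (Suc (2 * j))) (p j)" by metis
  show "zindep (doubled I) (interleave x (hat I B x y))"
  proof (rule zindep_change[OF fin w ind])
    fix m assume m: "m \<in> doubled I"
    then show "?r (interleave x (hat I B x y) m) (F m) (interleave (\<lambda>i j. 0) p m)"
      by (cases rule: doubledE) (use x y in auto)
  next
    fix V' :: "nat \<Rightarrow> real" assume V': "posv V'"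
    define V where "V m = (if even m then V' m else V' m / (\<Prod>i\<in>I. V' (2 * i) powi B i (m div 2)))" for m
    have pos: "0 < (\<Prod>i\<in>I. V' (2 * i) powi B i j)" for j
      using V' by (auto simp: posv_def intro!: prod_pos)
    show "\<exists>V. posv V \<and> (\<forall>m\<in>doubled I. F m V = V' m)"
    proof (intro exI[of _ V] conjI ballI)
      show "posv V" using V' pos by (auto simp: posv_def V_def)
      fix m
      show "F m V = V' m"
        using pos[of "m div 2"] by (auto simp: F_def V_def)
    qed
  qed
  show "zindep I (hat I B x y)"
  proof (rule zindep_change[OF fin w ind y])
    fix V' :: "nat \<Rightarrow> real" assume V': "posv V'"
    show "\<exists>V. posv V \<and> (\<forall>m\<in>I. F (Suc (2 * m)) V = V' m)"
      by (rule exI[of _ "interleave (\<lambda>_. 1) V'"]) (use V' in \<open>auto simp: posv_def F_def interleave_def\<close>)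
  qed
qed

section \<open>From Laurent polynomials to polynomials\<close>

lemma isCont_meval: "isCont (\<lambda>s::real. meval (v(j := c * s)) p) s0"
proof (induction p rule: mpoly_induct)
  case (var i)
  then show ?case by (cases "i = j") auto
qed auto

lemma vanish_at_0:
  fixes f :: "real \<Rightarrow> real"
  assumes "isCont f 0" "isCont g 0" "\<And>s. 0 < s \<Longrightarrow> s \<le> 1 \<Longrightarrow> \<bar>f s\<bar> \<le> s * g s"
  shows "f 0 = 0"
proof -
  have "((\<lambda>s. \<bar>f s\<bar>) \<longlongrightarrow> \<bar>f 0\<bar>) (at_right 0)"
    using assms(1) by (intro tendsto_rabs) (auto simp: isCont_def intro: tendsto_within_subset)
  moreover have "((\<lambda>s. s * g s) \<longlongrightarrow> 0 * g 0) (at_right 0)"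
    using assms(2) by (intro tendsto_mult) (auto simp: isCont_def intro: tendsto_within_subset)
  moreover have "\<forall>\<^sub>F s in at_right 0. \<bar>f s\<bar> \<le> s * g s"
    using assms(3) unfolding eventually_at_right_field by (intro exI[of _ 1]) auto
  ultimately have "\<bar>f 0\<bar> \<le> 0 * g 0" by (intro tendsto_le[of "at_right 0"]) auto
  then show ?thesis by simp
qed

text \<open>Tropical value zero means that the function stays between positive bounds as one
  variable tends to \<open>0\<close>. The upper bound excludes poles, so the monomial denominator
  can be removed one variable at a time; the lower bound excludes that a variable divides the
  result.\<close>

lemma sfe_polynomial:
  assumes fin: "finite I" and t: "sf_vars t \<subseteq> I" and val: "sf_value (trop I) trop_gen t = (\<lambda>_. 0)"
    and laurent: "(\<lambda>Y. sfe Y t) \<in> laurent I"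
  shows "\<exists>F. mpoly_vars F \<subseteq> I \<and> (\<forall>i\<in>I. \<not> mpoly_var i dvd F) \<and> sf_fract t = Fract F 1"
proof -
  have gen: "\<And>i. i \<in> sf_vars t \<Longrightarrow> trop_gen i \<in> carrier (trop I)"
    using t fin trop_gen_carrier by blast
  \<comment> \<open>With these weights only coordinate \<open>j\<close> moves along the curve, and
    it tends to \<open>0\<close>.\<close>
  have curve: "(\<lambda>i. a i * s powi trop_gen i j) = a(j := a j * s)" for a :: "nat \<Rightarrow> real" and s j
    by (auto simp: trop_gen_def)
  have cancel: "\<exists>r'. \<forall>Y. posv Y \<longrightarrow> meval Y D * sfe Y t = meval Y r'"
    if r: "\<And>Y. posv Y \<Longrightarrow> meval Y (mpoly_var j * D) * sfe Y t = meval Y r" for j D r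
  proof -
    have "mpoly_var j - of_int 0 dvd r"
    proof (rule dvd_of_pos_vanish)
      fix a :: "nat \<Rightarrow> real" assume a: "posv a"
      have "\<exists>C>0. \<forall>s. 0 < s \<and> s \<le> 1 \<longrightarrow>
          sfe (\<lambda>i. a i * s powi trop_gen i j) t \<le> C * s powi sf_value (trop I) trop_gen t j"
        by (rule sfe_trop_upper[OF fin gen a])
      then have "\<exists>C>0. \<forall>s. 0 < s \<and> s \<le> 1 \<longrightarrow> sfe (a(j := a j * s)) t \<le> C"
        by (simp add: val curve)
      then obtain C where C: "C > 0 \<and> (\<forall>s. 0 < s \<and> s \<le> 1 \<longrightarrow> sfe (a(j := a j * s)) t \<le> C)" ..
      have "meval (a(j := a j * 0)) r = 0"
      proof (rule vanish_at_0[where g = "\<lambda>s. a j * \<bar>meval (a(j := a j * s)) D\<bar> * C"])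
        fix s :: real assume s: "0 < s" "s \<le> 1"
        have pos: "posv (a(j := a j * s))" using a s by (auto simp: posv_def)
        have "\<bar>meval (a(j := a j * s)) r\<bar> = s * (a j * \<bar>meval (a(j := a j * s)) D\<bar>) * sfe (a(j := a j * s)) t"
        proof -
          have "0 < a j" using a by (simp add: posv_def)
          then show ?thesis
            using s sfe_pos[OF pos, of t] by (simp add: r[OF pos, symmetric] abs_mult)
        qed
        also have "\<dots> \<le> s * (a j * \<bar>meval (a(j := a j * s)) D\<bar>) * C"
          using C s a by (intro mult_left_mono) (auto simp: posv_def less_imp_le)
        finally show "\<bar>meval (a(j := a j * s)) r\<bar> \<le> s * (a j * \<bar>meval (a(j := a j * s)) D\<bar> * C)"
          by (simp add: mult.assoc)
      qed (rule isCont_meval, intro continuous_intros isCont_meval)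
      then show "meval (a(j := of_int 0)) r = 0" by simp
    qed
    then obtain r' where r': "r = mpoly_var j * r'" by auto
    have "meval Y D * sfe Y t = meval Y r'" if Y: "posv Y" for Y
      using r[OF Y] Y by (simp add: r' posv_def mult.assoc less_imp_neq[symmetric])
    then show ?thesis by blast
  qed
  have cancel_power: "\<exists>r'. \<forall>Y. posv Y \<longrightarrow> meval Y D * sfe Y t = meval Y r'"
    if "\<exists>r. \<forall>Y. posv Y \<longrightarrow> meval Y (mpoly_var j ^ n * D) * sfe Y t = meval Y r" for j n D
    using that
  proof (induction n)
    case (Suc n)
    then show ?case using cancel[of j "mpoly_var j ^ n * D"] by (simp add: mult.assoc) blast
  qed simp
  obtain N r where "\<And>Y. posv Y \<Longrightarrow> meval Y (all_vars I ^ N) * sfe Y t = meval Y r"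
    using laurent unfolding loc_def laurent_dens_def by auto
  then have start: "\<exists>r. \<forall>Y. posv Y \<longrightarrow> meval Y ((\<Prod>j\<in>I. mpoly_var j ^ N)) * sfe Y t = meval Y r"
    by (auto simp: all_vars_def prod_power_distrib)
  have reduce: "\<exists>r. \<forall>Y. posv Y \<longrightarrow> meval Y 1 * sfe Y t = meval Y r"
    if "finite A" "\<exists>r. \<forall>Y. posv Y \<longrightarrow> meval Y (\<Prod>j\<in>A. mpoly_var j ^ N) * sfe Y t = meval Y r" for A
    using that
  proof (induction A rule: finite_induct)
    case (insert j A)
    then show ?case using cancel_power[of j N "\<Prod>j\<in>A. mpoly_var j ^ N"] by simp
  qed simp
  obtain r where r: "\<And>Y. posv Y \<Longrightarrow> sfe Y t = meval Y r"
    using reduce[OF fin start] by auto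
  \<comment> \<open>The polynomial \<open>r\<close> may contain variables outside \<open>I\<close>.
    Setting them to \<open>1\<close> does not alter its positive values, since \<open>t\<close> does
    not contain them.\<close>
  define F where "F = meval (\<lambda>i. if i \<in> I then mpoly_var i else 1) r"
  have F: "meval Y F = sfe Y t" if Y: "posv Y" for Y :: "nat \<Rightarrow> real"
  proof -
    let ?Y = "\<lambda>i. if i \<in> I then Y i else 1"
    have "(\<lambda>i. meval Y (if i \<in> I then mpoly_var i else 1)) = ?Y" by auto
    then have "meval Y F = meval ?Y r" by (simp add: F_def meval_compose)
    also have "\<dots> = sfe ?Y t" using Y by (subst r) (auto simp: posv_def)
    also have "\<dots> = sfe Y t" using t by (intro sfe_cong) auto
    finally show ?thesis .
  qed
  show ?thesis
  proof (intro exI[of _ F] conjI ballI)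
    show "mpoly_vars F \<subseteq> I" unfolding F_def by (rule mpoly_vars_meval) auto
    have "sf_num t = F * sf_den t"
    proof (rule meval_pos_eq)
      fix Y :: "nat \<Rightarrow> real" assume Y: "posv Y"
      show "meval Y (sf_num t) = meval Y (F * sf_den t)"
        using sf_numden_pos[OF Y, of t] F[OF Y] by simp
    qed
    then show "sf_fract t = Fract F 1"
      by (simp add: sf_fract_numden eq_fract sf_numden_nonzero)
    fix j assume j: "j \<in> I"
    show "\<not> mpoly_var j dvd F"
    proof
      assume "mpoly_var j dvd F"
      then obtain D where D: "F = mpoly_var j * D" by auto
      have p1: "posv (ones :: nat \<Rightarrow> real)" by (simp add: posv_def)
      have "\<exists>C>0. \<forall>s::real. 0 < s \<and> s \<le> 1 \<longrightarrow>
          C * s powi sf_value (trop I) trop_gen t j \<le> sfe (\<lambda>i. 1 * s powi trop_gen i j) t"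
        by (rule sfe_trop_lower[OF fin gen p1])
      then have "\<exists>C>0. \<forall>s::real. 0 < s \<and> s \<le> 1 \<longrightarrow> C \<le> sfe (ones(j := 1 * s)) t"
        unfolding curve by (simp add: val)
      then obtain C where C: "C > 0 \<and> (\<forall>s::real. 0 < s \<and> s \<le> 1 \<longrightarrow> C \<le> sfe (ones(j := 1 * s)) t)" ..
      \<comment> \<open>Divisibility would make the values along the curve at most a bounded
        multiple of \<open>s\<close>, against the lower bound \<open>C\<close>.\<close>
      have "C = 0"
      proof (rule vanish_at_0[where f = "\<lambda>_. C" and g = "\<lambda>s. meval (ones(j := 1 * s)) D"])
        fix s :: real assume s: "0 < s" "s \<le> 1"
        have "posv (ones(j := 1 * s))" using s by (auto simp: posv_def)
        then have "sfe (ones(j := 1 * s)) t = s * meval (ones(j := 1 * s)) D"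
          using F[symmetric] by (simp add: D)
        then show "\<bar>C\<bar> \<le> s * meval (ones(j := 1 * s)) D" using C s by auto
      qed (intro continuous_intros isCont_meval)+
      then show False using C by simp
    qed
  qed
qed

locale principal_seed =
  fixes I :: "nat set" and x y :: "nat \<Rightarrow> 'k::field_char_0" and B :: "nat \<Rightarrow> nat \<Rightarrow> int"
  assumes fin: "finite I" and ind: "zindep (doubled I) (interleave x y)"
    and skew: "skew_symmetrizable I B"
begin

abbreviation "P \<equiv> trop I"
abbreviation "e \<equiv> coeff_map I y"
abbreviation "S \<equiv> Seed x trop_gen B"
abbreviation mut :: "nat \<Rightarrow> ('k, nat \<Rightarrow> int) seed \<Rightarrow> ('k, nat \<Rightarrow> int) seed" where
  "mut k T \<equiv> mutate I P e k T"

text \<open>\<open>SF z p\<close>: the element \<open>z\<close> has a subtraction-free expression, whose tropical value is \<open>p\<close>. The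
  \<open>j\<close>-th entry of \<open>p\<close> is the valuation of \<open>z\<close> at \<open>y\<^sub>j = 0\<close>.\<close>

definition SF :: "'k \<Rightarrow> (nat \<Rightarrow> int) \<Rightarrow> bool" where
  "SF z p \<longleftrightarrow> (\<exists>f. sfrel I (doubled I) (interleave x y) wgt z f p)"

lemma w: "\<forall>m\<in>doubled I. wgt m \<in> carrier (trop I)"
  using wgt_carrier[OF fin] by blast

lemma SF_x: "i \<in> I \<Longrightarrow> SF (x i) (\<lambda>_. 0)"
  using sfrel_var[where i = "2 * i" and v = "interleave x y", OF fin w] unfolding SF_def by auto

lemma SF_y: "i \<in> I \<Longrightarrow> SF (y i) (trop_gen i)"
  using sfrel_var[where i = "Suc (2 * i)" and v = "interleave x y", OF fin w] unfolding SF_def by auto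

lemma SF_1: "SF 1 (\<lambda>_. 0)"
  using sfrel_1[OF fin w] unfolding SF_def by blast

lemma SF_add: "SF z p \<Longrightarrow> SF z' p' \<Longrightarrow> SF (z + z') (\<lambda>j. min (p j) (p' j))"
  using sfrel_add[OF fin w] unfolding SF_def by blast

lemma SF_mult: "SF z p \<Longrightarrow> SF z' p' \<Longrightarrow> SF (z * z') (\<lambda>j. p j + p' j)"
  using sfrel_mult[OF fin w] unfolding SF_def by blast

lemma SF_divide: "SF z p \<Longrightarrow> SF z' p' \<Longrightarrow> SF (z / z') (\<lambda>j. p j - p' j)"
  using sfrel_divide[OF fin w] unfolding SF_def by blast

lemma SF_powi: "SF z p \<Longrightarrow> SF (z powi k) (\<lambda>j. k * p j)"
  using sfrel_powi[OF fin w] unfolding SF_def by blast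

lemma SF_prod:
  assumes "finite A" "\<And>a. a \<in> A \<Longrightarrow> SF (z a) (p a)"
  shows "SF (\<Prod>a\<in>A. z a) (\<lambda>j. \<Sum>a\<in>A. p a j)"
proof -
  obtain f where "\<And>a. a \<in> A \<Longrightarrow> sfrel I (doubled I) (interleave x y) wgt (z a) (f a) (p a)"
    using assms(2) unfolding SF_def by metis
  then have "sfrel I (doubled I) (interleave x y) wgt (\<Prod>a\<in>A. z a) (\<lambda>V. \<Prod>a\<in>A. f a V) (\<lambda>j. \<Sum>a\<in>A. p a j)"
    by (rule sfrel_prod[OF fin w assms(1)])
  then show ?thesis unfolding SF_def by blast
qed

lemma SF_unique: "SF z p \<Longrightarrow> SF z p' \<Longrightarrow> p = p'"
  using sfrel_unique(1)[OF fin w ind] unfolding SF_def by blast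

lemma SF_nonzero: "SF z p \<Longrightarrow> z \<noteq> 0"
  using sfrel_nonzero[OF fin w ind] unfolding SF_def by blast

lemma SF_sfe:
  assumes "\<And>i. i \<in> sf_vars t \<Longrightarrow> SF (z i) (p i)"
  shows "SF (sfe z t) (sf_value (trop I) p t)"
proof -
  obtain f where "\<And>i. i \<in> sf_vars t \<Longrightarrow> sfrel I (doubled I) (interleave x y) wgt (z i) (f i) (p i)"
    using assms unfolding SF_def by metis
  then have "sfrel I (doubled I) (interleave x y) wgt (sfe z t) (\<lambda>V. sfe (\<lambda>i. f i V) t) (sf_value (trop I) p t)"
    by (rule sfrel_sfe[OF fin w])
  then show ?thesis unfolding SF_def by blast
qed

lemma y_nonzero: "\<forall>i\<in>I. y i \<noteq> 0"
  using SF_nonzero SF_y by blast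

lemma x_nonzero: "i \<in> I \<Longrightarrow> x i \<noteq> 0"
  using SF_nonzero SF_x by blast

lemmas e_simps = coeff_map_add[OF fin y_nonzero] coeff_map_mult[OF fin y_nonzero]
  coeff_map_0[OF fin y_nonzero] coeff_map_uminus[OF fin y_nonzero] coeff_map_sum[OF fin y_nonzero]
  coeff_map_gen[OF fin y_nonzero]

lemma e_nonzero: "e p \<noteq> 0"
  using coeff_map_nonzero[OF fin y_nonzero] by blast

lemma SF_e: "p \<in> carrier P \<Longrightarrow> SF (e p) p"
  using SF_prod[OF fin SF_powi[OF SF_y], of "\<lambda>i. i" p] sum_trop_gen[OF fin, of p]
  by (simp add: coeff_map_def)

definition seed_ok :: "('k, nat \<Rightarrow> int) seed \<Rightarrow> bool" where
  "seed_ok T \<longleftrightarrow> (\<forall>i\<in>I. SF (cluster T i) (\<lambda>_. 0)) \<and> (\<forall>i\<in>I. coeffs T i \<in> carrier P) \<and>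
     skew_symmetrizable I (exch T)"

lemma SF_y_hat:
  assumes "seed_ok T" "j \<in> I" shows "SF (y_hat I e T j) (coeffs T j)"
proof -
  have "SF (\<Prod>i\<in>I. cluster T i powi exch T i j) (\<lambda>l. \<Sum>i\<in>I. exch T i j * 0)"
    by (rule SF_prod[OF fin SF_powi]) (use assms in \<open>auto simp: seed_ok_def\<close>)
  then show ?thesis
    using SF_mult[OF SF_e[of "coeffs T j"]] assms unfolding y_hat_def seed_ok_def by fastforce
qed

lemma seed_ok_nonzero: "seed_ok T \<Longrightarrow> i \<in> I \<Longrightarrow> cluster T i \<noteq> 0"
  using SF_nonzero unfolding seed_ok_def by blast

lemma seed_ok_diag: "seed_ok T \<Longrightarrow> i \<in> I \<Longrightarrow> exch T i i = 0"
  using skew_symmetrizable_diag unfolding seed_ok_def by blast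

lemma cluster_mut:
  assumes "seed_ok T" "k \<in> I"
  shows "cluster (mut k T) j = xstep I k (exch T) (cluster T) (y_hat I e T) j /
      (if j = k then e (\<lambda>l. min (coeffs T k l) 0) else 1)"
  by (rule cluster_mutate[OF fin y_nonzero])
    (use assms seed_ok_nonzero seed_ok_diag in \<open>auto simp: seed_ok_def\<close>)

lemma min_carrier: "p \<in> carrier P \<Longrightarrow> (\<lambda>l. min (p l) 0) \<in> carrier P"
  using fin by (auto simp: carrier_trop)

text \<open>The normalization of the coefficients makes the two terms of an exchange relation have
  no common factor \<open>y\<^sub>j\<close>, so that cluster variables have valuation zero.\<close>

lemma seed_ok_mutate:
  assumes T: "seed_ok T" and k: "k \<in> I"
  shows "seed_ok (mut k T)"
  unfolding seed_ok_def
proof (intro conjI ballI)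
  fix i assume i: "i \<in> I"
  show "coeffs (mut k T) i \<in> carrier P"
    using T k i mutate_coeffs_carrier[OF fin] unfolding seed_ok_def mutate_def by simp
  show "SF (cluster (mut k T) i) (\<lambda>_. 0)"
  proof (cases "i = k")
    case False
    then show ?thesis using T i by (simp add: mutate_def mutate_cluster_def seed_ok_def)
  next
    case True
    have X: "SF (cluster T i) (\<lambda>_. 0)" if "i \<in> I" for i using T that by (simp add: seed_ok_def)
    have "SF (\<Prod>i\<in>I. cluster T i powi pos_part (- exch T i k)) (\<lambda>l. \<Sum>i\<in>I. pos_part (- exch T i k) * 0)"
      by (rule SF_prod[OF fin SF_powi[OF X]])
    then have "SF ((1 + y_hat I e T k) * (\<Prod>i\<in>I. cluster T i powi pos_part (- exch T i k)) / cluster T k)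
        (\<lambda>l. min 0 (coeffs T k l) + (\<Sum>i\<in>I. pos_part (- exch T i k) * 0) - 0)"
      by (intro SF_divide SF_mult SF_add SF_1 SF_y_hat T k X)
    moreover have "SF (e (\<lambda>l. min (coeffs T k l) 0)) (\<lambda>l. min (coeffs T k l) 0)"
      using T k by (intro SF_e min_carrier) (simp add: seed_ok_def)
    ultimately show ?thesis
      using SF_divide True unfolding cluster_mut[OF T k] xstep_def by (fastforce simp: min.commute)
  qed
next
  show "skew_symmetrizable I (exch (mut k T))"
    using T k skew_symmetrizable_mutate by (simp add: mutate_def seed_ok_def)
qed

lemma seed_ok_initial: "seed_ok S"
  using SF_x skew fin trop_gen_carrier by (simp add: seed_ok_def)

lemma seed_ok_seeds: "T \<in> seeds I P e S \<Longrightarrow> seed_ok T"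
  by (induction rule: seeds.induct) (auto intro: seed_ok_initial seed_ok_mutate)

lemma y_hat_mut:
  assumes "seed_ok T" "k \<in> I" "j \<in> I"
  shows "y_hat I e (mut k T) j = ystep k (exch T) (y_hat I e T) j"
  by (rule y_hat_mutate[OF fin y_nonzero])
    (use assms seed_ok_nonzero seed_ok_diag seed_ok_nonzero[OF seed_ok_mutate] in \<open>auto simp: seed_ok_def\<close>)

lemma y_hat_initial: "j \<in> I \<Longrightarrow> y_hat I e S j = hat I B x y j"
  by (simp add: y_hat_def hat_def e_simps)

lemma zindep_y_hat: "zindep I (y_hat I e S)"
proof -
  have "meval (y_hat I e S) p = meval (hat I B x y) p" if "mpoly_vars p \<subseteq> I" for p
    using that by (intro meval_cong_vars y_hat_initial) auto
  then show ?thesis using zindep_hat(2)[OF fin ind, of B] unfolding zindep_def by metis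
qed

section \<open>F-polynomials\<close>

definition xmon :: "'k \<Rightarrow> bool" where
  "xmon z \<longleftrightarrow> (\<exists>g. z = (\<Prod>i\<in>I. x i powi g i))"

lemma xmon_1: "xmon 1"
  unfolding xmon_def by (rule exI[of _ "\<lambda>_. 0"]) simp

lemma xmon_mult:
  assumes "xmon z" "xmon z'" shows "xmon (z * z')"
proof -
  obtain g g' where "z = (\<Prod>i\<in>I. x i powi g i)" "z' = (\<Prod>i\<in>I. x i powi g' i)"
    using assms unfolding xmon_def by blast
  then have "z * z' = (\<Prod>i\<in>I. x i powi (g i + g' i))"
    using x_nonzero by (simp add: prod.distrib power_int_add)
  then show ?thesis unfolding xmon_def by (rule exI[of _ "\<lambda>i. g i + g' i"])
qed

lemma xmon_powi:
  assumes "xmon z" shows "xmon (z powi k)"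
proof -
  obtain g where "z = (\<Prod>i\<in>I. x i powi g i)"
    using assms unfolding xmon_def by blast
  then have "z powi k = (\<Prod>i\<in>I. x i powi (g i * k))"
    by (simp add: prod_powi power_int_mult)
  then show ?thesis unfolding xmon_def by (rule exI[of _ "\<lambda>i. g i * k"])
qed

lemma xmon_prod: "finite A \<Longrightarrow> (\<And>a. a \<in> A \<Longrightarrow> xmon (z a)) \<Longrightarrow> xmon (\<Prod>a\<in>A. z a)"
  by (induction A rule: finite_induct) (auto intro: xmon_1 xmon_mult)

lemma xmon_inverse: "xmon z \<Longrightarrow> xmon (inverse z)"
  using xmon_powi[of z "-1"] by (simp add: power_int_minus)

lemma xmon_x: "i \<in> I \<Longrightarrow> xmon (x i)"
  unfolding xmon_def
  by (rule exI[of _ "\<lambda>j. if j = i then 1 else 0"], subst prod_eq_single[of _ i]) (use fin in auto)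

lemma xmon_nonzero: "xmon z \<Longrightarrow> z \<noteq> 0"
  unfolding xmon_def using fin x_nonzero by auto

lemma SF_xmon: "xmon z \<Longrightarrow> SF z (\<lambda>_. 0)"
  unfolding xmon_def using SF_prod[OF fin SF_powi[OF SF_x], of "\<lambda>i. i"] by auto

definition hrel :: "'k \<Rightarrow> ((nat \<Rightarrow> real) \<Rightarrow> real) \<Rightarrow> bool" where
  "hrel z f \<longleftrightarrow> (\<exists>p. sfrel I I (y_hat I e S) trop_gen z f p)"

lemma gen: "\<forall>i\<in>I. trop_gen i \<in> carrier P"
  using trop_gen_carrier[OF fin] by blast

lemma hrel_var: "i \<in> I \<Longrightarrow> hrel (y_hat I e S i) (\<lambda>Y. Y i)"
  using sfrel_var[OF fin gen] unfolding hrel_def by blast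

lemma hrel_1: "hrel 1 (\<lambda>Y. 1)"
  using sfrel_1[OF fin gen] unfolding hrel_def by blast

lemma hrel_add: "hrel z f \<Longrightarrow> hrel z' f' \<Longrightarrow> hrel (z + z') (\<lambda>Y. f Y + f' Y)"
  using sfrel_add[OF fin gen] unfolding hrel_def by blast

lemma hrel_mult: "hrel z f \<Longrightarrow> hrel z' f' \<Longrightarrow> hrel (z * z') (\<lambda>Y. f Y * f' Y)"
  using sfrel_mult[OF fin gen] unfolding hrel_def by blast

lemma hrel_divide: "hrel z f \<Longrightarrow> hrel z' f' \<Longrightarrow> hrel (z / z') (\<lambda>Y. f Y / f' Y)"
  using sfrel_divide[OF fin gen] unfolding hrel_def by blast

lemma hrel_powi: "hrel z f \<Longrightarrow> hrel (z powi k) (\<lambda>Y. f Y powi k)"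
  using sfrel_powi[OF fin gen] unfolding hrel_def by blast

lemma hrel_prod:
  assumes "finite A" "\<And>a. a \<in> A \<Longrightarrow> hrel (z a) (f a)"
  shows "hrel (\<Prod>a\<in>A. z a) (\<lambda>Y. \<Prod>a\<in>A. f a Y)"
proof -
  obtain p where "\<And>a. a \<in> A \<Longrightarrow> sfrel I I (y_hat I e S) trop_gen (z a) (f a) (p a)"
    using assms(2) unfolding hrel_def by metis
  then have "sfrel I I (y_hat I e S) trop_gen (\<Prod>a\<in>A. z a) (\<lambda>V. \<Prod>a\<in>A. f a V) (\<lambda>j. \<Sum>a\<in>A. p a j)"
    by (rule sfrel_prod[OF fin gen assms(1)])
  then show ?thesis unfolding hrel_def by blast
qed

lemma hrel_cong: "hrel z f \<Longrightarrow> (\<And>Y. posv Y \<Longrightarrow> f Y = g Y) \<Longrightarrow> hrel z g"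
  unfolding hrel_def sfrel_def by fastforce

text \<open>Each \<open>y j\<close> is the initial \<open>y_hat\<close> at \<open>j\<close> divided
  by a monomial in \<open>x\<close>. This rewrites the normalizing coefficients, which are monomials
  in \<open>y\<close>, in terms of \<open>y_hat\<close>.\<close>

lemma e_hrel: "\<exists>a. xmon a \<and> hrel (e p / a) (\<lambda>Y. \<Prod>j\<in>I. Y j powi p j)"
proof -
  let ?a = "\<Prod>j\<in>I. inverse (\<Prod>i\<in>I. x i powi B i j) powi p j"
  have a: "xmon ?a"
    by (intro xmon_prod[OF fin] xmon_powi xmon_inverse xmon_x)
  have "y j powi p j = y_hat I e S j powi p j * inverse (\<Prod>i\<in>I. x i powi B i j) powi p j" if j: "j \<in> I" for j
  proof -
    have "(\<Prod>i\<in>I. x i powi B i j) \<noteq> 0" using fin x_nonzero by auto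
    then have "y j = y_hat I e S j * inverse (\<Prod>i\<in>I. x i powi B i j)"
      by (simp add: y_hat_initial[OF j] hat_def)
    then show ?thesis by (simp only: power_int_mult_distrib)
  qed
  then have "e p = (\<Prod>j\<in>I. y_hat I e S j powi p j) * ?a"
    by (simp add: coeff_map_def[of I y p] prod.distrib)
  moreover have "?a \<noteq> 0" using a by (rule xmon_nonzero)
  ultimately have "e p / ?a = (\<Prod>j\<in>I. y_hat I e S j powi p j)" by simp
  then have "hrel (e p / ?a) (\<lambda>Y. \<Prod>j\<in>I. Y j powi p j)"
    by (simp only:) (intro hrel_prod[OF fin] hrel_powi hrel_var)
  with a show ?thesis by blast
qed

text \<open>The link from seeds to the recursion without normalization. The monomials
  \<open>a\<close> in \<open>x\<close> and \<open>m\<close> in \<open>y_hat\<close> absorb the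
  normalizing coefficients that \<open>xrun\<close> leaves out.\<close>

definition tracks :: "nat list \<Rightarrow> ('k, nat \<Rightarrow> int) seed \<Rightarrow> bool" where
  "tracks w T \<longleftrightarrow> exch T = brun B w \<and> (\<forall>j\<in>I. hrel (y_hat I e T j) (\<lambda>Y. yrun B Y w j)) \<and>
     (\<forall>i\<in>I. \<exists>a m. xmon a \<and> monomial_fun I m \<and> hrel (cluster T i / a) (\<lambda>Y. m Y * xrun I B ones Y w i))"

lemma tracks_mutate:
  assumes T: "seed_ok T" "tracks w T" and k: "k \<in> I"
  shows "tracks (w @ [k]) (mut k T)"
  unfolding tracks_def
proof (intro conjI ballI)
  have ex: "exch T = brun B w" and yh: "\<And>j. j \<in> I \<Longrightarrow> hrel (y_hat I e T j) (\<lambda>Y. yrun B Y w j)"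
    using T(2) unfolding tracks_def by auto
  have "\<forall>i\<in>I. \<exists>a m. xmon a \<and> monomial_fun I m \<and> hrel (cluster T i / a) (\<lambda>Y. m Y * xrun I B ones Y w i)"
    using T(2) unfolding tracks_def by blast
  then have "\<exists>a. \<forall>i\<in>I. \<exists>m. xmon (a i) \<and> monomial_fun I m \<and> hrel (cluster T i / a i) (\<lambda>Y. m Y * xrun I B ones Y w i)"
    by (rule bchoice)
  then obtain a where "\<forall>i\<in>I. \<exists>m. xmon (a i) \<and> monomial_fun I m \<and> hrel (cluster T i / a i) (\<lambda>Y. m Y * xrun I B ones Y w i)" ..
  then have "\<exists>m. \<forall>i\<in>I. xmon (a i) \<and> monomial_fun I (m i) \<and> hrel (cluster T i / a i) (\<lambda>Y. m i Y * xrun I B ones Y w i)"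
    by (rule bchoice)
  then obtain m where "\<forall>i\<in>I. xmon (a i) \<and> monomial_fun I (m i) \<and> hrel (cluster T i / a i) (\<lambda>Y. m i Y * xrun I B ones Y w i)" ..
  then have a: "\<And>i. i \<in> I \<Longrightarrow> xmon (a i)" "\<And>i. i \<in> I \<Longrightarrow> monomial_fun I (m i)"
    "\<And>i. i \<in> I \<Longrightarrow> hrel (cluster T i / a i) (\<lambda>Y. m i Y * xrun I B ones Y w i)" by auto
  show "exch (mut k T) = brun B (w @ [k])" by (simp add: mutate_def run_snoc ex)
  fix j assume j: "j \<in> I"
  have "hrel (ystep k (exch T) (y_hat I e T) j) (\<lambda>Y. ystep k (brun B w) (yrun B Y w) j)"
  proof (cases "j = k")
    case True
    then show ?thesis using hrel_divide[OF hrel_1 yh[OF k]] by (simp add: ystep_def inverse_eq_divide)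
  next
    case False
    then show ?thesis
      by (auto simp: ystep_def ex intro!: hrel_mult hrel_powi hrel_add hrel_1 yh j k)
  qed
  then show "hrel (y_hat I e (mut k T) j) (\<lambda>Y. yrun B Y (w @ [k]) j)"
    by (simp add: y_hat_mut T k j run_snoc)
  show "\<exists>a m. xmon a \<and> monomial_fun I m \<and> hrel (cluster (mut k T) j / a) (\<lambda>Y. m Y * xrun I B ones Y (w @ [k]) j)"
  proof (cases "j = k")
    case False
    then show ?thesis using a[OF j] unfolding cluster_mut[OF T(1) k] run_snoc xstep_def by auto
  next
    case True
    define q where "q = (\<lambda>l. min (coeffs T k l) 0)"
    obtain b where b: "xmon b" "hrel (e q / b) (\<lambda>Y. \<Prod>j\<in>I. Y j powi q j)" using e_hrel by blast
    let ?n = "\<lambda>i. pos_part (- exch T i k)"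
    let ?A = "(\<Prod>i\<in>I. a i powi ?n i) * inverse (a k) * inverse b"
    let ?M = "\<lambda>Y. (\<Prod>i\<in>I. m i Y powi ?n i) / m k Y / (\<Prod>j\<in>I. Y j powi q j)"
    have "(\<Prod>i\<in>I. (cluster T i / a i) powi ?n i) = (\<Prod>i\<in>I. cluster T i powi ?n i) / (\<Prod>i\<in>I. a i powi ?n i)"
      by (simp add: power_int_divide_distrib prod_dividef)
    moreover have "cluster (mut k T) k = (1 + y_hat I e T k) * (\<Prod>i\<in>I. cluster T i powi ?n i) / cluster T k / e q"
      by (simp add: cluster_mut[OF T(1) k] xstep_def q_def)
    ultimately have eq: "cluster (mut k T) k / ?A
        = (1 + y_hat I e T k) * (\<Prod>i\<in>I. (cluster T i / a i) powi ?n i) / (cluster T k / a k) / (e q / b)"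
      by (simp only:) (simp add: divide_inverse mult_ac)
    have h: "hrel (cluster (mut k T) k / ?A) (\<lambda>Y. (1 + yrun B Y w k) *
        (\<Prod>i\<in>I. (m i Y * xrun I B ones Y w i) powi ?n i) / (m k Y * xrun I B ones Y w k) / (\<Prod>j\<in>I. Y j powi q j))"
      unfolding eq by (intro hrel_divide hrel_mult hrel_add hrel_1 hrel_prod[OF fin] hrel_powi yh a b k)
    have "xmon ?A" by (intro xmon_mult xmon_prod[OF fin] xmon_powi xmon_inverse a b k)
    moreover have "monomial_fun I ?M"
      by (intro monomial_fun_divide monomial_fun_prod[OF fin] monomial_fun_powi a k monomial_fun_var[OF fin])
    moreover have "hrel (cluster (mut k T) k / ?A) (\<lambda>Y. ?M Y * xrun I B ones Y (w @ [k]) k)"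
      by (rule hrel_cong[OF h])
        (simp add: run_snoc xstep_def ex power_int_mult_distrib prod.distrib mult_ac)
    ultimately show ?thesis using True by blast
  qed
qed

lemma seeds_tracks: "T \<in> seeds I P e S \<Longrightarrow> \<exists>w. set w \<subseteq> I \<and> tracks w T"
proof (induction rule: seeds.induct)
  case initial
  have "tracks [] S"
    unfolding tracks_def
  proof (intro conjI ballI)
    fix i assume i: "i \<in> I"
    show "\<exists>a m. xmon a \<and> monomial_fun I m \<and> hrel (cluster S i / a) (\<lambda>Y. m Y * xrun I B ones Y [] i)"
      by (rule exI[of _ "x i"], rule exI[of _ "\<lambda>_. 1"])
        (use i x_nonzero[OF i] in \<open>auto intro: xmon_x monomial_fun_1 hrel_1\<close>)
  qed (auto intro: hrel_var)
  then show ?case by (intro exI[of _ "[]"]) simp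
next
  case (mutated T k)
  then obtain w where "set w \<subseteq> I" "tracks w T" by blast
  then show ?case using tracks_mutate[OF seed_ok_seeds[OF mutated(1)] _ mutated(2)] mutated(2)
    by (intro exI[of _ "w @ [k]"]) auto
qed

lemma laurent_monomial_fun:
  assumes "monomial_fun I m" shows "m \<in> laurent I"
proof -
  obtain g where "\<And>Y. posv Y \<Longrightarrow> m Y = (\<Prod>l\<in>I. Y l powi g l)"
    using assms unfolding monomial_fun_def by blast
  moreover have "(\<lambda>Y. \<Prod>l\<in>I. Y l powi g l) \<in> laurent I"
    by (intro loc_unit_loc loc_unit_prod[OF laurent_dens_mult fin] loc_unit_powi[OF laurent_dens_mult]
        laurent_unit_var fin)
  ultimately show ?thesis by (metis (no_types, lifting) loc_cong)
qed

lemma meval_eq_sfe: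
  assumes "zindep I v" "sf_vars t \<subseteq> I" "sf_fract t = Fract F 1"
  shows "meval v F = sfe v t"
proof -
  have "sf_num t = F * sf_den t" using assms(3) by (simp add: sf_fract_numden eq_fract sf_numden_nonzero)
  then show ?thesis using sfe_zindep[OF assms(1,2)] sf_numden_zindep[OF assms(1,2)] by simp
qed

text \<open>Up to a monomial \<open>a\<close> in \<open>x\<close>, the cluster variable is a Laurent
  expression in \<open>y_hat\<close> by \<open>laurent_xrun\<close>. As \<open>z\<close> and
  \<open>a\<close> have valuation zero and the initial \<open>y_hat\<close> at \<open>j\<close> has
  valuation \<open>trop_gen j\<close>, the expression has tropical value zero, and
  \<open>sfe_polynomial\<close> applies.\<close>

lemma gF_expansion_exists:
  assumes "z \<in> cluster_variables I P e S"
  shows "\<exists>g F t. gF_expansion I e S z g F \<and> sf_vars t \<subseteq> I \<and> sf_fract t = Fract F 1"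
proof -
  obtain T i where z: "z = cluster T i" and T: "T \<in> seeds I P e S" and i: "i \<in> I"
    using assms unfolding cluster_variables_def by blast
  obtain w where w: "set w \<subseteq> I" "tracks w T" using seeds_tracks[OF T] by blast
  obtain a m where a: "xmon a" "monomial_fun I m" "hrel (z / a) (\<lambda>Y. m Y * xrun I B ones Y w i)"
    using w(2) i unfolding tracks_def z by blast
  obtain t where t: "sf_vars t \<subseteq> I" "z / a = sfe (y_hat I e S) t"
    "\<And>Y. posv Y \<Longrightarrow> m Y * xrun I B ones Y w i = sfe Y t"
    using a(3) unfolding hrel_def sfrel_def by blast
  have za: "z = a * sfe (y_hat I e S) t" using t(2) xmon_nonzero[OF a(1)] by (simp add: field_simps)
  have "(\<lambda>Y. m Y * xrun I B ones Y w i) \<in> laurent I"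
    by (intro loc_mult[OF laurent_dens_mult] laurent_monomial_fun a laurent_xrun fin w skew i)
  then have L: "(\<lambda>Y. sfe Y t) \<in> laurent I" by (rule loc_cong) (rule t(3))
  have "SF (sfe (y_hat I e S) t) (sf_value P trop_gen t)"
    using SF_y_hat[OF seed_ok_initial] t(1) by (intro SF_sfe) auto
  then have "SF z (\<lambda>j. 0 + sf_value P trop_gen t j)"
    unfolding za using SF_xmon[OF a(1)] by (intro SF_mult)
  moreover have "SF z (\<lambda>_. 0)" using seed_ok_seeds[OF T] i by (simp add: seed_ok_def z)
  ultimately have "sf_value P trop_gen t = (\<lambda>_. 0)" using SF_unique by fastforce
  from sfe_polynomial[OF fin t(1) this L] obtain F where
    F: "mpoly_vars F \<subseteq> I" "\<And>i. i \<in> I \<Longrightarrow> \<not> mpoly_var i dvd F" "sf_fract t = Fract F 1" by blast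
  obtain g where g: "a = (\<Prod>i\<in>I. x i powi g i)" using a(1) unfolding xmon_def by blast
  have "gF_expansion I e S z (\<lambda>i. if i \<in> I then g i else 0) F"
    unfolding gF_expansion_def mpoly_eval_of_int
    using F za g meval_eq_sfe[OF zindep_y_hat t(1) F(3)] by simp
  then show ?thesis using t(1) F(3) by blast
qed

lemma gF_expansion_unique:
  assumes "I \<noteq> {}" "gF_expansion I e S z g F" "gF_expansion I e S z g' F'"
  shows "g = g' \<and> F = F'"
proof -
  let ?Y = "y_hat I e S"
  let ?v = "interleave x (hat I B x y)"
  \<comment> \<open>Adding \<open>N\<close> makes all exponents nonnegative, so that both expansions
    become polynomials in the independent family of \<open>x\<close> and \<open>hat\<close>.\<close>
  define N where "N = (\<Sum>i\<in>I. \<bar>g i\<bar> + \<bar>g' i\<bar>)"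
  have N: "0 \<le> g i + N \<and> 0 \<le> g' i + N" if "i \<in> I" for i
  proof -
    have "\<bar>g i\<bar> + \<bar>g' i\<bar> \<le> N" unfolding N_def by (rule member_le_sum) (use fin that in auto)
    then show ?thesis by linarith
  qed
  define Q where "Q g F = (\<Prod>i\<in>I. mpoly_var (2 * i) ^ nat (g i + N)) * meval (\<lambda>j. if j \<in> I then mpoly_var (Suc (2 * j)) else 1) F" for g F
  have ev: "meval v (Q g F) = (\<Prod>i\<in>I. v (2 * i) ^ nat (g i + N)) * meval (\<lambda>j. v (Suc (2 * j))) F"
    if "mpoly_vars F \<subseteq> I" for g F and v :: "nat \<Rightarrow> 'r::comm_ring_1"
  proof -
    have "meval (\<lambda>j. meval v (if j \<in> I then mpoly_var (Suc (2 * j)) else 1)) F = meval (\<lambda>j. v (Suc (2 * j))) F"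
      using that by (intro meval_cong_vars) auto
    then show ?thesis by (simp add: Q_def meval_prod meval_compose)
  qed
  have varsQ: "mpoly_vars (Q g F) \<subseteq> doubled I" for g F
  proof -
    have pow: "mpoly_vars (mpoly_var i ^ k) \<subseteq> {i}" for i k
      by (induction k) (auto dest!: subsetD[OF mpoly_vars_mult])
    have "mpoly_vars (\<Prod>i\<in>A. mpoly_var (2 * i) ^ k i) \<subseteq> doubled I" if "finite A" "A \<subseteq> I" for A k
      using that
    proof (induction A rule: finite_induct)
      case (insert i A)
      moreover have "mpoly_vars (mpoly_var (2 * i) ^ k i) \<subseteq> doubled I"
        using pow[of "2 * i" "k i"] insert.prems by (auto dest!: subsetD)
      ultimately show ?case using insert.hyps insert.prems by (simp add: vars_multI)
    qed simp
    then show ?thesis unfolding Q_def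
      using fin by (intro vars_multI mpoly_vars_meval) auto
  qed
  have vars: "mpoly_vars F \<subseteq> I" "mpoly_vars F' \<subseteq> I" using assms unfolding gF_expansion_def by auto
  have zeq: "z * (\<Prod>i\<in>I. x i powi N) = (\<Prod>i\<in>I. x i ^ nat (g i + N)) * meval (hat I B x y) F"
    if "gF_expansion I e S z g F" "\<And>i. i \<in> I \<Longrightarrow> 0 \<le> g i + N" for g F
  proof -
    have "(\<Prod>i\<in>I. x i powi g i) * (\<Prod>i\<in>I. x i powi N) = (\<Prod>i\<in>I. x i ^ nat (g i + N))"
      unfolding prod.distrib[symmetric]
    proof (rule prod.cong[OF refl])
      fix i assume i: "i \<in> I"
      have "x i powi g i * x i powi N = x i powi (g i + N)" using x_nonzero[OF i] by (simp add: power_int_add)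
      then show "x i powi g i * x i powi N = x i ^ nat (g i + N)" using that(2)[OF i] by (simp add: power_int_def)
    qed
    moreover have "meval ?Y F = meval (hat I B x y) F"
      using that(1) unfolding gF_expansion_def by (intro meval_cong_vars y_hat_initial) auto
    ultimately show ?thesis
      using that(1) unfolding gF_expansion_def mpoly_eval_of_int by (simp add: mult_ac)
  qed
  have "meval ?v (Q g F - Q g' F') = 0"
    using zeq[OF assms(2)] zeq[OF assms(3)] N by (simp add: ev vars)
  then have "Q g F - Q g' F' = 0"
    using zindepD[OF zindep_hat(1)[OF fin ind, of B]] vars_diffI[OF varsQ varsQ] by blast
  then have "meval (interleave X Y) (Q g F) = meval (interleave X Y) (Q g' F')" for X Y :: "nat \<Rightarrow> real" by simp
  then have real: "(\<Prod>i\<in>I. X i ^ nat (g i + N)) * meval Y F = (\<Prod>i\<in>I. X i ^ nat (g' i + N)) * meval Y F'"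
    for X Y :: "nat \<Rightarrow> real" by (simp add: ev vars)
  have FF: "F = F'"
    by (rule meval_pos_eq) (use real[of "\<lambda>_. 1"] in simp)
  \<comment> \<open>Zero is divisible by every variable, so \<open>F\<close> is nonzero once there
    is a variable. This is where \<open>I \<noteq> {}\<close> enters.\<close>
  have "F \<noteq> 0" using assms(1,2) unfolding gF_expansion_def by auto
  then obtain Y :: "nat \<Rightarrow> real" where Y: "meval Y F \<noteq> 0" using meval_pos_zero by blast
  have "g i = g' i" for i
  proof (cases "i \<in> I")
    case True
    let ?X = "\<lambda>j. if j = i then 2 else 1 :: real"
    have "(\<Prod>j\<in>I. ?X j ^ nat (f j + N)) = 2 ^ nat (f i + N)" for f :: "nat \<Rightarrow> int"
      by (subst prod_eq_single[of _ i]) (use fin True in auto)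
    then have "nat (g i + N) = nat (g' i + N)" using real[of ?X Y] Y by (simp add: FF)
    then show ?thesis using N[OF True] by linarith
  next
    case False
    then show ?thesis using assms unfolding gF_expansion_def by auto
  qed
  then show ?thesis using FF by auto
qed

lemma gF_expansionD:
  assumes "I \<noteq> {}" "z \<in> cluster_variables I P e S"
  shows "\<exists>t. gF_expansion I e S z (g_vector I e S z) (F_polynomial I e S z) \<and> sf_vars t \<subseteq> I \<and>
    sf_fract t = Fract (F_polynomial I e S z) 1"
proof -
  obtain g F t where g: "gF_expansion I e S z g F" "sf_vars t \<subseteq> I" "sf_fract t = Fract F 1"
    using gF_expansion_exists[OF assms(2)] by blast
  have "g_vector I e S z = g" unfolding g_vector_def
    by (rule the_equality) (use g gF_expansion_unique[OF assms(1)] in blast)+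
  moreover have "F_polynomial I e S z = F" unfolding F_polynomial_def
    by (rule the_equality) (use g gF_expansion_unique[OF assms(1)] in blast)+
  ultimately show ?thesis using g by blast
qed

end

section \<open>The isomorphism of cluster algebras\<close>

lemma subring_hull: "subring (subring hull X)"
  by (rule hull_in) (fastforce simp: subring_def)

lemma subring_hull_least: "X \<subseteq> R \<Longrightarrow> subring R \<Longrightarrow> subring hull X \<subseteq> R"
  by (rule hull_minimal)

lemma subring_ops:
  assumes "subring R" "a \<in> R" "b \<in> R"
  shows "a + b \<in> R" "a - b \<in> R" "a * b \<in> R"
  using assms unfolding subring_def by blast+

lemma seeds_trans: "T \<in> seeds I P e T' \<Longrightarrow> T' \<in> seeds I P e S \<Longrightarrow> T \<in> seeds I P e S"
  by (induction rule: seeds.induct) (auto intro: seeds.intros)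

text \<open>Conditions under which \<open>T\<close> can take the part of an initial seed:
  \<open>indT\<close> makes the substitution of \<open>T\<close> for the first initial seed
  injective, \<open>span\<close> makes it onto on coefficients, and \<open>initial_T\<close> ensures
  that no seed is lost when mutations start from \<open>T\<close>.\<close>

locale seed_transfer =
  A0: principal_seed I x0 y0 B0 + A1: principal_seed I x1 y1 B1
  for I and x0 y0 :: "nat \<Rightarrow> 'l::field_char_0" and B0 and x1 y1 :: "nat \<Rightarrow> 'k::field_char_0" and B1 +
  fixes T :: "('k, nat \<Rightarrow> int) seed"
  assumes nonempty: "I \<noteq> {}"
    and T: "T \<in> seeds I (trop I) A1.e A1.S" and initial_T: "A1.S \<in> seeds I (trop I) A1.e T"
    and exch: "exch T = B0"
    and indT: "zindep (doubled I) (interleave (cluster T) (\<lambda>i. A1.e (coeffs T i)))"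
    and span: "\<And>p. p \<in> carrier (trop I) \<Longrightarrow> \<exists>n\<in>carrier (trop I). p = (\<lambda>l. \<Sum>i\<in>I. n i * coeffs T i l)"
begin

abbreviation "v0 \<equiv> interleave x0 y0"
abbreviation "v1 \<equiv> interleave (cluster T) (\<lambda>i. A1.e (coeffs T i))"
abbreviation "G \<equiv> qrel (doubled I) v0 v1"
text \<open>The homomorphism of coefficient groups that sends the \<open>i\<close>-th generator to
  \<open>coeffs T i\<close>. It need not respect the tropical addition, whence the correcting
  coefficients below.\<close>

abbreviation "push n \<equiv> (\<lambda>l. \<Sum>i\<in>I. n i * coeffs T i l)"
abbreviation "Z \<equiv> corresponding_variable I A0.e A0.S (trop I) A1.e T"

lemmas ind = A0.ind indT

lemma seeds_T: "seeds I (trop I) A1.e T = seeds I (trop I) A1.e A1.S"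
proof (intro equalityI subsetI)
  show "T' \<in> seeds I (trop I) A1.e A1.S" if "T' \<in> seeds I (trop I) A1.e T" for T'
    using that T by (rule seeds_trans)
  show "T' \<in> seeds I (trop I) A1.e T" if "T' \<in> seeds I (trop I) A1.e A1.S" for T'
    using that initial_T by (rule seeds_trans)
qed

lemma okT: "A1.seed_ok T"
  by (rule A1.seed_ok_seeds[OF T])

lemma G_x: "i \<in> I \<Longrightarrow> G (x0 i) (cluster T i)"
  using qrel_var[of "2 * i" "doubled I" v0 v1] by simp

lemma G_y: "i \<in> I \<Longrightarrow> G (y0 i) (A1.e (coeffs T i))"
  using qrel_var[of "Suc (2 * i)" "doubled I" v0 v1] by simp

lemma G_e: "G (A0.e n) (A1.e (push n))"
proof -
  have "G (\<Prod>i\<in>I. y0 i powi n i) (\<Prod>i\<in>I. A1.e (coeffs T i) powi n i)"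
    by (intro qrel_prod[OF ind] qrel_powi[OF ind] G_y)
  moreover have "(\<Prod>i\<in>I. A1.e (coeffs T i) powi n i) = A1.e (push n)"
    using A1.e_simps(5)[OF A1.fin, of "\<lambda>i l. n i * coeffs T i l"] A1.e_simps(2) by simp
  ultimately show ?thesis by (simp add: coeff_map_def[of I y0])
qed

lemma push_carrier: "push n \<in> carrier (trop I)"
  using okT A1.fin unfolding A1.seed_ok_def by (auto simp: carrier_trop intro!: sum.neutral)

lemma G_unique: "G z a \<Longrightarrow> G z b \<Longrightarrow> a = b"
  by (rule qrel_unique[OF ind])

lemma G_inj: "G a z \<Longrightarrow> G b z \<Longrightarrow> a = b"
  by (rule qrel_unique[OF ind(2,1) qrel_sym qrel_sym])

definition phi :: "'l \<Rightarrow> 'k" where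
  "phi z = (THE a. G z a)"

lemma phi_eq: "G z a \<Longrightarrow> phi z = a"
  unfolding phi_def by (rule the_equality) (auto intro: G_unique)

text \<open>Seeds obtained from the two initial seeds by the same mutations. The elements \<open>y_hat\<close> determine
  the mutations of the clusters up to coefficients, and they mutate independently of the latter.\<close>

definition related :: "('l, nat \<Rightarrow> int) seed \<Rightarrow> ('k, nat \<Rightarrow> int) seed \<Rightarrow> bool" where
  "related T0 T1 \<longleftrightarrow> T0 \<in> seeds I (trop I) A0.e A0.S \<and> T1 \<in> seeds I (trop I) A1.e A1.S \<and>
     exch T0 = exch T1 \<and> (\<forall>j\<in>I. G (y_hat I A0.e T0 j) (y_hat I A1.e T1 j)) \<and>
     (\<forall>i\<in>I. \<exists>q\<in>carrier (trop I). G (cluster T0 i) (A1.e q * cluster T1 i))"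

lemma G_y_hat_T:
  assumes "j \<in> I" shows "G (y_hat I A0.e A0.S j) (y_hat I A1.e T j)"
proof -
  have "G (y0 j * (\<Prod>i\<in>I. x0 i powi B0 i j)) (A1.e (coeffs T j) * (\<Prod>i\<in>I. cluster T i powi B0 i j))"
    by (intro qrel_mult[OF ind] qrel_prod[OF ind] qrel_powi[OF ind] G_x G_y assms)
  then show ?thesis using A0.y_hat_initial[OF assms] by (simp add: y_hat_def[of _ _ T] hat_def exch)
qed

lemma related_initial: "related A0.S T"
  unfolding related_def
proof (intro conjI ballI)
  fix i assume i: "i \<in> I"
  show "\<exists>q\<in>carrier (trop I). G (cluster A0.S i) (A1.e q * cluster T i)"
    by (rule bexI[of _ "\<lambda>_. 0"]) (use G_x[OF i] A1.fin in \<open>simp_all add: A1.e_simps carrier_trop\<close>)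
qed (use seeds.initial T exch G_y_hat_T in auto)

lemma related_mutate:
  assumes R: "related T0 T1" and k: "k \<in> I"
  shows "related (A0.mut k T0) (A1.mut k T1)"
  unfolding related_def
proof (intro conjI ballI)
  have s: "T0 \<in> seeds I (trop I) A0.e A0.S" "T1 \<in> seeds I (trop I) A1.e A1.S" and ex: "exch T0 = exch T1"
    and yh: "\<And>j. j \<in> I \<Longrightarrow> G (y_hat I A0.e T0 j) (y_hat I A1.e T1 j)"
    using R unfolding related_def by auto
  obtain q where q: "\<And>i. i \<in> I \<Longrightarrow> q i \<in> carrier (trop I)"
    "\<And>i. i \<in> I \<Longrightarrow> G (cluster T0 i) (A1.e (q i) * cluster T1 i)"
    using R unfolding related_def by metis
  note ok = A0.seed_ok_seeds[OF s(1)] A1.seed_ok_seeds[OF s(2)]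
  show "A0.mut k T0 \<in> seeds I (trop I) A0.e A0.S" "A1.mut k T1 \<in> seeds I (trop I) A1.e A1.S"
    using s k by (auto intro: seeds.mutated)
  show "exch (A0.mut k T0) = exch (A1.mut k T1)" by (simp add: mutate_def ex)
  fix j assume j: "j \<in> I"
  have "G (ystep k (exch T0) (y_hat I A0.e T0) j) (ystep k (exch T0) (y_hat I A1.e T1) j)"
    unfolding ystep_def
    by (auto intro!: qrel_inverse[OF ind] qrel_mult[OF ind] qrel_powi[OF ind] qrel_add[OF ind] qrel_1 yh j k)
  then show "G (y_hat I A0.e (A0.mut k T0) j) (y_hat I A1.e (A1.mut k T1) j)"
    by (simp add: A0.y_hat_mut[OF ok(1) k j] A1.y_hat_mut[OF ok(2) k j] ex)
  show "\<exists>q\<in>carrier (trop I). G (cluster (A0.mut k T0) j) (A1.e q * cluster (A1.mut k T1) j)"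
  proof (cases "j = k")
    case False
    then show ?thesis using q[OF j] by (auto simp: mutate_def mutate_cluster_def)
  next
    case True
    let ?n = "\<lambda>i. pos_part (- exch T0 i k)"
    define m0 where "m0 = (\<lambda>l. min (coeffs T0 k l) 0)"
    define m1 where "m1 = (\<lambda>l. min (coeffs T1 k l) 0)"
    \<comment> \<open>Collects the coefficients of both sides of the exchange relation: those
      attached to the old clusters, and the normalizations \<open>m0\<close> and \<open>m1\<close>,
      of which the former has been carried over by \<open>push\<close>.\<close>
    let ?q = "\<lambda>l. (\<Sum>i\<in>I. ?n i * q i l) + (-1) * q k l + (-1) * push m0 l + m1 l"
    have carr: "?q \<in> carrier (trop I)"
      using q(1) q(1)[OF k] push_carrier[of m0] A1.min_carrier[of "coeffs T1 k"] ok(2) k A1.fin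
      unfolding m1_def A1.seed_ok_def by (auto simp: carrier_trop)
    have "G ((1 + y_hat I A0.e T0 k) * (\<Prod>i\<in>I. cluster T0 i powi ?n i) / cluster T0 k / A0.e m0)
        ((1 + y_hat I A1.e T1 k) * (\<Prod>i\<in>I. (A1.e (q i) * cluster T1 i) powi ?n i) /
          (A1.e (q k) * cluster T1 k) / A1.e (push m0))"
      by (intro qrel_divide[OF ind] qrel_mult[OF ind] qrel_prod[OF ind] qrel_powi[OF ind] qrel_add[OF ind]
          qrel_1 yh k q(2) G_e)
    also have "(1 + y_hat I A0.e T0 k) * (\<Prod>i\<in>I. cluster T0 i powi ?n i) / cluster T0 k / A0.e m0
        = cluster (A0.mut k T0) k"
      by (simp add: A0.cluster_mut[OF ok(1) k] xstep_def m0_def)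
    also have "(1 + y_hat I A1.e T1 k) * (\<Prod>i\<in>I. (A1.e (q i) * cluster T1 i) powi ?n i) /
          (A1.e (q k) * cluster T1 k) / A1.e (push m0) = A1.e ?q * cluster (A1.mut k T1) k"
    proof -
      have "A1.e ?q = (\<Prod>i\<in>I. A1.e (q i) powi ?n i) * inverse (A1.e (q k)) * inverse (A1.e (push m0)) * A1.e m1"
        by (simp only: A1.e_simps(1,2) A1.e_simps(5)[OF A1.fin] power_int_minus1_right)
      moreover have "cluster (A1.mut k T1) k
          = (1 + y_hat I A1.e T1 k) * (\<Prod>i\<in>I. cluster T1 i powi ?n i) / cluster T1 k / A1.e m1"
        by (simp add: A1.cluster_mut[OF ok(2) k] xstep_def m1_def ex)
      ultimately show ?thesis
        using A1.e_nonzero by (simp add: power_int_mult_distrib prod.distrib divide_inverse mult_ac)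
    qed
    finally show ?thesis using carr True by blast
  qed
qed

lemma related_left: "T0 \<in> seeds I (trop I) A0.e A0.S \<Longrightarrow> \<exists>T1. related T0 T1"
  by (induction rule: seeds.induct) (auto intro: related_initial related_mutate)

lemma related_right:
  assumes "T1 \<in> seeds I (trop I) A1.e A1.S" shows "\<exists>T0. related T0 T1"
proof -
  have "T1 \<in> seeds I (trop I) A1.e T" using assms seeds_T by simp
  then show ?thesis
    by (induction rule: seeds.induct) (auto intro: related_initial related_mutate)
qed

lemma G_sfe: "(\<And>i. i \<in> sf_vars t \<Longrightarrow> G (a i) (b i)) \<Longrightarrow> G (sfe a t) (sfe b t)"
  by (induction t) (auto intro: qrel_1 qrel_add[OF ind] qrel_mult[OF ind] qrel_divide[OF ind])

lemma zindep_y_hat_T: "zindep I (y_hat I A1.e T)"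
proof -
  have "y_hat I A1.e T = hat I B0 (cluster T) (\<lambda>i. A1.e (coeffs T i))"
    by (simp add: fun_eq_iff y_hat_def hat_def exch)
  then show ?thesis using zindep_hat(2)[OF A1.fin indT] by simp
qed

text \<open>Comparing valuations identifies the coefficient relating \<open>\<phi>(z)\<close> to a cluster variable.\<close>

lemma related_cluster:
  assumes R: "related T0 T1" and i: "i \<in> I"
  shows "phi (cluster T0 i)
      = A1.e (semifield_eval I (trop I) (coeffs T) (F_polynomial I A0.e A0.S (cluster T0 i))) * Z (cluster T0 i)"
    "semifield_eval I (trop I) (coeffs T) (F_polynomial I A0.e A0.S (cluster T0 i)) \<in> carrier (trop I)"
    "Z (cluster T0 i) = cluster T1 i" "G (cluster T0 i) (phi (cluster T0 i))"
proof -
  let ?z = "cluster T0 i"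
  let ?g = "g_vector I A0.e A0.S ?z" and ?F = "F_polynomial I A0.e A0.S ?z"
  let ?E = "semifield_eval I (trop I) (coeffs T) ?F"
  have s: "T0 \<in> seeds I (trop I) A0.e A0.S" "T1 \<in> seeds I (trop I) A1.e A1.S"
    using R unfolding related_def by auto
  obtain q where q: "q \<in> carrier (trop I)" "G ?z (A1.e q * cluster T1 i)"
    using R i unfolding related_def by blast
  have "?z \<in> cluster_variables I (trop I) A0.e A0.S"
    using s i unfolding cluster_variables_def by blast
  from A0.gF_expansionD[OF nonempty this] obtain t where
    gF: "gF_expansion I A0.e A0.S ?z ?g ?F" and t: "sf_vars t \<subseteq> I" "sf_fract t = Fract ?F 1" by blast
  let ?w = "(\<Prod>i\<in>I. cluster T i powi ?g i) * meval (y_hat I A1.e T) ?F"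
  have m0: "meval (y_hat I A0.e A0.S) ?F = sfe (y_hat I A0.e A0.S) t"
    by (rule A0.meval_eq_sfe[OF A0.zindep_y_hat t])
  have m1: "meval (y_hat I A1.e T) ?F = sfe (y_hat I A1.e T) t"
    by (rule A0.meval_eq_sfe[OF zindep_y_hat_T t])
  have z: "?z = (\<Prod>i\<in>I. x0 i powi ?g i) * sfe (y_hat I A0.e A0.S) t"
    using gF unfolding gF_expansion_def mpoly_eval_of_int m0 by simp
  have "G ?z ?w"
    by (subst z, unfold m1)
      (use t in \<open>intro qrel_mult[OF ind] qrel_prod[OF ind] qrel_powi[OF ind] G_x G_sfe G_y_hat_T; auto\<close>)
  then have w: "phi ?z = ?w" "?w = A1.e q * cluster T1 i" using phi_eq G_unique q(2) by auto
  show "G ?z (phi ?z)" using \<open>G ?z ?w\<close> w by simp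
  have "A1.SF (\<Prod>i\<in>I. cluster T i powi ?g i) (\<lambda>l. \<Sum>i\<in>I. ?g i * 0)"
    by (rule A1.SF_prod[OF A1.fin A1.SF_powi]) (use okT in \<open>auto simp: A1.seed_ok_def\<close>)
  moreover have "A1.SF (sfe (y_hat I A1.e T) t) (sf_value (trop I) (coeffs T) t)"
    by (rule A1.SF_sfe) (use A1.SF_y_hat[OF okT] t in auto)
  ultimately have "A1.SF ?w (\<lambda>l. (\<Sum>i\<in>I. ?g i * 0) + sf_value (trop I) (coeffs T) t l)"
    unfolding m1 by (rule A1.SF_mult)
  moreover have "A1.SF ?w (\<lambda>l. q l + 0)"
    unfolding w(2) using A1.seed_ok_seeds[OF s(2)] i
    by (intro A1.SF_mult A1.SF_e q) (simp add: A1.seed_ok_def)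
  ultimately have "q = sf_value (trop I) (coeffs T) t" using A1.SF_unique by fastforce
  also have "\<dots> = ?E"
    by (rule semifield_eval_trop[symmetric]) (use A1.fin okT t in \<open>auto simp: A1.seed_ok_def\<close>)
  finally have qE: "q = ?E" .
  then show "?E \<in> carrier (trop I)" using q by simp
  have Zw: "Z ?z = ?w / A1.e ?E"
    by (simp add: corresponding_variable_def mpoly_eval_of_int)
  then show "phi ?z = A1.e ?E * Z ?z" using w A1.e_nonzero by simp
  show "Z ?z = cluster T1 i" using Zw w qE A1.e_nonzero by simp
qed

section \<open>The bijection between cluster variables\<close>

lemma Z_cluster_variable:
  assumes "z \<in> cluster_variables I (trop I) A0.e A0.S"
  shows "phi z = A1.e (semifield_eval I (trop I) (coeffs T) (F_polynomial I A0.e A0.S z)) * Z z"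
    "semifield_eval I (trop I) (coeffs T) (F_polynomial I A0.e A0.S z) \<in> carrier (trop I)"
    "Z z \<in> cluster_variables I (trop I) A1.e A1.S" "G z (phi z)"
proof -
  obtain T0 i where z: "z = cluster T0 i" "T0 \<in> seeds I (trop I) A0.e A0.S" "i \<in> I"
    using assms unfolding cluster_variables_def by blast
  obtain T1 where R: "related T0 T1" using related_left[OF z(2)] by blast
  note * = related_cluster[OF R z(3), folded z(1)]
  show "phi z = A1.e (semifield_eval I (trop I) (coeffs T) (F_polynomial I A0.e A0.S z)) * Z z"
    "semifield_eval I (trop I) (coeffs T) (F_polynomial I A0.e A0.S z) \<in> carrier (trop I)" "G z (phi z)"
    using * by auto
  show "Z z \<in> cluster_variables I (trop I) A1.e A1.S"
    using *(3) R z(3) unfolding cluster_variables_def related_def by auto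
qed

text \<open>If \<open>z\<close> and \<open>z'\<close> have the same image, they differ by a
  coefficient; by \<open>span\<close> it comes from some \<open>A0.e n\<close>. Both have valuation
  zero, so \<open>n\<close> is zero. Surjectivity holds because every seed on the right is related
  to one on the left.\<close>

lemma bij_Z: "bij_betw Z (cluster_variables I (trop I) A0.e A0.S) (cluster_variables I (trop I) A1.e A1.S)"
proof (rule bij_betw_imageI)
  show "inj_on Z (cluster_variables I (trop I) A0.e A0.S)"
  proof (rule inj_onI)
    fix z z' assume z: "z \<in> cluster_variables I (trop I) A0.e A0.S" "z' \<in> cluster_variables I (trop I) A0.e A0.S"
      and eq: "Z z = Z z'"
    define q where "q = semifield_eval I (trop I) (coeffs T) (F_polynomial I A0.e A0.S z)"
    define q' where "q' = semifield_eval I (trop I) (coeffs T) (F_polynomial I A0.e A0.S z')"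
    have w: "G z (A1.e q * Z z)" "G z' (A1.e q' * Z z)" "q \<in> carrier (trop I)" "q' \<in> carrier (trop I)"
      using Z_cluster_variable[OF z(1)] Z_cluster_variable[OF z(2)] eq unfolding q_def q'_def by auto
    have "(\<lambda>l. q l + - q' l) \<in> carrier (trop I)" using w A1.fin by (auto simp: carrier_trop)
    then obtain n where n: "n \<in> carrier (trop I)" "(\<lambda>l. q l + - q' l) = push n" using span by blast
    have "G (z' * A0.e n) (A1.e q' * Z z * A1.e (push n))"
      by (intro qrel_mult[OF ind] w G_e)
    also have "A1.e q' * Z z * A1.e (push n) = A1.e q * Z z"
      unfolding n(2)[symmetric] using A1.e_nonzero[of q'] A1.e_simps(1)[of q "\<lambda>l. - q' l"] A1.e_simps(4)[of q']
      by (simp add: field_simps)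
    finally have zz: "z = z' * A0.e n" using w(1) G_inj by blast
    have v: "A0.SF z (\<lambda>_. 0)" "A0.SF z' (\<lambda>_. 0)"
      using z A0.seed_ok_seeds unfolding cluster_variables_def A0.seed_ok_def by auto
    have "A0.SF z (\<lambda>l. 0 + n l)" unfolding zz by (intro A0.SF_mult A0.SF_e v n)
    then have "n = (\<lambda>_. 0)" using A0.SF_unique[OF v(1)] by fastforce
    then show "z = z'" using zz by (simp add: A0.e_simps)
  qed
  show "Z ` cluster_variables I (trop I) A0.e A0.S = cluster_variables I (trop I) A1.e A1.S"
  proof
    show "Z ` cluster_variables I (trop I) A0.e A0.S \<subseteq> cluster_variables I (trop I) A1.e A1.S"
      using Z_cluster_variable(3) by blast
    show "cluster_variables I (trop I) A1.e A1.S \<subseteq> Z ` cluster_variables I (trop I) A0.e A0.S"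
    proof
      fix z assume "z \<in> cluster_variables I (trop I) A1.e A1.S"
      then obtain T1 i where z: "z = cluster T1 i" "T1 \<in> seeds I (trop I) A1.e A1.S" "i \<in> I"
        unfolding cluster_variables_def by blast
      obtain T0 where R: "related T0 T1" using related_right[OF z(2)] by blast
      have "Z (cluster T0 i) = z" using related_cluster(3)[OF R z(3)] z(1) by simp
      moreover have "cluster T0 i \<in> cluster_variables I (trop I) A0.e A0.S"
        using R z(3) unfolding cluster_variables_def related_def by blast
      ultimately show "z \<in> Z ` cluster_variables I (trop I) A0.e A0.S" by blast
    qed
  qed
qed

section \<open>The ring isomorphism\<close>

lemma G_image_coeffs:
  assumes "p \<in> carrier (trop I)" shows "\<exists>n\<in>carrier (trop I). G (A0.e n) (A1.e p)"
proof -
  obtain n where n: "n \<in> carrier (trop I)" "p = push n" using span[OF assms] ..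
  then show ?thesis using G_e[of n] by (intro bexI[of _ n]) simp_all
qed

abbreviation "CA0 \<equiv> cluster_algebra I (trop I) A0.e A0.S"
abbreviation "CA1 \<equiv> cluster_algebra I (trop I) A1.e A1.S"

lemma CA_subring: "subring CA0" "subring CA1"
  unfolding cluster_algebra_def by (rule subring_hull)+

text \<open>Reduces the claim that every element of a cluster algebra has an image in the other one
  to the generators, by minimality of the hull.\<close>

lemma subring_G:
  assumes "subring R" shows "subring {z. \<exists>a\<in>R. G z a}"
  unfolding subring_def
proof (intro conjI ballI)
  have "0 \<in> R" "1 \<in> R" using assms unfolding subring_def by auto
  then show "0 \<in> {z. \<exists>a\<in>R. G z a}" "1 \<in> {z. \<exists>a\<in>R. G z a}" using qrel_0 qrel_1 by blast+
  fix a b assume "a \<in> {z. \<exists>a\<in>R. G z a}" "b \<in> {z. \<exists>a\<in>R. G z a}"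
  then obtain a' b' where ab: "a' \<in> R" "b' \<in> R" "G a a'" "G b b'" by auto
  note ops = subring_ops[OF assms ab(1,2)]
  show "a + b \<in> {z. \<exists>a\<in>R. G z a}" using ops(1) qrel_add[OF ind ab(3,4)] by auto
  show "a - b \<in> {z. \<exists>a\<in>R. G z a}" using ops(2) qrel_diff[OF ind ab(3,4)] by auto
  show "a * b \<in> {z. \<exists>a\<in>R. G z a}" using ops(3) qrel_mult[OF ind ab(3,4)] by auto
qed

lemma subring_G':
  assumes "subring R" shows "subring {a. \<exists>z\<in>R. G z a}"
  unfolding subring_def
proof (intro conjI ballI)
  have "0 \<in> R" "1 \<in> R" using assms unfolding subring_def by auto
  then show "0 \<in> {a. \<exists>z\<in>R. G z a}" "1 \<in> {a. \<exists>z\<in>R. G z a}" using qrel_0 qrel_1 by blast+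
  fix a b assume "a \<in> {a. \<exists>z\<in>R. G z a}" "b \<in> {a. \<exists>z\<in>R. G z a}"
  then obtain a' b' where ab: "a' \<in> R" "b' \<in> R" "G a' a" "G b' b" by auto
  note ops = subring_ops[OF assms ab(1,2)]
  show "a + b \<in> {a. \<exists>z\<in>R. G z a}" using ops(1) qrel_add[OF ind ab(3,4)] by auto
  show "a - b \<in> {a. \<exists>z\<in>R. G z a}" using ops(2) qrel_diff[OF ind ab(3,4)] by auto
  show "a * b \<in> {a. \<exists>z\<in>R. G z a}" using ops(3) qrel_mult[OF ind ab(3,4)] by auto
qed

lemma CA_mem:
  "p \<in> carrier (trop I) \<Longrightarrow> A0.e p \<in> CA0" "z \<in> cluster_variables I (trop I) A0.e A0.S \<Longrightarrow> z \<in> CA0"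
  "p \<in> carrier (trop I) \<Longrightarrow> A1.e p \<in> CA1" "a \<in> cluster_variables I (trop I) A1.e A1.S \<Longrightarrow> a \<in> CA1"
  unfolding cluster_algebra_def by (auto intro: hull_inc)

lemma G_CA0: "z \<in> CA0 \<Longrightarrow> \<exists>a\<in>CA1. G z a"
proof -
  have "CA0 \<subseteq> {z. \<exists>a\<in>CA1. G z a}"
    unfolding cluster_algebra_def[of I "trop I" A0.e]
  proof (rule subring_hull_least[OF _ subring_G[OF CA_subring(2)]])
    have "\<exists>a\<in>CA1. G z a" if "z \<in> cluster_variables I (trop I) A0.e A0.S" for z
      using Z_cluster_variable[OF that] CA_mem subring_ops(3)[OF CA_subring(2)] by metis
    moreover have "\<exists>a\<in>CA1. G (A0.e n) a" for n using G_e push_carrier CA_mem by blast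
    ultimately show "A0.e ` carrier (trop I) \<union> cluster_variables I (trop I) A0.e A0.S \<subseteq> {z. \<exists>a\<in>CA1. G z a}"
      by blast
  qed
  then show "z \<in> CA0 \<Longrightarrow> \<exists>a\<in>CA1. G z a" by blast
qed

lemma G_CA1: "a \<in> CA1 \<Longrightarrow> \<exists>z\<in>CA0. G z a"
proof -
  have "CA1 \<subseteq> {a. \<exists>z\<in>CA0. G z a}"
    unfolding cluster_algebra_def[of I "trop I" A1.e]
  proof (rule subring_hull_least[OF _ subring_G'[OF CA_subring(1)]])
    have "\<exists>z\<in>CA0. G z a" if a: "a \<in> cluster_variables I (trop I) A1.e A1.S" for a
    proof -
      obtain z where z: "z \<in> cluster_variables I (trop I) A0.e A0.S" "a = Z z"
        using a bij_Z unfolding bij_betw_def by blast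
      define q where "q = semifield_eval I (trop I) (coeffs T) (F_polynomial I A0.e A0.S z)"
      have w: "G z (A1.e q * a)" "q \<in> carrier (trop I)"
        using Z_cluster_variable[OF z(1)] unfolding q_def z(2) by auto
      then have "(\<lambda>l. - q l) \<in> carrier (trop I)" using A1.fin by (simp add: carrier_trop)
      then obtain n where n: "n \<in> carrier (trop I)" "G (A0.e n) (A1.e (\<lambda>l. - q l))"
        using G_image_coeffs by blast
      have "G (z * A0.e n) (A1.e q * a * A1.e (\<lambda>l. - q l))" by (intro qrel_mult[OF ind] w n)
      then have "G (z * A0.e n) a" using A1.e_nonzero[of q] by (simp add: A1.e_simps field_simps)
      then show ?thesis using subring_ops(3)[OF CA_subring(1) CA_mem(2)[OF z(1)] CA_mem(1)[OF n(1)]] by blast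
    qed
    then show "A1.e ` carrier (trop I) \<union> cluster_variables I (trop I) A1.e A1.S \<subseteq> {a. \<exists>z\<in>CA0. G z a}"
      using G_image_coeffs CA_mem by blast
  qed
  then show "a \<in> CA1 \<Longrightarrow> \<exists>z\<in>CA0. G z a" by blast
qed

lemma G_phi: "z \<in> CA0 \<Longrightarrow> G z (phi z)"
  using G_CA0 phi_eq by blast

lemma related_seeds:
  assumes "related T0 T1"
  shows "T0 \<in> seeds I (trop I) A0.e A0.S" "T1 \<in> seeds I (trop I) A1.e A1.S"
  using assms unfolding related_def by blast+

lemma related_clusters:
  assumes "related T0 T1"
  shows "\<forall>i\<in>I. cluster T1 i = Z (cluster T0 i) \<and> (\<forall>j\<in>I. exch T1 i j = exch T0 i j)"
  using related_cluster(3)[OF assms] assms unfolding related_def by auto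

theorem iso: "cluster_algebra_iso I (trop I) A0.e A0.S (trop I) A1.e A1.S phi Z"
  unfolding cluster_algebra_iso_def Let_def
proof (intro conjI ballI)
  show "bij_betw phi CA0 CA1"
  proof (rule bij_betw_imageI)
    show "inj_on phi CA0" by (rule inj_onI) (metis G_phi G_inj)
    show "phi ` CA0 = CA1"
    proof
      show "phi ` CA0 \<subseteq> CA1" using G_CA0 phi_eq by blast
      show "CA1 \<subseteq> phi ` CA0" using G_CA1 phi_eq by blast
    qed
  qed
  show "phi 1 = 1" by (rule phi_eq[OF qrel_1])
  show "phi (a + b) = phi a + phi b" "phi (a * b) = phi a * phi b" if "a \<in> CA0" "b \<in> CA0" for a b
    using that by (auto intro!: phi_eq qrel_add[OF ind] qrel_mult[OF ind] G_phi)
  show "phi ` A0.e ` carrier (trop I) = A1.e ` carrier (trop I)"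
  proof
    show "phi ` A0.e ` carrier (trop I) \<subseteq> A1.e ` carrier (trop I)"
      using phi_eq[OF G_e] push_carrier by auto
    show "A1.e ` carrier (trop I) \<subseteq> phi ` A0.e ` carrier (trop I)"
    proof
      fix a assume "a \<in> A1.e ` carrier (trop I)"
      then obtain n where "n \<in> carrier (trop I)" "G (A0.e n) a" using G_image_coeffs by blast
      then show "a \<in> phi ` A0.e ` carrier (trop I)" using phi_eq by blast
    qed
  qed
  show "bij_betw Z (cluster_variables I (trop I) A0.e A0.S) (cluster_variables I (trop I) A1.e A1.S)"
    by (rule bij_Z)
  show "\<exists>q\<in>carrier (trop I). phi z = A1.e q * Z z" if "z \<in> cluster_variables I (trop I) A0.e A0.S" for z
    using Z_cluster_variable[OF that] by blast
  fix T0 assume "T0 \<in> seeds I (trop I) A0.e A0.S"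
  then obtain T1 where R: "related T0 T1" using related_left by blast
  show "\<exists>T1\<in>seeds I (trop I) A1.e A1.S.
      (\<forall>i\<in>I. cluster T1 i = Z (cluster T0 i) \<and> (\<forall>j\<in>I. exch T1 i j = exch T0 i j)) \<and>
      (\<forall>k\<in>I. \<forall>i\<in>I. cluster (A1.mut k T1) i = Z (cluster (A0.mut k T0) i) \<and>
        (\<forall>j\<in>I. exch (A1.mut k T1) i j = exch (A0.mut k T0) i j))"
  proof (rule bexI[of _ T1], rule conjI[OF related_clusters[OF R]], rule ballI)
    fix k assume "k \<in> I"
    from related_clusters[OF related_mutate[OF R this]]
    show "\<forall>i\<in>I. cluster (A1.mut k T1) i = Z (cluster (A0.mut k T0) i) \<and>
        (\<forall>j\<in>I. exch (A1.mut k T1) i j = exch (A0.mut k T0) i j)" .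
  qed (rule related_seeds[OF R])
next
  fix T1 assume "T1 \<in> seeds I (trop I) A1.e A1.S"
  then obtain T0 where R: "related T0 T1" using related_right by blast
  show "\<exists>T0\<in>seeds I (trop I) A0.e A0.S.
      (\<forall>i\<in>I. cluster T1 i = Z (cluster T0 i) \<and> (\<forall>j\<in>I. exch T1 i j = exch T0 i j)) \<and>
      (\<forall>k\<in>I. \<forall>i\<in>I. cluster (A1.mut k T1) i = Z (cluster (A0.mut k T0) i) \<and>
        (\<forall>j\<in>I. exch (A1.mut k T1) i j = exch (A0.mut k T0) i j))"
  proof (rule bexI[of _ T0], rule conjI[OF related_clusters[OF R]], rule ballI)
    fix k assume "k \<in> I"
    from related_clusters[OF related_mutate[OF R this]]
    show "\<forall>i\<in>I. cluster (A1.mut k T1) i = Z (cluster (A0.mut k T0) i) \<and>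
        (\<forall>j\<in>I. exch (A1.mut k T1) i j = exch (A0.mut k T0) i j)" .
  qed (rule related_seeds[OF R])
qed

end

text \<open>A relation in \<open>x\<close> and \<open>y\<close> is read as a polynomial in
  \<open>x\<close> over the group ring. Independence of \<open>x\<close> over the coefficient field
  kills the group ring elements, and the embedding condition then kills their integer
  coefficients.\<close>

lemma zindep_interleaveI:
  fixes x y :: "nat \<Rightarrow> 'k::field_char_0"
  assumes fin: "finite I" and emb: "coeff_embedding (trop I) (coeff_map I y)"
    and ind: "alg_independent (subfield hull (coeff_map I y ` carrier (trop I))) I x"
  shows "zindep (doubled I) (interleave x y)"
  unfolding zindep_def
proof (intro allI impI)
  fix p assume p: "mpoly_vars p \<subseteq> doubled I \<and> meval (interleave x y) p = 0"
  let ?xp = "Poly_Mapping.map_key (\<lambda>i::nat. 2 * i)"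
  let ?yp = "\<lambda>m i. int (Poly_Mapping.lookup m (Suc (2 * i)))"
  let ?e = "coeff_map I y"
  let ?c = "Poly_Mapping.lookup p" and ?K = "Poly_Mapping.keys p"
  have inj: "inj (\<lambda>i::nat. 2 * i)" by (rule injI) simp
  have xp: "Poly_Mapping.lookup (?xp m) i = Poly_Mapping.lookup m (2 * i)" for m :: "nat \<Rightarrow>\<^sub>0 nat" and i
    by (simp add: map_key.rep_eq[OF inj])
  have keys: "Poly_Mapping.keys m \<subseteq> doubled I" if "m \<in> ?K" for m
    using p that by (auto simp: mpoly_vars_def)
  have xkeys: "Poly_Mapping.keys (?xp m) \<subseteq> I" if "m \<in> ?K" for m
  proof
    fix i assume "i \<in> Poly_Mapping.keys (?xp m)"
    then have "2 * i \<in> Poly_Mapping.keys m" by (simp add: in_keys_iff xp)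
    then show "i \<in> I" using keys[OF that] doubled_simps(1) by blast
  qed
  have zero: "Poly_Mapping.lookup m j = 0" if "m \<in> ?K" "j \<notin> doubled I" for m j
    using keys[OF that(1)] that(2) by (auto simp: in_keys_iff subset_iff)
  have ycar: "?yp m \<in> carrier (trop I)" if "m \<in> ?K" for m
    using zero[OF that] fin by (simp add: carrier_trop)
  have mon: "mon_eval (interleave x y) m = mon_eval x (?xp m) * ?e (?yp m)" if m: "m \<in> ?K" for m
  proof -
    let ?A = "(\<lambda>i. 2 * i) ` I" and ?B = "(\<lambda>i. Suc (2 * i)) ` I"
    have "Poly_Mapping.keys m \<subseteq> ?A \<union> ?B" using keys[OF m] by (auto elim!: doubledE)
    moreover have "?A \<inter> ?B = {}" by (auto, presburger)
    ultimately have "mon_eval (interleave x y) m =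
        (\<Prod>i\<in>?A. interleave x y i ^ Poly_Mapping.lookup m i) * (\<Prod>i\<in>?B. interleave x y i ^ Poly_Mapping.lookup m i)"
      using fin by (simp add: mon_eval_superset[of "?A \<union> ?B"] prod.union_disjoint)
    also have "\<dots> = (\<Prod>i\<in>I. x i ^ Poly_Mapping.lookup m (2 * i)) * (\<Prod>i\<in>I. y i ^ Poly_Mapping.lookup m (Suc (2 * i)))"
      by (simp add: prod.reindex inj_on_def)
    finally show ?thesis
      using mon_eval_superset[OF fin xkeys[OF m], of x] by (simp add: xp coeff_map_def)
  qed
  \<comment> \<open>Monomials of \<open>p\<close> with the same part in \<open>x\<close> are
    collected into one coefficient.\<close>
  define f where "f = (\<Sum>m\<in>?K. Poly_Mapping.single (?xp m) (of_int (?c m) * ?e (?yp m)))"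
  have f: "Poly_Mapping.lookup f m1 = (\<Sum>m | m \<in> ?K \<and> ?xp m = m1. of_int (?c m) * ?e (?yp m))" for m1
    unfolding f_def by (simp add: lookup_sum lookup_single when_def sum.inter_filter)
  have hull: "Poly_Mapping.lookup f m1 \<in> subfield hull (?e ` carrier (trop I))" for m1
    unfolding hull_def
  proof (rule InterI)
    fix R assume "R \<in> {R. subfield R \<and> ?e ` carrier (trop I) \<subseteq> R}"
    then have R: "0 \<in> R" "1 \<in> R" "\<And>a b. a \<in> R \<Longrightarrow> b \<in> R \<Longrightarrow> a + b \<in> R \<and> a - b \<in> R \<and> a * b \<in> R"
      and eR: "\<And>q. q \<in> carrier (trop I) \<Longrightarrow> ?e q \<in> R"
      by (auto simp: subfield_def subring_def)
    have nat: "of_nat k \<in> R" for k by (induction k) (use R in auto)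
    have int: "of_int k \<in> R" for k
      using R(3)[OF nat[of "nat k"] nat[of "nat (- k)"]] R(1)
      by (cases "k \<ge> 0") (use R(3)[OF R(1) nat[of "nat (- k)"]] in auto)
    have sum: "(\<Sum>m\<in>A. g m) \<in> R" if "\<forall>m\<in>A. g m \<in> R" for A :: "(nat \<Rightarrow>\<^sub>0 nat) set" and g
      using that by (induction A rule: infinite_finite_induct) (use R in auto)
    show "Poly_Mapping.lookup f m1 \<in> R"
      unfolding f by (rule sum) (use R(3) int eR ycar in auto)
  qed
  have fkeys: "Poly_Mapping.keys f \<subseteq> ?xp ` ?K"
  proof
    fix m1 assume "m1 \<in> Poly_Mapping.keys f"
    then have "Poly_Mapping.lookup f m1 \<noteq> 0" by (simp add: in_keys_iff)
    then have "{m. m \<in> ?K \<and> ?xp m = m1} \<noteq> {}" unfolding f by force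
    then show "m1 \<in> ?xp ` ?K" by blast
  qed
  have "mpoly_eval (\<lambda>t. t) x f = (\<Sum>m1\<in>?xp ` ?K. Poly_Mapping.lookup f m1 * mon_eval x m1)"
    unfolding mpoly_eval_def mon_eval_def
    by (rule sum.mono_neutral_left) (use fkeys in \<open>auto simp: in_keys_iff\<close>)
  also have "\<dots> = (\<Sum>m1\<in>?xp ` ?K. \<Sum>m | m \<in> ?K \<and> ?xp m = m1. of_int (?c m) * mon_eval (interleave x y) m)"
    unfolding f sum_distrib_right by (intro sum.cong refl) (auto simp: mon)
  also have "\<dots> = meval (interleave x y) p"
    unfolding meval_def by (rule sum.image_gen[symmetric]) simp
  finally have "mpoly_eval (\<lambda>t. t) x f = 0" using p by simp
  moreover have "mpoly_vars f \<subseteq> I" using fkeys xkeys unfolding mpoly_vars_def by blast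
  ultimately have f0: "f = 0" using ind hull unfolding alg_independent_def by blast
  show "p = 0"
  proof (rule ccontr)
    assume "p \<noteq> 0"
    then have "?K \<noteq> {}" by simp
    then obtain m0 where m0: "m0 \<in> ?K" by blast
    let ?M = "{m \<in> ?K. ?xp m = ?xp m0}"
    \<comment> \<open>With the part in \<open>x\<close> fixed, the part in \<open>y\<close>
      determines the monomial; so the sum runs over distinct elements of the coefficient group, as
      the embedding condition demands.\<close>
    have inj_yp: "inj_on ?yp ?M"
    proof (rule inj_onI)
      fix m m' assume *: "m \<in> ?M" "m' \<in> ?M" "?yp m = ?yp m'"
      show "m = m'"
      proof (rule poly_mapping_eqI)
        fix j
        have "Poly_Mapping.lookup m (2 * i) = Poly_Mapping.lookup m' (2 * i)" for i
          using * by (auto simp: xp[symmetric])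
        moreover have "Poly_Mapping.lookup m (Suc (2 * i)) = Poly_Mapping.lookup m' (Suc (2 * i))" for i
          using fun_cong[OF *(3), of i] by simp
        ultimately show "Poly_Mapping.lookup m j = Poly_Mapping.lookup m' j"
          by (cases "even j") (auto elim!: evenE oddE)
      qed
    qed
    let ?g = "inv_into ?M ?yp"
    have "(\<Sum>q\<in>?yp ` ?M. of_int (?c (?g q)) * ?e q) = (\<Sum>m\<in>?M. of_int (?c m) * ?e (?yp m))"
      by (subst sum.reindex[OF inj_yp]) (simp add: inv_into_f_f[OF inj_yp])
    also have "\<dots> = 0" using f[of "?xp m0"] f0 by simp
    finally have sum0: "(\<Sum>q\<in>?yp ` ?M. of_int (?c (?g q)) * ?e q) = 0" .
    have "?yp ` ?M \<subseteq> carrier (trop I)" using ycar by blast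
    moreover have "finite (?yp ` ?M)" by simp
    ultimately have "\<forall>q\<in>?yp ` ?M. ?c (?g q) = 0"
      using emb[unfolded coeff_embedding_def, THEN conjunct2, THEN spec[of _ "?yp ` ?M"], THEN spec[of _ "\<lambda>q. ?c (?g q)"]]
        sum0 by blast
    then have "?c (?g (?yp m0)) = 0" using m0 by blast
    moreover have "?g (?yp m0) = m0" by (rule inv_into_f_f[OF inj_yp]) (use m0 in simp)
    ultimately show False using m0 by (simp add: in_keys_iff)
  qed
qed

section \<open>Mutation at the first vertex of a Coxeter element\<close>

text \<open>At such a vertex the correction terms of the matrix mutation vanish, so only signs
  change, and one monomial of the exchange relation is \<open>1\<close>.\<close>

locale sink_mutation = principal_seed +
  fixes k
  assumes k: "k \<in> I" and sink: "\<And>i. B i k \<le> 0" "\<And>j. 0 \<le> B k j"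
begin

abbreviation "T \<equiv> mut k S"
abbreviation "M \<equiv> (\<Prod>i\<in>I - {k}. x i powi (- B i k))"

lemma B_k: "B k k = 0"
  using sink(1)[of k] sink(2)[of k] by simp

lemma exch_T: "exch T i j = (if i = k \<or> j = k then - B i j else B i j)"
  using sink(1)[of i] sink(2)[of j] by (simp add: mutate_def mutate_exch_def)

lemma coeffs_T: "coeffs T j = (if j = k then (\<lambda>l. - trop_gen k l) else (\<lambda>l. trop_gen j l + B k j * trop_gen k l))"
proof -
  have "min (trop_gen k l) 0 = 0" for l by (simp add: trop_gen_def)
  then show ?thesis
    using sink(2)[of j] mutate_coeffs_trop[where y = trop_gen and k = k and B = B and j = j, OF fin trop_gen_carrier[OF fin k]]
    by (simp add: mutate_def)
qed

lemma e_coeffs_T: "j \<in> I \<Longrightarrow> e (coeffs T j) = (if j = k then inverse (y k) else y j * y k powi B k j)"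
  unfolding coeffs_T using k by (simp add: e_simps)

lemma prod_remove_k: "f k = 1 \<Longrightarrow> (\<Prod>i\<in>I. f i) = (\<Prod>i\<in>I - {k}. f i)" for f :: "nat \<Rightarrow> 'c::comm_monoid_mult"
  using fin k by (simp add: prod.remove)

lemma cluster_T: "cluster T j = (if j = k then (y k + M) / x k else x j)"
proof -
  have "splus P (trop_gen k) \<one>\<^bsub>P\<^esub> = (\<lambda>_. 0)" by (auto simp: trop_gen_def fun_eq_iff)
  moreover have "(\<Prod>i\<in>I. x i powi pos_part (B i k)) = 1"
    by (rule prod.neutral) (use sink in auto)
  moreover have "(\<Prod>i\<in>I. x i powi pos_part (- B i k)) = (\<Prod>i\<in>I. x i powi (- B i k))"
    by (rule prod.cong) (use sink in auto)
  ultimately show ?thesis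
    using k by (simp add: mutate_def mutate_cluster_def e_simps B_k prod_remove_k)
qed

lemma y_M_nonzero: "y k + M \<noteq> 0"
proof -
  have "SF (y k + M) (\<lambda>j. min (trop_gen k j) (\<Sum>i\<in>I - {k}. - B i k * 0))"
    by (intro SF_add SF_y SF_prod SF_powi SF_x) (use k fin in auto)
  then show ?thesis by (rule SF_nonzero)
qed

text \<open>Checked directly from the explicit form of \<open>T\<close>. It makes the initial seed
  reachable from \<open>T\<close>, as \<open>seed_transfer\<close> requires.\<close>

lemma mut_T: "mut k T = S"
proof -
  have "exch (mut k T) = B" by (simp add: mutate_def mutate_exch_mutate_exch)
  moreover have "coeffs (mut k T) = trop_gen"
  proof
    fix j
    have ck: "coeffs T k = (\<lambda>l. - trop_gen k l)" by (simp add: coeffs_T)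
    have car: "coeffs T k \<in> carrier P" unfolding ck using trop_gen_carrier[OF fin k] fin by (simp add: carrier_trop)
    have "coeffs (mut k T) j = mutate_coeffs P k (exch T) (coeffs T) j" by (simp add: mutate_def)
    also have "\<dots> = trop_gen j"
      unfolding mutate_coeffs_trop[where y = "coeffs T", OF fin car]
      using sink(2)[of j] by (auto simp: ck coeffs_T exch_T trop_gen_def fun_eq_iff)
    finally show "coeffs (mut k T) j = trop_gen j" .
  qed
  moreover have "cluster (mut k T) = x"
  proof
    fix j
    have ck: "coeffs T k = (\<lambda>l. - trop_gen k l)" by (simp add: coeffs_T)
    \<comment> \<open>Unlike in the first mutation the normalization is not trivial: the coefficient
      now has a negative exponent and is its own minimum with \<open>0\<close>.\<close>
    have "splus P (coeffs T k) \<one>\<^bsub>P\<^esub> = (\<lambda>l. - trop_gen k l)" by (auto simp: ck trop_gen_def fun_eq_iff)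
    moreover have "(\<Prod>i\<in>I. cluster T i powi pos_part (exch T i k)) = M"
      using sink by (subst prod_remove_k) (auto simp: exch_T B_k cluster_T intro!: prod.cong)
    moreover have "(\<Prod>i\<in>I. cluster T i powi pos_part (- exch T i k)) = 1"
      by (rule prod.neutral) (use sink in \<open>auto simp: exch_T\<close>)
    ultimately have "cluster (mut k T) k = (e (\<lambda>l. - trop_gen k l) * M + 1) / e (\<lambda>l. - trop_gen k l) / cluster T k"
      by (simp add: mutate_def[of _ _ _ _ T] mutate_cluster_def ck)
    also have "(e (\<lambda>l. - trop_gen k l) * M + 1) / e (\<lambda>l. - trop_gen k l) = y k + M"
      using k y_nonzero by (simp add: e_simps field_simps)
    also have "(y k + M) / cluster T k = (y k + M) / ((y k + M) / x k)" by (simp add: cluster_T)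
    also have "\<dots> = x k" using x_nonzero[OF k] y_M_nonzero by simp
    finally show "cluster (mut k T) j = x j"
      by (cases "j = k") (simp_all add: mutate_def[of _ _ _ _ T] mutate_cluster_def[of _ _ _ _ T] cluster_T)
  qed
  ultimately show ?thesis by (cases "mut k T") simp
qed

lemma T_seeds: "T \<in> seeds I P e S" "S \<in> seeds I P e T"
  using seeds.mutated[OF seeds.initial k, of P e S] seeds.mutated[OF seeds.initial k, of P e T] mut_T by simp_all

lemma span_T:
  assumes p: "p \<in> carrier P"
  shows "\<exists>n\<in>carrier P. p = (\<lambda>l. \<Sum>i\<in>I. n i * coeffs T i l)"
proof (rule bexI)
  \<comment> \<open>Comparing exponents of the generators other than \<open>k\<close> forces
    \<open>p i\<close>; the exponent of generator \<open>k\<close> then determines the remaining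
    value.\<close>
  let ?n = "\<lambda>i. if i = k then (\<Sum>j\<in>I. B k j * p j) - p k else p i"
  show "?n \<in> carrier P" using p k fin by (auto simp: carrier_trop)
  have "(\<lambda>l. \<Sum>i\<in>I. ?n i * coeffs T i l) = (\<lambda>l. \<Sum>i\<in>I. p i * trop_gen i l)"
  proof
    fix l
    have "(\<Sum>i\<in>I. ?n i * coeffs T i l) = ?n k * coeffs T k l + (\<Sum>i\<in>I - {k}. ?n i * coeffs T i l)"
      using fin k by (rule sum.remove)
    also have "(\<Sum>i\<in>I - {k}. ?n i * coeffs T i l)
        = (\<Sum>i\<in>I - {k}. p i * trop_gen i l) + (\<Sum>i\<in>I - {k}. B k i * p i) * trop_gen k l"
      unfolding sum_distrib_right sum.distrib[symmetric]
      by (rule sum.cong) (auto simp: coeffs_T algebra_simps)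
    also have "(\<Sum>i\<in>I - {k}. B k i * p i) = (\<Sum>i\<in>I. B k i * p i)"
      using fin k by (simp add: sum.remove[of _ k] B_k)
    also have "?n k * coeffs T k l + ((\<Sum>i\<in>I - {k}. p i * trop_gen i l) + (\<Sum>i\<in>I. B k i * p i) * trop_gen k l)
        = p k * trop_gen k l + (\<Sum>i\<in>I - {k}. p i * trop_gen i l)"
      by (simp add: coeffs_T algebra_simps)
    also have "\<dots> = (\<Sum>i\<in>I. p i * trop_gen i l)" using fin k by (simp add: sum.remove[of _ k])
    finally show "(\<Sum>i\<in>I. ?n i * coeffs T i l) = (\<Sum>i\<in>I. p i * trop_gen i l)" .
  qed
  then show "p = (\<lambda>l. \<Sum>i\<in>I. ?n i * coeffs T i l)" using sum_trop_gen[OF fin p] by simp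
qed

lemma zindep_T: "zindep (doubled I) (interleave (cluster T) (\<lambda>i. e (coeffs T i)))"
proof -
  let ?v = "interleave x y" and ?v' = "interleave (cluster T) (\<lambda>i. e (coeffs T i))"
  let ?sf = "sfrel I (doubled I) ?v wgt"
  define X :: "(nat \<Rightarrow> real) \<Rightarrow> nat \<Rightarrow> real" where
    "X V j = (if j = k then (V (Suc (2 * k)) + (\<Prod>i\<in>I - {k}. V (2 * i) powi (- B i k))) / V (2 * k) else V (2 * j))" for V j
  define Y :: "(nat \<Rightarrow> real) \<Rightarrow> nat \<Rightarrow> real" where
    "Y V j = (if j = k then 1 / V (Suc (2 * k)) else V (Suc (2 * j)) * V (Suc (2 * k)) powi B k j)" for V j
  have sfx: "\<exists>p. ?sf (x i) (\<lambda>V. V (2 * i)) p" if "i \<in> I" for i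
    using sfrel_var[where i = "2 * i" and v = ?v, OF fin w] that by auto
  have sfy: "\<exists>p. ?sf (y i) (\<lambda>V. V (Suc (2 * i))) p" if "i \<in> I" for i
    using sfrel_var[where i = "Suc (2 * i)" and v = ?v, OF fin w] that by auto
  have X: "\<exists>p. ?sf (cluster T i) (\<lambda>V. X V i) p" if i: "i \<in> I" for i
  proof (cases "i = k")
    case True
    obtain px where px: "\<forall>i\<in>I. ?sf (x i) (\<lambda>V. V (2 * i)) (px i)" using bchoice[of I] sfx by metis
    obtain py where py: "?sf (y k) (\<lambda>V. V (Suc (2 * k))) py" using sfy[OF k] by blast
    have "?sf M (\<lambda>V. \<Prod>i\<in>I - {k}. V (2 * i) powi (- B i k)) (\<lambda>j. \<Sum>i\<in>I - {k}. - B i k * px i j)"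
    proof (rule sfrel_prod[OF fin w])
      show "?sf (x a powi (- B a k)) (\<lambda>V. V (2 * a) powi (- B a k)) (\<lambda>j. - B a k * px a j)" if "a \<in> I - {k}" for a
        by (rule sfrel_powi[OF fin w]) (use px that in blast)
    qed (use fin in simp)
    note sfrel_divide[OF fin w sfrel_add[OF fin w py this] px[rule_format, OF k]]
    then show ?thesis using True by (auto simp: cluster_T X_def)
  next
    case False
    then show ?thesis using sfx[OF i] by (simp add: cluster_T X_def)
  qed
  have Y: "\<exists>p. ?sf (e (coeffs T i)) (\<lambda>V. Y V i) p" if i: "i \<in> I" for i
  proof -
    obtain py where py: "?sf (y k) (\<lambda>V. V (Suc (2 * k))) py" using sfy[OF k] by blast
    obtain pi where pi: "?sf (y i) (\<lambda>V. V (Suc (2 * i))) pi" using sfy[OF i] by blast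
    show ?thesis
      using sfrel_divide[OF fin w sfrel_1[OF fin w] py] sfrel_mult[OF fin w pi sfrel_powi[OF fin w py, of "B k i"]]
      by (auto simp: e_coeffs_T[OF i] Y_def divide_inverse)
  qed
  have "\<forall>m\<in>doubled I. \<exists>p. ?sf (?v' m) (\<lambda>V. interleave (X V) (Y V) m) p"
    using X Y by (auto elim!: doubledE)
  from bchoice[OF this] obtain p where p: "\<forall>m\<in>doubled I. ?sf (?v' m) (\<lambda>V. interleave (X V) (Y V) m) (p m)" ..
  show ?thesis
  proof (rule zindep_change[OF fin w ind])
    show "?sf (?v' m) (\<lambda>V. interleave (X V) (Y V) m) (p m)" if "m \<in> doubled I" for m using p that by blast
    fix V :: "nat \<Rightarrow> real" assume V: "posv V"
    then have pos: "0 < V i" for i by (simp add: posv_def)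
    \<comment> \<open>The inverse change of variables has the same shape. The \<open>y\<close> part
      comes first, because solving the exchange relation for the old variable at \<open>k\<close>
      involves the old \<open>y k\<close>.\<close>
    define ys where "ys j = Y V j" for j
    define xs where "xs j = (if j = k then (ys k + (\<Prod>i\<in>I - {k}. V (2 * i) powi (- B i k))) / V (2 * k) else V (2 * j))" for j
    have ys: "0 < ys j" for j using pos by (simp add: ys_def Y_def)
    have xs: "0 < xs j" for j
      using pos ys[of k] by (auto simp: xs_def intro!: divide_pos_pos add_pos_pos prod_pos)
    have "posv (interleave xs ys)" using xs ys by (simp add: posv_def interleave_def)
    moreover have "interleave (X (interleave xs ys)) (Y (interleave xs ys)) m = V m" if "m \<in> doubled I" for m
    proof -
      have 1: "Y (interleave xs ys) j = V (Suc (2 * j))" for j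
        using pos[of "Suc (2 * k)"] pos[of "Suc (2 * j)"]
        by (simp add: Y_def ys_def power_int_divide_distrib)
      have "(\<Prod>i\<in>I - {k}. xs i powi (- B i k)) = (\<Prod>i\<in>I - {k}. V (2 * i) powi (- B i k))"
        by (rule prod.cong) (auto simp: xs_def)
      moreover have "ys k + (\<Prod>i\<in>I - {k}. V (2 * i) powi (- B i k)) \<noteq> 0"
        using xs[of k] by (auto simp: xs_def)
      ultimately have "X (interleave xs ys) j = V (2 * j)" for j
        using pos[of "2 * k"] by (simp add: X_def) (simp add: xs_def)
      then show ?thesis using that 1 by (auto elim!: doubledE)
    qed
    ultimately show "\<exists>V'. posv V' \<and> (\<forall>m\<in>doubled I. interleave (X V') (Y V') m = V m)" by blast
  qed
qed

end

section \<open>Pinnings and root subgroups\<close>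

lemma mat22_mult: "mat22 p q r s ** mat22 p' q' r' s'
    = mat22 (p * p' + q * r') (p * q' + q * s') (r * p' + s * r') (r * q' + s * s')"
  by (simp add: vec_eq_iff matrix_matrix_mult_def mat22_def forall_2 sum_2)

lemma det_mat22: "det (mat22 p q r s) = p * s - q * r"
  by (simp add: det_2 mat22_def)

lemma mat22_1: "mat22 1 0 0 1 = mat 1"
  by (simp add: vec_eq_iff mat22_def forall_2 mat_def)

lemma mat22_SL2 [simp]: "mat22 p q r s \<in> SL2 \<longleftrightarrow> p * s - q * r = 1"
  by (simp add: SL2_def det_mat22)

lemma mat22_cases:
  obtains p q r s where "A = mat22 p q r s"
proof
  show "A = mat22 (A $ 1 $ 1) (A $ 1 $ 2) (A $ 2 $ 1) (A $ 2 $ 2)"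
    by (simp add: vec_eq_iff mat22_def forall_2)
qed

lemma entry_polynomial_continuous: "entry_polynomial f \<Longrightarrow> continuous_on UNIV f"
  by (induction rule: entry_polynomial.induct) (auto intro!: continuous_intros)

lemma regular_on_continuous:
  assumes "regular_on X f" shows "continuous_on X f"
  unfolding continuous_on_def
proof
  fix p assume p: "p \<in> X"
  then obtain r s where rs: "entry_polynomial r" "entry_polynomial s" "s p \<noteq> 0"
    "\<And>q. q \<in> X \<Longrightarrow> s q \<noteq> 0 \<Longrightarrow> f q = r q / s q"
    using assms unfolding regular_on_def by blast
  have lim: "(g \<longlongrightarrow> g p) (at p within X)" if "entry_polynomial g" for g
    using entry_polynomial_continuous[OF that] unfolding continuous_on_def
    by (auto intro: tendsto_within_subset)
  have "((\<lambda>q. r q / s q) \<longlongrightarrow> f p) (at p within X)"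
    unfolding rs(4)[OF p rs(3)] by (intro tendsto_divide lim rs)
  moreover have "open {q. s q \<noteq> 0}"
    by (rule open_Collect_neq[OF entry_polynomial_continuous[OF rs(2)] continuous_on_const])
  then have "\<forall>\<^sub>F q in at p within X. s q \<noteq> 0 \<and> q \<in> X"
    using rs(3) unfolding eventually_at_topological by blast
  then have "\<forall>\<^sub>F q in at p within X. r q / s q = f q"
    by (rule eventually_mono) (use rs(4) in auto)
  ultimately show "(f \<longlongrightarrow> f p) (at p within X)"
    by (rule Lim_transform_eventually)
qed

lemma regular_on_const: "regular_on X (\<lambda>p. z)"
  unfolding regular_on_def
  by (rule ballI, rule exI[of _ "\<lambda>p. z"], rule exI[of _ "\<lambda>p. 1"]) (auto intro: entry_polynomial.intros)

lemma regular_on_mult: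
  assumes "regular_on X f" "regular_on X g" shows "regular_on X (\<lambda>p. f p * g p)"
  unfolding regular_on_def
proof
  fix p assume p: "p \<in> X"
  obtain r s where 1: "entry_polynomial r" "entry_polynomial s" "s p \<noteq> 0"
    "\<forall>q\<in>X. s q \<noteq> 0 \<longrightarrow> f q = r q / s q"
    using assms(1) p unfolding regular_on_def by blast
  obtain r' s' where 2: "entry_polynomial r'" "entry_polynomial s'" "s' p \<noteq> 0"
    "\<forall>q\<in>X. s' q \<noteq> 0 \<longrightarrow> g q = r' q / s' q"
    using assms(2) p unfolding regular_on_def by blast
  show "\<exists>r s. entry_polynomial r \<and> entry_polynomial s \<and> s p \<noteq> 0 \<and>
      (\<forall>q\<in>X. s q \<noteq> 0 \<longrightarrow> f q * g q = r q / s q)"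
    by (rule exI[of _ "\<lambda>q. r q * r' q"], rule exI[of _ "\<lambda>q. s q * s' q"])
      (use 1 2 in \<open>auto intro: entry_polynomial.intros\<close>)
qed

lemma regular_on_add:
  assumes "regular_on X f" "regular_on X g" shows "regular_on X (\<lambda>p. f p + g p)"
  unfolding regular_on_def
proof
  fix p assume p: "p \<in> X"
  obtain r s where 1: "entry_polynomial r" "entry_polynomial s" "s p \<noteq> 0"
    "\<forall>q\<in>X. s q \<noteq> 0 \<longrightarrow> f q = r q / s q"
    using assms(1) p unfolding regular_on_def by blast
  obtain r' s' where 2: "entry_polynomial r'" "entry_polynomial s'" "s' p \<noteq> 0"
    "\<forall>q\<in>X. s' q \<noteq> 0 \<longrightarrow> g q = r' q / s' q"
    using assms(2) p unfolding regular_on_def by blast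
  show "\<exists>r s. entry_polynomial r \<and> entry_polynomial s \<and> s p \<noteq> 0 \<and>
      (\<forall>q\<in>X. s q \<noteq> 0 \<longrightarrow> f q + g q = r q / s q)"
    by (rule exI[of _ "\<lambda>q. r q * s' q + r' q * s q"], rule exI[of _ "\<lambda>q. s q * s' q"])
      (use 1 2 in \<open>auto simp: add_frac_eq intro!: entry_polynomial.intros\<close>)
qed

lemma regular_on_power: "regular_on X f \<Longrightarrow> regular_on X (\<lambda>p. f p ^ k)"
  by (induction k) (auto intro: regular_on_const regular_on_mult)

lemma regular_on_prod:
  "finite A \<Longrightarrow> (\<And>i. i \<in> A \<Longrightarrow> regular_on X (f i)) \<Longrightarrow> regular_on X (\<lambda>p. \<Prod>i\<in>A. f i p)"
  by (induction A rule: finite_induct) (auto intro: regular_on_const regular_on_mult)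

lemma regular_on_subset:
  assumes "regular_on X f" "Y \<subseteq> X" shows "regular_on Y f"
  unfolding regular_on_def
proof
  fix p assume "p \<in> Y"
  then have "p \<in> X" using assms(2) by blast
  then obtain r s where "entry_polynomial r" "entry_polynomial s" "s p \<noteq> 0"
    "\<forall>q\<in>X. s q \<noteq> 0 \<longrightarrow> f q = r q / s q"
    using assms(1) unfolding regular_on_def by blast
  then show "\<exists>r s. entry_polynomial r \<and> entry_polynomial s \<and> s p \<noteq> 0 \<and>
      (\<forall>q\<in>Y. s q \<noteq> 0 \<longrightarrow> f q = r q / s q)"
    using assms(2) by (intro exI[of _ r] exI[of _ s]) blast
qed

text \<open>A cofinite subset of the complex plane is dense. This carries formulas from generic
  parameters to all parameters.\<close>

lemma eq_of_cofinite:
  fixes f g :: "complex \<Rightarrow> 'b::t2_space"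
  assumes "continuous_on UNIV f" "continuous_on UNIV g" "finite E" "\<And>u. u \<notin> E \<Longrightarrow> f u = g u"
  shows "f u = g u"
proof -
  have "closed {u. f u = g u}" by (rule closed_Collect_eq) fact+
  moreover have "- E \<subseteq> {u. f u = g u}" using assms by auto
  moreover have "closure (- E) = UNIV"
    using empty_interior_finite[OF assms(3)] by (simp add: closure_complement)
  ultimately show ?thesis using closure_minimal by blast
qed

lemma mem_of_cofinite:
  fixes f :: "complex \<Rightarrow> 'b::topological_space"
  assumes "continuous_on UNIV f" "closed C" "finite E" "\<And>u. u \<notin> E \<Longrightarrow> f u \<in> C"
  shows "f u \<in> C"
proof -
  have "closed (f -` C)" using assms(1,2) by (rule closed_vimage[rotated])
  moreover have "- E \<subseteq> f -` C" using assms by auto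
  moreover have "closure (- E) = UNIV"
    using empty_interior_finite[OF assms(3)] by (simp add: closure_complement)
  ultimately show ?thesis using closure_minimal by blast
qed

lemma finite_root: "finite {u :: complex. 1 + c * u = 0}"
proof (rule finite_subset)
  show "{u. 1 + c * u = 0} \<subseteq> {- 1 / c}"
    by (cases "c = 0") (auto simp: field_simps add_eq_0_iff)
qed simp

lemma group_GL: "group (GL :: (complex^'m::finite^'m) monoid)"
proof (rule groupI)
  fix A :: "complex^'m^'m" assume "A \<in> carrier GL"
  then obtain B where "A ** B = mat 1" "B ** A = mat 1" by (auto simp: GL_def invertible_def)
  then show "\<exists>B\<in>carrier GL. B \<otimes>\<^bsub>GL\<^esub> A = \<one>\<^bsub>GL\<^esub>"
    by (intro bexI[of _ B]) (auto simp: GL_def invertible_def)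
qed (auto simp: GL_def matrix_mul_assoc invertible_def[of "mat 1"] intro: invertible_mult)

lemma inv_GL:
  assumes "A ** B = mat 1" "B ** A = (mat 1 :: complex^'m::finite^'m)"
  shows "inv\<^bsub>GL\<^esub> A = B"
proof -
  interpret group "GL :: (complex^'m^'m) monoid" by (rule group_GL)
  show ?thesis
    by (rule inv_equality) (use assms in \<open>auto simp: GL_def invertible_def\<close>)
qed

locale sc_group =
  fixes n :: nat and a :: "nat \<Rightarrow> nat \<Rightarrow> int" and \<psi> :: "('m::finite) pinning"
  assumes sc: "simply_connected_group n a \<psi>"
begin

abbreviation "x \<equiv> x_pos \<psi>"
abbreviation "y \<equiv> x_neg \<psi>"
abbreviation "h \<equiv> coroot \<psi>"
abbreviation "tor \<equiv> torus_elem n \<psi>"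
abbreviation "G \<equiv> group_set n \<psi>"

lemma pin_1: "i \<in> {1..n} \<Longrightarrow> \<psi> i (mat 1) = mat 1"
  and pin_mult: "i \<in> {1..n} \<Longrightarrow> A \<in> SL2 \<Longrightarrow> B \<in> SL2 \<Longrightarrow> \<psi> i (A ** B) = \<psi> i A ** \<psi> i B"
  and pin_regular: "i \<in> {1..n} \<Longrightarrow> regular_on SL2 (\<lambda>A. \<psi> i A $ r $ s)"
  and h_x: "i \<in> {1..n} \<Longrightarrow> j \<in> {1..n} \<Longrightarrow> t \<noteq> 0 \<Longrightarrow> h i t ** x j u = x j (t powi a i j * u) ** h i t"
  and h_y: "i \<in> {1..n} \<Longrightarrow> j \<in> {1..n} \<Longrightarrow> t \<noteq> 0 \<Longrightarrow> h i t ** y j u = y j (t powi (- a i j) * u) ** h i t"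
  and x_y: "i \<in> {1..n} \<Longrightarrow> j \<in> {1..n} \<Longrightarrow> i \<noteq> j \<Longrightarrow> x i t ** y j u = y j u ** x i t"
proof -
  note s = sc[unfolded simply_connected_group_def]
  note c = conjunct1[OF s] conjunct1[OF conjunct2[OF s]] conjunct1[OF conjunct2[OF conjunct2[OF s]]]
  show "i \<in> {1..n} \<Longrightarrow> \<psi> i (mat 1) = mat 1"
    and "i \<in> {1..n} \<Longrightarrow> A \<in> SL2 \<Longrightarrow> B \<in> SL2 \<Longrightarrow> \<psi> i (A ** B) = \<psi> i A ** \<psi> i B"
    and "i \<in> {1..n} \<Longrightarrow> regular_on SL2 (\<lambda>A. \<psi> i A $ r $ s)"
    using c(1) by simp_all
  show "i \<in> {1..n} \<Longrightarrow> j \<in> {1..n} \<Longrightarrow> t \<noteq> 0 \<Longrightarrow> h i t ** x j u = x j (t powi a i j * u) ** h i t"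
    and "i \<in> {1..n} \<Longrightarrow> j \<in> {1..n} \<Longrightarrow> t \<noteq> 0 \<Longrightarrow> h i t ** y j u = y j (t powi (- a i j) * u) ** h i t"
    using c(2)[THEN bspec, THEN bspec, of i j] by simp_all
  show "i \<in> {1..n} \<Longrightarrow> j \<in> {1..n} \<Longrightarrow> i \<noteq> j \<Longrightarrow> x i t ** y j u = y j u ** x i t"
    using c(3)[THEN bspec, THEN bspec, of i j] by simp
qed

lemma pin_mat22:
  assumes "i \<in> {1..n}" "p * s - q * r = 1" "p' * s' - q' * r' = 1"
  shows "\<psi> i (mat22 p q r s) ** \<psi> i (mat22 p' q' r' s')
    = \<psi> i (mat22 (p * p' + q * r') (p * q' + q * s') (r * p' + s * r') (r * q' + s * s'))"
  using pin_mult[OF assms(1), of "mat22 p q r s" "mat22 p' q' r' s'"] assms by (simp add: mat22_mult)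

lemma x_add: "i \<in> {1..n} \<Longrightarrow> x i s ** x i t = x i (s + t)"
  by (simp add: x_pos_def pin_mat22 add.commute)

lemma h_mult: "i \<in> {1..n} \<Longrightarrow> s \<noteq> 0 \<Longrightarrow> t \<noteq> 0 \<Longrightarrow> h i s ** h i t = h i (s * t)"
  by (simp add: coroot_def pin_mat22)

lemma x_0 [simp]: "i \<in> {1..n} \<Longrightarrow> x i 0 = mat 1"
  and y_0 [simp]: "i \<in> {1..n} \<Longrightarrow> y i 0 = mat 1"
  and h_1 [simp]: "i \<in> {1..n} \<Longrightarrow> h i 1 = mat 1"
  by (simp_all add: x_pos_def x_neg_def coroot_def mat22_1 pin_1)

text \<open>The Gauss decomposition in \<open>SL2\<close>: the product on the left has upper left
  entry \<open>1 + t * u\<close>.\<close>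

lemma x_y_swap:
  assumes "i \<in> {1..n}" "1 + t * u \<noteq> 0"
  shows "x i t ** y i u = y i (u / (1 + t * u)) ** h i (1 + t * u) ** x i (t / (1 + t * u))"
proof -
  define d where "d = 1 + t * u"
  have d: "d \<noteq> 0" using assms by (simp add: d_def)
  have "y i (u / d) ** h i d ** x i (t / d) = \<psi> i (mat22 d t u (u * t / d + inverse d))"
    using assms(1) d by (simp add: x_pos_def x_neg_def coroot_def pin_mat22)
  moreover have "u * t / d + inverse d = 1" using d by (simp add: field_simps) (simp add: d_def)
  moreover have "x i t ** y i u = \<psi> i (mat22 d t u 1)"
    using assms(1) by (simp add: x_pos_def x_neg_def pin_mat22 d_def)
  ultimately show ?thesis by (simp add: d_def)
qed

text \<open>The point is the free parameter \<open>r\<close>. Conjugation by \<open>h i t\<close>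
  rescales the six factors from \<open>r = 1\<close> to \<open>r = t powi a i j\<close> and so
  reproduces the same torus element; \<open>h_commute\<close> obtains the commutativity of the torus
  in this way.\<close>

lemma h_factors:
  assumes "i \<in> {1..n}" "s \<noteq> 0" "r \<noteq> 0"
  shows "h i s = x i (r * s) ** y i (- 1 / (r * s)) ** x i (r * s) ** x i (- r) ** y i (1 / r) ** x i (- r)"
  using assms by (simp add: x_pos_def x_neg_def coroot_def pin_mat22 field_simps)

lemma assoc2: "A ** B = C ** D \<Longrightarrow> A ** (B ** Z) = C ** (D ** (Z :: complex^'m^'m))"
  by (simp add: matrix_mul_assoc)

lemma h_commute:
  assumes "i \<in> {1..n}" "j \<in> {1..n}" "s \<noteq> 0" "t \<noteq> 0"
  shows "h i t ** h j s = h j s ** h i t"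
proof -
  let ?r = "t powi a i j"
  have r: "?r \<noteq> 0" using assms by simp
  note hx = h_x[OF assms(1,2,4)] and hy = h_y[OF assms(1,2,4)]
  have e: "t powi (- a i j) * (- 1 / (1 * s)) = - 1 / (?r * s)" "t powi (- a i j) * (1 / 1) = 1 / ?r"
    by (simp_all add: power_int_minus divide_inverse)
  have "h i t ** h j s = h i t ** (x j (1 * s) ** (y j (- 1 / (1 * s)) ** (x j (1 * s) ** (x j (- 1) ** (y j (1 / 1) ** x j (- 1))))))"
    by (subst h_factors[OF assms(2,3), of 1]) (simp_all add: matrix_mul_assoc)
  also have "\<dots> = x j (?r * s) ** (y j (- 1 / (?r * s)) ** (x j (?r * s) ** (x j (- ?r) ** (y j (1 / ?r) ** (x j (- ?r) ** h i t)))))"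
    by (simp only: assoc2[OF hx] assoc2[OF hy] hx e) simp
  also have "\<dots> = h j s ** h i t"
    by (subst h_factors[OF assms(2,3) r]) (simp add: matrix_mul_assoc)
  finally show ?thesis .
qed

abbreviation "fac w t \<equiv> foldr (\<lambda>i X. h i (t i) ** X) w (mat 1)"

lemma fac_h:
  assumes "set w \<subseteq> {1..n}" "\<forall>i\<in>{1..n}. t i \<noteq> 0" "j \<in> {1..n}" "d \<noteq> 0"
  shows "h j d ** fac w t = fac w t ** h j d"
  using assms(1)
proof (induction w)
  case (Cons i w)
  have "h j d ** (h i (t i) ** fac w t) = h i (t i) ** (h j d ** fac w t)"
    using Cons.prems assms by (intro assoc2 h_commute) auto
  also have "h j d ** fac w t = fac w t ** h j d" using Cons by simp
  finally show ?case by (simp add: matrix_mul_assoc)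
qed simp

lemma fac_update:
  assumes "set w \<subseteq> {1..n}" "distinct w" "\<forall>i\<in>{1..n}. t i \<noteq> 0" "j \<in> set w" "d \<noteq> 0"
  shows "h j d ** fac w t = fac w (t(j := d * t j))"
  using assms(1,2,4)
proof (induction w)
  case (Cons i w)
  show ?case
  proof (cases "i = j")
    case True
    then have "fac w (t(j := d * t j)) = fac w t"
      using Cons.prems by (intro foldr_cong) auto
    then show ?thesis using True Cons.prems assms by (simp add: matrix_mul_assoc h_mult)
  next
    case False
    have "h j d ** (h i (t i) ** fac w t) = h i (t i) ** (h j d ** fac w t)"
      using Cons.prems assms by (intro assoc2 h_commute) auto
    then show ?thesis using False Cons by simp
  qed
qed simp

lemma tor_mult_h:
  assumes "\<forall>i\<in>{1..n}. t i \<noteq> 0" "j \<in> {1..n}" "d \<noteq> 0"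
  shows "h j d ** tor t = tor (t(j := d * t j))" "tor t ** h j d = tor (t(j := d * t j))"
proof -
  have s: "set [1..<Suc n] = {1..n}" by auto
  show "h j d ** tor t = tor (t(j := d * t j))"
    unfolding torus_elem_def by (rule fac_update) (use assms s in \<open>auto simp del: upt_Suc\<close>)
  moreover have "h j d ** tor t = tor t ** h j d"
    unfolding torus_elem_def by (rule fac_h[OF _ assms]) (use s in blast)
  ultimately show "tor t ** h j d = tor (t(j := d * t j))" by simp
qed

text \<open>The simple root \<open>\<alpha>\<^sub>j\<close> as a character, evaluated at
  \<open>tor t\<close>.\<close>

definition chi :: "nat \<Rightarrow> (nat \<Rightarrow> complex) \<Rightarrow> complex" where
  "chi j t = (\<Prod>i=1..n. t i powi a i j)"

lemma tor_1: "tor (\<lambda>_. 1) = mat 1"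
proof -
  have "fac w (\<lambda>_. 1) = mat 1" if "set w \<subseteq> {1..n}" for w
    using that by (induction w) auto
  moreover have "set [1..<Suc n] \<subseteq> {1..n}" by auto
  ultimately show ?thesis unfolding torus_elem_def by blast
qed

lemma tor_conj:
  assumes "\<forall>i\<in>{1..n}. t i \<noteq> 0" "j \<in> {1..n}"
  shows "tor t ** x j u = x j (chi j t * u) ** tor t" "tor t ** y j u = y j (inverse (chi j t) * u) ** tor t"
proof -
  have "fac w t ** x j u = x j ((\<Prod>i\<leftarrow>w. t i powi a i j) * u) ** fac w t \<and>
      fac w t ** y j u = y j (inverse (\<Prod>i\<leftarrow>w. t i powi a i j) * u) ** fac w t"
    if "set w \<subseteq> {1..n}" for w
    using that
  proof (induction w arbitrary: u)
    case (Cons i w)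
    then have i: "i \<in> {1..n}" "t i \<noteq> 0" using assms by auto
    note hx = h_x[OF i(1) assms(2) i(2)] and hy = h_y[OF i(1) assms(2) i(2)]
    have "fac (i # w) t ** x j u = h i (t i) ** (fac w t ** x j u)"
      by (simp add: matrix_mul_assoc)
    also have "\<dots> = h i (t i) ** (x j ((\<Prod>i\<leftarrow>w. t i powi a i j) * u) ** fac w t)"
      using Cons by simp
    also have "\<dots> = x j ((\<Prod>i\<leftarrow>i # w. t i powi a i j) * u) ** fac (i # w) t"
      by (simp add: assoc2[OF hx] mult.assoc)
    finally have 1: "fac (i # w) t ** x j u = x j ((\<Prod>i\<leftarrow>i # w. t i powi a i j) * u) ** fac (i # w) t" .
    have "fac (i # w) t ** y j u = h i (t i) ** (fac w t ** y j u)"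
      by (simp add: matrix_mul_assoc)
    also have "\<dots> = h i (t i) ** (y j (inverse (\<Prod>i\<leftarrow>w. t i powi a i j) * u) ** fac w t)"
      using Cons by simp
    also have "\<dots> = y j (inverse (\<Prod>i\<leftarrow>i # w. t i powi a i j) * u) ** fac (i # w) t"
      by (simp add: assoc2[OF hy] power_int_minus mult.assoc)
    finally show ?case using 1 by blast
  qed simp
  moreover have "set [1..<Suc n] \<subseteq> {1..n}" by auto
  ultimately have "tor t ** x j u = x j ((\<Prod>i\<leftarrow>[1..<Suc n]. t i powi a i j) * u) ** tor t"
      "tor t ** y j u = y j (inverse (\<Prod>i\<leftarrow>[1..<Suc n]. t i powi a i j) * u) ** tor t"
    unfolding torus_elem_def by blast+
  moreover have "(\<Prod>i\<leftarrow>[1..<Suc n]. t i powi a i j) = chi j t"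
    unfolding chi_def
    by (simp add: prod.distinct_set_conv_list[symmetric] atLeastLessThanSuc_atLeastAtMost del: upt_Suc)
  ultimately show "tor t ** x j u = x j (chi j t * u) ** tor t" "tor t ** y j u = y j (inverse (chi j t) * u) ** tor t"
    by simp_all
qed

lemma chi_nonzero: "\<forall>i\<in>{1..n}. t i \<noteq> 0 \<Longrightarrow> chi j t \<noteq> 0"
  by (simp add: chi_def)

lemma x_tor:
  assumes "\<forall>i\<in>{1..n}. t i \<noteq> 0" "j \<in> {1..n}"
  shows "x j s ** tor t = tor t ** x j (s / chi j t)"
  using tor_conj(1)[OF assms, of "s / chi j t"] chi_nonzero[OF assms(1), of j] by simp

lemma x_h:
  assumes "i \<in> {1..n}" "j \<in> {1..n}" "t \<noteq> 0"
  shows "x j s ** h i t = h i t ** x j (t powi (- a i j) * s)"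
proof -
  have "t powi a i j * (t powi (- a i j) * s) = s" using assms(3) by (simp add: power_int_minus)
  then show ?thesis using h_x[OF assms, of "t powi (- a i j) * s"] by (simp only:)
qed

section \<open>Words in root subgroups\<close>

abbreviation "word w \<equiv> fst ` set w \<subseteq> {1..n}"
definition "xw w = foldr (\<lambda>(i, t) X. x i t ** X) w (mat 1)"
definition "yw w = foldr (\<lambda>(i, t) X. y i t ** X) w (mat 1)"
text \<open>The additive character of a unipotent group at the \<open>j\<close>-th simple root,
  taken on words rather than on group elements; this spares the question whether it is well
  defined.\<close>

definition wt :: "nat \<Rightarrow> (nat \<times> complex) list \<Rightarrow> complex" where
  "wt j w = (\<Sum>(i, t)\<leftarrow>w. if i = j then t else 0)"

lemma xw_simps [simp]: "xw [] = mat 1" "xw ((i, t) # w) = x i t ** xw w"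
  by (simp_all add: xw_def)

lemma yw_simps [simp]: "yw [] = mat 1" "yw ((i, t) # w) = y i t ** yw w"
  by (simp_all add: yw_def)

lemma wt_simps [simp]: "wt j [] = 0" "wt j ((i, t) # w) = (if i = j then t else 0) + wt j w"
  "wt j (w @ w') = wt j w + wt j w'"
  by (simp_all add: wt_def)

lemma xw_append: "xw (w @ w') = xw w ** xw w'"
  by (induction w) (auto simp: matrix_mul_assoc)

lemma yw_append: "yw (w @ w') = yw w ** yw w'"
  by (induction w) (auto simp: matrix_mul_assoc)

lemma x_inverse: "i \<in> {1..n} \<Longrightarrow> x i (- t) ** x i t = mat 1" "i \<in> {1..n} \<Longrightarrow> x i t ** x i (- t) = mat 1"
  by (simp_all add: x_add)

lemma N_pos_word: "g \<in> N_pos n \<psi> \<Longrightarrow> \<exists>w. word w \<and> g = xw w"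
  unfolding N_pos_def
proof (induction rule: generate.induct)
  case one
  show ?case by (rule exI[of _ "[]"]) (simp add: GL_def)
next
  case (incl g)
  then obtain i t where "i \<in> {1..n}" "g = x i t" by blast
  then show ?case by (intro exI[of _ "[(i, t)]"]) auto
next
  case (inv g)
  then obtain i t where "i \<in> {1..n}" "g = x i t" by blast
  then show ?case using inv_GL[OF x_inverse(2,1)] by (intro exI[of _ "[(i, - t)]"]) auto
next
  case (eng g g')
  then obtain w w' where "word w" "g = xw w" "word w'" "g' = xw w'" by blast
  then show ?case by (intro exI[of _ "w @ w'"]) (auto simp: xw_append GL_def)
qed

lemma generate_mult: "A \<in> generate GL H \<Longrightarrow> B \<in> generate GL H \<Longrightarrow> A ** B \<in> generate GL H"
  using generate.eng[of A GL H B] by (simp add: GL_def)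

lemma generate_1: "mat 1 \<in> generate GL H"
  using generate.one[of GL H] by (simp add: GL_def)

lemma xw_N_pos: "word w \<Longrightarrow> xw w \<in> N_pos n \<psi>"
proof (induction w)
  case (Cons p w)
  obtain i t where p: "p = (i, t)" by force
  have "x i t \<in> N_pos n \<psi>"
    unfolding N_pos_def by (rule generate.incl) (use Cons.prems p in auto)
  then show ?case using Cons p unfolding N_pos_def by (auto intro: generate_mult)
qed (simp add: N_pos_def generate_1)

lemma yw_N_neg: "word w \<Longrightarrow> yw w \<in> N_neg n \<psi>"
proof (induction w)
  case (Cons p w)
  obtain i t where p: "p = (i, t)" by force
  have "y i t \<in> N_neg n \<psi>"
    unfolding N_neg_def by (rule generate.incl) (use Cons.prems p in auto)
  then show ?case using Cons p unfolding N_neg_def by (auto intro: generate_mult)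
qed (simp add: N_neg_def generate_1)

text \<open>The factor \<open>y j u\<close> travels left through the word. It commutes with letters
  of other indices, and each letter of index \<open>j\<close> is passed by \<open>x_y_swap\<close>,
  which excludes at most one further \<open>u\<close> and adds its parameter to the weight.\<close>

lemma push_right:
  assumes "word w" "j \<in> {1..n}"
  shows "\<exists>E. finite E \<and> (\<forall>u. u \<notin> E \<longrightarrow> 1 + wt j w * u \<noteq> 0 \<and>
    (\<exists>w'. word w' \<and> xw w ** y j u = y j (u / (1 + wt j w * u)) ** (h j (1 + wt j w * u) ** xw w')))"
  using assms(1)
proof (induction w)
  case Nil
  show ?case
    by (rule exI[of _ "{}"]) (use assms in \<open>auto intro!: exI[of _ "[]"]\<close>)
next
  case (Cons p w)
  obtain i t where p: "p = (i, t)" by force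
  have i: "i \<in> {1..n}" and w: "word w" using Cons.prems p by auto
  obtain E where E: "finite E" "\<And>u. u \<notin> E \<Longrightarrow> 1 + wt j w * u \<noteq> 0 \<and>
    (\<exists>w'. word w' \<and> xw w ** y j u = y j (u / (1 + wt j w * u)) ** (h j (1 + wt j w * u) ** xw w'))"
    using Cons.IH[OF w] by blast
  show ?case
  proof (cases "i = j")
    case False
    show ?thesis
    proof (intro exI[of _ E] conjI allI impI E(1))
      fix u assume u: "u \<notin> E"
      let ?d = "1 + wt j w * u"
      obtain w' where w': "word w'" "xw w ** y j u = y j (u / ?d) ** (h j ?d ** xw w')" and d: "?d \<noteq> 0"
        using E(2)[OF u] by blast
      show "1 + wt j (p # w) * u \<noteq> 0" using d p False by simp
      have "xw (p # w) ** y j u = x i t ** (y j (u / ?d) ** (h j ?d ** xw w'))"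
        using w' p by (simp add: matrix_mul_assoc[symmetric])
      also have "\<dots> = y j (u / ?d) ** (h j ?d ** (x i (?d powi (- a j i) * t) ** xw w'))"
        by (simp only: assoc2[OF x_y[OF i assms(2) False]] assoc2[OF x_h[OF assms(2) i d]])
      finally show "\<exists>w'. word w' \<and> xw (p # w) ** y j u
          = y j (u / (1 + wt j (p # w) * u)) ** (h j (1 + wt j (p # w) * u) ** xw w')"
        using w' i p False by (intro exI[of _ "(i, ?d powi (- a j i) * t) # w'"]) simp
    qed
  next
    case True
    show ?thesis
    proof (intro exI[of _ "E \<union> {u. 1 + (t + wt j w) * u = 0}"] conjI allI impI)
      show "finite (E \<union> {u. 1 + (t + wt j w) * u = 0})" using E(1) finite_root by simp
      fix u assume u: "u \<notin> E \<union> {u. 1 + (t + wt j w) * u = 0}"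
      let ?d = "1 + wt j w * u" and ?D = "1 + (t + wt j w) * u"
      let ?m = "u / ?d"
      obtain w' where w': "word w'" "xw w ** y j u = y j ?m ** (h j ?d ** xw w')" and d: "?d \<noteq> 0"
        using E(2) u by blast
      have D: "?D \<noteq> 0" using u by simp
      then show "1 + wt j (p # w) * u \<noteq> 0" using p True by simp
      \<comment> \<open>The torus factors \<open>?D / ?d\<close> and \<open>?d\<close> multiply to
        \<open>?D\<close>, which carries the invariant on.\<close>
      have e: "1 + t * ?m = ?D / ?d" using d by (simp add: field_simps)
      have e0: "1 + t * ?m \<noteq> 0" using e D d by simp
      have e1: "?m / (1 + t * ?m) = u / ?D" unfolding e using d D by simp
      let ?T = "t / (1 + t * ?m)"
      have "xw (p # w) ** y j u = x j t ** (y j ?m ** (h j ?d ** xw w'))"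
        using w' p True by (simp add: matrix_mul_assoc[symmetric])
      also have "\<dots> = y j (u / ?D) ** (h j (1 + t * ?m) ** (x j ?T ** (h j ?d ** xw w')))"
        unfolding matrix_mul_assoc x_y_swap[OF assms(2) e0] e1 ..
      also have "\<dots> = y j (u / ?D) ** (h j (1 + t * ?m) ** (h j ?d ** (x j (?d powi (- a j j) * ?T) ** xw w')))"
        by (simp only: assoc2[OF x_h[OF assms(2) assms(2) d]])
      also have "\<dots> = y j (u / ?D) ** ((h j (1 + t * ?m) ** h j ?d) ** (x j (?d powi (- a j j) * ?T) ** xw w'))"
        by (simp add: matrix_mul_assoc)
      also have "h j (1 + t * ?m) ** h j ?d = h j ?D"
        unfolding e using h_mult[OF assms(2), of "?D / ?d" ?d] d D by simp
      finally show "\<exists>w'. word w' \<and> xw (p # w) ** y j u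
          = y j (u / (1 + wt j (p # w) * u)) ** (h j (1 + wt j (p # w) * u) ** xw w')"
        using w' assms(2) p True by (intro exI[of _ "(j, ?d powi (- a j j) * ?T) # w'"]) simp
    qed
  qed
qed

text \<open>The mirror image of \<open>push_right\<close>. The induction appends letters at the end,
  the side on which the travelling factor meets them.\<close>

lemma push_left:
  assumes "word w" "j \<in> {1..n}"
  shows "\<exists>E. finite E \<and> (\<forall>s. s \<notin> E \<longrightarrow> 1 + wt j w * s \<noteq> 0 \<and>
    (\<exists>w'. word w' \<and> x j s ** yw w = yw w' ** (h j (1 + wt j w * s) ** x j (s / (1 + wt j w * s)))))"
  using assms(1)
proof (induction w rule: rev_induct)
  case Nil
  show ?case
    by (rule exI[of _ "{}"]) (use assms in \<open>auto intro!: exI[of _ "[]"]\<close>)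
next
  case (snoc p w)
  obtain i t where p: "p = (i, t)" by force
  have i: "i \<in> {1..n}" and w: "word w" using snoc.prems p by auto
  obtain E where E: "finite E" "\<And>s. s \<notin> E \<Longrightarrow> 1 + wt j w * s \<noteq> 0 \<and>
    (\<exists>w'. word w' \<and> x j s ** yw w = yw w' ** (h j (1 + wt j w * s) ** x j (s / (1 + wt j w * s))))"
    using snoc.IH[OF w] by blast
  show ?case
  proof (cases "i = j")
    case False
    show ?thesis
    proof (intro exI[of _ E] conjI allI impI E(1))
      fix s assume s: "s \<notin> E"
      let ?d = "1 + wt j w * s"
      obtain w' where w': "word w'" "x j s ** yw w = yw w' ** (h j ?d ** x j (s / ?d))" and d: "?d \<noteq> 0"
        using E(2)[OF s] by blast
      show "1 + wt j (w @ [p]) * s \<noteq> 0" using d p False by simp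
      have "x j s ** yw (w @ [p]) = (x j s ** yw w) ** y i t"
        using p by (simp add: yw_append matrix_mul_assoc)
      also have "\<dots> = yw w' ** (h j ?d ** (x j (s / ?d) ** y i t))"
        using w' by (simp add: matrix_mul_assoc)
      also have "\<dots> = yw w' ** (y i (?d powi (- a j i) * t) ** (h j ?d ** x j (s / ?d)))"
        using False by (simp only: x_y[OF assms(2) i] assoc2[OF h_y[OF assms(2) i d]] not_sym)
      finally show "\<exists>w'. word w' \<and> x j s ** yw (w @ [p])
          = yw w' ** (h j (1 + wt j (w @ [p]) * s) ** x j (s / (1 + wt j (w @ [p]) * s)))"
        using w' i p False by (intro exI[of _ "w' @ [(i, ?d powi (- a j i) * t)]"]) (auto simp: yw_append matrix_mul_assoc)
    qed
  next
    case True
    show ?thesis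
    proof (intro exI[of _ "E \<union> {s. 1 + (wt j w + t) * s = 0}"] conjI allI impI)
      show "finite (E \<union> {s. 1 + (wt j w + t) * s = 0})" using E(1) finite_root by simp
      fix s assume s: "s \<notin> E \<union> {s. 1 + (wt j w + t) * s = 0}"
      let ?d = "1 + wt j w * s" and ?D = "1 + (wt j w + t) * s"
      let ?m = "s / ?d"
      obtain w' where w': "word w'" "x j s ** yw w = yw w' ** (h j ?d ** x j ?m)" and d: "?d \<noteq> 0"
        using E(2) s by blast
      have D: "?D \<noteq> 0" using s by simp
      then show "1 + wt j (w @ [p]) * s \<noteq> 0" using p True by simp
      have e: "1 + ?m * t = ?D / ?d" using d by (simp add: field_simps)
      have e0: "1 + ?m * t \<noteq> 0" using e D d by simp
      have e1: "?m / (1 + ?m * t) = s / ?D" unfolding e using d D by simp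
      let ?T = "t / (1 + ?m * t)"
      have "x j s ** yw (w @ [p]) = (x j s ** yw w) ** y j t"
        using p True by (simp add: yw_append matrix_mul_assoc)
      also have "\<dots> = yw w' ** (h j ?d ** (x j ?m ** y j t))"
        using w' by (simp add: matrix_mul_assoc)
      also have "\<dots> = yw w' ** (h j ?d ** (y j ?T ** (h j (1 + ?m * t) ** x j (s / ?D))))"
        unfolding x_y_swap[OF assms(2) e0] e1 by (simp add: matrix_mul_assoc)
      also have "\<dots> = yw w' ** (y j (?d powi (- a j j) * ?T) ** (h j ?d ** (h j (1 + ?m * t) ** x j (s / ?D))))"
        by (simp only: assoc2[OF h_y[OF assms(2) assms(2) d]])
      also have "\<dots> = yw w' ** (y j (?d powi (- a j j) * ?T) ** ((h j ?d ** h j (1 + ?m * t)) ** x j (s / ?D)))"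
        by (simp add: matrix_mul_assoc)
      also have "h j ?d ** h j (1 + ?m * t) = h j ?D"
        unfolding e using h_mult[OF assms(2), of ?d "?D / ?d"] d D by simp
      finally show "\<exists>w'. word w' \<and> x j s ** yw (w @ [p])
          = yw w' ** (h j (1 + wt j (w @ [p]) * s) ** x j (s / (1 + wt j (w @ [p]) * s)))"
        using w' assms(2) p True
        by (intro exI[of _ "w' @ [(j, ?d powi (- a j j) * ?T)]"]) (auto simp: yw_append matrix_mul_assoc)
    qed
  qed
qed

end

section \<open>Generalized minors on the open cell\<close>

declare One_nat_def [simp del]

lemma matrix_inv_eq:
  assumes "A ** B = mat 1" "B ** A = (mat 1 :: complex^'m::finite^'m)"
  shows "matrix_inv A = B"
proof -
  have "invertible A" using assms unfolding invertible_def by blast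
  then have "matrix_inv A ** A = mat 1" unfolding invertible_def matrix_inv_def by (rule someI2_ex) blast
  then have "matrix_inv A ** A ** B = B" by simp
  then show ?thesis using assms(1) by (simp add: matrix_mul_assoc[symmetric])
qed

lemma continuous_on_matrix_mult:
  fixes f g :: "'b::topological_space \<Rightarrow> complex^'m::finite^'m"
  assumes "continuous_on X f" "continuous_on X g"
  shows "continuous_on X (\<lambda>p. f p ** g p)"
  unfolding matrix_matrix_mult_def
  by (intro continuous_on_vec_lambda continuous_on_sum continuous_on_mult continuous_on_component assms)

lemma mat22_if: "mat22 p q r s = (\<chi> i j. if i = 1 then if j = 1 then p else q else if j = 1 then r else s)"
  by (simp add: vec_eq_iff mat22_def forall_2)

lemma continuous_on_mat22:
  assumes "continuous_on X p" "continuous_on X q" "continuous_on X r" "continuous_on X s"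
  shows "continuous_on X (\<lambda>u. mat22 (p u) (q u) (r u) (s u))"
proof -
  have ite: "continuous_on X (\<lambda>u. if b then f u else g u)"
    if "continuous_on X f" "continuous_on X g" for b and f g :: "'a \<Rightarrow> complex"
    using that by (cases b) auto
  then show ?thesis unfolding mat22_if by (intro continuous_on_vec_lambda ite assms)
qed

context sc_group
begin

lemma pin_continuous: "i \<in> {1..n} \<Longrightarrow> continuous_on SL2 (\<psi> i)"
proof -
  assume i: "i \<in> {1..n}"
  have "continuous_on SL2 (\<lambda>A. \<chi> r s. \<psi> i A $ r $ s)"
    by (intro continuous_on_vec_lambda regular_on_continuous pin_regular i)
  then show ?thesis by simp
qed

lemma x_continuous: "i \<in> {1..n} \<Longrightarrow> continuous_on UNIV (x i)"
  unfolding x_pos_def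
  by (rule continuous_on_compose2[OF pin_continuous]) (auto intro!: continuous_on_mat22 continuous_intros)

lemma y_continuous: "i \<in> {1..n} \<Longrightarrow> continuous_on UNIV (y i)"
  unfolding x_neg_def
  by (rule continuous_on_compose2[OF pin_continuous]) (auto intro!: continuous_on_mat22 continuous_intros)

lemma G_mult: "A \<in> G \<Longrightarrow> B \<in> G \<Longrightarrow> A ** B \<in> G"
  unfolding group_set_def by (rule generate_mult)

lemma G_1: "mat 1 \<in> G"
  unfolding group_set_def by (rule generate_1)

lemma G_pin: "i \<in> {1..n} \<Longrightarrow> A \<in> SL2 \<Longrightarrow> \<psi> i A \<in> G"
  unfolding group_set_def by (rule generate.incl) blast

lemma G_x: "i \<in> {1..n} \<Longrightarrow> x i t \<in> G" and G_y: "i \<in> {1..n} \<Longrightarrow> y i t \<in> G"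
  and G_h: "i \<in> {1..n} \<Longrightarrow> t \<noteq> 0 \<Longrightarrow> h i t \<in> G" and G_s: "i \<in> {1..n} \<Longrightarrow> s_bar \<psi> i \<in> G"
  unfolding x_pos_def x_neg_def coroot_def s_bar_def by (auto intro!: G_pin)

lemma G_xw: "word w \<Longrightarrow> xw w \<in> G"
proof (induction w)
  case (Cons p w)
  then show ?case by (cases p) (auto intro!: G_mult G_x)
qed (simp add: G_1)

lemma G_yw: "word w \<Longrightarrow> yw w \<in> G"
proof (induction w)
  case (Cons p w)
  then show ?case by (cases p) (auto intro!: G_mult G_y)
qed (simp add: G_1)

lemma G_tor: "\<forall>i\<in>{1..n}. t i \<noteq> 0 \<Longrightarrow> tor t \<in> G"
proof -
  assume t: "\<forall>i\<in>{1..n}. t i \<noteq> 0"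
  have "fac w t \<in> G" if "set w \<subseteq> {1..n}" for w
    using that t by (induction w) (auto intro!: G_mult G_h G_1)
  moreover have "set [1..<Suc n] \<subseteq> {1..n}" by auto
  ultimately show ?thesis unfolding torus_elem_def by blast
qed

definition "Big = {yw v ** (tor t ** xw w) |v t w. word v \<and> word w \<and> (\<forall>i\<in>{1..n}. t i \<noteq> 0)}"

lemma BigI: "word v \<Longrightarrow> word w \<Longrightarrow> \<forall>i\<in>{1..n}. t i \<noteq> 0 \<Longrightarrow> yw v ** (tor t ** xw w) \<in> Big"
  unfolding Big_def by blast

lemma BigE:
  assumes "p \<in> Big"
  obtains v t w where "word v" "word w" "\<forall>i\<in>{1..n}. t i \<noteq> 0" "p = yw v ** (tor t ** xw w)"
  using assms unfolding Big_def by blast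

lemma Big_G: "Big \<subseteq> G"
  by (auto elim!: BigE intro!: G_mult G_xw G_yw G_tor)

lemma Big_mult_x: "yw v ** (tor t ** xw w) ** x j s = yw v ** (tor t ** xw (w @ [(j, s)]))"
  by (simp add: xw_append matrix_mul_assoc)

text \<open>The torus part changes in its \<open>j\<close>-th coordinate alone. So the minor of
  \<open>fund_weight i\<close> with \<open>i \<noteq> j\<close> is unaffected, and that of
  \<open>fund_weight j\<close> is multiplied by an explicit linear polynomial in
  \<open>u\<close>.\<close>

lemma Big_mult_y:
  assumes "word v" "word w" "\<forall>i\<in>{1..n}. t i \<noteq> 0" "j \<in> {1..n}"
  shows "\<exists>E. finite E \<and> (\<forall>u. u \<notin> E \<longrightarrow> (\<exists>v' w' d. word v' \<and> word w' \<and> d \<noteq> 0 \<and> d = 1 + wt j w * u \<and>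
    yw v ** (tor t ** xw w) ** y j u = yw v' ** (tor (t(j := d * t j)) ** xw w')))"
proof -
  obtain E where E: "finite E" "\<And>u. u \<notin> E \<Longrightarrow> 1 + wt j w * u \<noteq> 0 \<and>
    (\<exists>w'. word w' \<and> xw w ** y j u = y j (u / (1 + wt j w * u)) ** (h j (1 + wt j w * u) ** xw w'))"
    using push_right[OF assms(2,4)] by blast
  show ?thesis
  proof (intro exI[of _ E] conjI allI impI E(1))
    fix u assume u: "u \<notin> E"
    define d where "d = 1 + wt j w * u"
    obtain w' where d: "d \<noteq> 0" and w': "word w'" "xw w ** y j u = y j (u / d) ** (h j d ** xw w')"
      using E(2)[OF u] unfolding d_def by blast
    let ?m = "inverse (chi j t) * (u / d)"
    have "yw v ** (tor t ** xw w) ** y j u = yw v ** (tor t ** (y j (u / d) ** (h j d ** xw w')))"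
      unfolding w'(2)[symmetric] by (simp add: matrix_mul_assoc)
    also have "\<dots> = yw v ** (y j ?m ** (tor t ** (h j d ** xw w')))"
      by (simp only: assoc2[OF tor_conj(2)[OF assms(3,4)]])
    also have "\<dots> = yw v ** (y j ?m ** ((tor t ** h j d) ** xw w'))"
      by (simp add: matrix_mul_assoc)
    also have "\<dots> = yw (v @ [(j, ?m)]) ** (tor (t(j := d * t j)) ** xw w')"
      by (simp only: tor_mult_h(2)[OF assms(3,4) d]) (simp add: yw_append matrix_mul_assoc)
    finally show "\<exists>v' w' d. word v' \<and> word w' \<and> d \<noteq> 0 \<and> d = 1 + wt j w * u \<and>
        yw v ** (tor t ** xw w) ** y j u = yw v' ** (tor (t(j := d * t j)) ** xw w')"
      using w' d assms by (intro exI[of _ "v @ [(j, ?m)]"] exI[of _ w'] exI[of _ d]) (auto simp: d_def)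
  qed
qed

lemma SL2_factor:
  assumes "mat22 p q r s \<in> SL2" "r \<noteq> 0" "i \<in> {1..n}"
  shows "\<psi> i (mat22 p q r s) = x i ((p - 1) / r) ** y i r ** x i ((s - 1) / r)"
proof -
  have "p * s - q * r = 1" using assms(1) by simp
  then have "p * (r * s) - r = q * (r * r)" by algebra
  then have "(p * (r * s) - r) / (r * r) = q" using assms(2) by (simp add: divide_eq_eq)
  then show ?thesis using assms by (simp add: x_pos_def x_neg_def pin_mat22 field_simps)
qed

text \<open>The open cell is dense in the group: its closure is stable under multiplication by the root
  subgroups, since \<open>n\<^sub>- h n\<^sub>+ y\<^sub>j(u)\<close> lies in the cell for all but finitely many \<open>u\<close>.\<close>

lemma G_dense: "G \<subseteq> closure Big"
proof -
  let ?C = "closure Big"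
  have cont: "continuous_on X (\<lambda>q. q ** A)" for A :: "complex^'m^'m" and X :: "(complex^'m^'m) set"
    by (intro continuous_on_matrix_mult continuous_on_id continuous_on_const)
  have ext: "q ** A \<in> ?C" if "q \<in> ?C" "\<And>q. q \<in> Big \<Longrightarrow> q ** A \<in> ?C" for q A
  proof -
    have "(\<lambda>q. q ** A) ` closure Big \<subseteq> closure Big"
      by (rule image_closure_subset[OF cont closed_closure]) (use that(2) in blast)
    then show ?thesis using that(1) by blast
  qed
  have cx: "q ** x i t \<in> ?C" if "i \<in> {1..n}" "q \<in> ?C" for q i t
  proof (rule ext[OF that(2)])
    fix q assume "q \<in> Big"
    then obtain v s w where *: "word v" "word w" "\<forall>i\<in>{1..n}. s i \<noteq> 0" "q = yw v ** (tor s ** xw w)" by (rule BigE)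
    have "q ** x i t \<in> Big" unfolding *(4) Big_mult_x by (rule BigI) (use * that in auto)
    then show "q ** x i t \<in> ?C" using closure_subset by blast
  qed
  have cy: "q ** y i t \<in> ?C" if i: "i \<in> {1..n}" and "q \<in> ?C" for q i t
  proof (rule ext[OF that(2)])
    fix q assume "q \<in> Big"
    then obtain v s w where *: "word v" "word w" "\<forall>i\<in>{1..n}. s i \<noteq> 0" "q = yw v ** (tor s ** xw w)" by (rule BigE)
    obtain E where E: "finite E" "\<And>u. u \<notin> E \<Longrightarrow> \<exists>v' w' d. word v' \<and> word w' \<and> d \<noteq> 0 \<and> d = 1 + wt i w * u \<and>
      yw v ** (tor s ** xw w) ** y i u = yw v' ** (tor (s(i := d * s i)) ** xw w')"
      using Big_mult_y[OF *(1-3) i] by blast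
    have "q ** y i u \<in> ?C" if u: "u \<notin> E" for u
    proof -
      obtain v' w' d where d: "word v'" "word w'" "d \<noteq> 0" "q ** y i u = yw v' ** (tor (s(i := d * s i)) ** xw w')"
        using E(2)[OF u] *(4) by blast
      have "\<forall>j\<in>{1..n}. (s(i := d * s i)) j \<noteq> 0" using *(3) d(3) i by simp
      then have "q ** y i u \<in> Big" unfolding d(4) by (rule BigI[OF d(1,2)])
      then show ?thesis using closure_subset by blast
    qed
    then show "q ** y i t \<in> ?C"
      by (rule mem_of_cofinite[where f = "\<lambda>u. q ** y i u",
            OF continuous_on_matrix_mult[OF continuous_on_const y_continuous[OF i]] closed_closure E(1)])
  qed
  have c1: "q ** \<psi> i (mat22 a b c d) \<in> ?C" if "i \<in> {1..n}" "q \<in> ?C" "a * d - b * c = 1" "c \<noteq> 0" for q i a b c d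
    using that by (subst SL2_factor) (auto simp: matrix_mul_assoc intro!: cx cy)
  have c2: "q ** \<psi> i A \<in> ?C" if i: "i \<in> {1..n}" and q: "q \<in> ?C" and A: "A \<in> SL2" for q i A
  proof -
    obtain a b c d where Aeq: "A = mat22 a b c d" by (rule mat22_cases)
    have det: "a * d - b * c = 1" using A by (simp add: Aeq)
    show ?thesis
    proof (cases "c = 0")
      case False
      then show ?thesis unfolding Aeq by (intro c1 i q det)
    next
      case True
      \<comment> \<open>Here \<open>d\<close> is nonzero because the determinant is
        \<open>1\<close>. A factor \<open>y i 1\<close> brings it into the lower left corner, where
        the previous case applies.\<close>
      have "\<psi> i A = \<psi> i (mat22 (a + b) b (c + d) d) ** y i (- 1)"
        unfolding Aeq x_neg_def using i det by (subst pin_mat22) (auto simp: algebra_simps)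
      then show ?thesis
        using True det i q by (auto simp: matrix_mul_assoc algebra_simps intro!: cy c1)
    qed
  qed
  have one: "mat 1 \<in> ?C"
  proof -
    have "yw [] ** (tor (\<lambda>_. 1) ** xw []) \<in> Big" by (rule BigI) auto
    then show ?thesis using closure_subset by (auto simp: tor_1)
  qed
  have "q ** g \<in> ?C" if "g \<in> G" "q \<in> ?C" for g q
    using that unfolding group_set_def
  proof (induction arbitrary: q rule: generate.induct)
    case one
    then show ?case by (simp add: GL_def)
  next
    case (incl g)
    then show ?case using c2 by blast
  next
    case (inv g)
    then obtain i A where i: "i \<in> {1..n}" and A: "A \<in> SL2" "g = \<psi> i A" by blast
    obtain a b c d where Aeq: "A = mat22 a b c d" by (rule mat22_cases)
    have det: "a * d - b * c = 1" using A by (simp add: Aeq)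
    let ?B = "mat22 d (- b) (- c) a"
    have "\<psi> i A ** \<psi> i ?B = mat 1" "\<psi> i ?B ** \<psi> i A = mat 1"
      unfolding Aeq using det i
      by (subst pin_mat22; simp add: algebra_simps mat22_1[symmetric] pin_1[symmetric])+
    then have "inv\<^bsub>GL\<^esub> g = \<psi> i ?B" unfolding A(2) by (rule inv_GL)
    then show ?case using det i inv by (auto intro!: c2 simp: algebra_simps)
  next
    case (eng g g')
    then show ?case by (simp add: GL_def matrix_mul_assoc)
  qed
  from this[OF _ one] show ?thesis by auto
qed

lemma eq_on_G:
  fixes f g :: "complex^'m^'m \<Rightarrow> complex"
  assumes "continuous_on G f" "continuous_on G g" "\<And>p. p \<in> Big \<Longrightarrow> f p = g p" "p \<in> G"
  shows "f p = g p"
proof -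
  have "\<exists>b. (\<forall>k. b k \<in> Big) \<and> b \<longlonglongrightarrow> p"
    using subsetD[OF G_dense assms(4)] unfolding closure_sequential .
  then obtain b where b: "\<And>k. b k \<in> Big" "b \<longlonglongrightarrow> p" by blast
  have ev: "\<forall>\<^sub>F k in sequentially. b k \<in> G"
    by (rule always_eventually) (use b(1) Big_G in blast)
  have "(\<lambda>k. f (b k)) \<longlonglongrightarrow> f p"
    by (rule continuous_on_tendsto_compose[OF assms(1) b(2) assms(4) ev])
  moreover have "(\<lambda>k. g (b k)) \<longlonglongrightarrow> g p"
    by (rule continuous_on_tendsto_compose[OF assms(2) b(2) assms(4) ev])
  moreover have "(\<lambda>k. f (b k)) = (\<lambda>k. g (b k))" using assms(3) b by auto
  ultimately show ?thesis using LIMSEQ_unique by metis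
qed

definition "s_inv i = \<psi> i (mat22 0 1 (-1) 0)"

lemma s_bar_inv: "i \<in> {1..n} \<Longrightarrow> s_bar \<psi> i ** s_inv i = mat 1" "i \<in> {1..n} \<Longrightarrow> s_inv i ** s_bar \<psi> i = mat 1"
  unfolding s_bar_def s_inv_def by (simp_all add: pin_mat22 mat22_1 pin_1)

lemma s_bar_eq: "i \<in> {1..n} \<Longrightarrow> s_bar \<psi> i = x i (- 1) ** (y i 1 ** x i (- 1))"
  unfolding s_bar_def x_pos_def x_neg_def by (simp add: pin_mat22)

lemma s_inv_eq: "i \<in> {1..n} \<Longrightarrow> s_inv i = y i (- 1) ** (x i 1 ** y i (- 1))"
  unfolding s_inv_def x_pos_def x_neg_def by (simp add: pin_mat22)

lemma G_s_inv: "i \<in> {1..n} \<Longrightarrow> s_inv i \<in> G"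
  unfolding s_inv_def by (rule G_pin) auto

end

section \<open>Minors at the first fundamental weight\<close>

locale minors = sc_group n a \<psi> for n a and \<psi> :: "('m::finite) pinning" +
  fixes \<Delta> :: "weight \<Rightarrow> weight \<Rightarrow> complex^'m^'m \<Rightarrow> complex"
  assumes gm: "generalized_minors n a \<psi> \<Delta>"
    and diag: "a 1 1 = 2" and off: "\<And>i. i \<in> {1..n} \<Longrightarrow> i \<noteq> 1 \<Longrightarrow> a i 1 \<le> 0" and n: "1 \<le> n"
begin

abbreviation "D i \<equiv> \<Delta> (fund_weight i) (fund_weight i)"
abbreviation "w1 \<equiv> weyl_action n a [1] (fund_weight 1)"

lemma one_mem: "1 \<in> {1..n}"
  using n by simp

lemma gmD:
  assumes "i \<in> {1..n}" "reduced_word n a u" "reduced_word n a v"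
  shows "regular_on G (\<Delta> (weyl_action n a u (fund_weight i)) (weyl_action n a v (fund_weight i)))"
    "word vs \<Longrightarrow> word ws \<Longrightarrow> \<forall>j\<in>{1..n}. t j \<noteq> 0 \<Longrightarrow>
      \<Delta> (weyl_action n a u (fund_weight i)) (weyl_action n a v (fund_weight i))
        (w_bar \<psi> u ** yw vs ** tor t ** xw ws ** matrix_inv (w_bar \<psi> v)) = t i"
proof -
  note g = gm[unfolded generalized_minors_def Let_def, THEN bspec, OF assms(1), THEN spec, THEN spec,
      THEN mp, OF conjI[OF assms(2,3)]]
  show "regular_on G (\<Delta> (weyl_action n a u (fund_weight i)) (weyl_action n a v (fund_weight i)))"
    using g by blast
  show "word vs \<Longrightarrow> word ws \<Longrightarrow> \<forall>j\<in>{1..n}. t j \<noteq> 0 \<Longrightarrow>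
      \<Delta> (weyl_action n a u (fund_weight i)) (weyl_action n a v (fund_weight i))
        (w_bar \<psi> u ** yw vs ** tor t ** xw ws ** matrix_inv (w_bar \<psi> v)) = t i"
    using g yw_N_neg[of vs] xw_N_pos[of ws] by blast
qed

lemma reduced_Nil: "reduced_word n a []"
  by (simp add: reduced_word_def)

lemma weyl_Nil: "weyl_action n a [] l = l"
  by (simp add: weyl_action_def)

lemma reduced_1: "reduced_word n a [1]"
  unfolding reduced_word_def
proof (intro conjI allI impI)
  show "set [1] \<subseteq> {1..n}" using n by simp
  fix w' assume w': "set w' \<subseteq> {1..n} \<and> weyl_action n a w' = weyl_action n a [1]"
  have "weyl_action n a [1] (fund_weight 1) 1 \<noteq> weyl_action n a [] (fund_weight 1) 1"
    using n diag by (simp add: weyl_action_def simple_reflection_def fund_weight_def simple_root_def)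
  then have "w' \<noteq> []" using w' by auto
  then show "length [1::nat] \<le> length w'" by (cases w') auto
qed

lemma matrix_inv_1: "matrix_inv (mat 1 :: complex^'m^'m) = mat 1"
  by (rule matrix_inv_eq) auto

lemma D_regular: "i \<in> {1..n} \<Longrightarrow> regular_on G (D i)"
  using gmD(1)[OF _ reduced_Nil reduced_Nil] by (simp add: weyl_Nil)

lemma D_Big:
  "i \<in> {1..n} \<Longrightarrow> word v \<Longrightarrow> word w \<Longrightarrow> \<forall>j\<in>{1..n}. t j \<noteq> 0 \<Longrightarrow> D i (yw v ** (tor t ** xw w)) = t i"
  using gmD(2)[OF _ reduced_Nil reduced_Nil, of i v w t]
  by (simp add: weyl_Nil w_bar_def matrix_inv_1 matrix_mul_assoc)

lemma other_regular: "regular_on G (\<Delta> (fund_weight 1) w1)" "regular_on G (\<Delta> w1 (fund_weight 1))"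
  "regular_on G (\<Delta> w1 w1)"
  using gmD(1)[OF one_mem reduced_Nil reduced_1] gmD(1)[OF one_mem reduced_1 reduced_Nil]
    gmD(1)[OF one_mem reduced_1 reduced_1] by (simp_all add: weyl_Nil)

abbreviation "sb \<equiv> s_bar \<psi> 1"
abbreviation "si \<equiv> s_inv 1"

lemma w_bar_1: "w_bar \<psi> [1] = sb" "matrix_inv sb = si"
  using matrix_inv_eq[OF s_bar_inv[OF one_mem]] by (simp_all add: w_bar_def)

lemma cont_D: "i \<in> {1..n} \<Longrightarrow> continuous_on G (D i)"
  by (rule regular_on_continuous[OF D_regular])

lemma cont_D_mult:
  assumes "i \<in> {1..n}" "A \<in> G" "B \<in> G"
  shows "continuous_on G (\<lambda>p. D i (A ** (p ** B)))"
  by (rule continuous_on_compose2[OF cont_D[OF assms(1)]])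
    (use assms G_mult in \<open>auto intro!: continuous_on_matrix_mult continuous_on_const continuous_on_id\<close>)

text \<open>A minor is prescribed only on a translate of the open cell. Since the cell is dense and
  minors are continuous, this determines it on the whole group as a translate of
  \<open>D 1\<close>.\<close>

lemma translate:
  assumes f: "continuous_on G f" and A: "A \<in> G" "A' \<in> G" "A' ** A = mat 1" and B: "B \<in> G" "B' \<in> G" "B ** B' = mat 1"
    and eq: "\<And>q. q \<in> Big \<Longrightarrow> f (A ** (q ** B)) = D 1 q" and p: "p \<in> G"
    and inv: "A ** A' = mat 1" "B' ** B = mat 1"
  shows "f p = D 1 (A' ** (p ** B'))"
proof -
  have "f (A ** (q ** B)) = D 1 q" if "q \<in> G" for q
  proof (rule eq_on_G[where f = "\<lambda>q. f (A ** (q ** B))", OF _ cont_D[OF one_mem] eq that])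
    show "continuous_on G (\<lambda>q. f (A ** (q ** B)))"
      by (rule continuous_on_compose2[OF f])
        (use A B G_mult in \<open>auto intro!: continuous_on_matrix_mult continuous_on_const continuous_on_id\<close>)
  qed
  from this[of "A' ** (p ** B')"] have "f (A ** ((A' ** (p ** B')) ** B)) = D 1 (A' ** (p ** B'))"
    using A B p G_mult by auto
  moreover have "A ** ((A' ** (p ** B')) ** B) = (A ** A') ** p ** (B' ** B)"
    by (simp add: matrix_mul_assoc)
  ultimately show ?thesis by (simp add: inv)
qed

lemma minor_right: "p \<in> G \<Longrightarrow> \<Delta> (fund_weight 1) w1 p = D 1 (p ** sb)"
proof -
  assume p: "p \<in> G"
  have "\<Delta> (fund_weight 1) w1 p = D 1 (mat 1 ** (p ** sb))"
  proof (rule translate[where B = si and A = "mat 1"])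
    fix q assume "q \<in> Big"
    then obtain v t w where "word v" "word w" "\<forall>i\<in>{1..n}. t i \<noteq> 0" "q = yw v ** (tor t ** xw w)" by (rule BigE)
    then show "\<Delta> (fund_weight 1) w1 (mat 1 ** (q ** si)) = D 1 q"
      using gmD(2)[OF one_mem reduced_Nil reduced_1, of v w t] D_Big[OF one_mem, of v w t]
      by (simp add: weyl_Nil w_bar_1) (simp add: w_bar_def matrix_mul_assoc)
  qed (use p G_1 G_s[OF one_mem] G_s_inv[OF one_mem] s_bar_inv[OF one_mem] regular_on_continuous[OF other_regular(1)] in auto)
  then show ?thesis by simp
qed

lemma minor_left: "p \<in> G \<Longrightarrow> \<Delta> w1 (fund_weight 1) p = D 1 (si ** p)"
proof -
  assume p: "p \<in> G"
  have "\<Delta> w1 (fund_weight 1) p = D 1 (si ** (p ** mat 1))"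
  proof (rule translate[where A = sb and B = "mat 1"])
    fix q assume "q \<in> Big"
    then obtain v t w where "word v" "word w" "\<forall>i\<in>{1..n}. t i \<noteq> 0" "q = yw v ** (tor t ** xw w)" by (rule BigE)
    then show "\<Delta> w1 (fund_weight 1) (sb ** (q ** mat 1)) = D 1 q"
      using gmD(2)[OF one_mem reduced_1 reduced_Nil, of v w t] D_Big[OF one_mem, of v w t]
      by (simp add: weyl_Nil w_bar_1) (simp add: w_bar_def matrix_inv_1 matrix_mul_assoc)
  qed (use p G_1 G_s[OF one_mem] G_s_inv[OF one_mem] s_bar_inv[OF one_mem] regular_on_continuous[OF other_regular(2)] in auto)
  then show ?thesis by simp
qed

lemma minor_both: "p \<in> G \<Longrightarrow> \<Delta> w1 w1 p = D 1 (si ** (p ** sb))"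
proof (rule translate[where A = sb and B = si])
  fix q assume "q \<in> Big"
  then obtain v t w where "word v" "word w" "\<forall>i\<in>{1..n}. t i \<noteq> 0" "q = yw v ** (tor t ** xw w)" by (rule BigE)
  then show "\<Delta> w1 w1 (sb ** (q ** si)) = D 1 q"
    using gmD(2)[OF one_mem reduced_1 reduced_1, of v w t] D_Big[OF one_mem, of v w t]
    by (simp add: w_bar_1) (simp add: matrix_mul_assoc)
qed (use G_1 G_s[OF one_mem] G_s_inv[OF one_mem] s_bar_inv[OF one_mem] regular_on_continuous[OF other_regular(3)] in auto)

lemma D_right_x:
  assumes "i \<in> {1..n}" "j \<in> {1..n}" "p \<in> G" shows "D i (p ** x j s) = D i p"
proof (rule eq_on_G[OF _ cont_D[OF assms(1)] _ assms(3)])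
  show "continuous_on G (\<lambda>p. D i (p ** x j s))"
    using cont_D_mult[OF assms(1) G_1 G_x[OF assms(2)]] by simp
  fix q assume "q \<in> Big"
  then obtain v t w where *: "word v" "word w" "\<forall>i\<in>{1..n}. t i \<noteq> 0" "q = yw v ** (tor t ** xw w)" by (rule BigE)
  show "D i (q ** x j s) = D i q"
    unfolding *(4) Big_mult_x using * assms by (subst (1 2) D_Big) auto
qed

lemma D_left_y:
  assumes "i \<in> {1..n}" "j \<in> {1..n}" "p \<in> G" shows "D i (y j s ** p) = D i p"
proof (rule eq_on_G[OF _ cont_D[OF assms(1)] _ assms(3)])
  show "continuous_on G (\<lambda>p. D i (y j s ** p))"
    using cont_D_mult[OF assms(1) G_y[OF assms(2)] G_1] by simp
  fix q assume "q \<in> Big"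
  then obtain v t w where *: "word v" "word w" "\<forall>i\<in>{1..n}. t i \<noteq> 0" "q = yw v ** (tor t ** xw w)" by (rule BigE)
  have "y j s ** q = yw ((j, s) # v) ** (tor t ** xw w)" by (simp add: *(4) matrix_mul_assoc)
  moreover have "D i (yw ((j, s) # v) ** (tor t ** xw w)) = t i" by (rule D_Big) (use * assms in auto)
  moreover have "D i q = t i" unfolding *(4) by (rule D_Big) (use * assms in auto)
  ultimately show "D i (y j s ** q) = D i q" by simp
qed

lemma cont_param:
  assumes "i \<in> {1..n}" "continuous_on UNIV F" "\<And>u. F u \<in> G"
  shows "continuous_on UNIV (\<lambda>u :: complex. D i (F u))"
  by (rule continuous_on_compose2[OF cont_D[OF assms(1)] assms(2)]) (use assms in auto)

lemma D_right_y:
  assumes "i \<in> {1..n}" "j \<in> {1..n}" "i \<noteq> j" "p \<in> G" shows "D i (p ** y j s) = D i p"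
proof (rule eq_on_G[OF _ cont_D[OF assms(1)] _ assms(4)])
  show "continuous_on G (\<lambda>p. D i (p ** y j s))"
    using cont_D_mult[OF assms(1) G_1 G_y[OF assms(2)]] by simp
  fix q assume q: "q \<in> Big"
  then obtain v t w where *: "word v" "word w" "\<forall>i\<in>{1..n}. t i \<noteq> 0" "q = yw v ** (tor t ** xw w)" by (rule BigE)
  obtain E where E: "finite E" "\<And>u. u \<notin> E \<Longrightarrow> \<exists>v' w' d. word v' \<and> word w' \<and> d \<noteq> 0 \<and> d = 1 + wt j w * u \<and>
      yw v ** (tor t ** xw w) ** y j u = yw v' ** (tor (t(j := d * t j)) ** xw w')"
    using Big_mult_y[OF *(1-3) assms(2)] by blast
  show "D i (q ** y j s) = D i q"
  proof (rule eq_of_cofinite[where f = "\<lambda>u. D i (q ** y j u)" and g = "\<lambda>u. D i q", OF _ continuous_on_const E(1)])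
    show "continuous_on UNIV (\<lambda>u. D i (q ** y j u))"
      using q Big_G G_y[OF assms(2)]
      by (intro cont_param assms continuous_on_matrix_mult continuous_on_const y_continuous G_mult) auto
    fix u assume "u \<notin> E"
    then obtain v' w' d where v': "word v'" "word w'" "d \<noteq> 0" "q ** y j u = yw v' ** (tor (t(j := d * t j)) ** xw w')"
      using E(2) *(4) by blast
    have "D i (q ** y j u) = (t(j := d * t j)) i" unfolding v'(4)
      by (rule D_Big) (use * v' assms in auto)
    also have "\<dots> = D i q" unfolding *(4) using * assms by (subst D_Big) auto
    finally show "D i (q ** y j u) = D i q" .
  qed
qed

text \<open>The group elements in question lie in the open cell only for generic \<open>s\<close> and \<open>u\<close>; the other
  values are reached by continuity.\<close>

lemma D_two_sided:
  assumes "word v" "word w" "\<forall>i\<in>{1..n}. t i \<noteq> 0"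
  shows "D 1 (x 1 s ** (yw v ** (tor t ** xw w) ** y 1 u))
    = t 1 * ((1 + wt 1 v * s) * (1 + wt 1 w * u) + s * u / chi 1 t)"
proof -
  let ?q = "yw v ** (tor t ** xw w)"
  have qG: "?q \<in> G" using BigI[OF assms] Big_G by blast
  have mem: "x 1 s ** (?q ** y 1 u) \<in> G" for s u
    by (rule G_mult[OF G_x[OF one_mem] G_mult[OF qG G_y[OF one_mem]]])
  note chi = chi_nonzero[OF assms(3), of 1]
  obtain E where E: "finite E" "\<And>s. s \<notin> E \<Longrightarrow> 1 + wt 1 v * s \<noteq> 0 \<and>
    (\<exists>w'. word w' \<and> x 1 s ** yw v = yw w' ** (h 1 (1 + wt 1 v * s) ** x 1 (s / (1 + wt 1 v * s))))"
    using push_left[OF assms(1) one_mem] by blast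
  have gen: "D 1 (x 1 s ** (?q ** y 1 u)) = t 1 * ((1 + wt 1 v * s) * (1 + wt 1 w * u) + s * u / chi 1 t)"
    if s: "s \<notin> E" for s u
  proof -
    define d where "d = 1 + wt 1 v * s"
    obtain v' where d: "d \<noteq> 0" and v': "word v'" "x 1 s ** yw v = yw v' ** (h 1 d ** x 1 (s / d))"
      using E(2)[OF s] unfolding d_def by blast
    let ?t = "t(1 := d * t 1)" and ?w = "(1, (s / d) / chi 1 t) # w"
    have t': "\<forall>i\<in>{1..n}. ?t i \<noteq> 0" using assms d by auto
    have w': "word ?w" using assms n by auto
    have "x 1 s ** ?q = (x 1 s ** yw v) ** (tor t ** xw w)" by (simp add: matrix_mul_assoc)
    also have "\<dots> = yw v' ** (h 1 d ** (x 1 (s / d) ** (tor t ** xw w)))"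
      unfolding v'(2) by (simp add: matrix_mul_assoc)
    also have "\<dots> = yw v' ** (h 1 d ** (tor t ** (x 1 ((s / d) / chi 1 t) ** xw w)))"
      by (simp only: assoc2[OF x_tor[OF assms(3) one_mem]])
    also have "\<dots> = yw v' ** ((h 1 d ** tor t) ** xw ?w)" by (simp add: matrix_mul_assoc)
    also have "\<dots> = yw v' ** (tor ?t ** xw ?w)" by (simp only: tor_mult_h(1)[OF assms(3) one_mem d])
    finally have e: "x 1 s ** (?q ** y 1 u) = yw v' ** (tor ?t ** xw ?w) ** y 1 u" for u
      by (simp add: matrix_mul_assoc)
    obtain E' where E': "finite E'" "\<And>u. u \<notin> E' \<Longrightarrow> \<exists>v'' w'' c. word v'' \<and> word w'' \<and> c \<noteq> 0 \<and> c = 1 + wt 1 ?w * u \<and>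
        yw v' ** (tor ?t ** xw ?w) ** y 1 u = yw v'' ** (tor (?t(1 := c * ?t 1)) ** xw w'')"
      using Big_mult_y[OF v'(1) w' t' one_mem] by blast
    have "D 1 (x 1 s ** (?q ** y 1 u)) = t 1 * (d * (1 + wt 1 w * u) + s * u / chi 1 t)"
    proof (rule eq_of_cofinite[where f = "\<lambda>u. D 1 (x 1 s ** (?q ** y 1 u))"
          and g = "\<lambda>u. t 1 * (d * (1 + wt 1 w * u) + s * u / chi 1 t)" and u = u, OF _ _ E'(1)])
      show "continuous_on UNIV (\<lambda>u. D 1 (x 1 s ** (?q ** y 1 u)))"
        by (intro cont_param one_mem continuous_on_matrix_mult continuous_on_const y_continuous mem)
      show "continuous_on UNIV (\<lambda>u. t 1 * (d * (1 + wt 1 w * u) + s * u / chi 1 t))"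
        by (intro continuous_intros) (simp add: chi)
      fix u assume "u \<notin> E'"
      then obtain v'' w'' c where c: "word v''" "word w''" "c \<noteq> 0" "c = 1 + wt 1 ?w * u"
        "yw v' ** (tor ?t ** xw ?w) ** y 1 u = yw v'' ** (tor (?t(1 := c * ?t 1)) ** xw w'')"
        using E'(2) by blast
      have "D 1 (x 1 s ** (?q ** y 1 u)) = (?t(1 := c * ?t 1)) 1"
        unfolding e c(5) by (rule D_Big) (use c t' one_mem in auto)
      also have "\<dots> = (1 + wt 1 ?w * u) * (d * t 1)" using c(4) by simp
      also have "\<dots> = t 1 * (d * (1 + wt 1 w * u) + s * u / chi 1 t)"
        using d chi by (simp add: field_simps)
      finally show "D 1 (x 1 s ** (?q ** y 1 u)) = t 1 * (d * (1 + wt 1 w * u) + s * u / chi 1 t)" .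
    qed
    then show ?thesis by (simp add: d_def)
  qed
  show ?thesis
  proof (rule eq_of_cofinite[where f = "\<lambda>s. D 1 (x 1 s ** (?q ** y 1 u))"
        and g = "\<lambda>s. t 1 * ((1 + wt 1 v * s) * (1 + wt 1 w * u) + s * u / chi 1 t)" and u = s, OF _ _ E(1) gen])
    show "continuous_on UNIV (\<lambda>s. D 1 (x 1 s ** (?q ** y 1 u)))"
      by (intro cont_param one_mem continuous_on_matrix_mult continuous_on_const x_continuous mem)
    show "continuous_on UNIV (\<lambda>s. t 1 * ((1 + wt 1 v * s) * (1 + wt 1 w * u) + s * u / chi 1 t))"
      by (intro continuous_intros) (simp add: chi)
  qed
qed

text \<open>The outer factor of the three-term factorization of the reflection is absorbed by the
  unipotent invariance of \<open>D 1\<close>; what is left has the shape treated in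
  \<open>D_two_sided\<close>.\<close>

lemma D_sb_general:
  assumes "p \<in> G"
  shows "D 1 (p ** sb) = D 1 (p ** x 1 (- 1) ** y 1 1)" "D 1 (si ** p) = D 1 (x 1 1 ** (y 1 (- 1) ** p))"
proof -
  have "p ** sb = p ** x 1 (- 1) ** y 1 1 ** x 1 (- 1)"
    using s_bar_eq[OF one_mem] by (simp add: matrix_mul_assoc)
  then show "D 1 (p ** sb) = D 1 (p ** x 1 (- 1) ** y 1 1)"
    using D_right_x[OF one_mem one_mem, of "p ** x 1 (- 1) ** y 1 1" "-1"] assms G_mult G_x[OF one_mem] G_y[OF one_mem] by simp
  have "si ** p = y 1 (- 1) ** (x 1 1 ** (y 1 (- 1) ** p))"
    using s_inv_eq[OF one_mem] by (simp add: matrix_mul_assoc)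
  then show "D 1 (si ** p) = D 1 (x 1 1 ** (y 1 (- 1) ** p))"
    using D_left_y[OF one_mem one_mem, of "x 1 1 ** (y 1 (- 1) ** p)" "-1"] assms G_mult G_x[OF one_mem] G_y[OF one_mem] by simp
qed

text \<open>The inserted letters with parameter \<open>-1\<close> cancel the \<open>1\<close> in the
  factors \<open>1 + wt 1 v * s\<close> and \<open>1 + wt 1 w * u\<close> at
  \<open>s = u = 1\<close>, which leaves the bare weights.\<close>

lemma D_cell:
  assumes "word v" "word w" "\<forall>i\<in>{1..n}. t i \<noteq> 0"
  defines "q \<equiv> yw v ** (tor t ** xw w)"
  shows "D 1 (q ** sb) = t 1 * wt 1 w" "D 1 (si ** q) = t 1 * wt 1 v"
    "D 1 (si ** (q ** sb)) = t 1 * (wt 1 v * wt 1 w + 1 / chi 1 t)"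
proof -
  let ?v = "(1, -1) # v" and ?w = "w @ [(1, -1)]"
  have qG: "q \<in> G" using BigI[OF assms(1-3)] Big_G unfolding q_def by blast
  have word: "word ?v" "word ?w" using assms n by auto
  have 1: "q ** x 1 (- 1) = yw v ** (tor t ** xw ?w)" unfolding q_def by (rule Big_mult_x)
  have 2: "y 1 (- 1) ** q = yw ?v ** (tor t ** xw w)" unfolding q_def by (simp add: matrix_mul_assoc)
  show "D 1 (q ** sb) = t 1 * wt 1 w"
    using D_two_sided[OF assms(1) word(2) assms(3), of 0 1] D_sb_general(1)[OF qG] n by (simp add: 1)
  show "D 1 (si ** q) = t 1 * wt 1 v"
    using D_two_sided[OF word(1) assms(2,3), of 1 0] D_sb_general(2)[OF qG] n by (simp add: 2)
  have "D 1 (si ** (q ** sb)) = D 1 ((si ** q) ** sb)" by (simp add: matrix_mul_assoc)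
  also have "\<dots> = D 1 ((si ** q) ** x 1 (- 1) ** y 1 1)"
    by (rule D_sb_general(1)) (intro G_mult G_s_inv one_mem qG)
  also have "\<dots> = D 1 (si ** (q ** x 1 (- 1) ** y 1 1))" by (simp add: matrix_mul_assoc)
  also have "\<dots> = D 1 (x 1 1 ** (y 1 (- 1) ** (q ** x 1 (- 1) ** y 1 1)))"
    by (rule D_sb_general(2)) (intro G_mult G_x G_y one_mem qG)
  also have "y 1 (- 1) ** (q ** x 1 (- 1) ** y 1 1) = yw ?v ** (tor t ** xw ?w) ** y 1 1"
    unfolding 1 by (simp add: matrix_mul_assoc)
  also have "D 1 (x 1 1 ** (yw ?v ** (tor t ** xw ?w) ** y 1 1)) = t 1 * (wt 1 v * wt 1 w + 1 / chi 1 t)"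
    using D_two_sided[OF word assms(3), of 1 1] by simp
  finally show "D 1 (si ** (q ** sb)) = t 1 * (wt 1 v * wt 1 w + 1 / chi 1 t)" .
qed

theorem minor_identity:
  assumes "p \<in> G"
  shows "D 1 p * \<Delta> w1 w1 p = \<Delta> (fund_weight 1) w1 p * \<Delta> w1 (fund_weight 1) p
    + (\<Prod>i\<in>{1..n} - {1}. D i p ^ nat (- a i 1))"
proof (rule eq_on_G[OF _ _ _ assms])
  show "continuous_on G (\<lambda>p. D 1 p * \<Delta> w1 w1 p)"
    by (intro continuous_on_mult regular_on_continuous D_regular other_regular one_mem)
  show "continuous_on G (\<lambda>p. \<Delta> (fund_weight 1) w1 p * \<Delta> w1 (fund_weight 1) p
      + (\<Prod>i\<in>{1..n} - {1}. D i p ^ nat (- a i 1)))"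
    by (intro continuous_on_mult continuous_on_add continuous_on_prod continuous_on_power
        regular_on_continuous D_regular other_regular) auto
  fix q assume q: "q \<in> Big"
  then obtain v t w where *: "word v" "word w" "\<forall>i\<in>{1..n}. t i \<noteq> 0" "q = yw v ** (tor t ** xw w)" by (rule BigE)
  have qG: "q \<in> G" using q Big_G by blast
  have Dq: "D i q = t i" if "i \<in> {1..n}" for i unfolding *(4) by (rule D_Big) (use * that in auto)
  \<comment> \<open>As the diagonal entry is \<open>2\<close>, the quotient
    \<open>t 1 ^ 2 / chi 1 t\<close> contains no \<open>t 1\<close> and is exactly the monomial in
    the other minors.\<close>
  have "chi 1 t = t 1 ^ 2 * (\<Prod>i\<in>{1..n} - {1}. t i powi a i 1)"
    unfolding chi_def by (subst prod.remove[of _ 1]) (use n diag in \<open>auto simp: power_int_def\<close>)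
  moreover have "(\<Prod>i\<in>{1..n} - {1}. t i powi a i 1) * (\<Prod>i\<in>{1..n} - {1}. D i q ^ nat (- a i 1)) = 1"
    unfolding prod.distrib[symmetric]
  proof (rule prod.neutral, rule ballI)
    fix i assume i: "i \<in> {1..n} - {1}"
    then have "t i \<noteq> 0" "a i 1 \<le> 0" using * off by auto
    then have "D i q ^ nat (- a i 1) = t i powi (- a i 1)" using Dq[of i] i by (simp add: power_int_def)
    then show "t i powi a i 1 * D i q ^ nat (- a i 1) = 1"
      using \<open>t i \<noteq> 0\<close> by (simp add: power_int_minus)
  qed
  ultimately have "(\<Prod>i\<in>{1..n} - {1}. D i q ^ nat (- a i 1)) = t 1 ^ 2 / chi 1 t"
    using chi_nonzero[OF *(3), of 1] * n by (simp add: field_simps)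
  then show "D 1 q * \<Delta> w1 w1 q = \<Delta> (fund_weight 1) w1 q * \<Delta> w1 (fund_weight 1) q
      + (\<Prod>i\<in>{1..n} - {1}. D i q ^ nat (- a i 1))"
    using D_cell[OF *(1-3), folded *(4)] Dq[OF one_mem]
    by (simp add: minor_right[OF qG] minor_left[OF qG] minor_both[OF qG] power2_eq_square algebra_simps)
qed

lemma D_w_bar:
  assumes "set w \<subseteq> {1..n} - {1}" "q \<in> G"
  shows "D 1 (q ** w_bar \<psi> w) = D 1 q"
  using assms
proof (induction w arbitrary: q)
  case (Cons i w)
  have i: "i \<in> {1..n}" "1 \<noteq> i" using Cons.prems by auto
  have "D 1 (q ** w_bar \<psi> (i # w)) = D 1 (q ** s_bar \<psi> i ** w_bar \<psi> w)"
    by (simp add: w_bar_def matrix_mul_assoc)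
  also have "\<dots> = D 1 (q ** s_bar \<psi> i)" using Cons.prems G_mult G_s[OF i(1)] by (intro Cons.IH) auto
  also have "q ** s_bar \<psi> i = q ** x i (- 1) ** y i 1 ** x i (- 1)"
    using s_bar_eq[OF i(1)] by (simp add: matrix_mul_assoc)
  also have "D 1 \<dots> = D 1 q"
  proof -
    have m1: "q ** x i (- 1) \<in> G" by (intro G_mult Cons.prems G_x i)
    have "q ** x i (- 1) ** y i 1 \<in> G" by (rule G_mult[OF m1 G_y[OF i(1)]])
    then show ?thesis using m1 Cons.prems(2)
      by (simp add: D_right_x[OF one_mem i(1)] D_right_y[OF one_mem i])
  qed
  finally show ?case .
qed (simp add: w_bar_def)

lemma D_xw_right: "word w \<Longrightarrow> q \<in> G \<Longrightarrow> D 1 (q ** xw w) = D 1 q"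
proof (induction w arbitrary: q)
  case (Cons p w)
  then show ?case using D_right_x[OF one_mem] G_mult G_x
    by (cases p) (auto simp: matrix_mul_assoc)
qed simp

text \<open>Everything to the right of \<open>sb\<close> is absorbed by \<open>D 1\<close>. What
  remains is the third formula of \<open>D_cell\<close> with trivial torus part and an empty word on
  the negative side, where the product of weights is \<open>0\<close> and \<open>chi\<close> is
  \<open>1\<close>.\<close>

theorem minor_left_cell:
  assumes "word v" "word w" "set c \<subseteq> {1..n} - {1}"
  shows "\<Delta> w1 (fund_weight 1) (xw v ** w_bar \<psi> (1 # c) ** xw w) = 1"
proof -
  have cG: "w_bar \<psi> c \<in> G"
    using assms(3)
  proof (induction c)
    case (Cons i c)
    then show ?case by (simp add: w_bar_def) (auto intro!: G_mult G_s)
  qed (simp add: w_bar_def G_1)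
  note mem = G_mult G_s[OF one_mem] G_s_inv[OF one_mem] cG G_xw[OF assms(1)] G_xw[OF assms(2)]
  have "\<Delta> w1 (fund_weight 1) (xw v ** w_bar \<psi> (1 # c) ** xw w)
      = D 1 (si ** (xw v ** sb) ** w_bar \<psi> c ** xw w)"
    by (subst minor_left) (auto simp: w_bar_def matrix_mul_assoc intro!: mem[unfolded w_bar_def])
  also have "\<dots> = D 1 (si ** (xw v ** sb))"
    using assms by (subst D_xw_right) (auto intro!: D_w_bar mem)
  also have "si ** (xw v ** sb) = si ** (yw [] ** (tor (\<lambda>_. 1) ** xw v) ** sb)" by (simp add: tor_1)
  also have "D 1 \<dots> = 1"
    by (subst D_cell(3)) (use assms in \<open>auto simp: chi_def\<close>)
  finally show ?thesis .
qed

end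

section \<open>Coxeter elements\<close>

lemma function_field_ops:
  assumes K: "is_function_field X \<iota>" and f: "regular_on X f" and g: "regular_on X g"
  shows "\<iota> (\<lambda>p. f p + g p) = \<iota> f + \<iota> g" "\<iota> (\<lambda>p. f p * g p) = \<iota> f * \<iota> g"
    "(\<And>p. p \<in> X \<Longrightarrow> f p = g p) \<Longrightarrow> \<iota> f = \<iota> g"
  using K[unfolded is_function_field_def, THEN conjunct2, THEN conjunct1, THEN spec, THEN spec, THEN mp, OF conjI[OF f g]]
  by simp_all

lemma function_field_prod:
  assumes K: "is_function_field X \<iota>" and f: "\<And>i. i \<in> A \<Longrightarrow> regular_on X (f i)"
  shows "\<iota> (\<lambda>p. \<Prod>i\<in>A. f i p) = (\<Prod>i\<in>A. \<iota> (f i))"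
  using f
proof (induction A rule: infinite_finite_induct)
  case (insert i A)
  have "\<iota> (\<lambda>p. f i p * (\<Prod>i\<in>A. f i p)) = \<iota> (f i) * \<iota> (\<lambda>p. \<Prod>i\<in>A. f i p)"
    using insert by (intro function_field_ops[OF K] regular_on_prod) auto
  then show ?case using insert by simp
qed (use K in \<open>simp_all add: is_function_field_def\<close>)

lemma function_field_power:
  assumes "is_function_field X \<iota>" "regular_on X f"
  shows "\<iota> (\<lambda>p. f p ^ k) = \<iota> f ^ k"
  using function_field_prod[OF assms(1), of "{..<k}" "\<lambda>_. f"] assms(2) by simp

lemma coxeter_prec_Cons:
  "coxeter_prec a (k # xs) i j \<longleftrightarrow> i \<noteq> j \<and> a i j \<noteq> 0 \<and> i = k \<and> j \<in> set xs \<or> coxeter_prec a xs i j"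
proof -
  have "(\<exists>p q. p < q \<and> q < length (k # xs) \<and> (k # xs) ! p = i \<and> (k # xs) ! q = j) \<longleftrightarrow>
      i = k \<and> j \<in> set xs \<or> (\<exists>p q. p < q \<and> q < length xs \<and> xs ! p = i \<and> xs ! q = j)" (is "?L \<longleftrightarrow> ?R")
  proof
    assume ?L
    then obtain p q where *: "p < q" "q < length (k # xs)" "(k # xs) ! p = i" "(k # xs) ! q = j" by blast
    then obtain q' where q: "q = Suc q'" by (cases q) auto
    show ?R using * unfolding q by (cases p) auto
  next
    assume ?R
    then show ?L
    proof
      assume "i = k \<and> j \<in> set xs"
      then obtain q where "q < length xs" "xs ! q = j" "i = k" by (auto simp: in_set_conv_nth)
      then show ?L by (intro exI[of _ 0] exI[of _ "Suc q"]) simp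
    next
      assume "\<exists>p q. p < q \<and> q < length xs \<and> xs ! p = i \<and> xs ! q = j"
      then obtain p q where "p < q" "q < length xs" "xs ! p = i" "xs ! q = j" by blast
      then show ?L by (rule_tac exI[of _ "Suc p"], rule_tac exI[of _ "Suc q"]) simp
    qed
  qed
  then show ?thesis unfolding coxeter_prec_def by blast
qed

lemma coxeter_prec_snoc:
  "coxeter_prec a (xs @ [k]) i j \<longleftrightarrow> i \<noteq> j \<and> a i j \<noteq> 0 \<and> j = k \<and> i \<in> set xs \<or> coxeter_prec a xs i j"
proof (induction xs)
  case Nil
  show ?case by (auto simp: coxeter_prec_def)
qed (auto simp: coxeter_prec_Cons)

lemma coxeter_prec_set: "coxeter_prec a xs i j \<Longrightarrow> i \<in> set xs \<and> j \<in> set xs"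
  by (auto simp: coxeter_prec_def)

context minors
begin

text \<open>The reflections in \<open>w\<close> act before the one at \<open>1\<close> and fix the
  first fundamental weight. So the weight \<open>c \<omega>\<^sub>1\<close> is already reached by a
  single reflection.\<close>

lemma weyl_action_fund_weight: "set w \<subseteq> {1..n} - {1} \<Longrightarrow> weyl_action n a (1 # w) (fund_weight 1) = w1"
proof -
  assume "set w \<subseteq> {1..n} - {1}"
  then have "foldr (simple_reflection n a) w (fund_weight 1) = fund_weight 1"
    by (induction w) (auto simp: simple_reflection_def fund_weight_def)
  then show ?thesis by (simp add: weyl_action_def)
qed

theorem exchange_relation:
  assumes K: "is_function_field (reduced_cell n \<psi> (1 # w)) \<iota>" and w: "set w \<subseteq> {1..n} - {1}"
  shows "cox_x \<Delta> \<iota> (fund_weight 1) * cox_x \<Delta> \<iota> w1 =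
    cox_y n a \<Delta> (1 # w) \<iota> 1 + (\<Prod>i\<in>{1..n} - {1}. cox_x \<Delta> \<iota> (fund_weight i) ^ nat (- a i 1))"
proof -
  let ?X = "reduced_cell n \<psi> (1 # w)"
  have elem: "\<exists>u v. word u \<and> word v \<and> p = xw u ** w_bar \<psi> (1 # w) ** xw v" if p: "p \<in> ?X" for p
  proof -
    obtain n1 n2 where *: "n1 \<in> N_pos n \<psi>" "n2 \<in> N_pos n \<psi>" "p = n1 ** w_bar \<psi> (1 # w) ** n2"
      using p unfolding reduced_cell_def by blast
    then show ?thesis using N_pos_word[OF *(1)] N_pos_word[OF *(2)] by blast
  qed
  have wG: "w_bar \<psi> v \<in> G" if "set v \<subseteq> {1..n}" for v
    using that
  proof (induction v)
    case (Cons i v)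
    then have "s_bar \<psi> i \<in> G" "w_bar \<psi> v \<in> G" by (simp_all add: G_s)
    then show ?case using G_mult by (simp add: w_bar_def)
  qed (simp add: w_bar_def G_1)
  have XG: "?X \<subseteq> G"
  proof
    fix p assume "p \<in> ?X"
    then obtain u v where p: "word u" "word v" "p = xw u ** w_bar \<psi> (1 # w) ** xw v" using elem by blast
    have "w_bar \<psi> (1 # w) \<in> G" by (rule wG) (use w n in auto)
    then show "p \<in> G" unfolding p(3) by (rule G_mult[OF G_mult[OF G_xw[OF p(1)]] G_xw[OF p(2)]])
  qed
  note reg = regular_on_subset[OF _ XG]
  have D: "regular_on ?X (D i)" if "i \<in> {1..n}" for i using reg[OF D_regular[OF that]] .
  note other = reg[OF other_regular(1)] reg[OF other_regular(3)]
  let ?M = "\<lambda>p. \<Prod>i\<in>{1..n} - {1}. D i p ^ nat (- a i 1)"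
  have M: "regular_on ?X ?M" by (rule regular_on_prod) (auto intro!: regular_on_power D)
  have eq: "D 1 p * \<Delta> w1 w1 p = \<Delta> (fund_weight 1) w1 p + ?M p" if p: "p \<in> ?X" for p
  proof -
    obtain u v where "word u" "word v" "p = xw u ** w_bar \<psi> (1 # w) ** xw v" using elem[OF p] by blast
    then have "\<Delta> w1 (fund_weight 1) p = 1" using minor_left_cell[OF _ _ w] by simp
    then show ?thesis using minor_identity[OF subsetD[OF XG p]] by simp
  qed
  have "\<iota> (D 1) * \<iota> (\<Delta> w1 w1) = \<iota> (\<lambda>p. D 1 p * \<Delta> w1 w1 p)"
    by (rule function_field_ops(2)[OF K D[OF one_mem] other(2), symmetric])
  also have "\<dots> = \<iota> (\<lambda>p. \<Delta> (fund_weight 1) w1 p + ?M p)"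
    by (rule function_field_ops(3)[OF K regular_on_mult[OF D[OF one_mem] other(2)] regular_on_add[OF other(1) M] eq])
  also have "\<dots> = \<iota> (\<Delta> (fund_weight 1) w1) + \<iota> ?M"
    by (rule function_field_ops(1)[OF K other(1) M])
  finally have rel: "\<iota> (D 1) * \<iota> (\<Delta> w1 w1) = \<iota> (\<Delta> (fund_weight 1) w1) + \<iota> ?M" .
  have "\<iota> ?M = (\<Prod>i\<in>{1..n} - {1}. \<iota> (\<lambda>p. D i p ^ nat (- a i 1)))"
    by (rule function_field_prod[OF K]) (auto intro!: regular_on_power D)
  also have "\<dots> = (\<Prod>i\<in>{1..n} - {1}. \<iota> (D i) ^ nat (- a i 1))"
    by (rule prod.cong) (auto intro!: function_field_power[OF K] D)
  finally have prod: "\<iota> ?M = (\<Prod>i\<in>{1..n} - {1}. \<iota> (D i) ^ nat (- a i 1))" .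
  have y: "cox_y n a \<Delta> (1 # w) \<iota> 1 = \<iota> (\<Delta> (fund_weight 1) w1)"
  proof -
    \<comment> \<open>No letter precedes \<open>1\<close> in the factorization, so the product in
      \<open>cox_y\<close> is empty and a single minor remains.\<close>
    have "1 \<notin> set w" using w by blast
    then have "{i. coxeter_prec a (1 # w) i 1} = {}"
      using coxeter_prec_set[of a w] by (auto simp: coxeter_prec_Cons)
    then show ?thesis
      by (simp only: cox_y_def weyl_action_fund_weight[OF w] prod.empty mult_1_right)
  qed
  show ?thesis unfolding cox_x_def rel prod y ..
qed

end

context
  fixes a :: "nat \<Rightarrow> nat \<Rightarrow> int" and k :: nat and w :: "nat list"
  assumes k: "k \<notin> set w" and zero: "\<forall>i\<in>set w. a i k = 0 \<longleftrightarrow> a k i = 0"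
begin

lemma not_prec: "\<not> coxeter_prec a w k j" "\<not> coxeter_prec a w i k"
  using k coxeter_prec_set[of a w] by blast+

lemma coxeter_matrix_first:
  "coxeter_matrix a (k # w) i k = (if i \<in> set w then a i k else 0)"
  "coxeter_matrix a (k # w) k j = (if j \<in> set w then - a k j else 0)"
  using k zero by (auto simp: coxeter_matrix_def coxeter_prec_Cons not_prec)

text \<open>Moving \<open>k\<close> from the first to the last place reverses exactly the relations
  that involve \<open>k\<close>. The sign change agrees with the matrix mutation in
  \<open>sink_mutation\<close>.\<close>

lemma coxeter_matrix_rotate:
  "coxeter_matrix a (w @ [k]) i j = (if i = k \<or> j = k then - coxeter_matrix a (k # w) i j else coxeter_matrix a (k # w) i j)"
  using k zero
  by (cases "i = k"; cases "j = k")
    (auto simp: coxeter_matrix_def coxeter_prec_Cons coxeter_prec_snoc not_prec)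

end

lemma is_seed_principal:
  assumes "is_seed {1..n} (trop {1..n}) (cox_coeff n a \<Delta> c \<iota>) (cox_seed a \<Delta> c \<iota>)"
  shows "principal_seed {1..n} (\<lambda>i. cox_x \<Delta> \<iota> (fund_weight i)) (cox_y n a \<Delta> c \<iota>) (coxeter_matrix a c)"
    "cox_coeff n a \<Delta> c \<iota> = coeff_map {1..n} (cox_y n a \<Delta> c \<iota>)"
proof -
  show e: "cox_coeff n a \<Delta> c \<iota> = coeff_map {1..n} (cox_y n a \<Delta> c \<iota>)"
    by (simp add: fun_eq_iff cox_coeff_def coeff_map_def)
  show "principal_seed {1..n} (\<lambda>i. cox_x \<Delta> \<iota> (fund_weight i)) (cox_y n a \<Delta> c \<iota>) (coxeter_matrix a c)"
  proof
    note seed = assms[unfolded is_seed_def cox_seed_def seed.sel e]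
    show "zindep (doubled {1..n}) (interleave (\<lambda>i. cox_x \<Delta> \<iota> (fund_weight i)) (cox_y n a \<Delta> c \<iota>))"
      by (rule zindep_interleaveI) (use seed in blast)+
    show "skew_symmetrizable {1..n} (coxeter_matrix a c)" using seed by blast
  qed simp
qed

theorem corollary5p10:
  fixes n :: nat and a :: "nat \<Rightarrow> nat \<Rightarrow> int"
    and \<psi> :: "('m::finite) pinning"
    and \<Delta> :: "weight \<Rightarrow> weight \<Rightarrow> complex^'m^'m \<Rightarrow> complex"
    and c c' :: "nat list"
    and \<iota> :: "(complex^'m^'m \<Rightarrow> complex) \<Rightarrow> 'k::field_char_0"
    and \<iota>' :: "(complex^'m^'m \<Rightarrow> complex) \<Rightarrow> 'l::field_char_0"
  assumes cartan: "finite_type_cartan n a" "indecomposable n a"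
    and G: "simply_connected_group n a \<psi>" "generalized_minors n a \<psi> \<Delta>"
    and c: "c = [1..<Suc n]"
    and c': "c' = [2..<Suc n] @ [1]"
    and K: "is_function_field (reduced_cell n \<psi> c) \<iota>"
    and K': "is_function_field (reduced_cell n \<psi> c') \<iota>'"
    and I: "I = {1..n}"
    and P: "P = trop I"
    and e: "e = cox_coeff n a \<Delta> c \<iota>"
    and S: "S = cox_seed a \<Delta> c \<iota>" "is_seed I P e S"
    and e': "e' = cox_coeff n a \<Delta> c' \<iota>'"
    and S': "S' = cox_seed a \<Delta> c' \<iota>'" "is_seed I P e' S'"
    and T: "T = mutate I P e 1 S"
    and z: "z = corresponding_variable I e' S' P e T"
  shows "exch T = coxeter_matrix a c' \<and>
    (\<exists>\<phi> :: 'l \<Rightarrow> 'k.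
       cluster_algebra_iso I P e' S' P e S \<phi> z \<and>
       (\<forall>z0\<in>cluster_variables I P e' S'.
          \<phi> z0 = e (semifield_eval I P (coeffs T) (F_polynomial I e' S' z0)) * z z0) \<and>
       (\<forall>i\<in>I. \<phi> (cox_y n a \<Delta> c' \<iota>' i) = e (coeffs T i)) \<and>
       (\<forall>i\<in>I. i \<noteq> 1 \<longrightarrow>
          \<phi> (cox_x \<Delta> \<iota>' (fund_weight i)) = cox_x \<Delta> \<iota> (fund_weight i) \<and>
          \<phi> (cox_y n a \<Delta> c' \<iota>' i) = cox_y n a \<Delta> c \<iota> i * cox_y n a \<Delta> c \<iota> 1 powi (- a 1 i)) \<and>
       \<phi> (cox_x \<Delta> \<iota>' (fund_weight 1)) = cox_x \<Delta> \<iota> (weyl_action n a c (fund_weight 1)) \<and>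
       cox_x \<Delta> \<iota> (weyl_action n a c (fund_weight 1)) =
         inverse (cox_x \<Delta> \<iota> (fund_weight 1)) *
         (cox_y n a \<Delta> c \<iota> 1 + (\<Prod>i\<in>I - {1}. cox_x \<Delta> \<iota> (fund_weight i) powi (- a i 1))) \<and>
       \<phi> (cox_y n a \<Delta> c' \<iota>' 1) = inverse (cox_y n a \<Delta> c \<iota> 1))"
proof -
  have n: "1 \<le> n" using cartan(2) by (simp add: indecomposable_def)
  define w where "w = [2..<Suc n]"
  have c_eq: "c = 1 # w" "c' = w @ [1]" and setw: "set w = {1..n} - {1}"
    using n by (auto simp: c c' w_def upt_conv_Cons numeral_2_eq_2 One_nat_def simp del: upt_Suc)
  have diag: "a 1 1 = 2" and off: "\<And>i. i \<in> {1..n} \<Longrightarrow> i \<noteq> 1 \<Longrightarrow> a i 1 \<le> 0 \<and> a 1 i \<le> 0 \<and> (a i 1 = 0 \<longleftrightarrow> a 1 i = 0)"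
    using cartan(1) n by (auto simp: finite_type_cartan_def)
  have nw: "1 \<notin> set w" and zero: "\<forall>i\<in>set w. a i 1 = 0 \<longleftrightarrow> a 1 i = 0"
    using off setw by auto
  let ?x = "\<lambda>i. cox_x \<Delta> \<iota> (fund_weight i)" and ?x' = "\<lambda>i. cox_x \<Delta> \<iota>' (fund_weight i)"
  let ?y = "cox_y n a \<Delta> c \<iota>" and ?y' = "cox_y n a \<Delta> c' \<iota>'"
  let ?B = "coxeter_matrix a c" and ?B' = "coxeter_matrix a c'"
  have oneI: "1 \<in> I" using n I by simp
  have p: "principal_seed I ?x ?y ?B" "e = coeff_map I ?y" "S = Seed ?x trop_gen ?B"
    using is_seed_principal[of n a \<Delta> c \<iota>] S P e I by (simp_all add: cox_seed_def)
  have p': "principal_seed I ?x' ?y' ?B'" "e' = coeff_map I ?y'" "S' = Seed ?x' trop_gen ?B'"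
    using is_seed_principal[of n a \<Delta> c' \<iota>'] S' P e' I by (simp_all add: cox_seed_def)
  note Bc = coxeter_matrix_first[OF nw zero, folded c_eq]
  \<comment> \<open>As \<open>1\<close> comes first in \<open>c\<close>, its column consists of
    off-diagonal entries of \<open>a\<close> and its row of negatives of such entries, apart from
    zeros.\<close>
  have sink: "?B i 1 \<le> 0" "0 \<le> ?B 1 i" for i
    unfolding Bc using off setw by auto
  interpret A: sink_mutation I ?x ?y ?B 1
    by (intro sink_mutation.intro p sink_mutation_axioms.intro oneI sink)
  have T_eq: "T = A.T" unfolding T P p(2,3) ..
  have exch: "exch A.T = ?B'"
    unfolding fun_eq_iff A.exch_T c_eq(2) coxeter_matrix_rotate[OF nw zero] c_eq(1)[symmetric] by simp
  interpret A': principal_seed I ?x' ?y' ?B' by (rule p'(1))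
  interpret R: seed_transfer I ?x' ?y' ?B' ?x ?y ?B A.T
  proof (rule seed_transfer.intro[OF p'(1) p(1)], rule seed_transfer_axioms.intro)
    show "I \<noteq> {}" using oneI by blast
  qed (rule A.T_seeds exch A.zindep_T A.span_T, assumption?)+
  interpret L: minors n a \<psi> \<Delta>
    by (intro minors.intro sc_group.intro minors_axioms.intro G diag n) (use off in blast)
  have z_eq: "z = R.Z" unfolding z T_eq p p' P ..
  have Wc: "weyl_action n a c (fund_weight 1) = weyl_action n a [1] (fund_weight 1)"
    unfolding c_eq(1) by (rule L.weyl_action_fund_weight) (simp add: setw)
  have M: "(\<Prod>i\<in>I - {1}. ?x i powi (- ?B i 1)) = (\<Prod>i\<in>I - {1}. ?x i powi (- a i 1))"
    by (rule prod.cong) (auto simp: Bc setw I)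
  have "(\<Prod>i\<in>I - {1}. ?x i powi (- a i 1)) = (\<Prod>i\<in>I - {1}. ?x i ^ nat (- a i 1))"
    by (rule prod.cong) (use off I in \<open>auto simp: power_int_def\<close>)
  then have rel: "?x 1 * cox_x \<Delta> \<iota> (weyl_action n a c (fund_weight 1)) = ?y 1 + (\<Prod>i\<in>I - {1}. ?x i powi (- a i 1))"
    using L.exchange_relation[of w \<iota>] K setw unfolding Wc by (simp add: c_eq I)
  then have x1: "cox_x \<Delta> \<iota> (weyl_action n a c (fund_weight 1)) =
      inverse (?x 1) * (?y 1 + (\<Prod>i\<in>I - {1}. ?x i powi (- a i 1)))"
    using A.x_nonzero[OF oneI] unfolding rel[symmetric] by simp
  show ?thesis
  proof (rule conjI, unfold T_eq, rule exch, rule exI[of _ R.phi], intro conjI ballI impI)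
    show "cluster_algebra_iso I P e' S' P e S R.phi z"
      using R.iso unfolding z_eq p p' P .
    show "R.phi z0 = e (semifield_eval I P (coeffs A.T) (F_polynomial I e' S' z0)) * z z0"
      if "z0 \<in> cluster_variables I P e' S'" for z0
      using R.Z_cluster_variable(1)[of z0] that unfolding z_eq p p' P .
    show y: "R.phi (?y' i) = e (coeffs A.T i)" if "i \<in> I" for i
      unfolding p(2) by (rule R.phi_eq[OF R.G_y[OF that]])
    have x: "R.phi (?x' i) = cluster A.T i" if "i \<in> I" for i
      by (rule R.phi_eq[OF R.G_x[OF that]])
    show "R.phi (?x' i) = ?x i" if "i \<in> I" "i \<noteq> 1" for i
      using x[OF that(1)] that(2) by (simp add: A.cluster_T)
    show "R.phi (?y' i) = ?y i * ?y 1 powi (- a 1 i)" if i: "i \<in> I" "i \<noteq> 1" for i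
    proof -
      have "?B 1 i = - a 1 i" using i I setw by (simp add: Bc)
      then show ?thesis unfolding y[OF i(1)] p(2) A.e_coeffs_T[OF i(1)] using i(2) by simp
    qed
    show "R.phi (?y' 1) = inverse (?y 1)"
      unfolding y[OF oneI] p(2) A.e_coeffs_T[OF oneI] by simp
    show "R.phi (?x' 1) = cox_x \<Delta> \<iota> (weyl_action n a c (fund_weight 1))"
      unfolding x[OF oneI] A.cluster_T x1 M by (simp add: divide_inverse mult.commute)
  qed (rule x1)
qed

end
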